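(* Let $\alpha_1\in\,]0,1[$, $a=(a_0,a_\infty)\in\mathbb R^2\setminus\alpha_1\mathbb Z^2$, and for $\tau\in\mathbb H$ put $t_\tau=\frac1{\alpha_1}(a_0\tau-a_\infty)$. Let $\mathcal B_a$ be the rank $2$ holomorphic bundle on $\mathbb H$ with fiber $H^1(E_{\tau,t_\tau},L_\tau)$ at $\tau$, $\nabla_a^{GM}$ its Gauss–Manin connection, and $[\varphi_0],[\varphi_1]$ the two trivializing global sections of $\mathcal B_a$ given by the classes of $du$ and $\rho'(u)du$. 1. In the basis $([\varphi_0],[\varphi_1])$, the action of $\nabla_a^{GM}$ is written $$\nabla_a^{GM}\begin{pmatrix} [\varphi_0] \\ [\varphi_1] \end{pmatrix}=M_a\cdot\begin{pmatrix} [\varphi_0] \\ [\varphi_1] \end{pmatrix}$$ for a certain explicit matrix $M_a$ of holomorphic $1$-forms on $\mathbb H$. 2. The differential equation on $\mathbb H$ with $F_0(\tau)=\int_{[0,1]}T_a^{\alpha_1}(u,\tau)du$ and $F_\infty(\tau)=\int_{[0,\tau]}T_a^{\alpha_1}(u,\tau)du$ as a basis of solutions is written $$\frac{d^2F}{d\tau^2}-\Big(2i\pi\frac{a_0^2}{\alpha_1}\Big)\cdot\frac{dF}{d\tau}+\varphi_a\cdot F=0$$ for an explicit global holomorphic function $\varphi_a$ on $\mathbb H$.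
   Context: $E_\tau=\mathbb C/(\mathbb Z+\mathbb Z\tau)$; $\theta(u)=\theta(u,\tau)=-i\sum_{k\in\mathbb Z}(-1)^k\exp(i\pi(k+\frac12)^2\tau+2i\pi(k+\frac12)u)$; a prime denotes $\partial/\partial u$; $\rho(u)=\theta'(u)/\theta(u)$. $T_a^{\alpha_1}(u,\tau)=e^{2i\pi a_0u}\,\theta(u,\tau)^{\alpha_1}\theta(u-t_\tau,\tau)^{-\alpha_1}$, a multivalued function on $E_{\tau,t_\tau}=E_\tau\setminus\{[0],[t_\tau]\}$ with multiplicative unitary monodromy. $L_\tau$ is the rank one local system on $E_{\tau,t_\tau}$ of solutions $h$ of $dh+\omega h=0$, $\omega=d_u\log T_a^{\alpha_1}$ (generated by the branches of $1/T_a^{\alpha_1}$). One has $H^1(E_{\tau,t_\tau},L_\tau)\simeq H^0(E_{\tau,t_\tau},\Omega^1)/(d+\omega\wedge)H^0(E_{\tau,t_\tau},\mathcal O)$, of dimension $2$ with the classes of $du$ and $\rho'(u)du$ as basis, and $1$-forms $\eta$ pair with twisted cycles $\boldsymbol\gamma$ (cycles with coefficients in the dual local system generated by branches of $T_a^{\alpha_1}$) by $\int_{\boldsymbol\gamma}T_a^{\alpha_1}\eta$. The spaces $H^1(E_{\tau,t_\tau},L_\tau)$, $\tau\in\mathbb H$, form a local system $B_a$, $\mathcal B_a=B_a\otimes\mathcal O_{\mathbb H}$, and $\nabla_a^{GM}:\mathcal B_a\to\mathcal B_a\otimes\Omega^1_{\mathbb H}$ is the connection whose flat sections are the sections of $B_a$;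 equivalently $d\langle b,\boldsymbol\gamma\rangle=\langle\nabla_a^{GM}b,\boldsymbol\gamma\rangle$ for every locally constant family of twisted cycles $\boldsymbol\gamma$. In (2), the branches are chosen as follows: let $\tilde t_\tau$ be the representative of $t_\tau$ in $\{x+y\tau:x,y\in[0,1[\}$; push the sides $[0,1]$, $[0,\tau]$ of the fundamental parallelogram slightly outwards (below, resp. to the left; translates accordingly) if needed so that $\tilde t_\tau$ lies inside, cut the interior along an arc from $0$ to $\tilde t_\tau$, and use on both sides the boundary values of one branch of $T_a^{\alpha_1}$ on this simply connected domain, depending holomorphically on $\tau$. *)

theory Defs
  imports "HOL-Complex_Analysis.Complex_Analysis"
begin

definition UHP :: "complex set" where
  "UHP = {\<tau>. Im \<tau> > 0}"

definition jtheta :: "complex \<Rightarrow> complex \<Rightarrow> complex" where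
  "jtheta u \<tau> = - \<i> * (\<Sum>\<^sub>\<infinity>k\<in>(UNIV :: int set). (-1) powi k *
     exp (\<i> * of_real pi * (of_int k + 1/2)\<^sup>2 * \<tau> + 2 * \<i> * of_real pi * (of_int k + 1/2) * u))"

definition jtheta_d :: "nat \<Rightarrow> complex \<Rightarrow> complex \<Rightarrow> complex" where
  "jtheta_d n u \<tau> = (deriv ^^ n) (\<lambda>v. jtheta v \<tau>) u"

definition rho :: "complex \<Rightarrow> complex \<Rightarrow> complex" where
  "rho u \<tau> = jtheta_d 1 u \<tau> / jtheta u \<tau>"

definition rho_d :: "nat \<Rightarrow> complex \<Rightarrow> complex \<Rightarrow> complex" where
  "rho_d n u \<tau> = (deriv ^^ n) (\<lambda>v. rho v \<tau>) u"

text \<open>Throughout, \<open>ai\<close> stands for \<open>a\<^sub>\<infinity>\<close> and \<open>\<alpha>\<close> for \<open>\<alpha>\<^sub>1\<close>.\<close>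

definition tpt :: "real \<Rightarrow> real \<Rightarrow> real \<Rightarrow> complex \<Rightarrow> complex" where
  "tpt \<alpha> a0 ai \<tau> = (of_real a0 * \<tau> - of_real ai) / of_real \<alpha>"

text \<open>
  Points of the plane are also described by real coordinates: the complex number \<open>x + \<i> y\<close>
  marks the point \<open>x + y \<tau>\<close>. In these coordinates the lattice \<open>\<int> + \<int> \<tau>\<close> is
  \<open>\<int> + \<int> \<i>\<close> and \<open>tpt \<alpha> a0 ai \<tau>\<close> is the point
  \<open>tmark \<alpha> a0 ai\<close>, both independent of \<open>\<tau>\<close>: they trivialise the whole family of
  punctured tori over the upper half-plane.
\<close>

definition mark :: "complex \<Rightarrow> complex \<Rightarrow> complex" where
  "mark \<tau> z = of_real (Re z) + of_real (Im z) * \<tau>"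

definition gauss_lattice :: "complex set" where
  "gauss_lattice = {Complex (of_int m) (of_int n) | m n. True}"

definition tmark :: "real \<Rightarrow> real \<Rightarrow> real \<Rightarrow> complex" where
  "tmark \<alpha> a0 ai = Complex (- ai / \<alpha>) (a0 / \<alpha>)"

definition punctures :: "real \<Rightarrow> real \<Rightarrow> real \<Rightarrow> complex set" where
  "punctures \<alpha> a0 ai = gauss_lattice \<union> (+) (tmark \<alpha> a0 ai) ` gauss_lattice"

text \<open>
  A family of branches of \<open>T\<close> is parametrised by a space \<open>X\<close> mapped by \<open>p\<close> to pairs
  \<open>(\<tau>, u)\<close>. It comes from logarithms of \<open>\<theta>(u)\<close> and \<open>\<theta>(u - t\<^sub>\<tau>)\<close>
  which are continuous on \<open>X\<close>, hence holomorphic in every variable in which \<open>p\<close> is. On the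
  torus, translating a branch by a lattice vector gives a constant multiple of a branch.
\<close>

definition is_T_branch ::
  "real \<Rightarrow> real \<Rightarrow> real \<Rightarrow> 'x::topological_space set \<Rightarrow> ('x \<Rightarrow> complex \<times> complex) \<Rightarrow> ('x \<Rightarrow> complex) \<Rightarrow> bool"
where
  "is_T_branch \<alpha> a0 ai X p B \<longleftrightarrow>
     (\<exists>L L'. continuous_on X L \<and> continuous_on X L' \<and>
        (\<forall>x\<in>X. let (\<tau>, u) = p x in
            exp (L x) = jtheta u \<tau> \<and> exp (L' x) = jtheta (u - tpt \<alpha> a0 ai \<tau>) \<tau> \<and>
            B x = exp (2 * \<i> * of_real pi * of_real a0 * u + of_real \<alpha> * L x - of_real \<alpha> * L' x)))"

text \<open>The coefficient of \<open>du\<close> in \<open>\<omega> = d\<^sub>u log T\<close>.\<close>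

definition omega :: "real \<Rightarrow> real \<Rightarrow> real \<Rightarrow> complex \<Rightarrow> complex \<Rightarrow> complex" where
  "omega \<alpha> a0 ai \<tau> u =
     2 * \<i> * of_real pi * of_real a0 + of_real \<alpha> * (rho u \<tau> - rho (u - tpt \<alpha> a0 ai \<tau>) \<tau>)"

text \<open>
  Holomorphic functions on the punctured torus, as doubly periodic functions on the plane; values
  at the punctures are irrelevant. A function \<open>h\<close> also stands for the 1-form \<open>h du\<close>.
\<close>

definition hol_fun :: "real \<Rightarrow> real \<Rightarrow> real \<Rightarrow> complex \<Rightarrow> (complex \<Rightarrow> complex) set" where
  "hol_fun \<alpha> a0 ai \<tau> =
     {h. h holomorphic_on - (mark \<tau> ` punctures \<alpha> a0 ai) \<and>
         (\<forall>u \<in> - (mark \<tau> ` punctures \<alpha> a0 ai). \<forall>l \<in> gauss_lattice. h (u + mark \<tau> l) = h u)}"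

text \<open>The classes modulo \<open>df + \<omega> f\<close>, as cosets.\<close>

definition H1_class ::
  "real \<Rightarrow> real \<Rightarrow> real \<Rightarrow> complex \<Rightarrow> (complex \<Rightarrow> complex) \<Rightarrow> (complex \<Rightarrow> complex) set" where
  "H1_class \<alpha> a0 ai \<tau> h =
     {k \<in> hol_fun \<alpha> a0 ai \<tau>. \<exists>f \<in> hol_fun \<alpha> a0 ai \<tau>.
        \<forall>u \<in> - (mark \<tau> ` punctures \<alpha> a0 ai). k u - h u = deriv f u + omega \<alpha> a0 ai \<tau> u * f u}"

definition H1 :: "real \<Rightarrow> real \<Rightarrow> real \<Rightarrow> complex \<Rightarrow> (complex \<Rightarrow> complex) set set" where
  "H1 \<alpha> a0 ai \<tau> = H1_class \<alpha> a0 ai \<tau> ` hol_fun \<alpha> a0 ai \<tau>"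

definition H1_add ::
  "(complex \<Rightarrow> complex) set \<Rightarrow> (complex \<Rightarrow> complex) set \<Rightarrow> (complex \<Rightarrow> complex) set" where
  "H1_add A B = {\<lambda>u. h u + k u | h k. h \<in> A \<and> k \<in> B}"

definition H1_scale ::
  "real \<Rightarrow> real \<Rightarrow> real \<Rightarrow> complex \<Rightarrow> complex \<Rightarrow> (complex \<Rightarrow> complex) set \<Rightarrow> (complex \<Rightarrow> complex) set" where
  "H1_scale \<alpha> a0 ai \<tau> c A = (\<Union>h\<in>A. H1_class \<alpha> a0 ai \<tau> (\<lambda>u. c * h u))"

text \<open>
  A family of twisted chains is a formal sum \<open>\<Sum> c (g \<otimes> s)\<close>: \<open>g\<close> is a path in real
  coordinates, giving the path \<open>mark \<tau> \<circ> g\<close> for each \<open>\<tau>\<close>, and \<open>s (\<tau>, x)\<close>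
  is a branch of \<open>T\<close> along these paths. It is closed when its boundary, with values in the dual
  local system on the torus, vanishes; an element of a stalk of that local system is determined by
  its value. Transport is along the real trivialisation, so these are locally constant families.
  The upper half-plane being simply connected, every class of twisted cycles at one \<open>\<tau>\<close>, and
  every local locally constant family, extends to such a global one.
\<close>

type_synonym tw_chain = "(complex \<times> (real \<Rightarrow> complex) \<times> (complex \<times> real \<Rightarrow> complex)) list"

definition flat_twisted_cycle :: "real \<Rightarrow> real \<Rightarrow> real \<Rightarrow> tw_chain \<Rightarrow> bool" where
  "flat_twisted_cycle \<alpha> a0 ai \<gamma> \<longleftrightarrow>
     (\<forall>(c, g, s) \<in> set \<gamma>. valid_path g \<and> path_image g \<inter> punctures \<alpha> a0 ai = {} \<and>
        is_T_branch \<alpha> a0 ai (UHP \<times> {0..1}) (\<lambda>(\<tau>, x). (\<tau>, mark \<tau> (g x))) s) \<and>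
     (\<forall>\<tau>\<in>UHP. \<forall>z. (\<Sum>(c, g, s)\<leftarrow>\<gamma>.
        c * ((if g 1 - z \<in> gauss_lattice then s (\<tau>, 1) else 0)
           - (if g 0 - z \<in> gauss_lattice then s (\<tau>, 0) else 0))) = 0)"

definition form_pairing :: "complex \<Rightarrow> (complex \<Rightarrow> complex) \<Rightarrow> tw_chain \<Rightarrow> complex" where
  "form_pairing \<tau> h \<gamma> = (\<Sum>(c, g, s)\<leftarrow>\<gamma>. c * integral {0..1} (\<lambda>x.
     s (\<tau>, x) * h (mark \<tau> (g x)) * vector_derivative (\<lambda>y. mark \<tau> (g y)) (at x within {0..1})))"

definition H1_pairing :: "complex \<Rightarrow> (complex \<Rightarrow> complex) set \<Rightarrow> tw_chain \<Rightarrow> complex" where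
  "H1_pairing \<tau> A \<gamma> = (THE w. \<forall>h\<in>A. form_pairing \<tau> h \<gamma> = w)"

text \<open>
  Sections of the bundle are extensional dependent functions on \<open>UHP\<close>. Holomorphic 1-forms on
  \<open>UHP\<close> are identified with their coefficient of \<open>d\<tau>\<close>, so \<open>gauss_manin \<alpha> a0 ai b\<close>
  is the section \<open>c\<close> with \<open>\<nabla>b = c \<otimes> d\<tau>\<close>.
\<close>

definition gauss_manin ::
  "real \<Rightarrow> real \<Rightarrow> real \<Rightarrow> (complex \<Rightarrow> (complex \<Rightarrow> complex) set) \<Rightarrow> complex \<Rightarrow> (complex \<Rightarrow> complex) set"
where
  "gauss_manin \<alpha> a0 ai b = (THE c. c \<in> (\<Pi>\<^sub>E \<tau>\<in>UHP. H1 \<alpha> a0 ai \<tau>) \<and>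
     (\<forall>\<gamma>. flat_twisted_cycle \<alpha> a0 ai \<gamma> \<longrightarrow> (\<forall>\<tau>\<in>UHP.
        ((\<lambda>\<tau>'. H1_pairing \<tau>' (b \<tau>') \<gamma>) has_field_derivative H1_pairing \<tau> (c \<tau>) \<gamma>) (at \<tau>))))"

definition sec0 :: "real \<Rightarrow> real \<Rightarrow> real \<Rightarrow> complex \<Rightarrow> (complex \<Rightarrow> complex) set" where
  "sec0 \<alpha> a0 ai = (\<lambda>\<tau>\<in>UHP. H1_class \<alpha> a0 ai \<tau> (\<lambda>u. 1))"

definition sec1 :: "real \<Rightarrow> real \<Rightarrow> real \<Rightarrow> complex \<Rightarrow> (complex \<Rightarrow> complex) set" where
  "sec1 \<alpha> a0 ai = (\<lambda>\<tau>\<in>UHP. H1_class \<alpha> a0 ai \<tau> (\<lambda>u. rho_d 1 u \<tau>))"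

text \<open>
  Below, \<open>\<beta> = 2\<pi>i a\<^sub>0\<close>, \<open>t = t\<^sub>\<tau>\<close>, \<open>Y = \<theta>'''(0)/\<theta>'(0)\<close>.
  By the heat equation \<open>4\<pi>i \<partial>\<^sub>\<tau>\<theta> = \<theta>''\<close>, writing \<open>\<omega>\<close> for the coefficient \<open>omega\<close>, the
  function \<open>g = \<partial>\<^sub>\<tau> log T - \<rho> \<omega>/(2\<pi>i)\<close> is elliptic and
    \<open>\<partial>\<^sub>\<tau> T = T (g - \<rho>'/(2\<pi>i)) + \<partial>\<^sub>u(\<rho> T)/(2\<pi>i)\<close>,
    \<open>\<partial>\<^sub>\<tau> (\<rho>' T) = T (\<rho>' g + \<rho>'''/(4\<pi>i)) + \<partial>\<^sub>u(\<rho> \<rho>' T)/(2\<pi>i)\<close>.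
  Reducing the elliptic factors of \<open>T\<close> modulo \<open>f' + \<omega> f\<close> gives the two rows of the matrix of
  coefficients of \<open>d\<tau>\<close>. Eliminating \<open>[\<rho>' du]\<close> gives the potential
  \<open>det M - \<partial>\<^sub>\<tau> M\<^sub>1\<^sub>1\<close>, where \<open>M\<^sub>1\<^sub>1\<close> is the top left entry; it simplifies to \<open>phi_pot\<close>.
\<close>

definition theta_Y :: "complex \<Rightarrow> complex" where
  "theta_Y \<tau> = jtheta_d 3 0 \<tau> / jtheta_d 1 0 \<tau>"

definition GM_matrix :: "real \<Rightarrow> real \<Rightarrow> real \<Rightarrow> complex \<Rightarrow> complex^2^2" where
  "GM_matrix \<alpha> a0 ai \<tau> =
    (let t = tpt \<alpha> a0 ai \<tau>; \<beta> = 2 * \<i> * of_real pi * of_real a0; Y = theta_Y \<tau>;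
         r = rho t \<tau>; r1 = rho_d 1 t \<tau>; r2 = rho_d 2 t \<tau>; r3 = rho_d 3 t \<tau>;
         A = of_real a0 * r
             + of_real \<alpha> / (4 * \<i> * of_real pi) * (jtheta_d 2 t \<tau> / jtheta t \<tau> - Y)
     in vector
       [vector [2 * \<i> * of_real pi * of_real (a0\<^sup>2 / \<alpha>) + A,
                (of_real \<alpha> - 1) / (2 * \<i> * of_real pi)],
        vector [(of_real \<alpha> * (r3 + 2 * r * r2 + 2 * r\<^sup>2 * r1 + 4 * r1\<^sup>2 - 2 * Y * r1)
                 + 2 * \<beta> * (r2 + 2 * r * r1) + 2 * \<beta>\<^sup>2 / of_real \<alpha> * r1) / (4 * \<i> * of_real pi),
                - A]])"

definition phi_pot :: "real \<Rightarrow> real \<Rightarrow> real \<Rightarrow> complex \<Rightarrow> complex" where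
  "phi_pot \<alpha> a0 ai \<tau> =
    (let t = tpt \<alpha> a0 ai \<tau>; \<beta> = 2 * \<i> * of_real pi * of_real a0; Y = theta_Y \<tau>;
         q = (\<lambda>n. jtheta_d n t \<tau> / jtheta t \<tau>)
     in (4 * \<beta>^3 / of_real \<alpha> * q 1
         + \<beta>\<^sup>2 * (6 * q 2 - 2 * Y)
         + 4 * of_real \<alpha> * \<beta> * (q 3 - Y * q 1)
         + of_real (\<alpha>\<^sup>2) * (q 4 - 2 * Y * q 2 + 2 * Y\<^sup>2 - jtheta_d 5 0 \<tau> / jtheta_d 1 0 \<tau>))
        / (16 * of_real (pi\<^sup>2)))"

text \<open>The representative of \<open>t\<^sub>\<tau>\<close> in \<open>[0,1[\<^sup>2\<close>, in real coordinates.\<close>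

definition tred :: "real \<Rightarrow> real \<Rightarrow> real \<Rightarrow> complex" where
  "tred \<alpha> a0 ai = Complex (frac (- ai / \<alpha>)) (frac (a0 / \<alpha>))"

text \<open>
  The sides are pushed outwards by a bump of size governed by \<open>e\<close>, and only when
  \<open>tred \<alpha> a0 ai\<close> lies on them; at most one of the two is pushed, since
  \<open>tred \<alpha> a0 ai \<noteq> 0\<close> when \<open>a \<notin> \<alpha> \<int>\<^sup>2\<close>.
\<close>

definition push_bottom :: "real \<Rightarrow> real \<Rightarrow> real \<Rightarrow> real \<Rightarrow> real \<Rightarrow> real" where
  "push_bottom e \<alpha> a0 ai x = (if Im (tred \<alpha> a0 ai) = 0 then e * x * (1 - x) else 0)"

definition push_left :: "real \<Rightarrow> real \<Rightarrow> real \<Rightarrow> real \<Rightarrow> real \<Rightarrow> real" where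
  "push_left e \<alpha> a0 ai y = (if Re (tred \<alpha> a0 ai) = 0 then e * y * (1 - y) else 0)"

definition bottom_side :: "real \<Rightarrow> real \<Rightarrow> real \<Rightarrow> real \<Rightarrow> real \<Rightarrow> complex" where
  "bottom_side e \<alpha> a0 ai x = Complex x (- push_bottom e \<alpha> a0 ai x)"

definition left_side :: "real \<Rightarrow> real \<Rightarrow> real \<Rightarrow> real \<Rightarrow> real \<Rightarrow> complex" where
  "left_side e \<alpha> a0 ai y = Complex (- push_left e \<alpha> a0 ai y) y"

definition par_interior :: "real \<Rightarrow> real \<Rightarrow> real \<Rightarrow> real \<Rightarrow> complex set" where
  "par_interior e \<alpha> a0 ai =
     {z. - push_left e \<alpha> a0 ai (Im z) < Re z \<and> Re z < 1 - push_left e \<alpha> a0 ai (Im z) \<and>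
         - push_bottom e \<alpha> a0 ai (Re z) < Im z \<and> Im z < 1 - push_bottom e \<alpha> a0 ai (Re z)}"

definition is_cut :: "real \<Rightarrow> real \<Rightarrow> real \<Rightarrow> real \<Rightarrow> (real \<Rightarrow> complex) \<Rightarrow> bool" where
  "is_cut e \<alpha> a0 ai \<sigma> \<longleftrightarrow> arc \<sigma> \<and> pathstart \<sigma> = 0 \<and> pathfinish \<sigma> = tred \<alpha> a0 ai \<and>
     \<sigma> ` {0<..1} \<subseteq> par_interior e \<alpha> a0 ai"

text \<open>
  The cut parallelogram together with its two open sides (over all \<open>\<tau>\<close>); a branch which is
  continuous here has its boundary values on the sides.
\<close>

definition cut_domain ::
  "real \<Rightarrow> real \<Rightarrow> real \<Rightarrow> real \<Rightarrow> (real \<Rightarrow> complex) \<Rightarrow> (complex \<times> complex) set" where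
  "cut_domain e \<alpha> a0 ai \<sigma> =
     {(\<tau>, mark \<tau> z) | \<tau> z. \<tau> \<in> UHP \<and>
        z \<in> (par_interior e \<alpha> a0 ai - path_image \<sigma>)
            \<union> bottom_side e \<alpha> a0 ai ` {0<..<1} \<union> left_side e \<alpha> a0 ai ` {0<..<1}}"

definition F_zero ::
  "real \<Rightarrow> real \<Rightarrow> real \<Rightarrow> real \<Rightarrow> (complex \<times> complex \<Rightarrow> complex) \<Rightarrow> complex \<Rightarrow> complex" where
  "F_zero e \<alpha> a0 ai T \<tau> =
     contour_integral (\<lambda>x. mark \<tau> (bottom_side e \<alpha> a0 ai x)) (\<lambda>u. T (\<tau>, u))"

definition F_infty ::
  "real \<Rightarrow> real \<Rightarrow> real \<Rightarrow> real \<Rightarrow> (complex \<times> complex \<Rightarrow> complex) \<Rightarrow> complex \<Rightarrow> complex" where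
  "F_infty e \<alpha> a0 ai T \<tau> =
     contour_integral (\<lambda>y. mark \<tau> (left_side e \<alpha> a0 ai y)) (\<lambda>u. T (\<tau>, u))"

definition ode_solution :: "real \<Rightarrow> real \<Rightarrow> real \<Rightarrow> (complex \<Rightarrow> complex) \<Rightarrow> bool" where
  "ode_solution \<alpha> a0 ai F \<longleftrightarrow> F holomorphic_on UHP \<and>
     (\<forall>\<tau>\<in>UHP. deriv (deriv F) \<tau> - (2 * \<i> * of_real pi * of_real (a0\<^sup>2 / \<alpha>)) * deriv F \<tau>
               + phi_pot \<alpha> a0 ai \<tau> * F \<tau> = 0)"

end

theory Submission
  imports Defs
begin

text \<open>
  Theta series satisfy the heat equation, and all needed identities between \<open>\<rho>\<close> and its derivatives
  follow from Liouville's theorem and the location of the zeros of \<open>\<theta>\<close>. They express \<open>\<partial>\<^sub>\<tau> (T du)\<close> and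
  \<open>\<partial>\<^sub>\<tau> (\<rho>' T du)\<close> through \<open>T du\<close> and \<open>\<rho>' T du\<close> up to exact forms, which gives the connection once the
  pairing of classes with twisted cycles is known to be nondegenerate. The second order equation holds for
  \<open>T\<close> itself modulo an exact form \<open>d (T R)\<close>; along the sides of the parallelogram the boundary terms vanish
  in the limit because \<open>T\<close> vanishes at the lattice points.

  The Wronskian of the two periods has no zero: otherwise a form \<open>h = \<lambda> + \<mu> \<partial>\<^sub>\<tau> log T\<close>, with \<open>\<lambda>\<close> and \<open>\<mu>\<close> not
  both \<open>0\<close>, has vanishing integrals against \<open>T\<close> along both sides. The solutions of \<open>f' + \<omega> f = h\<close> which are regular at the various lattice
  points then agree and form an entire function with \<open>f (u + 1) = f u\<close> and \<open>f (u + \<tau>) = f u - \<mu>\<close>. So \<open>f'\<close> is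
  constant, hence \<open>f = 0\<close> and \<open>\<lambda> = \<mu> = 0\<close>.
\<close>

section \<open>The theta series\<close>

text \<open>Cycles are transported at constant real coordinates, so a point
  \<open>mark \<tau> z\<close> moves with velocity \<open>Im z\<close>, and every derivative in
  \<tau> of an integral carries end point terms weighted by \<open>Im z\<close>. These are not
  periodic; neither are the primitives split off from the derivatives of \<open>T\<close>, since
  \<rho> drops by \<open>2 \<pi> i\<close> under \<open>u + \<tau>\<close>. The two defects cancel,
  on cycles as well as in the boundary term of the second order equation. The bounds on \<alpha> are
  spent at the punctures: \<open>\<alpha> > 0\<close> at 0, and \<open>\<alpha> < 1\<close> at
  \<open>t\<close>, where \<open>T\<close> has a singularity of order \<open>- \<alpha>\<close> that
  must be integrable. Together they make the monodromy around 0 nontrivial, so that a loop there can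
  serve as a regularised starting point of a path. The sides of the parallelogram link the regular
  solutions at neighbouring lattice points. If \<open>t\<close> lies on a side, the pushed side does
  not fit between the translates of \<open>t\<close>; in a sheared lattice basis \<open>t\<close> is
  interior to the cell again, and the pushed side joins opposite corners.\<close>

definition kap :: complex where "kap = 2 * \<i> * of_real pi"

lemma kap_nonzero [simp]: "kap \<noteq> 0"
  by (simp add: kap_def)

text \<open>Each derivative in \<open>u\<close> brings down a factor \<open>kap * (k + 1/2)\<close>.
  Giving all orders \<open>n\<close> one shape lets the heat equation, parity and convergence be
  checked term by term.\<close>

definition th_term :: "nat \<Rightarrow> complex \<Rightarrow> complex \<Rightarrow> int \<Rightarrow> complex" where
  "th_term n u \<tau> k = - \<i> * (kap * (of_int k + 1/2)) ^ n * ((-1) powi k *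
     exp (\<i> * of_real pi * (of_int k + 1/2)\<^sup>2 * \<tau> + 2 * \<i> * of_real pi * (of_int k + 1/2) * u))"

definition th :: "nat \<Rightarrow> complex \<Rightarrow> complex \<Rightarrow> complex" where
  "th n u \<tau> = (\<Sum>\<^sub>\<infinity>k. th_term n u \<tau> k)"

lemma jtheta_eq_th: "jtheta u \<tau> = th 0 u \<tau>"
  unfolding jtheta_def th_def th_term_def
  by (subst infsum_cmult_right' [symmetric]) (simp add: mult_ac)

lemma summable_exp_abs_int:
  "(\<lambda>k::int. exp (- \<bar>of_int k + 1/2 :: real\<bar>)) summable_on UNIV"
proof -
  have nat: "(\<lambda>n::nat. exp (- (real n + 1/2))) summable_on UNIV"
  proof -
    have "summable (\<lambda>n::nat. exp (-1/2) * (exp (-1)) ^ n :: real)"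
      by (intro summable_mult summable_geometric) auto
    also have "(\<lambda>n::nat. exp (-1/2) * (exp (-1)) ^ n :: real) = (\<lambda>n. exp (- (real n + 1/2)))"
      by (auto simp: fun_eq_iff exp_of_nat_mult [symmetric] exp_add [symmetric])
    finally show ?thesis
      by (subst summable_on_UNIV_nonneg_real_iff) auto
  qed
  have U: "(UNIV::int set) = range int \<union> range (\<lambda>n. - int n - 1)"
  proof (intro equalityI subsetI)
    fix k :: int
    show "k \<in> range int \<union> range (\<lambda>n. - int n - 1)"
    proof (cases "k \<ge> 0")
      case True
      then have "k = int (nat k)" by simp
      then show ?thesis by blast
    next
      case False
      then have "k = - int (nat (- k - 1)) - 1" by simp
      then show ?thesis by blast
    qed
  qed auto
  have "(\<lambda>k::int. exp (- \<bar>of_int k + 1/2 :: real\<bar>)) summable_on range int"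
    by (subst summable_on_reindex) (use nat in \<open>auto simp: o_def inj_on_def\<close>)
  moreover have "(\<lambda>k::int. exp (- \<bar>of_int k + 1/2 :: real\<bar>)) summable_on range (\<lambda>n. - int n - 1)"
  proof (subst summable_on_reindex)
    have "(\<lambda>k::int. exp (- \<bar>of_int k + 1/2 :: real\<bar>)) \<circ> (\<lambda>n. - int n - 1) = (\<lambda>n::nat. exp (- (real n + 1/2)))"
    proof
      fix n :: nat
      have "\<bar>of_int (- int n - 1) + 1/2 :: real\<bar> = real n + 1/2"
        by (simp add: abs_if)
      then show "((\<lambda>k::int. exp (- \<bar>of_int k + 1/2 :: real\<bar>)) \<circ> (\<lambda>n. - int n - 1)) n = exp (- (real n + 1/2))"
        by simp
    qed
    with nat show "(\<lambda>k::int. exp (- \<bar>of_int k + 1/2 :: real\<bar>)) \<circ> (\<lambda>n. - int n - 1) summable_on UNIV"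
      by simp
  qed (auto simp: inj_on_def)
  ultimately show ?thesis
    by (subst U, intro summable_on_Un_disjoint) auto
qed

text \<open>A single term of the exponential series is at most its sum. This trades the polynomial
  factor of a differentiated theta term for an exponential one.\<close>

lemma power_le_fact_mult_exp:
  fixes y :: real
  assumes "y \<ge> 0"
  shows "y ^ n \<le> fact n * exp y"
proof -
  have "y ^ n /\<^sub>R fact n \<le> (\<Sum>k. y ^ k /\<^sub>R fact k)"
    using sum_le_suminf[OF summable_exp_generic[of y], of "{n}"] assms by auto
  then have "y ^ n / fact n \<le> exp y"
    by (simp add: exp_def divide_inverse mult.commute)
  then show ?thesis
    by (simp add: field_simps)
qed

text \<open>Gaussian decay in \<open>k\<close> beats every linear exponential: the one from
  \<open>u\<close>, the one replacing the power of \<open>k\<close>, and one more that is held back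
  so that the majorant is summable. The bound is uniform for bounded \<open>u\<close> and
  \<open>Im \<tau> \<ge> \<delta>\<close>.\<close>

lemma th_term_bound:
  assumes "R \<ge> 0" "\<delta> > 0" "norm u \<le> R" "\<delta> \<le> Im \<tau>"
  shows "norm (th_term n u \<tau> k) \<le>
     fact n * exp ((2 * pi * R + 2 * pi + 1)\<^sup>2 / (4 * pi * \<delta>)) * exp (- \<bar>of_int k + 1/2 :: real\<bar>)"
proof -
  define x where "x = (of_int k + 1/2 :: real)"
  define B where "B = 2 * pi * R + 2 * pi + 1"
  have xc: "of_int k + 1/2 = complex_of_real x"
    by (simp add: x_def)
  have nkap: "norm (kap * (of_int k + 1/2)) = 2 * pi * \<bar>x\<bar>"
    unfolding xc by (simp add: kap_def norm_mult)
  have nexp: "norm (exp (\<i> * of_real pi * (of_int k + 1/2)\<^sup>2 * \<tau> + 2 * \<i> * of_real pi * (of_int k + 1/2) * u))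
      = exp (- pi * x\<^sup>2 * Im \<tau> - 2 * pi * x * Im u)"
    unfolding xc norm_exp_eq_Re by (simp add: power2_eq_square)
  have sgn: "norm ((-1::complex) powi k) = 1"
    by (simp add: norm_power_int)
  have "norm (th_term n u \<tau> k) = (2 * pi * \<bar>x\<bar>) ^ n * exp (- pi * x\<^sup>2 * Im \<tau> - 2 * pi * x * Im u)"
    using nkap nexp sgn unfolding th_term_def norm_mult norm_power by simp
  also have "\<dots> \<le> (fact n * exp (2 * pi * \<bar>x\<bar>)) * exp (- pi * x\<^sup>2 * \<delta> + 2 * pi * \<bar>x\<bar> * R)"
  proof (intro mult_mono power_le_fact_mult_exp)
    have "- (x * Im u) \<le> \<bar>x\<bar> * R"
    proof -
      have "- (x * Im u) \<le> \<bar>x\<bar> * \<bar>Im u\<bar>" by (metis abs_ge_minus_self abs_mult)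
      also have "\<dots> \<le> \<bar>x\<bar> * R"
        using abs_Im_le_cmod[of u] assms by (intro mult_left_mono) auto
      finally show ?thesis .
    qed
    then have "2 * pi * (- (x * Im u)) \<le> 2 * pi * (\<bar>x\<bar> * R)"
      by (intro mult_left_mono) auto
    moreover have "pi * x\<^sup>2 * \<delta> \<le> pi * x\<^sup>2 * Im \<tau>"
      using assms by (intro mult_left_mono) auto
    ultimately have "- pi * x\<^sup>2 * Im \<tau> - 2 * pi * x * Im u \<le> - pi * x\<^sup>2 * \<delta> + 2 * pi * \<bar>x\<bar> * R"
      by (simp only: mult_minus_left mult_minus_right mult.assoc)
    then show "exp (- pi * x\<^sup>2 * Im \<tau> - 2 * pi * x * Im u) \<le> exp (- pi * x\<^sup>2 * \<delta> + 2 * pi * \<bar>x\<bar> * R)"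
      by simp
  qed auto
  also have "\<dots> = fact n * exp (B * \<bar>x\<bar> - pi * \<delta> * x\<^sup>2) * exp (- \<bar>x\<bar>)"
    by (simp add: B_def exp_add [symmetric] algebra_simps)
  also have "\<dots> \<le> fact n * exp (B\<^sup>2 / (4 * pi * \<delta>)) * exp (- \<bar>x\<bar>)"
  proof -
    \<comment> \<open>Completing the square: the exponent \<open>B |x| - \<pi> \<delta> x^2\<close>
      never exceeds its maximum \<open>B^2 / (4 \<pi> \<delta>)\<close>.\<close>
    have "0 \<le> (2 * pi * \<delta> * \<bar>x\<bar> - B)\<^sup>2" by simp
    then have "4 * pi * \<delta> * (B * \<bar>x\<bar> - pi * \<delta> * x\<^sup>2) \<le> B\<^sup>2"
      by (simp add: power2_eq_square algebra_simps)
    then have "B * \<bar>x\<bar> - pi * \<delta> * x\<^sup>2 \<le> B\<^sup>2 / (4 * pi * \<delta>)"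
      using assms by (simp add: field_simps)
    then show ?thesis by (intro mult_mono) auto
  qed
  finally show ?thesis by (simp add: B_def x_def)
qed

lemma th_uniform_limit:
  assumes "R \<ge> 0" "\<delta> > 0"
  shows "uniform_limit (cball 0 R \<times> {\<tau>. \<delta> \<le> Im \<tau>})
    (\<lambda>X p. \<Sum>k\<in>X. th_term n (fst p) (snd p) k) (\<lambda>p. th n (fst p) (snd p)) (finite_subsets_at_top UNIV)"
  unfolding th_def
proof (rule Weierstrass_m_test_general)
  show "(\<lambda>k. fact n * exp ((2 * pi * R + 2 * pi + 1)\<^sup>2 / (4 * pi * \<delta>)) * exp (- \<bar>of_int k + 1/2 :: real\<bar>)) summable_on UNIV"
    by (intro summable_on_cmult_right summable_exp_abs_int)
qed (use th_term_bound assms in auto)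

lemma th_term_summable:
  assumes "Im \<tau> > 0"
  shows "th_term n u \<tau> summable_on UNIV"
proof -
  have "(\<lambda>k. norm (th_term n u \<tau> k)) summable_on UNIV"
    by (rule summable_on_comparison_test[OF
          summable_on_cmult_right[OF summable_exp_abs_int]])
       (use th_term_bound[of "norm u" "Im \<tau>" u \<tau> n] assms in auto)
  then show ?thesis by (rule abs_summable_summable)
qed

lemma th_continuous_on: "continuous_on (UNIV \<times> UHP) (\<lambda>p. th n (fst p) (snd p))"
proof -
  have "isCont (\<lambda>p. th n (fst p) (snd p)) (u, \<tau>)" if "Im \<tau> > 0" for u \<tau>
  proof -
    define s where "s = ball (0::complex) (norm u + 1) \<times> {w. Im \<tau> / 2 < Im w}"
    have "uniform_limit s (\<lambda>X p. \<Sum>k\<in>X. th_term n (fst p) (snd p) k) (\<lambda>p. th n (fst p) (snd p)) (finite_subsets_at_top UNIV)"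
      by (rule uniform_limit_on_subset[OF th_uniform_limit[of "norm u + 1" "Im \<tau> / 2"]])
         (use that in \<open>auto simp: s_def\<close>)
    then have "continuous_on s (\<lambda>p. th n (fst p) (snd p))"
      by (rule uniform_limit_theorem[rotated])
         (auto simp: th_term_def intro!: always_eventually continuous_intros)
    moreover have "open s"
      unfolding s_def by (intro open_Times open_halfspace_Im_gt) auto
    moreover have "(u, \<tau>) \<in> s"
      using that by (simp add: s_def)
    ultimately show ?thesis
      by (simp add: continuous_on_eq_continuous_at)
  qed
  then show ?thesis
    by (intro continuous_at_imp_continuous_on) (auto simp: UHP_def)
qed

lemma th_term_deriv_u:
  "((\<lambda>u. th_term n u \<tau> k) has_field_derivative th_term (Suc n) u \<tau> k) (at u)"
proof -
  define c where "c = of_int k + (1/2 :: complex)"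
  show ?thesis
    unfolding th_term_def c_def [symmetric]
    by (rule derivative_eq_intros refl | simp)+ (simp add: kap_def algebra_simps)
qed

lemma th_term_deriv_tau:
  "((\<lambda>\<tau>. th_term n u \<tau> k) has_field_derivative th_term (n + 2) u \<tau> k / (2 * kap)) (at \<tau>)"
proof -
  define c where "c = of_int k + (1/2 :: complex)"
  define A where "A = \<i> * of_real pi * c\<^sup>2"
  define B where "B = 2 * \<i> * of_real pi * c * u"
  have A: "A = (kap * c)\<^sup>2 / (2 * kap)"
    by (simp add: A_def kap_def power2_eq_square field_simps)
  have "((\<lambda>\<tau>. - \<i> * (kap * c) ^ n * ((-1) powi k * exp (A * \<tau> + B))) has_field_derivative
      - \<i> * (kap * c) ^ n * ((-1) powi k * (A * exp (A * \<tau> + B)))) (at \<tau>)"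
    by (rule derivative_eq_intros refl | simp)+
  also have "- \<i> * (kap * c) ^ n * ((-1) powi k * (A * exp (A * \<tau> + B))) =
      - \<i> * (kap * c) ^ (n + 2) * ((-1) powi k * exp (A * \<tau> + B)) / (2 * kap)"
    unfolding power_add by (subst A) (simp only: mult_ac times_divide_eq_right)
  finally show ?thesis
    unfolding th_term_def c_def [symmetric] A_def [symmetric] B_def [symmetric] .
qed

lemma th_term_continuous_u: "continuous_on S (\<lambda>u. th_term n u \<tau> k)"
  unfolding th_term_def by (intro continuous_intros)

lemma th_term_continuous_tau: "continuous_on S (\<lambda>\<tau>. th_term n u \<tau> k)"
  unfolding th_term_def by (intro continuous_intros)

lemma th_deriv_u:
  assumes "Im \<tau> > 0"
  shows "((\<lambda>u. th n u \<tau>) has_field_derivative th (Suc n) u \<tau>) (at u)"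
proof -
  let ?F = "finite_subsets_at_top (UNIV::int set)"
  have ball_norm: "norm w \<le> norm u + 1" if "dist u w \<le> 1" for w
    using that norm_triangle_sub[of w u] by (simp add: dist_norm norm_minus_commute)
  have lim: "uniform_limit (cball u 1) (\<lambda>X u. \<Sum>k\<in>X. th_term n u \<tau> k) (\<lambda>u. th n u \<tau>) ?F"
  proof -
    have "uniform_limit ((\<lambda>u. (u, \<tau>)) ` cball u 1) (\<lambda>X p. \<Sum>k\<in>X. th_term n (fst p) (snd p) k) (\<lambda>p. th n (fst p) (snd p)) ?F"
      by (rule uniform_limit_on_subset[OF th_uniform_limit[of "norm u + 1" "Im \<tau>"]])
         (use assms ball_norm in auto)
    then show ?thesis by (simp add: uniform_limit_iff)
  qed
  obtain g' where g': "\<And>w. w \<in> ball u 1 \<Longrightarrow> ((\<lambda>u. th n u \<tau>) has_field_derivative g' w) (at w) \<and>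
      ((\<lambda>X. \<Sum>k\<in>X. th_term (Suc n) w \<tau> k) \<longlongrightarrow> g' w) ?F"
  proof (rule has_complex_derivative_uniform_limit[OF _ lim _ zero_less_one,
        where f' = "\<lambda>X w. \<Sum>k\<in>X. th_term (Suc n) w \<tau> k"])
    show "\<forall>\<^sub>F X in ?F. continuous_on (cball u 1) (\<lambda>u. \<Sum>k\<in>X. th_term n u \<tau> k) \<and>
        (\<forall>w\<in>ball u 1. ((\<lambda>u. \<Sum>k\<in>X. th_term n u \<tau> k) has_field_derivative (\<Sum>k\<in>X. th_term (Suc n) w \<tau> k)) (at w))"
      by (intro always_eventually allI conjI ballI)
         (auto intro!: continuous_intros DERIV_sum th_term_deriv_u th_term_continuous_u)
  qed auto
  have "((\<lambda>X. \<Sum>k\<in>X. th_term (Suc n) u \<tau> k) \<longlongrightarrow> th (Suc n) u \<tau>) ?F"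
    using has_sum_infsum[OF th_term_summable[OF assms, of "Suc n" u]] by (simp add: has_sum_def th_def)
  then have "g' u = th (Suc n) u \<tau>"
    using g'[of u] tendsto_unique[of ?F] by auto
  then show ?thesis using g'[of u] by auto
qed

text \<open>The heat equation, as \<open>2 * kap = 4 \<pi> i\<close>: the exponent has
  \<open>(k + 1/2)^2\<close> with \<tau> but \<open>k + 1/2\<close> with \<open>u\<close>, so one
  derivative in \<tau> is worth two in \<open>u\<close>.\<close>

lemma th_deriv_tau:
  assumes "Im \<tau> > 0"
  shows "((\<lambda>\<tau>. th n u \<tau>) has_field_derivative th (n + 2) u \<tau> / (2 * kap)) (at \<tau>)"
proof -
  let ?F = "finite_subsets_at_top (UNIV::int set)"
  define r where "r = Im \<tau> / 2"
  have r: "r > 0" using assms by (simp add: r_def)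
  have Imr: "r \<le> Im w" if "w \<in> cball \<tau> r" for w
  proof -
    have "Im (\<tau> - w) \<le> r"
      using that abs_Im_le_cmod[of "\<tau> - w"] by (auto simp: dist_norm)
    then show ?thesis by (simp add: r_def)
  qed
  have lim: "uniform_limit (cball \<tau> r) (\<lambda>X \<tau>. \<Sum>k\<in>X. th_term n u \<tau> k) (\<lambda>\<tau>. th n u \<tau>) ?F"
  proof -
    have "uniform_limit ((\<lambda>\<tau>. (u, \<tau>)) ` cball \<tau> r) (\<lambda>X p. \<Sum>k\<in>X. th_term n (fst p) (snd p) k) (\<lambda>p. th n (fst p) (snd p)) ?F"
      by (rule uniform_limit_on_subset[OF th_uniform_limit[of "norm u" r]]) (use Imr r in auto)
    then show ?thesis by (simp add: uniform_limit_iff)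
  qed
  obtain g' where g': "\<And>w. w \<in> ball \<tau> r \<Longrightarrow> ((\<lambda>\<tau>. th n u \<tau>) has_field_derivative g' w) (at w) \<and>
      ((\<lambda>X. \<Sum>k\<in>X. th_term (n + 2) u w k / (2 * kap)) \<longlongrightarrow> g' w) ?F"
  proof (rule has_complex_derivative_uniform_limit[OF _ lim _ r,
        where f' = "\<lambda>X w. \<Sum>k\<in>X. th_term (n + 2) u w k / (2 * kap)"])
    show "\<forall>\<^sub>F X in ?F. continuous_on (cball \<tau> r) (\<lambda>\<tau>. \<Sum>k\<in>X. th_term n u \<tau> k) \<and>
        (\<forall>w\<in>ball \<tau> r. ((\<lambda>\<tau>. \<Sum>k\<in>X. th_term n u \<tau> k) has_field_derivative (\<Sum>k\<in>X. th_term (n + 2) u w k / (2 * kap))) (at w))"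
      by (intro always_eventually allI conjI ballI)
         (auto intro!: continuous_intros DERIV_sum th_term_deriv_tau[unfolded add_2_eq_Suc'] th_term_continuous_tau)
  qed auto
  have "((\<lambda>X. (\<Sum>k\<in>X. th_term (n + 2) u \<tau> k) / (2 * kap)) \<longlongrightarrow> th (n + 2) u \<tau> / (2 * kap)) ?F"
    using has_sum_infsum[OF th_term_summable[OF assms, of "n + 2" u]]
    by (intro tendsto_divide) (auto simp: has_sum_def th_def)
  then have "g' \<tau> = th (n + 2) u \<tau> / (2 * kap)"
    using g'[of \<tau>] r tendsto_unique[of ?F] by (auto simp: sum_divide_distrib)
  then show ?thesis using g'[of \<tau>] r by auto
qed

section \<open>Real coordinates and quasi-periodicity\<close>

lemma UHP_iff [simp]: "\<tau> \<in> UHP \<longleftrightarrow> Im \<tau> > 0"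
  by (simp add: UHP_def)

lemma open_UHP: "open UHP"
  unfolding UHP_def by (rule open_halfspace_Im_gt)

lemma convex_UHP: "convex UHP"
  unfolding UHP_def by (rule convex_halfspace_Im_gt)

lemma exp_kap_of_int [simp]: "exp (kap * of_int m) = 1"
  by (simp add: kap_def exp_eq_1 mult_ac)

lemma exp_kap_half: "exp (kap / 2) = -1"
  by (simp add: kap_def)

lemma mark_add [simp]: "mark \<tau> (a + b) = mark \<tau> a + mark \<tau> b"
  by (simp add: mark_def algebra_simps)

lemma mark_diff [simp]: "mark \<tau> (a - b) = mark \<tau> a - mark \<tau> b"
  by (simp add: mark_def algebra_simps)

lemma mark_0 [simp]: "mark \<tau> 0 = 0"
  by (simp add: mark_def)

lemma mark_Complex: "mark \<tau> (Complex x y) = of_real x + of_real y * \<tau>"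
  by (simp add: mark_def)

lemma mark_scaleR: "mark \<tau> (r *\<^sub>R z) = r *\<^sub>R mark \<tau> z"
  by (simp add: mark_def scaleR_conv_of_real algebra_simps)

lemma linear_mark: "linear (mark \<tau>)"
  by (rule linearI) (auto simp: mark_scaleR)

text \<open>At \<open>\<tau> = \<i>\<close> the real coordinates are the plane itself, so facts
  about \<open>mark \<tau>\<close> specialise to facts about the lattice and the punctures in real
  coordinates.\<close>

lemma mark_ii [simp]: "mark \<i> z = z"
  by (simp add: mark_def complex_eq_iff)

lemma inj_mark:
  assumes "Im \<tau> > 0"
  shows "inj (mark \<tau>)"
proof (rule injI)
  fix a b assume *: "mark \<tau> a = mark \<tau> b"
  from arg_cong[OF this, of Im] assms have "Im a = Im b" by (simp add: mark_def)
  with arg_cong[OF *, of Re] show "a = b" by (simp add: mark_def complex_eq_iff)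
qed

definition unmark :: "complex \<Rightarrow> complex \<Rightarrow> complex" where
  "unmark \<tau> u = Complex (Re u - Im u / Im \<tau> * Re \<tau>) (Im u / Im \<tau>)"

lemma mark_unmark [simp]: "Im \<tau> > 0 \<Longrightarrow> mark \<tau> (unmark \<tau> u) = u"
  by (simp add: mark_def unmark_def complex_eq_iff)

lemma unmark_mark [simp]: "Im \<tau> > 0 \<Longrightarrow> unmark \<tau> (mark \<tau> z) = z"
  by (simp add: mark_def unmark_def complex_eq_iff)

lemma continuous_on_mark [continuous_intros]:
  "continuous_on S f \<Longrightarrow> continuous_on S g \<Longrightarrow> continuous_on S (\<lambda>x. mark (f x) (g x))"
  unfolding mark_def by (intro continuous_intros)

lemma continuous_on_unmark: "continuous_on S (unmark \<tau>)"
proof -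
  have "unmark \<tau> = (\<lambda>u. of_real (Re u - Im u / Im \<tau> * Re \<tau>) + \<i> * of_real (Im u / Im \<tau>))"
    by (auto simp: fun_eq_iff unmark_def complex_eq_iff)
  then show ?thesis
    by (simp only:) (auto simp: divide_inverse intro!: continuous_intros)
qed

lemma open_mark_image:
  assumes "Im \<tau> > 0" "open S"
  shows "open (mark \<tau> ` S)"
proof -
  have "mark \<tau> ` S = unmark \<tau> -` S"
    using assms(1) by (auto simp: image_iff) (metis mark_unmark)
  then show ?thesis
    using open_vimage[OF assms(2) continuous_on_unmark] by simp
qed

lemma convex_mark_image: "convex S \<Longrightarrow> convex (mark \<tau> ` S)"
  by (rule convex_linear_image[OF linear_mark])

lemma gauss_lattice_iff: "l \<in> gauss_lattice \<longleftrightarrow> (\<exists>m n. l = Complex (of_int m) (of_int n))"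
  by (auto simp: gauss_lattice_def)

lemma gauss_lattice_ReIm: "l \<in> gauss_lattice \<longleftrightarrow> Re l \<in> \<int> \<and> Im l \<in> \<int>"
  unfolding gauss_lattice_iff by (auto simp: complex_eq_iff elim!: Ints_cases)

lemma gauss_lattice_closed [simp, intro]:
  "0 \<in> gauss_lattice"
  "a \<in> gauss_lattice \<Longrightarrow> b \<in> gauss_lattice \<Longrightarrow> a + b \<in> gauss_lattice"
  "a \<in> gauss_lattice \<Longrightarrow> b \<in> gauss_lattice \<Longrightarrow> a - b \<in> gauss_lattice"
  "a \<in> gauss_lattice \<Longrightarrow> - a \<in> gauss_lattice"
  by (auto simp: gauss_lattice_ReIm)

text \<open>Two points of the coset differ by some \<open>m + n \<tau>\<close>. Its imaginary part
  has modulus at least \<open>Im \<tau>\<close> unless \<open>n = 0\<close>, and then its modulus is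
  at least 1 unless \<open>m = 0\<close>.\<close>

lemma not_islimpt_lattice_coset:
  assumes "Im \<tau> > 0"
  shows "\<not> z islimpt (\<lambda>l. c + mark \<tau> l) ` gauss_lattice"
proof -
  define e where "e = min 1 (Im \<tau>)"
  have e: "e > 0" using assms by (simp add: e_def)
  have "y = x" if "x \<in> (\<lambda>l. c + mark \<tau> l) ` gauss_lattice" "y \<in> (\<lambda>l. c + mark \<tau> l) ` gauss_lattice" "dist y x < e" for x y
  proof -
    from that(1,2) obtain a b where ab: "a \<in> gauss_lattice" "b \<in> gauss_lattice" "x = c + mark \<tau> a" "y = c + mark \<tau> b" by auto
    then have "b - a \<in> gauss_lattice" by auto
    then obtain m n where mn: "b - a = Complex (of_int m) (of_int n)" unfolding gauss_lattice_iff by auto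
    have d: "norm (of_int m + of_int n * \<tau>) < e"
      using that(3) ab mark_diff[of \<tau> b a] mn by (simp add: dist_norm mark_Complex)
    have "\<bar>of_int n * Im \<tau>\<bar> < Im \<tau>"
      using abs_Im_le_cmod[of "of_int m + of_int n * \<tau>"] d by (simp add: e_def)
    then have "\<bar>of_int n :: real\<bar> * Im \<tau> < 1 * Im \<tau>" using assms by (simp add: abs_mult)
    then have n0: "n = 0" using assms by (simp add: mult_less_cancel_right)
    with d have "\<bar>real_of_int m\<bar> < 1" by (simp add: e_def)
    then have "m = 0" by linarith
    with n0 mn have "b = a" by (simp add: complex_eq_iff)
    with ab show ?thesis by simp
  qed
  then show ?thesis using discrete_imp_not_islimpt[OF e] by blast
qed

lemma not_islimpt_Lam: "Im \<tau> > 0 \<Longrightarrow> \<not> z islimpt mark \<tau> ` gauss_lattice"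
  using not_islimpt_lattice_coset[of \<tau> z 0] by simp

lemma th_term_shift_1: "th_term n (u + 1) \<tau> k = - th_term n u \<tau> k"
proof -
  have "\<i> * of_real pi * (of_int k + 1/2)\<^sup>2 * \<tau> + 2 * \<i> * of_real pi * (of_int k + 1/2) * (u + 1)
      = (\<i> * of_real pi * (of_int k + 1/2)\<^sup>2 * \<tau> + 2 * \<i> * of_real pi * (of_int k + 1/2) * u)
         + (kap * of_int k + kap / 2)"
    by (simp add: kap_def algebra_simps)
  then show ?thesis
    unfolding th_term_def by (simp add: exp_add exp_kap_half del: exp_kap_of_int) (simp add: exp_add)
qed

lemma th_shift_1: "th n (u + 1) \<tau> = - th n u \<tau>"
  unfolding th_def th_term_shift_1 by (rule infsum_uminus)

text \<open>Completing the square in the exponent turns \<open>k\<close> into \<open>k + 1\<close>,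
  at the price of a factor that does not depend on \<open>k\<close>.\<close>

lemma th_term_shift_tau:
  "th_term 0 (u + \<tau>) \<tau> k = - exp (- kap * (\<tau> / 2 + u)) * th_term 0 u \<tau> (k + 1)"
proof -
  define c where "c = of_int k + (1/2::complex)"
  have c1: "of_int (k + 1) + 1/2 = c + 1" by (simp add: c_def)
  have E: "\<i> * of_real pi * c\<^sup>2 * \<tau> + 2 * \<i> * of_real pi * c * (u + \<tau>)
     = - kap * (\<tau> / 2 + u) + (\<i> * of_real pi * (c + 1)\<^sup>2 * \<tau> + 2 * \<i> * of_real pi * (c + 1) * u)"
    by (simp add: kap_def power2_eq_square algebra_simps)
  moreover have "(-1::complex) powi (k + 1) = - ((-1) powi k)"
    by (simp add: power_int_add)
  ultimately show ?thesis
    unfolding th_term_def c1 c_def [symmetric] E exp_add[of "- kap * (\<tau> / 2 + u)"] by simp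
qed

lemma th0_shift_tau: "th 0 (u + \<tau>) \<tau> = - exp (- kap * (\<tau> / 2 + u)) * th 0 u \<tau>"
proof -
  have "th 0 (u + \<tau>) \<tau> = (\<Sum>\<^sub>\<infinity>k. - exp (- kap * (\<tau> / 2 + u)) * th_term 0 u \<tau> (k + 1))"
    unfolding th_def by (intro infsum_cong th_term_shift_tau)
  also have "\<dots> = - exp (- kap * (\<tau> / 2 + u)) * (\<Sum>\<^sub>\<infinity>k. th_term 0 u \<tau> (k + 1))"
    by (rule infsum_cmult_right')
  also have "(\<Sum>\<^sub>\<infinity>k. th_term 0 u \<tau> (k + 1)) = th 0 u \<tau>"
    unfolding th_def by (rule infsum_reindex_bij_betw[of "\<lambda>k. k + 1"]) (auto intro: bij_plus_right)
  finally show ?thesis .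
qed

text \<open>The substitution of \<open>- k - 1\<close> for \<open>k\<close> reverses the sign of
  \<open>k + 1/2\<close>; this costs one sign per derivative and one from the alternating
  factor.\<close>

lemma th_minus: "th n (- u) \<tau> = (-1) ^ Suc n * th n u \<tau>"
proof -
  have "th_term n (- u) \<tau> (- k - 1) = (-1) ^ Suc n * th_term n u \<tau> k" for k
  proof -
    define c where "c = of_int k + (1/2::complex)"
    have c1: "of_int (- k - 1) + 1/2 = - c" by (simp add: c_def)
    have "(-1::complex) powi (- k - 1) = - ((-1) powi k)"
      by (cases "even k") (auto simp: power_int_minus_left)
    moreover have "(kap * - c) ^ n = (-1) ^ n * (kap * c) ^ n"
      by (metis mult_minus_right power_minus)
    ultimately show ?thesis
      unfolding th_term_def c1 c_def [symmetric] by simp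
  qed
  then have "(-1) ^ Suc n * th n u \<tau> = (\<Sum>\<^sub>\<infinity>k. th_term n (- u) \<tau> (- k - 1))"
    unfolding th_def by (simp only: infsum_cmult_right')
  also have "\<dots> = th n (- u) \<tau>"
    unfolding th_def
    by (rule infsum_reindex_bij_betw[of "\<lambda>k. - k - 1"])
       (rule bij_betwI[of _ _ _ "\<lambda>k. - k - 1"], auto)
  finally show ?thesis ..
qed

lemma th_even_0: "even n \<Longrightarrow> th n 0 \<tau> = 0"
  using th_minus[of n 0 \<tau>] by simp

lemma th0_shift_int: "th 0 (u + of_int m) \<tau> = exp (kap * of_int m / 2) * th 0 u \<tau>"
proof (induction m rule: int_induct[where k = 0])
  case (step1 i)
  have "th 0 (u + of_int (i + 1)) \<tau> = - th 0 (u + of_int i) \<tau>"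
    using th_shift_1[of 0 "u + of_int i" \<tau>] by (simp add: add.assoc)
  then show ?case
    using step1 exp_kap_half by (simp add: ring_distribs add_divide_distrib exp_add)
next
  case (step2 i)
  have "th 0 (u + of_int i) \<tau> = - th 0 (u + of_int (i - 1)) \<tau>"
    using th_shift_1[of 0 "u + of_int (i - 1)" \<tau>] by simp
  then have "th 0 (u + of_int (i - 1)) \<tau> = - exp (kap * of_int i / 2) * th 0 u \<tau>"
    using step2 by (simp add: minus_equation_iff)
  moreover have "exp (kap * of_int i / 2) = exp (kap * of_int (i - 1) / 2) * exp (kap / 2)"
    by (simp add: exp_add [symmetric] algebra_simps add_divide_distrib diff_divide_distrib)
  ultimately show ?case by (simp add: exp_kap_half)
qed auto

lemma th0_shift_int_tau:
  "th 0 (u + of_int n * \<tau>) \<tau> = exp (kap * (of_int n / 2 - of_int n ^ 2 * \<tau> / 2 - of_int n * u)) * th 0 u \<tau>"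
proof (induction n rule: int_induct[where k = 0])
  case (step1 i)
  have "th 0 (u + of_int (i + 1) * \<tau>) \<tau> = exp (kap / 2) * exp (- kap * (\<tau> / 2 + (u + of_int i * \<tau>))) * th 0 (u + of_int i * \<tau>) \<tau>"
    using th0_shift_tau[of "u + of_int i * \<tau>" \<tau>] by (simp add: algebra_simps exp_kap_half)
  then show ?case
    unfolding step1 by (simp add: exp_add [symmetric] mult.assoc [symmetric])
      (simp add: power2_eq_square field_simps)
next
  case (step2 i)
  define A where "A = kap / 2 + - kap * (\<tau> / 2 + (u + of_int (i - 1) * \<tau>))"
  have "th 0 (u + of_int i * \<tau>) \<tau> = exp A * th 0 (u + of_int (i - 1) * \<tau>) \<tau>"
    using th0_shift_tau[of "u + of_int (i - 1) * \<tau>" \<tau>]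
    unfolding A_def exp_add by (simp add: algebra_simps exp_kap_half)
  then have "th 0 (u + of_int (i - 1) * \<tau>) \<tau> = exp (- A) * th 0 (u + of_int i * \<tau>) \<tau>"
    by (simp add: exp_minus)
  moreover have "- A + kap * (of_int i / 2 - of_int i ^ 2 * \<tau> / 2 - of_int i * u) =
      kap * (of_int (i - 1) / 2 - of_int (i - 1) ^ 2 * \<tau> / 2 - of_int (i - 1) * u)"
    by (simp add: A_def power2_eq_square field_simps)
  ultimately show ?case
    unfolding step2 by (metis exp_add mult.assoc)
qed auto

lemma th0_shift_lattice:
  "th 0 (u + mark \<tau> (Complex (of_int m) (of_int n))) \<tau> =
     exp (kap * ((of_int m + of_int n) / 2 - of_int n ^ 2 * \<tau> / 2 - of_int n * u)) * th 0 u \<tau>"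
proof -
  have "th 0 (u + mark \<tau> (Complex (of_int m) (of_int n))) \<tau> = th 0 ((u + of_int n * \<tau>) + of_int m) \<tau>"
    by (simp add: mark_Complex algebra_simps)
  also have "\<dots> = exp (kap * of_int m / 2) * exp (kap * (of_int n / 2 - of_int n ^ 2 * \<tau> / 2 - of_int n * u)) * th 0 u \<tau>"
    unfolding th0_shift_int th0_shift_int_tau by (simp add: mult.assoc)
  also have "\<dots> = exp (kap * ((of_int m + of_int n) / 2 - of_int n ^ 2 * \<tau> / 2 - of_int n * u)) * th 0 u \<tau>"
    by (simp add: exp_add [symmetric]) (simp add: algebra_simps add_divide_distrib)
  finally show ?thesis .
qed

lemma th_lattice_eq_0: "u \<in> mark \<tau> ` gauss_lattice \<Longrightarrow> th 0 u \<tau> = 0"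
  using th0_shift_lattice[of 0 \<tau>] by (auto simp: gauss_lattice_iff th_even_0)

section \<open>Doubly periodic functions and Liouville's theorem\<close>

lemma periodic_add_int:
  fixes f :: "complex \<Rightarrow> 'a"
  assumes "\<And>u. f (u + w) = f u"
  shows "f (u + of_int n * w) = f u"
proof (induction n rule: int_induct[where k = 0])
  case (step1 i)
  then show ?case using assms[of "u + of_int i * w"] by (simp add: algebra_simps)
next
  case (step2 i)
  then show ?case using assms[of "u + of_int (i - 1) * w"] by (simp add: algebra_simps)
qed auto

lemma periodic_lattice:
  fixes f :: "complex \<Rightarrow> 'a"
  assumes "\<And>u. f (u + 1) = f u" "\<And>u. f (u + \<tau>) = f u" "l \<in> gauss_lattice"
  shows "f (u + mark \<tau> l) = f u"
proof -
  from assms(3) obtain m n where l: "l = Complex (of_int m) (of_int n)" by (auto simp: gauss_lattice_iff)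
  have "f (u + mark \<tau> l) = f ((u + of_int n * \<tau>) + of_int m * 1)"
    by (simp add: l mark_Complex algebra_simps)
  also have "\<dots> = f u"
    by (simp only: periodic_add_int[of f 1, OF assms(1)] periodic_add_int[of f \<tau>, OF assms(2)])
  finally show ?thesis .
qed

lemma lattice_reduce:
  assumes "Im \<tau> > 0"
  obtains l z where "l \<in> gauss_lattice" "z \<in> cbox 0 (Complex 1 1)" "u = mark \<tau> z + mark \<tau> l"
proof
  define w where "w = unmark \<tau> u"
  show "Complex (of_int \<lfloor>Re w\<rfloor>) (of_int \<lfloor>Im w\<rfloor>) \<in> gauss_lattice" by (auto simp: gauss_lattice_iff)
  show "Complex (frac (Re w)) (frac (Im w)) \<in> cbox 0 (Complex 1 1)"
    by (auto simp: cbox_def Basis_complex_def frac_lt_1 less_imp_le)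
  have "w = Complex (frac (Re w)) (frac (Im w)) + Complex (of_int \<lfloor>Re w\<rfloor>) (of_int \<lfloor>Im w\<rfloor>)"
    by (simp add: complex_eq_iff frac_def)
  then have "mark \<tau> w = mark \<tau> (Complex (frac (Re w)) (frac (Im w))) + mark \<tau> (Complex (of_int \<lfloor>Re w\<rfloor>) (of_int \<lfloor>Im w\<rfloor>))"
    by (metis mark_add)
  then show "u = mark \<tau> (Complex (frac (Re w)) (frac (Im w))) + mark \<tau> (Complex (of_int \<lfloor>Re w\<rfloor>) (of_int \<lfloor>Im w\<rfloor>))"
    using assms by (simp add: w_def)
qed

lemma entire_elliptic_const:
  assumes "Im \<tau> > 0" "f holomorphic_on UNIV" "\<And>u. f (u + 1) = f u" "\<And>u. f (u + \<tau>) = f u"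
  obtains c where "\<And>u. f u = c"
proof -
  have "compact (mark \<tau> ` cbox 0 (Complex 1 1))"
    by (auto intro!: compact_continuous_image continuous_intros)
  then have "compact (f ` mark \<tau> ` cbox 0 (Complex 1 1))"
    by (intro compact_continuous_image[OF holomorphic_on_imp_continuous_on[OF holomorphic_on_subset[OF assms(2)]]]) auto
  moreover have "range f \<subseteq> f ` mark \<tau> ` cbox 0 (Complex 1 1)"
  proof safe
    fix u
    obtain l z where "l \<in> gauss_lattice" "z \<in> cbox 0 (Complex 1 1)" "u = mark \<tau> z + mark \<tau> l"
      using lattice_reduce[OF assms(1)] by blast
    then show "f u \<in> f ` mark \<tau> ` cbox 0 (Complex 1 1)"
      using periodic_lattice[of f \<tau> l, OF assms(3,4)] by auto
  qed
  ultimately have "bounded (range f)"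
    using bounded_subset compact_imp_bounded by blast
  then show ?thesis
    using Liouville_theorem[OF assms(2)] that by (auto simp: constant_on_def)
qed

lemma holomorphic_removable_discrete:
  assumes Z: "\<And>z. \<not> z islimpt Z" and hol: "f holomorphic_on - Z"
    and bdd: "\<And>z. z \<in> Z \<Longrightarrow> \<exists>B. \<forall>\<^sub>F w in at z. norm (f w) \<le> B"
  obtains g where "g holomorphic_on UNIV" "\<And>z. z \<notin> Z \<Longrightarrow> g z = f z"
proof
  have opn: "open (- Z)"
    using Z closed_limpt by blast
  show eq: "remove_sings f z = f z" if "z \<notin> Z" for z
    using that hol opn by (intro remove_sings_at_analytic) (auto simp: analytic_at)
  have "remove_sings f analytic_on {z}" for z
  proof (cases "z \<in> Z")
    case False
    have "remove_sings f holomorphic_on - Z"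
      using hol by (rule holomorphic_transform) (use eq in auto)
    then show ?thesis using False opn by (auto simp: analytic_at)
  next
    case True
    have "\<not> z islimpt Z" by (rule Z)
    then obtain S where S: "z \<in> S" "open S" "\<And>y. y \<in> Z \<Longrightarrow> y \<in> S \<Longrightarrow> y = z"
      unfolding islimpt_def by metis
    have "f holomorphic_on S - {z}"
      using S by (intro holomorphic_on_subset[OF hol]) auto
    moreover obtain B where "\<forall>\<^sub>F w in at z. norm (f w) \<le> B" using bdd[OF True] by blast
    ultimately obtain g where g: "g holomorphic_on S" "\<And>w. w \<in> S - {z} \<Longrightarrow> g w = f w"
      using holomorphic_on_extend_bounded[of f S z] S by (metis interior_open)
    have "g \<midarrow>z\<rightarrow> g z"
      using g(1) S by (meson continuous_on_eq_continuous_at holomorphic_on_imp_continuous_on isCont_def)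
    moreover have "\<forall>\<^sub>F w in at z. g w = f w"
      using S g(2) eventually_at_in_open[of S z] by (auto elim: eventually_mono)
    ultimately have "f \<midarrow>z\<rightarrow> g z"
      using tendsto_cong by force
    then have gz: "remove_sings f z = g z" by (rule remove_sings_eqI)
    have "remove_sings f holomorphic_on S"
      using g(1)
    proof (rule holomorphic_transform)
      fix w assume w: "w \<in> S"
      show "g w = remove_sings f w"
      proof (cases "w = z")
        case False
        then have "w \<notin> Z" using S w by blast
        then show ?thesis using eq g(2) w False by simp
      qed (simp add: gz)
    qed
    then show ?thesis using S analytic_at by blast
  qed
  then show "remove_sings f holomorphic_on UNIV"
    using analytic_imp_holomorphic analytic_on_analytic_at by blast
qed

lemma elliptic_const:
  assumes \<tau>: "Im \<tau> > 0" and Z: "\<And>z. \<not> z islimpt Z" and hol: "f holomorphic_on - Z"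
    and bdd: "\<And>z. z \<in> Z \<Longrightarrow> \<exists>B. \<forall>\<^sub>F w in at z. norm (f w) \<le> B"
    and per: "\<And>u. u \<notin> Z \<Longrightarrow> f (u + 1) = f u" "\<And>u. u \<notin> Z \<Longrightarrow> f (u + \<tau>) = f u"
    and Zper: "\<And>u. u + 1 \<in> Z \<longleftrightarrow> u \<in> Z" "\<And>u. u + \<tau> \<in> Z \<longleftrightarrow> u \<in> Z"
  obtains c where "\<And>u. u \<notin> Z \<Longrightarrow> f u = c"
proof -
  obtain g where g: "g holomorphic_on UNIV" "\<And>z. z \<notin> Z \<Longrightarrow> g z = f z"
    using holomorphic_removable_discrete[OF Z hol bdd] by blast
  have contg: "continuous_on UNIV g" using g(1) by (rule holomorphic_on_imp_continuous_on)
  \<comment> \<open>The removed points may spoil the equation only on a set with empty interior, so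
    it extends by continuity from the dense complement.\<close>
  have shift: "g (u + w) = g u" if "\<And>u. u \<notin> Z \<Longrightarrow> f (u + w) = f u" "\<And>u. u + w \<in> Z \<longleftrightarrow> u \<in> Z" for w u
  proof -
    have "closed {u. g (u + w) = g u}"
      by (intro closed_Collect_eq continuous_on_compose2[OF contg] continuous_intros) (auto intro: contg)
    moreover have "- Z \<subseteq> {u. g (u + w) = g u}"
      using g(2) that by auto
    ultimately have "closure (- Z) \<subseteq> {u. g (u + w) = g u}" by (rule closure_minimal[rotated])
    moreover have "closure (- Z) = UNIV"
    proof -
      have "interior Z = {}"
        using Z interior_limit_point by blast
      then show ?thesis by (simp add: closure_complement)
    qed
    ultimately show ?thesis by auto
  qed
  obtain c where "\<And>u. g u = c"
    using entire_elliptic_const[OF \<tau> g(1)] shift[of 1] shift[of \<tau>] per Zper by metis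
  then show ?thesis using that g(2) by metis
qed

section \<open>Zeros of the theta function\<close>

lemma has_integral_character:
  "((\<lambda>x. exp (kap * of_int k * of_real x)) has_integral (if k = 0 then 1 else 0)) {0..1::real}"
proof (cases "k = 0")
  case True
  then show ?thesis using has_integral_const_real[of "1::complex" 0 1] by simp
next
  case False
  have "((\<lambda>x. exp (kap * of_int k * of_real x)) has_integral
      (exp (kap * of_int k * of_real 1) / (kap * of_int k) - exp (kap * of_int k * of_real 0) / (kap * of_int k))) {0..1::real}"
  proof (rule fundamental_theorem_of_calculus)
    fix x :: real
    have "((\<lambda>z. exp (kap * of_int k * z) / (kap * of_int k)) has_field_derivative exp (kap * of_int k * of_real x)) (at (of_real x))"
      using False by (auto intro!: derivative_eq_intros)
    then show "((\<lambda>x. exp (kap * of_int k * of_real x) / (kap * of_int k)) has_vector_derivative exp (kap * of_int k * of_real x)) (at x within {0..1})"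
      by (rule has_vector_derivative_real_field)
  qed auto
  then show ?thesis using False by simp
qed

text \<open>On the real axis \<open>\<theta>(x)\<close> times \<open>exp (- \<pi> i x)\<close> is a
  uniformly convergent Fourier series, and its zeroth coefficient \<open>c 0\<close> is visibly not
  0.\<close>

lemma th0_not_identically_0:
  assumes "Im \<tau> > 0"
  obtains u where "th 0 u \<tau> \<noteq> 0"
proof -
  let ?F = "finite_subsets_at_top (UNIV::int set)"
  define c where "c k = - \<i> * ((-1) powi k * exp (\<i> * of_real pi * (of_int k + 1/2)\<^sup>2 * \<tau>))" for k :: int
  have trm: "th_term 0 (of_real x) \<tau> k * exp (- (kap / 2) * of_real x) = c k * exp (kap * of_int k * of_real x)" for k and x :: real
    unfolding th_term_def c_def
    by (simp add: exp_add [symmetric] mult.assoc) (simp add: kap_def algebra_simps exp_add [symmetric])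
  have "uniform_limit ((\<lambda>x. (of_real x, \<tau>)) ` {0..1::real}) (\<lambda>X p. \<Sum>k\<in>X. th_term 0 (fst p) (snd p) k) (\<lambda>p. th 0 (fst p) (snd p)) ?F"
    by (rule uniform_limit_on_subset[OF th_uniform_limit[of 1 "Im \<tau>"]]) (use assms in auto)
  then have lim: "uniform_limit {0..1::real} (\<lambda>X x. \<Sum>k\<in>X. th_term 0 (of_real x) \<tau> k) (\<lambda>x. th 0 (of_real x) \<tau>) ?F"
    by (simp add: uniform_limit_iff)
  have "\<exists>u. th 0 u \<tau> \<noteq> 0"
  proof (rule ccontr)
    assume "\<not> ?thesis"
    then have z: "th 0 u \<tau> = 0" for u by auto
    have lim': "uniform_limit {0..1::real} (\<lambda>X x. (\<Sum>k\<in>X. th_term 0 (of_real x) \<tau> k) * exp (- (kap / 2) * of_real x)) (\<lambda>x. 0 * exp (- (kap / 2) * of_real x)) ?F"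
      using lim unfolding z
      by (intro uniform_lim_mult uniform_limit_const)
         (auto intro!: compact_imp_bounded compact_continuous_image continuous_intros)
    obtain I J where IJ: "\<And>X. ((\<lambda>x. (\<Sum>k\<in>X. th_term 0 (of_real x) \<tau> k) * exp (- (kap / 2) * of_real x)) has_integral I X) {0..1::real}"
      "((\<lambda>x::real. 0 * exp (- (kap / 2) * of_real x)) has_integral J) {0..1::real}" "(I \<longlongrightarrow> J) ?F"
      by (rule uniform_limit_integral[OF lim'])
         (auto simp: th_term_def intro!: continuous_intros)
    have J: "J = 0" using IJ(2) by (simp add: has_integral_iff)
    have I: "I X = c 0" if "finite X" "0 \<in> X" for X
    proof -
      have "((\<lambda>x. \<Sum>k\<in>X. c k * exp (kap * of_int k * of_real x)) has_integral (\<Sum>k\<in>X. c k * (if k = 0 then 1 else 0))) {0..1::real}"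
        using that by (intro has_integral_sum has_integral_mult_right has_integral_character)
      also have "(\<lambda>x. \<Sum>k\<in>X. c k * exp (kap * of_int k * of_real x)) = (\<lambda>x::real. (\<Sum>k\<in>X. th_term 0 (of_real x) \<tau> k) * exp (- (kap / 2) * of_real x))"
        unfolding sum_distrib_right trm ..
      also have "(\<Sum>k\<in>X. c k * (if k = 0 then 1 else 0)) = c 0"
        using that by (simp add: if_distrib cong: if_cong)
      finally show ?thesis using IJ(1)[of X] by (rule has_integral_unique[rotated])
    qed
    have "\<forall>\<^sub>F X in ?F. finite X \<and> 0 \<in> X"
      by (auto simp: eventually_finite_subsets_at_top intro!: exI[of _ "{0}"])
    then have "\<forall>\<^sub>F X in ?F. I X = c 0" by eventually_elim (use I in auto)
    then have "(I \<longlongrightarrow> c 0) ?F" by (rule tendsto_eventually)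
    then have "c 0 = J" using IJ(3) by (intro tendsto_unique) auto
    then show False unfolding J by (simp add: c_def)
  qed
  then show ?thesis using that by blast
qed

text \<open>Factors of the Jacobi product for \<theta>, paired by sign, with nome
  \<open>exp (2 \<pi> i \<tau>)\<close>. Zeros can be read off from a product but hardly from the
  series, so \<theta> is compared with the product up to a constant.\<close>

definition bfac :: "complex \<Rightarrow> nat \<Rightarrow> complex \<Rightarrow> complex" where
  "bfac \<tau> n u = (1 - exp (kap * \<tau>) ^ Suc n * exp (kap * u)) * (1 - exp (kap * \<tau>) ^ Suc n * exp (- kap * u))"

definition tprod :: "complex \<Rightarrow> complex \<Rightarrow> complex" where
  "tprod \<tau> u = (\<Prod>n. bfac \<tau> n u)"

lemma norm_nome:
  assumes "Im \<tau> > 0"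
  shows "norm (exp (kap * \<tau>)) < 1"
  using assms by (simp add: kap_def)

lemma norm_bfac_minus_1:
  assumes "Im \<tau> > 0" "norm u \<le> R"
  shows "norm (bfac \<tau> n u - 1) \<le> (2 * exp (2 * pi * R) + 1) * norm (exp (kap * \<tau>)) ^ Suc n"
proof -
  define q where "q = exp (kap * \<tau>) ^ Suc n"
  have q1: "norm q \<le> 1" unfolding q_def norm_power
    by (intro power_le_one) (use norm_nome[OF assms(1)] in auto)
  have e: "norm (exp (kap * w)) \<le> exp (2 * pi * R)" if "norm w \<le> R" for w
  proof -
    have "\<bar>Im w\<bar> \<le> R" using abs_Im_le_cmod[of w] that by linarith
    then have "2 * pi * (- Im w) \<le> 2 * pi * R" by (intro mult_left_mono) auto
    then show ?thesis by (simp add: kap_def)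
  qed
  have "bfac \<tau> n u - 1 = q * (q - exp (kap * u) - exp (kap * (- u)))"
  proof -
    define w v where "w = exp (kap * u)" and "v = exp (kap * (- u))"
    have "w * v = 1" by (simp add: w_def v_def exp_minus)
    then have "(1 - q * w) * (1 - q * v) - 1 = q * (q - w - v)" by algebra
    then show ?thesis unfolding bfac_def q_def [symmetric] w_def v_def by simp
  qed
  also have "norm \<dots> \<le> norm q * (norm q + norm (exp (kap * u)) + norm (exp (kap * (- u))))"
    unfolding norm_mult by (intro mult_left_mono order_trans[OF norm_triangle_ineq4] add_right_mono) auto
  also have "\<dots> \<le> norm q * (1 + exp (2 * pi * R) + exp (2 * pi * R))"
    using e[of u] e[of "- u"] assms q1 by (intro mult_left_mono add_mono) auto
  finally show ?thesis
    by (simp add: q_def norm_power mult_ac del: power_Suc norm_exp_eq_Re)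
qed

lemma summable_bfac_bound:
  assumes "Im \<tau> > 0"
  shows "summable (\<lambda>n. (2 * exp (2 * pi * R) + 1) * norm (exp (kap * \<tau>)) ^ Suc n)"
  using norm_nome[OF assms] by (intro summable_mult) (simp del: norm_exp_eq_Re add: summable_Suc_iff summable_geometric)

lemma convergent_prod_bfac:
  assumes "Im \<tau> > 0"
  shows "convergent_prod (\<lambda>n. bfac \<tau> n u)"
proof (rule abs_convergent_prod_imp_convergent_prod, rule summable_imp_abs_convergent_prod)
  show "summable (\<lambda>n. norm (bfac \<tau> n u - 1))"
    by (rule summable_comparison_test'[OF summable_bfac_bound[OF assms, of "norm u"], of 0])
       (use norm_bfac_minus_1[OF assms, of u "norm u"] in auto)
qed

lemma tprod_LIMSEQ:
  assumes "Im \<tau> > 0"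
  shows "(\<lambda>N. \<Prod>n<N. bfac \<tau> n u) \<longlonglongrightarrow> tprod \<tau> u"
  unfolding tprod_def LIMSEQ_lessThan_iff_atMost
  by (rule convergent_prod_LIMSEQ[OF convergent_prod_bfac[OF assms]])

lemma tprod_holomorphic:
  assumes "Im \<tau> > 0"
  shows "tprod \<tau> holomorphic_on UNIV"
proof -
  have hol: "tprod \<tau> holomorphic_on ball 0 R" if "R > 0" for R
  proof -
    have bh: "bfac \<tau> n holomorphic_on S" for n S
      unfolding bfac_def by (intro holomorphic_intros)
    have "uniformly_convergent_on (cball 0 R) (\<lambda>N u. \<Sum>n<N. norm (bfac \<tau> n u - 1))"
      by (rule Weierstrass_m_test'[OF _ summable_bfac_bound[OF assms, of R]])
         (use norm_bfac_minus_1[OF assms, of _ R] in auto)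
    then have "uniformly_convergent_on (cball 0 R) (\<lambda>N u. \<Prod>n<N. 1 + (bfac \<tau> n u - 1))"
      by (intro uniformly_convergent_on_prod)
         (auto intro!: holomorphic_on_imp_continuous_on holomorphic_intros bh)
    then have "uniformly_convergent_on (cball 0 R) (\<lambda>N u. \<Prod>n<N. bfac \<tau> n u)" by simp
    then obtain l where l: "uniform_limit (cball 0 R) (\<lambda>N u. \<Prod>n<N. bfac \<tau> n u) l sequentially"
      by (auto simp: uniformly_convergent_on_def)
    have "l u = tprod \<tau> u" if "u \<in> cball 0 R" for u
      using tendsto_uniform_limitI[OF l that] tprod_LIMSEQ[OF assms, of u] by (rule LIMSEQ_unique)
    moreover have "l holomorphic_on ball 0 R"
      by (rule holomorphic_uniform_limit[OF always_eventually l])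
         (auto intro!: holomorphic_intros bh holomorphic_on_imp_continuous_on)
    ultimately show ?thesis by (auto intro: holomorphic_transform)
  qed
  have "tprod \<tau> field_differentiable at u" for u
    by (rule holomorphic_on_imp_differentiable_at[of _ "ball 0 (norm u + 1)"])
       (use hol[of "norm u + 1"] in \<open>auto simp: add_nonneg_pos\<close>)
  then show ?thesis by (simp add: holomorphic_on_def)
qed

lemma bfac_eq_0_imp_lattice:
  assumes "bfac \<tau> n u = 0"
  shows "u \<in> mark \<tau> ` gauss_lattice"
proof -
  have *: "exp (kap * (of_nat (Suc n) * \<tau> + w)) = exp (kap * \<tau>) ^ Suc n * exp (kap * w)" for w
    by (simp only: exp_add distrib_left exp_of_nat_mult [symmetric] mult_ac)
  have "exp (kap * (of_nat (Suc n) * \<tau> + u)) = 1 \<or> exp (kap * (of_nat (Suc n) * \<tau> - u)) = 1"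
    using assms *[of u] *[of "- u"] by (auto simp: bfac_def)
  then obtain w m where w: "of_nat (Suc n) * \<tau> + w = of_int m" "w = u \<or> w = - u"
  proof -
    have "exp (kap * z) = 1 \<Longrightarrow> \<exists>m. z = of_int m" for z
      unfolding exp_eq_1 by (auto simp: kap_def complex_eq_iff)
    then show ?thesis using that \<open>_ \<or> _\<close> by (metis diff_conv_add_uminus)
  qed
  have "w = mark \<tau> (Complex (of_int m) (of_int (- int (Suc n))))"
    using w(1) by (simp add: mark_Complex algebra_simps)
  moreover have "- w = mark \<tau> (Complex (of_int (- m)) (of_int (int (Suc n))))"
    using w(1) by (simp add: mark_Complex algebra_simps)
  ultimately show ?thesis
    using w(2) by (metis gauss_lattice_iff image_eqI add.inverse_inverse)
qed

lemma tprod_nonzero: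
  assumes "Im \<tau> > 0" "\<And>n. bfac \<tau> n u \<noteq> 0"
  shows "tprod \<tau> u \<noteq> 0"
  unfolding tprod_def using prodinf_nonzero[OF convergent_prod_bfac[OF assms(1)]] assms(2) by blast

lemma tprod_0_nonzero:
  assumes "Im \<tau> > 0"
  shows "tprod \<tau> 0 \<noteq> 0"
proof (rule tprod_nonzero[OF assms])
  fix n
  have "norm (exp (kap * \<tau>) ^ Suc n) < 1"
    unfolding norm_power by (rule power_Suc_less_one) (use norm_nome[OF assms] in auto)
  then show "bfac \<tau> n 0 \<noteq> 0" by (auto simp: bfac_def)
qed

definition sprod :: "complex \<Rightarrow> complex \<Rightarrow> complex" where
  "sprod \<tau> u = sin (of_real pi * u) * tprod \<tau> u"

lemma sprod_nonzero:
  assumes "Im \<tau> > 0" "u \<notin> mark \<tau> ` gauss_lattice"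
  shows "sprod \<tau> u \<noteq> 0"
proof -
  have "sin (of_real pi * u) \<noteq> 0"
  proof
    assume "sin (of_real pi * u) = 0"
    then obtain m :: int where "of_real pi * u = of_real (of_int m * pi)"
      by (auto simp: sin_eq_0)
    then have "u = mark \<tau> (Complex (of_int m) (of_int 0))" by (simp add: mark_Complex)
    with assms show False by (auto simp: gauss_lattice_iff)
  qed
  moreover have "tprod \<tau> u \<noteq> 0"
    using assms bfac_eq_0_imp_lattice by (intro tprod_nonzero) auto
  ultimately show ?thesis by (simp add: sprod_def)
qed

lemma sprod_shift_1: "sprod \<tau> (u + 1) = - sprod \<tau> u"
proof -
  have "exp (kap * (u + 1)) = exp (kap * u)" "exp (- kap * (u + 1)) = exp (- kap * u)"
    using exp_kap_of_int[of 1] by (simp_all add: distrib_left exp_add exp_diff)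
  then have "bfac \<tau> n (u + 1) = bfac \<tau> n u" for n by (simp add: bfac_def)
  moreover have "sin (of_real pi * (u + 1)) = - sin (of_real pi * u)"
    by (simp add: distrib_left sin_add)
  ultimately show ?thesis by (simp add: sprod_def tprod_def)
qed

text \<open>A shift by \<tau> moves the index by one, in opposite directions for the two kinds of
  factors. For finite products this is telescoping with a correction that tends to 1; the statement
  is cross-multiplied because \<open>1 - exp (kap * (\<tau> + u))\<close> may vanish.\<close>

lemma tprod_shift_tau:
  assumes "Im \<tau> > 0"
  shows "tprod \<tau> (u + \<tau>) * (1 - exp (kap * (\<tau> + u))) = tprod \<tau> u * (1 - exp (- kap * u))"
proof -
  define q where "q = exp (kap * \<tau>)"
  define w where "w = exp (kap * u)"
  define v where "v = exp (- kap * u)"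
  have b: "bfac \<tau> n u = (1 - q ^ Suc n * w) * (1 - q ^ Suc n * v)" for n
    by (simp add: bfac_def q_def w_def v_def)
  have b': "bfac \<tau> n (u + \<tau>) = (1 - q ^ Suc (Suc n) * w) * (1 - q ^ n * v)" for n
  proof -
    have 1: "- kap * (u + \<tau>) = - kap * u - kap * \<tau>" by (simp add: algebra_simps)
    have 2: "exp (kap * (u + \<tau>)) = q * w" "exp (- kap * (u + \<tau>)) = v / q"
      unfolding 1 exp_diff by (simp_all add: q_def w_def v_def exp_add distrib_left)
    have "q \<noteq> 0" by (simp add: q_def)
    then show ?thesis unfolding bfac_def 2 q_def [symmetric] by (simp add: field_simps)
  qed
  have fin: "(\<Prod>n<N. bfac \<tau> n (u + \<tau>)) * ((1 - q * w) * (1 - q ^ N * v)) = (\<Prod>n<N. bfac \<tau> n u) * ((1 - q ^ Suc N * w) * (1 - v))" for N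
  proof (induction N)
    case (Suc N)
    have "(\<Prod>n<Suc N. bfac \<tau> n (u + \<tau>)) * ((1 - q * w) * (1 - q ^ Suc N * v))
       = ((\<Prod>n<N. bfac \<tau> n (u + \<tau>)) * ((1 - q * w) * (1 - q ^ N * v))) * ((1 - q ^ Suc (Suc N) * w) * (1 - q ^ Suc N * v))"
      unfolding prod.lessThan_Suc b' by (simp only: mult_ac)
    also have "\<dots> = (\<Prod>n<Suc N. bfac \<tau> n u) * ((1 - q ^ Suc (Suc N) * w) * (1 - v))"
      unfolding Suc prod.lessThan_Suc b by (simp only: mult_ac)
    finally show ?case .
  qed simp
  have q0: "(\<lambda>N. q ^ N) \<longlonglongrightarrow> 0"
    using norm_nome[OF assms] unfolding q_def by (rule LIMSEQ_power_zero)
  have "(\<lambda>N. (\<Prod>n<N. bfac \<tau> n (u + \<tau>)) * ((1 - q * w) * (1 - q ^ N * v))) \<longlonglongrightarrow> tprod \<tau> (u + \<tau>) * ((1 - q * w) * (1 - 0 * v))"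
    by (intro tendsto_intros tprod_LIMSEQ[OF assms] q0)
  moreover have "(\<lambda>N. (\<Prod>n<N. bfac \<tau> n u) * ((1 - q ^ Suc N * w) * (1 - v))) \<longlonglongrightarrow> tprod \<tau> u * ((1 - 0 * w) * (1 - v))"
    by (intro tendsto_intros tprod_LIMSEQ[OF assms] LIMSEQ_Suc[OF q0])
  ultimately have "tprod \<tau> (u + \<tau>) * ((1 - q * w) * (1 - 0 * v)) = tprod \<tau> u * ((1 - 0 * w) * (1 - v))"
    unfolding fin by (rule LIMSEQ_unique)
  then show ?thesis by (simp add: q_def w_def v_def exp_add [symmetric] distrib_left)
qed

lemma sprod_shift_tau:
  assumes "Im \<tau> > 0"
  shows "sprod \<tau> (u + \<tau>) = - exp (- kap * (\<tau> / 2 + u)) * sprod \<tau> u"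
proof -
  define Q where "Q = exp (kap / 2 * \<tau>)"
  define W where "W = exp (kap / 2 * u)"
  have nz [simp]: "Q \<noteq> 0" "W \<noteq> 0" by (simp_all add: Q_def W_def)
  have s: "sin (of_real pi * u) = (W - 1 / W) / (2 * \<i>)"
    by (simp add: sin_exp_eq W_def kap_def exp_minus field_simps)
  have s': "sin (of_real pi * (u + \<tau>)) = (Q * W - 1 / (Q * W)) / (2 * \<i>)"
    by (simp add: sin_exp_eq W_def Q_def kap_def exp_minus [symmetric] exp_add [symmetric] field_simps)
  have e: "exp (kap * (\<tau> + u)) = (Q * W)\<^sup>2" "exp (- kap * u) = 1 / W\<^sup>2" "exp (- kap * (\<tau> / 2 + u)) = 1 / (Q * W\<^sup>2)"
  proof -
    have 1: "exp (kap * \<tau>) = Q\<^sup>2" "exp (kap * u) = W\<^sup>2"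
      by (simp_all add: Q_def W_def exp_double [symmetric])
    have 2: "- kap * (\<tau> / 2 + u) = - (kap / 2 * \<tau> + kap * u)" by (simp add: algebra_simps)
    show "exp (kap * (\<tau> + u)) = (Q * W)\<^sup>2"
      by (simp add: distrib_left exp_add 1 power_mult_distrib)
    show "exp (- kap * u) = 1 / W\<^sup>2"
      by (simp add: exp_minus 1 divide_inverse)
    show "exp (- kap * (\<tau> / 2 + u)) = 1 / (Q * W\<^sup>2)"
      unfolding 2 exp_minus exp_add 1 Q_def [symmetric] by (simp add: divide_inverse)
  qed
  have "tprod \<tau> (u + \<tau>) * (1 - (Q * W)\<^sup>2) = tprod \<tau> u * (1 - 1 / W\<^sup>2)"
    using tprod_shift_tau[OF assms, of u] unfolding e .
  then show ?thesis
    unfolding sprod_def s s' e by (simp add: field_simps power2_eq_square) (algebra)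
qed

text \<open>Both functions have the same multipliers under \<open>u + 1\<close> and
  \<open>u + \<tau>\<close>, so their quotient is elliptic. It has a limit at 0, where
  \<open>sprod\<close> has a simple zero, and by periodicity is bounded at all lattice points, hence
  constant. That limit is a multiple of \<open>\<theta>'(0)\<close>, so
  \<open>\<theta>'(0) = 0\<close> would make the constant vanish.\<close>

lemma th0_eq_sprod:
  assumes \<tau>: "Im \<tau> > 0"
  obtains c where "c \<noteq> 0" "\<And>u. u \<notin> mark \<tau> ` gauss_lattice \<Longrightarrow> th 0 u \<tau> = c * sprod \<tau> u" "th 1 0 \<tau> \<noteq> 0"
proof -
  define Z where "Z = mark \<tau> ` gauss_lattice"
  define f where "f u = th 0 u \<tau> / sprod \<tau> u" for u
  have thh: "(\<lambda>u. th 0 u \<tau>) holomorphic_on S" for S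
    using th_deriv_u[OF \<tau>] by (auto simp: holomorphic_on_def field_differentiable_def intro: has_field_derivative_at_within)
  have f1: "f (u + 1) = f u" for u by (simp add: f_def sprod_shift_1 th_shift_1)
  have f2: "f (u + \<tau>) = f u" for u by (simp add: f_def sprod_shift_tau[OF \<tau>] th0_shift_tau)
  have Zl: "u + mark \<tau> l \<in> Z \<longleftrightarrow> u \<in> Z" if "l \<in> gauss_lattice" for u l
  proof
    assume "u + mark \<tau> l \<in> Z"
    then obtain k where "k \<in> gauss_lattice" "u = mark \<tau> (k - l)" by (auto simp: Z_def algebra_simps)
    then show "u \<in> Z" using that unfolding Z_def by (metis gauss_lattice_closed(3) imageI)
  next
    assume "u \<in> Z"
    then obtain k where "k \<in> gauss_lattice" "u + mark \<tau> l = mark \<tau> (k + l)" by (auto simp: Z_def)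
    then show "u + mark \<tau> l \<in> Z" using that unfolding Z_def by (metis gauss_lattice_closed(2) imageI)
  qed
  have Z1: "u + 1 \<in> Z \<longleftrightarrow> u \<in> Z" for u
    using Zl[of "Complex (of_int 1) (of_int 0)" u] by (auto simp: mark_Complex gauss_lattice_iff simp del: of_int_1 of_int_0) (simp_all)
  have Z2: "u + \<tau> \<in> Z \<longleftrightarrow> u \<in> Z" for u
    using Zl[of "Complex (of_int 0) (of_int 1)" u] by (auto simp: mark_Complex gauss_lattice_iff simp del: of_int_1 of_int_0) (simp_all)
  have "f holomorphic_on - Z"
    unfolding f_def sprod_def
    by (intro holomorphic_intros thh holomorphic_on_subset[OF tprod_holomorphic[OF \<tau>]])
       (use sprod_nonzero[OF \<tau>] in \<open>auto simp: Z_def sprod_def\<close>)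
  have lim0: "(f \<longlongrightarrow> th 1 0 \<tau> / (of_real pi * tprod \<tau> 0)) (at 0)"
  proof -
    have "((\<lambda>u. th 0 u \<tau>) has_field_derivative th 1 0 \<tau>) (at 0)"
      using th_deriv_u[OF \<tau>, of 0 0] by simp
    then have a: "((\<lambda>u. th 0 u \<tau> / u) \<longlongrightarrow> th 1 0 \<tau>) (at 0)"
      by (simp add: has_field_derivative_iff th_even_0)
    have "((\<lambda>u. sin (of_real pi * u)) has_field_derivative of_real pi) (at (0::complex))"
      by (auto intro!: derivative_eq_intros)
    then have b: "((\<lambda>u. sin (of_real pi * u) / u) \<longlongrightarrow> of_real pi) (at (0::complex))"
      by (simp add: has_field_derivative_iff)
    have c: "(tprod \<tau> \<longlongrightarrow> tprod \<tau> 0) (at 0)"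
      using tprod_holomorphic[OF \<tau>] holomorphic_on_imp_continuous_on continuous_on_eq_continuous_at isCont_def by blast
    have "((\<lambda>u. (th 0 u \<tau> / u) / ((sin (of_real pi * u) / u) * tprod \<tau> u)) \<longlongrightarrow> th 1 0 \<tau> / (of_real pi * tprod \<tau> 0)) (at 0)"
      by (intro tendsto_intros a b c) (use tprod_0_nonzero[OF \<tau>] in auto)
    moreover have "\<forall>\<^sub>F u in at 0. (th 0 u \<tau> / u) / ((sin (of_real pi * u) / u) * tprod \<tau> u) = f u"
      by (auto simp: eventually_at_filter f_def sprod_def)
    ultimately show ?thesis by (rule Lim_transform_eventually)
  qed
  have bdd: "\<exists>B. \<forall>\<^sub>F w in at z. norm (f w) \<le> B" if "z \<in> Z" for z
  proof -
    from that obtain l where l: "l \<in> gauss_lattice" "z = mark \<tau> l" by (auto simp: Z_def)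
    have "\<exists>B. \<forall>\<^sub>F w in at 0. norm (f w) \<le> B"
      using tendsto_norm[OF lim0, THEN order_tendstoD(2), of "norm (th 1 0 \<tau> / (of_real pi * tprod \<tau> 0)) + 1"]
      by (auto intro!: exI elim: eventually_mono intro: less_imp_le)
    then obtain B where "\<forall>\<^sub>F w in at 0. norm (f w) \<le> B" by blast
    then have "\<forall>\<^sub>F w in at 0. norm (f (w + z)) \<le> B"
      using periodic_lattice[of f \<tau> l, OF f1 f2 l(1)] l(2) by simp
    then show ?thesis by (subst at_to_0) (auto simp: eventually_filtermap)
  qed
  obtain c where c: "\<And>u. u \<notin> Z \<Longrightarrow> f u = c"
    using elliptic_const[OF \<tau> not_islimpt_Lam[OF \<tau>, folded Z_def] \<open>f holomorphic_on - Z\<close> bdd f1 f2 Z1 Z2] by blast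
  have cs: "th 0 u \<tau> = c * sprod \<tau> u" if "u \<notin> Z" for u
    using c[OF that] sprod_nonzero[OF \<tau>, of u] that by (auto simp: f_def Z_def field_simps)
  have "c \<noteq> 0"
  proof
    assume "c = 0"
    then have "th 0 u \<tau> = 0" for u using cs th_lattice_eq_0 by (cases "u \<in> Z") (auto simp: Z_def)
    then show False using th0_not_identically_0[OF \<tau>] by metis
  qed
  moreover have "th 1 0 \<tau> \<noteq> 0"
  proof
    assume "th 1 0 \<tau> = 0"
    then have "(f \<longlongrightarrow> 0) (at 0)" using lim0 by simp
    moreover have "\<forall>\<^sub>F u in at 0. f u = c"
    proof -
      have "\<forall>\<^sub>F u in at 0. u \<notin> Z"
        using not_islimpt_Lam[OF \<tau>, of 0] by (simp add: Z_def islimpt_iff_eventually)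
      then show ?thesis by eventually_elim (use c in auto)
    qed
    ultimately have "((\<lambda>_. c) \<longlongrightarrow> 0) (at (0::complex))" using tendsto_cong by force
    then show False using \<open>c \<noteq> 0\<close> by (simp add: tendsto_const_iff)
  qed
  ultimately show ?thesis using that cs by (auto simp: Z_def)
qed

lemma th0_eq_0_iff:
  assumes "Im \<tau> > 0"
  shows "th 0 u \<tau> = 0 \<longleftrightarrow> u \<in> mark \<tau> ` gauss_lattice"
  using th0_eq_sprod[OF assms] sprod_nonzero[OF assms] th_lattice_eq_0 by (metis mult_eq_0_iff)

lemma th1_0_nonzero [simp]: "Im \<tau> > 0 \<Longrightarrow> th (Suc 0) 0 \<tau> \<noteq> 0"
  using th0_eq_sprod[of \<tau>] by (metis One_nat_def)

section \<open>Logarithmic derivatives and the addition theorem\<close>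

text \<open>Differentiability in both variables jointly is needed because the arguments of \<theta>
  move with \<tau>. It follows from the two partial derivatives and the continuity of the one in
  \<tau>.\<close>

lemma th_has_derivative:
  assumes "Im \<tau> > 0"
  shows "((\<lambda>p. th n (fst p) (snd p)) has_derivative
     (\<lambda>p. th (Suc n) u \<tau> * fst p + th (n + 2) u \<tau> / (2 * kap) * snd p)) (at (u, \<tau>))"
proof -
  have "((\<lambda>(u, \<tau>). th n u \<tau>) has_derivative
     (\<lambda>(a, b). th (Suc n) u \<tau> * a + blinfun_mult_right (th (n + 2) u \<tau> / (2 * kap)) b)) (at (u, \<tau>) within UNIV \<times> UHP)"
  proof (rule has_derivative_partialsI)
    show "((\<lambda>u. th n u \<tau>) has_derivative (*) (th (Suc n) u \<tau>)) (at u)"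
      using th_deriv_u[OF assms] by (simp add: has_field_derivative_def)
  next
    fix u \<tau> :: complex assume "\<tau> \<in> UHP"
    then show "((\<lambda>\<tau>. th n u \<tau>) has_derivative blinfun_apply (blinfun_mult_right (th (n + 2) u \<tau> / (2 * kap)))) (at \<tau> within UHP)"
      using th_deriv_tau[of \<tau> n u] by (simp add: has_field_derivative_def has_derivative_at_withinI)
  next
    have "continuous (at (u, \<tau>) within UNIV \<times> UHP) (\<lambda>p. th (n + 2) (fst p) (snd p))"
      using th_continuous_on[of "n + 2"] assms by (auto simp: continuous_on_eq_continuous_within)
    then have "continuous (at (u, \<tau>) within UNIV \<times> UHP) (\<lambda>p. blinfun_mult_right (th (n + 2) (fst p) (snd p) / (2 * kap)))"
      by (intro bounded_linear.continuous[OF bounded_linear_blinfun_mult_right] continuous_divide) auto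
    then show "continuous (at (u, \<tau>) within UNIV \<times> UHP) (\<lambda>(u, \<tau>). blinfun_mult_right (th (n + 2) u \<tau> / (2 * kap)))"
      by (simp add: case_prod_unfold)
  qed (use assms convex_UHP in auto)
  moreover have "at (u, \<tau>) within UNIV \<times> UHP = at (u, \<tau>)"
    using assms by (intro at_within_open open_Times open_UHP) auto
  ultimately show ?thesis by (simp add: case_prod_unfold)
qed

lemma th_chain:
  assumes "(U has_field_derivative U') (at s within S)" "(V has_field_derivative V') (at s within S)"
    and "Im (V s) > 0"
  shows "((\<lambda>s. th n (U s) (V s)) has_field_derivative
     (th (Suc n) (U s) (V s) * U' + th (Suc (Suc n)) (U s) (V s) / (2 * kap) * V')) (at s within S)"
proof -
  have "((\<lambda>s. (U s, V s)) has_derivative (\<lambda>h. (U' * h, V' * h))) (at s within S)"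
    using assms(1,2) unfolding has_field_derivative_def by (rule has_derivative_Pair)
  from has_derivative_compose[OF this th_has_derivative[OF assms(3), of n "U s"]]
  have "((\<lambda>s. th n (U s) (V s)) has_derivative
      (\<lambda>h. th (Suc n) (U s) (V s) * (U' * h) + th (n + 2) (U s) (V s) / (2 * kap) * (V' * h))) (at s within S)"
    by simp
  then show ?thesis unfolding has_field_derivative_def
    by (rule has_derivative_eq_rhs) (auto simp: fun_eq_iff algebra_simps)
qed

lemma th_continuous [continuous_intros]:
  assumes "continuous_on S U" "continuous_on S V" "\<And>s. s \<in> S \<Longrightarrow> Im (V s) > 0"
  shows "continuous_on S (\<lambda>s. th n (U s) (V s))"
proof -
  have "continuous_on S (\<lambda>s. (U s, V s))" using assms by (intro continuous_intros)
  from continuous_on_compose2[OF th_continuous_on this, of n] show ?thesis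
    using assms(3) by (simp add: image_subset_iff)
qed

text \<open>By the heat equation these quotients are closed under differentiation: their derivatives
  in \<open>u\<close> and in \<tau> are polynomials in them. All later identities become algebra
  between them.\<close>

definition qq :: "nat \<Rightarrow> complex \<Rightarrow> complex \<Rightarrow> complex" where
  "qq n u \<tau> = th n u \<tau> / th 0 u \<tau>"

lemma qq_chain:
  assumes "(U has_field_derivative U') (at s within S)" "(V has_field_derivative V') (at s within S)"
    and "Im (V s) > 0" "th 0 (U s) (V s) \<noteq> 0"
  shows "((\<lambda>s. qq n (U s) (V s)) has_field_derivative
     ((qq (Suc n) (U s) (V s) - qq n (U s) (V s) * qq 1 (U s) (V s)) * U' +
      (qq (Suc (Suc n)) (U s) (V s) - qq n (U s) (V s) * qq 2 (U s) (V s)) / (2 * kap) * V')) (at s within S)"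
  unfolding qq_def
  by (rule DERIV_cong[OF DERIV_divide[OF th_chain[OF assms(1-3)] th_chain[OF assms(1-3)] assms(4)]])
     (use assms(4) in \<open>simp add: field_simps numeral_2_eq_2\<close>)

lemma qq_deriv_u:
  assumes "(U has_field_derivative U') (at s within S)" "Im \<tau> > 0" "th 0 (U s) \<tau> \<noteq> 0"
  shows "((\<lambda>s. qq n (U s) \<tau>) has_field_derivative
     ((qq (Suc n) (U s) \<tau> - qq n (U s) \<tau> * qq 1 (U s) \<tau>) * U')) (at s within S)"
  using qq_chain[OF assms(1) DERIV_const[of \<tau>] assms(2,3)] by simp

lemma qq_continuous [continuous_intros]:
  assumes "continuous_on S U" "continuous_on S V" "\<And>s. s \<in> S \<Longrightarrow> Im (V s) > 0"
    and "\<And>s. s \<in> S \<Longrightarrow> th 0 (U s) (V s) \<noteq> 0"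
  shows "continuous_on S (\<lambda>s. qq n (U s) (V s))"
  unfolding qq_def using assms by (intro continuous_intros ballI) auto

lemma qq_shift_1: "qq n (u + 1) \<tau> = qq n u \<tau>"
  by (simp add: qq_def th_shift_1)

lemma qq_minus: "qq n (- u) \<tau> = (- 1) ^ n * qq n u \<tau>"
  by (simp add: qq_def th_minus)

lemma th_shift_tau_deriv:
  assumes "Im \<tau> > 0" "\<And>u. th n (u + \<tau>) \<tau> = - exp (- kap * (\<tau> / 2 + u)) * g u"
    and "\<And>u. (g has_field_derivative g' u) (at u)"
  shows "th (Suc n) (u + \<tau>) \<tau> = - exp (- kap * (\<tau> / 2 + u)) * (g' u - kap * g u)"
proof -
  have "((\<lambda>u. th n (u + \<tau>) \<tau>) has_field_derivative th (Suc n) (u + \<tau>) \<tau>) (at u)"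
    using DERIV_shift[of "\<lambda>u. th n u \<tau>" _ u \<tau>] th_deriv_u[OF assms(1), of n "u + \<tau>"] by (simp add: add.commute)
  moreover have "((\<lambda>u. th n (u + \<tau>) \<tau>) has_field_derivative - exp (- kap * (\<tau> / 2 + u)) * (g' u - kap * g u)) (at u)"
    unfolding assms(2) by (auto intro!: derivative_eq_intros assms(3) simp: algebra_simps)
  ultimately show ?thesis by (rule DERIV_unique)
qed

lemma th_shift_tau:
  assumes "Im \<tau> > 0"
  shows "th 1 (u + \<tau>) \<tau> = - exp (- kap * (\<tau> / 2 + u)) * (th 1 u \<tau> - kap * th 0 u \<tau>)"
    and "th 2 (u + \<tau>) \<tau> = - exp (- kap * (\<tau> / 2 + u)) * (th 2 u \<tau> - 2 * kap * th 1 u \<tau> + kap\<^sup>2 * th 0 u \<tau>)"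
    and "th 3 (u + \<tau>) \<tau> = - exp (- kap * (\<tau> / 2 + u)) *
      (th 3 u \<tau> - 3 * kap * th 2 u \<tau> + 3 * kap\<^sup>2 * th 1 u \<tau> - kap ^ 3 * th 0 u \<tau>)"
proof -
  note d = th_deriv_u[OF assms]
  have 1: "th (Suc 0) (u + \<tau>) \<tau> = - exp (- kap * (\<tau> / 2 + u)) * (th (Suc 0) u \<tau> - kap * th 0 u \<tau>)" for u
    by (rule th_shift_tau_deriv[OF assms th0_shift_tau d])
  have 2: "th (Suc (Suc 0)) (u + \<tau>) \<tau> = - exp (- kap * (\<tau> / 2 + u)) * ((th (Suc (Suc 0)) u \<tau> - kap * th (Suc 0) u \<tau>) - kap * (th (Suc 0) u \<tau> - kap * th 0 u \<tau>))" for u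
    by (rule th_shift_tau_deriv[OF assms 1]) (auto intro!: derivative_eq_intros d)
  have 3: "th (Suc (Suc (Suc 0))) (u + \<tau>) \<tau> = - exp (- kap * (\<tau> / 2 + u)) *
     (((th (Suc (Suc (Suc 0))) u \<tau> - kap * th (Suc (Suc 0)) u \<tau>) - kap * (th (Suc (Suc 0)) u \<tau> - kap * th (Suc 0) u \<tau>))
      - kap * ((th (Suc (Suc 0)) u \<tau> - kap * th (Suc 0) u \<tau>) - kap * (th (Suc 0) u \<tau> - kap * th 0 u \<tau>)))" for u
    by (rule th_shift_tau_deriv[OF assms 2]) (auto intro!: derivative_eq_intros d)
  show "th 1 (u + \<tau>) \<tau> = - exp (- kap * (\<tau> / 2 + u)) * (th 1 u \<tau> - kap * th 0 u \<tau>)"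
    using 1 by simp
  show "th 2 (u + \<tau>) \<tau> = - exp (- kap * (\<tau> / 2 + u)) * (th 2 u \<tau> - 2 * kap * th 1 u \<tau> + kap\<^sup>2 * th 0 u \<tau>)"
    unfolding numeral_2_eq_2 2[of u] by (simp add: power2_eq_square algebra_simps)
  show "th 3 (u + \<tau>) \<tau> = - exp (- kap * (\<tau> / 2 + u)) *
      (th 3 u \<tau> - 3 * kap * th 2 u \<tau> + 3 * kap\<^sup>2 * th 1 u \<tau> - kap ^ 3 * th 0 u \<tau>)"
    unfolding numeral_2_eq_2 numeral_3_eq_3 3[of u] by (simp add: algebra_simps)
qed

lemma qq_shift_tau:
  assumes "Im \<tau> > 0" "th 0 u \<tau> \<noteq> 0"
  shows "qq 1 (u + \<tau>) \<tau> = qq 1 u \<tau> - kap"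
    and "qq 2 (u + \<tau>) \<tau> = qq 2 u \<tau> - 2 * kap * qq 1 u \<tau> + kap\<^sup>2"
    and "qq 3 (u + \<tau>) \<tau> = qq 3 u \<tau> - 3 * kap * qq 2 u \<tau> + 3 * kap\<^sup>2 * qq 1 u \<tau> - kap ^ 3"
  unfolding qq_def th_shift_tau[OF assms(1)] th0_shift_tau using assms(2)
  by (simp_all add: diff_divide_distrib add_divide_distrib)

lemma higher_deriv_jtheta:
  assumes "Im \<tau> > 0"
  shows "(deriv ^^ n) (\<lambda>v. jtheta v \<tau>) = (\<lambda>u. th n u \<tau>)"
proof (induction n)
  case 0
  then show ?case by (simp add: jtheta_eq_th)
next
  case (Suc n)
  then show ?case using th_deriv_u[OF assms, of n] by (auto simp: DERIV_imp_deriv)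
qed

lemma jtheta_d_eq_th: "Im \<tau> > 0 \<Longrightarrow> jtheta_d n u \<tau> = th n u \<tau>"
  by (simp add: jtheta_d_def higher_deriv_jtheta)

lemma rho_eq_qq: "Im \<tau> > 0 \<Longrightarrow> rho u \<tau> = qq 1 u \<tau>"
  by (simp add: rho_def qq_def jtheta_d_eq_th jtheta_eq_th)

text \<open>With its two successors this gives \<open>\<rho>'\<close>, \<open>\<rho>''\<close> and
  \<open>\<rho>'''\<close> in closed form, so that relations between them can be verified without
  iterated \<open>deriv\<close>.\<close>

definition r1 :: "complex \<Rightarrow> complex \<Rightarrow> complex" where
  "r1 u \<tau> = qq 2 u \<tau> - (qq 1 u \<tau>)\<^sup>2"

definition r2 :: "complex \<Rightarrow> complex \<Rightarrow> complex" where
  "r2 u \<tau> = qq 3 u \<tau> - 3 * qq 1 u \<tau> * qq 2 u \<tau> + 2 * qq 1 u \<tau> ^ 3"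

definition r3 :: "complex \<Rightarrow> complex \<Rightarrow> complex" where
  "r3 u \<tau> = qq 4 u \<tau> - 4 * qq 1 u \<tau> * qq 3 u \<tau> - 3 * (qq 2 u \<tau>)\<^sup>2
     + 12 * (qq 1 u \<tau>)\<^sup>2 * qq 2 u \<tau> - 6 * qq 1 u \<tau> ^ 4"

lemma numeral_4_eq_4': "(4::nat) = Suc (Suc (Suc (Suc 0)))" by simp

lemma rho_derivs:
  assumes "Im \<tau> > 0" "(U has_field_derivative U') (at s within S)" "th 0 (U s) \<tau> \<noteq> 0"
  shows "((\<lambda>s. qq 1 (U s) \<tau>) has_field_derivative r1 (U s) \<tau> * U') (at s within S)"
    and "((\<lambda>s. r1 (U s) \<tau>) has_field_derivative r2 (U s) \<tau> * U') (at s within S)"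
    and "((\<lambda>s. r2 (U s) \<tau>) has_field_derivative r3 (U s) \<tau> * U') (at s within S)"
proof -
  note d = qq_deriv_u[OF assms(2,1,3)]
  note s = numeral_2_eq_2 numeral_3_eq_3 numeral_4_eq_4'
  show "((\<lambda>s. qq 1 (U s) \<tau>) has_field_derivative r1 (U s) \<tau> * U') (at s within S)"
    by (rule DERIV_cong[OF d]) (simp add: r1_def s)
  show "((\<lambda>s. r1 (U s) \<tau>) has_field_derivative r2 (U s) \<tau> * U') (at s within S)"
    unfolding r1_def
    by (rule DERIV_cong, (rule derivative_intros d)+) (simp add: r2_def s algebra_simps)
  show "((\<lambda>s. r2 (U s) \<tau>) has_field_derivative r3 (U s) \<tau> * U') (at s within S)"
    unfolding r2_def
    by (rule DERIV_cong, (rule derivative_intros d)+) (simp add: r3_def s algebra_simps)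
qed

lemma open_th0_nonzero: "Im \<tau> > 0 \<Longrightarrow> open {u. th 0 u \<tau> \<noteq> 0}"
  by (intro open_Collect_neq continuous_intros) auto

lemma rho_d_eq:
  assumes "Im \<tau> > 0" "th 0 u \<tau> \<noteq> 0"
  shows "rho_d 1 u \<tau> = r1 u \<tau>" "rho_d 2 u \<tau> = r2 u \<tau>" "rho_d 3 u \<tau> = r3 u \<tau>"
proof -
  have step: "rho_d (Suc n) u \<tau> = g' u"
    if "\<And>u. th 0 u \<tau> \<noteq> 0 \<Longrightarrow> rho_d n u \<tau> = g u"
      "\<And>u. th 0 u \<tau> \<noteq> 0 \<Longrightarrow> (g has_field_derivative g' u) (at u)" "th 0 u \<tau> \<noteq> 0" for n g g' u
  proof -
    have "((\<lambda>u. rho_d n u \<tau>) has_field_derivative g' u) (at u)"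
      using that(2)[OF that(3)] open_th0_nonzero[OF assms(1)]
      by (rule has_field_derivative_transform_within_open) (use that in auto)
    then show ?thesis by (simp add: rho_d_def DERIV_imp_deriv)
  qed
  note d = rho_derivs[OF assms(1) DERIV_ident, simplified mult_1_right]
  have 0: "rho_d 0 u \<tau> = qq 1 u \<tau>" for u
    by (simp add: rho_d_def rho_eq_qq[OF assms(1)])
  have 1: "rho_d (Suc 0) u \<tau> = r1 u \<tau>" if "th 0 u \<tau> \<noteq> 0" for u
    by (rule step[OF 0 d(1) that])
  have 2: "rho_d (Suc (Suc 0)) u \<tau> = r2 u \<tau>" if "th 0 u \<tau> \<noteq> 0" for u
    by (rule step[OF 1 d(2) that])
  have 3: "rho_d (Suc (Suc (Suc 0))) u \<tau> = r3 u \<tau>" if "th 0 u \<tau> \<noteq> 0" for u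
    by (rule step[OF 2 d(3) that])
  show "rho_d 1 u \<tau> = r1 u \<tau>" "rho_d 2 u \<tau> = r2 u \<tau>" "rho_d 3 u \<tau> = r3 u \<tau>"
    using 1[OF assms(2)] 2[OF assms(2)] 3[OF assms(2)] by (simp_all add: numeral_2_eq_2 numeral_3_eq_3)
qed

lemma r_parity:
  "qq 1 (- u) \<tau> = - qq 1 u \<tau>" "r1 (- u) \<tau> = r1 u \<tau>" "r2 (- u) \<tau> = - r2 u \<tau>" "r3 (- u) \<tau> = r3 u \<tau>"
  by (simp_all add: r1_def r2_def r3_def qq_minus)

lemma r_shift_1: "r1 (u + 1) \<tau> = r1 u \<tau>" "r2 (u + 1) \<tau> = r2 u \<tau>"
  by (simp_all add: r1_def r2_def qq_shift_1)

lemma r_shift_tau: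
  assumes "Im \<tau> > 0" "th 0 u \<tau> \<noteq> 0"
  shows "r1 (u + \<tau>) \<tau> = r1 u \<tau>" "r2 (u + \<tau>) \<tau> = r2 u \<tau>"
  unfolding r1_def r2_def qq_shift_tau[OF assms]
  by (simp_all add: power2_eq_square power3_eq_cube algebra_simps)

lemma th0_shift_nonzero:
  assumes "Im \<tau> > 0"
  shows "th 0 (u + \<tau>) \<tau> = 0 \<longleftrightarrow> th 0 u \<tau> = 0"
  by (simp add: th0_shift_tau)

text \<open>Dividing out the zero at 0 yields the expansion of \<rho> there. Differentiating
  \<open>u * W u\<close> repeatedly gives the values: \<open>deriv W 0\<close> vanishes because
  \<theta> is odd, and the second derivative is the source of the constant \<open>Y\<close>.\<close>

lemma th0_factor_at_0:
  assumes \<tau>: "Im \<tau> > 0"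
  obtains W where "W holomorphic_on UNIV" "\<And>u. th 0 u \<tau> = u * W u" "W 0 = th 1 0 \<tau>"
    "deriv W 0 = 0" "3 * deriv (deriv W) 0 = th 3 0 \<tau>"
proof -
  have thh: "(\<lambda>u. th 0 u \<tau>) holomorphic_on S" for S
    using th_deriv_u[OF \<tau>] by (auto simp: holomorphic_on_def field_differentiable_def intro: has_field_derivative_at_within)
  define W where "W z = (if z = 0 then deriv (\<lambda>u. th 0 u \<tau>) 0 else (th 0 z \<tau> - th 0 0 \<tau>) / (z - 0))" for z
  have W: "W holomorphic_on UNIV"
    unfolding W_def by (rule pole_lemma) (auto intro: thh)
  have tW: "th 0 u \<tau> = u * W u" for u
    by (simp add: W_def th_even_0)
  have d: "(W has_field_derivative deriv W u) (at u)" "(deriv W has_field_derivative deriv (deriv W) u) (at u)"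
    "(deriv (deriv W) has_field_derivative deriv (deriv (deriv W)) u) (at u)" for u
    using W by (auto intro!: holomorphic_derivI[of _ UNIV] holomorphic_deriv)
  have "((\<lambda>u. u * W u) has_field_derivative W u + u * deriv W u) (at u)" for u
    by (rule derivative_eq_intros d refl)+ simp
  then have t1: "th (Suc 0) u \<tau> = W u + u * deriv W u" for u
    using th_deriv_u[OF \<tau>, of 0 u] DERIV_unique unfolding tW by blast
  have "((\<lambda>u. W u + u * deriv W u) has_field_derivative 2 * deriv W u + u * deriv (deriv W) u) (at u)" for u
    by (rule derivative_eq_intros d refl)+ simp
  then have t2: "th (Suc (Suc 0)) u \<tau> = 2 * deriv W u + u * deriv (deriv W) u" for u
    using th_deriv_u[OF \<tau>, of "Suc 0" u] DERIV_unique unfolding t1 by blast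
  have "((\<lambda>u. 2 * deriv W u + u * deriv (deriv W) u) has_field_derivative 3 * deriv (deriv W) u + u * deriv (deriv (deriv W)) u) (at u)" for u
    by (rule derivative_eq_intros d refl)+ simp
  then have t3: "th (Suc (Suc (Suc 0))) u \<tau> = 3 * deriv (deriv W) u + u * deriv (deriv (deriv W)) u" for u
    using th_deriv_u[OF \<tau>, of "Suc (Suc 0)" u] DERIV_unique unfolding t2 by blast
  show ?thesis
    using that[OF W tW] t1[of 0] t2[of 0] t3[of 0] th_even_0[of 2 \<tau>]
    by (simp add: numeral_2_eq_2 numeral_3_eq_3)
qed

declare One_nat_def [simp del]

section \<open>The addition theorem and the differential equation of \<rho>\<close>

definition Yc :: "complex \<Rightarrow> complex" where "Yc \<tau> = th 3 0 \<tau> / th 1 0 \<tau>"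

text \<open>With \<open>x + y + z = 0\<close> this is \<open>(\<rho>(x) + \<rho>(y) + \<rho>(z))\<^sup>2 + \<rho>'(x) + \<rho>'(y) + \<rho>'(z) = Y\<close>,
  i.e. the addition theorem in the form \<open>(\<zeta>(x) + \<zeta>(y) + \<zeta>(z))\<^sup>2 = \<wp>(x) + \<wp>(y) + \<wp>(z)\<close>.\<close>

lemma rho_addition:
  assumes \<tau>: "Im \<tau> > 0" and t: "th 0 t \<tau> \<noteq> 0" and u: "th 0 u \<tau> \<noteq> 0" "th 0 (u - t) \<tau> \<noteq> 0"
  shows "(qq 1 u \<tau> - qq 1 (u - t) \<tau> - qq 1 t \<tau>)\<^sup>2 + r1 u \<tau> + r1 (u - t) \<tau> + r1 t \<tau> = Yc \<tau>"
proof -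
  define f where "f u = (qq 1 u \<tau> - qq 1 (u - t) \<tau> - qq 1 t \<tau>)\<^sup>2 + r1 u \<tau> + r1 (u - t) \<tau> + r1 t \<tau>" for u
  define Z where "Z = {u. th 0 u \<tau> = 0} \<union> {u. th 0 (u - t) \<tau> = 0}"
  have Zeq: "Z = mark \<tau> ` gauss_lattice \<union> (\<lambda>l. t + mark \<tau> l) ` gauss_lattice"
    unfolding Z_def th0_eq_0_iff[OF \<tau>] by (auto simp: image_iff algebra_simps)
  have Zl: "\<not> z islimpt Z" for z
    unfolding Zeq islimpt_Un using not_islimpt_Lam[OF \<tau>] not_islimpt_lattice_coset[OF \<tau>] by blast
  have Z1: "u + 1 \<in> Z \<longleftrightarrow> u \<in> Z" for u
    using th_shift_1[of 0 u \<tau>] th_shift_1[of 0 "u - t" \<tau>] by (simp add: Z_def algebra_simps)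
  have Z2: "u + \<tau> \<in> Z \<longleftrightarrow> u \<in> Z" for u
    using th0_shift_nonzero[OF \<tau>, of u] th0_shift_nonzero[OF \<tau>, of "u - t"] by (simp add: Z_def algebra_simps)
  have f1: "f (u + 1) = f u" for u
  proof -
    have e: "u + 1 - t = (u - t) + 1" by simp
    show ?thesis unfolding f_def e qq_shift_1 r_shift_1 ..
  qed
  have f2: "f (u + \<tau>) = f u" if "u \<notin> Z" for u
  proof -
    have e: "u + \<tau> - t = (u - t) + \<tau>" by simp
    have nz: "th 0 u \<tau> \<noteq> 0" "th 0 (u - t) \<tau> \<noteq> 0" using that by (auto simp: Z_def)
    show ?thesis
      unfolding f_def e qq_shift_tau(1)[OF \<tau> nz(1)] qq_shift_tau(1)[OF \<tau> nz(2)]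
        r_shift_tau(1)[OF \<tau> nz(1)] r_shift_tau(1)[OF \<tau> nz(2)] by simp
  qed
  have hol: "f holomorphic_on - Z"
    unfolding holomorphic_on_def f_def field_differentiable_def
  proof (intro ballI exI)
    fix u assume "u \<in> - Z"
    then have "th 0 u \<tau> \<noteq> 0" "th 0 (u - t) \<tau> \<noteq> 0" by (auto simp: Z_def)
    then show "((\<lambda>u. (qq 1 u \<tau> - qq 1 (u - t) \<tau> - qq 1 t \<tau>)\<^sup>2 + r1 u \<tau> + r1 (u - t) \<tau> + r1 t \<tau>) has_field_derivative
      2 * (qq 1 u \<tau> - qq 1 (u - t) \<tau> - qq 1 t \<tau>) * (r1 u \<tau> * 1 - r1 (u - t) \<tau> * 1) + r2 u \<tau> * 1 + r2 (u - t) \<tau> * 1) (at u within - Z)"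
      by (auto intro!: derivative_eq_intros rho_derivs[OF \<tau>] simp: algebra_simps)
  qed
  obtain W where W: "W holomorphic_on UNIV" "\<And>u. th 0 u \<tau> = u * W u" "W 0 = th 1 0 \<tau>"
    "deriv W 0 = 0" "3 * deriv (deriv W) 0 = th 3 0 \<tau>"
    using th0_factor_at_0[OF \<tau>] by blast
  have dW: "(W has_field_derivative deriv W u) (at u)" "(deriv W has_field_derivative deriv (deriv W) u) (at u)" for u
    using W(1) by (auto intro!: holomorphic_derivI[of _ UNIV] holomorphic_deriv)
  define m where "m u = deriv W u / W u" for u
  define m' where "m' u = (deriv (deriv W) u * W u - deriv W u * deriv W u) / (W u * W u)" for u
  have dm: "(m has_field_derivative m' u) (at u)" if "W u \<noteq> 0" for u
    unfolding m_def m'_def by (rule DERIV_divide[OF dW(2) dW(1) that])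
  have W0: "W 0 \<noteq> 0" using W(3) th1_0_nonzero[OF \<tau>] by (simp add: One_nat_def)
  have q1m: "qq 1 u \<tau> = 1 / u + m u" if "u \<noteq> 0" "W u \<noteq> 0" for u
  proof -
    have "((\<lambda>u. u * W u) has_field_derivative W u + u * deriv W u) (at u)"
      by (rule derivative_eq_intros dW refl)+ simp
    then have "th 1 u \<tau> = W u + u * deriv W u"
      using th_deriv_u[OF \<tau>, of 0 u] DERIV_unique unfolding W(2) by (metis One_nat_def)
    then show ?thesis using that by (simp add: qq_def W(2) m_def field_simps)
  qed
  have Wev: "\<forall>\<^sub>F u in nhds 0. W u \<noteq> 0"
  proof -
    have "continuous_on UNIV W" using W(1) by (rule holomorphic_on_imp_continuous_on)
    then have "open {u. W u \<noteq> 0}" by (intro open_Collect_neq continuous_intros) auto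
    then show ?thesis using W0 eventually_nhds_in_open by fastforce
  qed
  have r1m: "r1 u \<tau> = - 1 / u\<^sup>2 + m' u" if u: "u \<noteq> 0" "W u \<noteq> 0" for u
  proof -
    have "open {u. u \<noteq> 0 \<and> W u \<noteq> 0}"
      by (intro open_Collect_conj open_Collect_neq continuous_intros holomorphic_on_imp_continuous_on[OF W(1)])
    then have "((\<lambda>u. qq 1 u \<tau>) has_field_derivative (- 1 / u\<^sup>2 + m' u)) (at u)"
    proof (rule has_field_derivative_transform_within_open[rotated])
      show "((\<lambda>u. 1 / u + m u) has_field_derivative (- 1 / u\<^sup>2 + m' u)) (at u)"
        by (rule DERIV_cong, (rule derivative_intros dm u)+) (use u in \<open>simp add: power2_eq_square\<close>)
    qed (use u q1m in auto)
    moreover have "((\<lambda>u. qq 1 u \<tau>) has_field_derivative r1 u \<tau>) (at u)"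
      using rho_derivs(1)[OF \<tau> DERIV_ident, of u] u by (simp add: W(2))
    ultimately show ?thesis by (rule DERIV_unique[symmetric])
  qed
  have f0: "(f \<longlongrightarrow> Yc \<tau>) (at 0)"
  proof -
    \<comment> \<open>With \<open>\<rho> = 1/u + m\<close> the square is \<open>(1/u + d)^2\<close>.
      Its double pole cancels against the one of \<open>r1\<close>, and since \<open>d 0 = 0\<close>
      the cross term \<open>2 d / u\<close> tends to twice the derivative of \<open>d\<close> at
      0.\<close>
    define d where "d u = m u - qq 1 (u - t) \<tau> - qq 1 t \<tau>" for u
    have mt: "th 0 (- t) \<tau> \<noteq> 0" using t by (simp add: th_minus)
    have dd: "(d has_field_derivative (m' 0 - r1 t \<tau>)) (at 0)"
      unfolding d_def by (auto intro!: derivative_eq_intros dm[OF W0] rho_derivs[OF \<tau>] simp: mt r_parity(2))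
    have d0: "d 0 = 0" using W(4) by (simp add: d_def m_def r_parity(1)[of t] qq_minus)
    have lim1: "((\<lambda>u. d u / u) \<longlongrightarrow> m' 0 - r1 t \<tau>) (at 0)"
      using dd by (simp add: has_field_derivative_iff d0)
    have lim2: "(d \<longlongrightarrow> 0) (at 0)" using DERIV_isCont[OF dd] by (simp add: isCont_def d0)
    have lim3: "(m' \<longlongrightarrow> m' 0) (at 0)"
    proof -
      have "continuous_on UNIV W" "continuous_on UNIV (deriv W)" "continuous_on UNIV (deriv (deriv W))"
        using W(1) by (auto intro!: holomorphic_on_imp_continuous_on holomorphic_deriv)
      then have "isCont W 0" "isCont (deriv W) 0" "isCont (deriv (deriv W)) 0"
        by (auto simp: continuous_on_eq_continuous_at)
      then have "isCont m' 0" unfolding m'_def using W0 by (intro continuous_intros) auto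
      then show ?thesis by (simp add: isCont_def)
    qed
    have lim4: "((\<lambda>u. r1 (u - t) \<tau>) \<longlongrightarrow> r1 t \<tau>) (at 0)"
    proof -
      have "((\<lambda>u. r1 (u - t) \<tau>) has_field_derivative r2 (0 - t) \<tau> * 1) (at 0)"
        by (rule rho_derivs(2)[OF \<tau>]) (auto intro!: derivative_eq_intros simp: mt)
      from DERIV_isCont[OF this] show ?thesis by (simp add: isCont_def r_parity)
    qed
    have "((\<lambda>u. 2 * (d u / u) + (d u)\<^sup>2 + m' u + r1 (u - t) \<tau> + r1 t \<tau>) \<longlongrightarrow> 2 * (m' 0 - r1 t \<tau>) + 0\<^sup>2 + m' 0 + r1 t \<tau> + r1 t \<tau>) (at 0)"
      by (intro tendsto_intros lim1 lim2 lim3 lim4)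
    moreover have "\<forall>\<^sub>F u in at 0. 2 * (d u / u) + (d u)\<^sup>2 + m' u + r1 (u - t) \<tau> + r1 t \<tau> = f u"
    proof -
      have "\<forall>\<^sub>F u in at 0. W u \<noteq> 0 \<and> u \<noteq> 0"
        using Wev by (auto simp: eventually_at_filter elim: eventually_mono)
      then show ?thesis
      proof eventually_elim
        case (elim u)
        then have eq: "qq 1 u \<tau> - qq 1 (u - t) \<tau> - qq 1 t \<tau> = 1 / u + d u" "r1 u \<tau> = - 1 / u\<^sup>2 + m' u"
          using q1m[of u] r1m[of u] by (simp_all add: d_def)
        show ?case unfolding f_def eq using elim by (simp add: power2_eq_square field_simps)
      qed
    qed
    ultimately have "(f \<longlongrightarrow> 2 * (m' 0 - r1 t \<tau>) + 0\<^sup>2 + m' 0 + r1 t \<tau> + r1 t \<tau>) (at 0)" by (rule Lim_transform_eventually)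
    moreover have "2 * (m' 0 - r1 t \<tau>) + 0\<^sup>2 + m' 0 + r1 t \<tau> + r1 t \<tau> = Yc \<tau>"
      using W0 W(5) by (simp add: m'_def W(4) Yc_def W(3)[symmetric] field_simps)
    ultimately show ?thesis by simp
  qed
  have b0: "\<exists>B. \<forall>\<^sub>F w in at 0. norm (f w) \<le> B"
    using tendsto_norm[OF f0, THEN order_tendstoD(2), of "norm (Yc \<tau>) + 1"]
    by (auto intro!: exI elim: eventually_mono intro: less_imp_le)
  \<comment> \<open>The reflection exchanges the punctures 0 and \<open>t\<close>, so the bound at 0
    serves for both.\<close>
  have sym: "f (t - u) = f u" for u
    using r_parity(1)[of "u - t" \<tau>] r_parity(2)[of "u - t" \<tau>] r_parity(1)[of u \<tau>] r_parity(2)[of u \<tau>]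
    by (simp add: f_def algebra_simps power2_eq_square)
  have bt: "\<exists>B. \<forall>\<^sub>F w in at t. norm (f w) \<le> B"
  proof -
    obtain B where "\<forall>\<^sub>F w in at 0. norm (f w) \<le> B" using b0 by blast
    moreover have "filterlim (\<lambda>w. t - w) (at 0) (at t)"
      by (auto simp: filterlim_at eventually_at_filter intro!: tendsto_eq_intros)
    ultimately have "\<forall>\<^sub>F w in at t. norm (f (t - w)) \<le> B" by (rule eventually_compose_filterlim)
    then show ?thesis unfolding sym by blast
  qed
  have fl: "f (w + mark \<tau> l) = f w" if "l \<in> gauss_lattice" "w \<notin> Z" for w l
  proof -
    \<comment> \<open>The value 0 on \<open>Z\<close> makes the periodicity unconditional, as
      \<open>periodic_lattice\<close> demands.\<close>
    define F where "F w = (if w \<in> Z then 0 else f w)" for w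
    have "F (w + mark \<tau> l) = F w"
      by (rule periodic_lattice[OF _ _ that(1)]) (use f1 f2 Z1 Z2 in \<open>auto simp: F_def\<close>)
    moreover have "(w + mark \<tau> l \<in> Z) = (w \<in> Z)"
      by (rule periodic_lattice[OF _ _ that(1)]) (use Z1 Z2 in auto)
    ultimately show ?thesis using that(2) by (simp add: F_def)
  qed
  have bdd: "\<exists>B. \<forall>\<^sub>F w in at z. norm (f w) \<le> B" if "z \<in> Z" for z
  proof -
    obtain c l where cl: "c = 0 \<or> c = t" "l \<in> gauss_lattice" "z = c + mark \<tau> l"
      using \<open>z \<in> Z\<close> unfolding Zeq by fastforce
    then obtain B where B: "\<forall>\<^sub>F w in at c. norm (f w) \<le> B" using b0 bt by blast
    have "\<forall>\<^sub>F w in at c. w \<notin> Z" using Zl[of c] by (simp add: islimpt_iff_eventually)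
    with B have ev: "\<forall>\<^sub>F w in at c. norm (f (w + mark \<tau> l)) \<le> B"
      by eventually_elim (use fl[OF cl(2)] in auto)
    have "filterlim (\<lambda>w. w - mark \<tau> l) (at c) (at z)"
      by (auto simp: filterlim_at eventually_at_filter cl(3) algebra_simps intro!: tendsto_eq_intros always_eventually)
    from eventually_compose_filterlim[OF ev this] show ?thesis by auto
  qed
  obtain c where c: "\<And>u. u \<notin> Z \<Longrightarrow> f u = c"
    using elliptic_const[OF \<tau> Zl hol bdd f1 f2 Z1 Z2] by blast
  have "\<forall>\<^sub>F u in at 0. f u = c"
    using Zl[of 0] c by (auto simp: islimpt_iff_eventually elim: eventually_mono)
  then have "((\<lambda>_. c) \<longlongrightarrow> Yc \<tau>) (at (0::complex))" using f0 tendsto_cong by force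
  then have "c = Yc \<tau>" by (simp add: tendsto_const_iff)
  then show ?thesis using c[of u] u by (auto simp: f_def Z_def)
qed

lemma rho_addition_u:
  assumes \<tau>: "Im \<tau> > 0" and t: "th 0 t \<tau> \<noteq> 0" and u: "th 0 u \<tau> \<noteq> 0" "th 0 (u - t) \<tau> \<noteq> 0"
  shows "2 * (qq 1 u \<tau> - qq 1 (u - t) \<tau> - qq 1 t \<tau>) * (r1 u \<tau> - r1 (u - t) \<tau>) + r2 u \<tau> + r2 (u - t) \<tau> = 0"
proof -
  define S where "S = {u. th 0 u \<tau> \<noteq> 0 \<and> th 0 (u - t) \<tau> \<noteq> 0}"
  have "open S" unfolding S_def
    by (intro open_Collect_conj open_Collect_neq continuous_intros) (auto intro: \<tau>)
  then have "((\<lambda>u. (qq 1 u \<tau> - qq 1 (u - t) \<tau> - qq 1 t \<tau>)\<^sup>2 + r1 u \<tau> + r1 (u - t) \<tau> + r1 t \<tau>) has_field_derivative 0) (at u)"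
    by (rule has_field_derivative_transform_within_open[OF DERIV_const[of "Yc \<tau>"]])
       (use u rho_addition[OF \<tau> t] in \<open>auto simp: S_def\<close>)
  moreover have "((\<lambda>u. (qq 1 u \<tau> - qq 1 (u - t) \<tau> - qq 1 t \<tau>)\<^sup>2 + r1 u \<tau> + r1 (u - t) \<tau> + r1 t \<tau>) has_field_derivative
      2 * (qq 1 u \<tau> - qq 1 (u - t) \<tau> - qq 1 t \<tau>) * (r1 u \<tau> - r1 (u - t) \<tau>) + r2 u \<tau> + r2 (u - t) \<tau>) (at u)"
    using u by (auto intro!: derivative_eq_intros rho_derivs[OF \<tau>] simp: algebra_simps)
  ultimately show ?thesis by (rule DERIV_unique[symmetric])
qed

text \<open>The three points \<open>u\<close>, \<open>t - u\<close>, \<open>- t\<close> of the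
  addition theorem play equal roles; replacing \<open>t\<close> by \<open>u - t\<close> in
  \<open>rho_addition_u\<close> exchanges the last two.\<close>

lemma rho_addition_t:
  assumes \<tau>: "Im \<tau> > 0" and t: "th 0 t \<tau> \<noteq> 0" and u: "th 0 u \<tau> \<noteq> 0" "th 0 (u - t) \<tau> \<noteq> 0"
  shows "2 * (qq 1 u \<tau> - qq 1 (u - t) \<tau> - qq 1 t \<tau>) * (r1 u \<tau> - r1 t \<tau>) + r2 u \<tau> + r2 t \<tau> = 0"
proof -
  have "th 0 (u - (u - t)) \<tau> \<noteq> 0" using t by simp
  from rho_addition_u[OF \<tau> u(2) u(1) this] show ?thesis by (simp add: algebra_simps)
qed

text \<open>One more derivative, of \<open>rho_addition_t\<close> in \<open>t\<close> at fixed
  \<open>u\<close>. It expresses the third derivative at \<open>t\<close> through lower ones, as the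
  second row of the matrix requires.\<close>

lemma rho_addition_tt:
  assumes \<tau>: "Im \<tau> > 0" and t: "th 0 t \<tau> \<noteq> 0" and u: "th 0 u \<tau> \<noteq> 0" "th 0 (u - t) \<tau> \<noteq> 0"
  shows "r3 t \<tau> = 2 * (qq 1 u \<tau> - qq 1 (u - t) \<tau> - qq 1 t \<tau>) * r2 t \<tau>
     + 2 * (r1 u \<tau> - r1 t \<tau>) * (r1 t \<tau> - r1 (u - t) \<tau>)"
proof -
  define S where "S = {t. th 0 t \<tau> \<noteq> 0 \<and> th 0 (u - t) \<tau> \<noteq> 0}"
  have "open S" unfolding S_def
    by (intro open_Collect_conj open_Collect_neq continuous_intros) (auto intro: \<tau>)
  then have "((\<lambda>t. 2 * (qq 1 u \<tau> - qq 1 (u - t) \<tau> - qq 1 t \<tau>) * (r1 u \<tau> - r1 t \<tau>) + r2 u \<tau> + r2 t \<tau>) has_field_derivative 0) (at t)"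
    by (rule has_field_derivative_transform_within_open[OF DERIV_const[of 0]])
       (use u t rho_addition_t[OF \<tau>] in \<open>auto simp: S_def\<close>)
  moreover have "((\<lambda>t. 2 * (qq 1 u \<tau> - qq 1 (u - t) \<tau> - qq 1 t \<tau>) * (r1 u \<tau> - r1 t \<tau>) + r2 u \<tau> + r2 t \<tau>) has_field_derivative
      2 * (r1 (u - t) \<tau> - r1 t \<tau>) * (r1 u \<tau> - r1 t \<tau>) - 2 * (qq 1 u \<tau> - qq 1 (u - t) \<tau> - qq 1 t \<tau>) * r2 t \<tau> + r3 t \<tau>) (at t)"
    using u t by (auto intro!: derivative_eq_intros rho_derivs[OF \<tau>] simp: algebra_simps)
  ultimately have "2 * (r1 (u - t) \<tau> - r1 t \<tau>) * (r1 u \<tau> - r1 t \<tau>) - 2 * (qq 1 u \<tau> - qq 1 (u - t) \<tau> - qq 1 t \<tau>) * r2 t \<tau> + r3 t \<tau> = 0"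
    by (rule DERIV_unique[symmetric])
  then show ?thesis by algebra
qed

text \<open>As \<open>\<rho>' = - \<wp> + Y / 3\<close>, constancy of this combination is the second
  order equation of \<wp>. It comes from elimination in the addition identities, with
  \<open>rho_addition_tt\<close> used once for \<open>u\<close>, \<open>t\<close> and once with the
  roles of \<open>u\<close> and \<open>t\<close> exchanged.\<close>

lemma rho_ode_const:
  assumes \<tau>: "Im \<tau> > 0" and t: "th 0 t \<tau> \<noteq> 0" and u: "th 0 u \<tau> \<noteq> 0" "th 0 (u - t) \<tau> \<noteq> 0"
  shows "r3 u \<tau> + 6 * (r1 u \<tau>)\<^sup>2 - 4 * Yc \<tau> * r1 u \<tau> = r3 t \<tau> + 6 * (r1 t \<tau>)\<^sup>2 - 4 * Yc \<tau> * r1 t \<tau>"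
proof -
  have tu: "th 0 (t - u) \<tau> \<noteq> 0" using u(2) th_minus[of 0 "u - t" \<tau>] by simp
  have p: "qq 1 (t - u) \<tau> = - qq 1 (u - t) \<tau>" "r1 (t - u) \<tau> = r1 (u - t) \<tau>"
    using r_parity[of "u - t" \<tau>] by simp_all
  have elim: "x3 + 6 * x1\<^sup>2 - 4 * Y * x1 = s3 + 6 * s1\<^sup>2 - 4 * Y * s1"
    if "Y = S\<^sup>2 + x1 + v1 + s1" "x2 = - s2 - 2 * S * (x1 - s1)"
      "s3 = 2 * S * s2 + 2 * (x1 - s1) * (s1 - v1)" "x3 = - 2 * S * x2 + 2 * (s1 - x1) * (x1 - v1)"
    for S x1 v1 s1 x2 s2 x3 s3 Y :: complex
    unfolding that by (simp add: power2_eq_square algebra_simps)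
  show ?thesis
  proof (rule elim)
    show "Yc \<tau> = (qq 1 u \<tau> - qq 1 (u - t) \<tau> - qq 1 t \<tau>)\<^sup>2 + r1 u \<tau> + r1 (u - t) \<tau> + r1 t \<tau>"
      using rho_addition[OF \<tau> t u] by simp
    show "r2 u \<tau> = - r2 t \<tau> - 2 * (qq 1 u \<tau> - qq 1 (u - t) \<tau> - qq 1 t \<tau>) * (r1 u \<tau> - r1 t \<tau>)"
      using rho_addition_t[OF \<tau> t u] by algebra
    show "r3 u \<tau> = - 2 * (qq 1 u \<tau> - qq 1 (u - t) \<tau> - qq 1 t \<tau>) * r2 u \<tau> + 2 * (r1 t \<tau> - r1 u \<tau>) * (r1 u \<tau> - r1 (u - t) \<tau>)"
      using rho_addition_tt[OF \<tau> u(1) t tu] unfolding p by (simp add: algebra_simps)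
  qed (rule rho_addition_tt[OF \<tau> t u])
qed

definition Zc :: "complex \<Rightarrow> complex" where "Zc \<tau> = th 5 0 \<tau> / th 1 0 \<tau>"

text \<open>In terms of \<open>\<theta>\<close>, the invariant \<open>\<rho>''' + 6 \<rho>'\<^sup>2 - 4 Y \<rho>'\<close> has only the denominator \<open>\<theta>\<^sup>2\<close>;
  its value is read off from the second derivative of the numerator at \<open>0\<close>.\<close>

lemma rho_ode:
  assumes \<tau>: "Im \<tau> > 0" and t: "th 0 t \<tau> \<noteq> 0"
  shows "r3 t \<tau> + 6 * (r1 t \<tau>)\<^sup>2 - 4 * Yc \<tau> * r1 t \<tau> = (Yc \<tau>)\<^sup>2 - Zc \<tau>"
proof -
  define K where "K = r3 t \<tau> + 6 * (r1 t \<tau>)\<^sup>2 - 4 * Yc \<tau> * r1 t \<tau>"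
  let ?t = "\<lambda>n u. th n u \<tau>"
  define N where "N u = ?t 0 u * ?t 4 u - 4 * ?t 1 u * ?t 3 u + 3 * (?t 2 u)\<^sup>2
     - 4 * Yc \<tau> * (?t 0 u * ?t 2 u - (?t 1 u)\<^sup>2) - K * (?t 0 u)\<^sup>2" for u
  define Z where "Z = {u. th 0 u \<tau> = 0} \<union> {u. th 0 (u - t) \<tau> = 0}"
  have Zeq: "Z = mark \<tau> ` gauss_lattice \<union> (\<lambda>l. t + mark \<tau> l) ` gauss_lattice"
    unfolding Z_def th0_eq_0_iff[OF \<tau>] by (auto simp: image_iff algebra_simps)
  have Zl: "\<not> z islimpt Z" for z
    unfolding Zeq islimpt_Un using not_islimpt_Lam[OF \<tau>] not_islimpt_lattice_coset[OF \<tau>] by blast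
  have N0: "N u = 0" if "u \<notin> Z" for u
  proof -
    from that have u: "th 0 u \<tau> \<noteq> 0" "th 0 (u - t) \<tau> \<noteq> 0" by (auto simp: Z_def)
    have "r3 u \<tau> + 6 * (r1 u \<tau>)\<^sup>2 - 4 * Yc \<tau> * r1 u \<tau> = K"
      unfolding K_def by (rule rho_ode_const[OF \<tau> t u])
    moreover have "r3 u \<tau> + 6 * (r1 u \<tau>)\<^sup>2 - 4 * Yc \<tau> * r1 u \<tau> =
       qq 4 u \<tau> - 4 * qq 1 u \<tau> * qq 3 u \<tau> + 3 * (qq 2 u \<tau>)\<^sup>2 - 4 * Yc \<tau> * (qq 2 u \<tau> - (qq 1 u \<tau>)\<^sup>2)"
      unfolding r3_def r1_def by algebra
    ultimately have "qq 4 u \<tau> - 4 * qq 1 u \<tau> * qq 3 u \<tau> + 3 * (qq 2 u \<tau>)\<^sup>2 - 4 * Yc \<tau> * (qq 2 u \<tau> - (qq 1 u \<tau>)\<^sup>2) - K = 0" by simp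
    moreover have "N u = (?t 0 u)\<^sup>2 * (qq 4 u \<tau> - 4 * qq 1 u \<tau> * qq 3 u \<tau> + 3 * (qq 2 u \<tau>)\<^sup>2 - 4 * Yc \<tau> * (qq 2 u \<tau> - (qq 1 u \<tau>)\<^sup>2) - K)"
      using u(1) by (simp add: N_def qq_def power2_eq_square field_simps)
    ultimately show ?thesis by simp
  qed
  have "N u = 0" for u
  proof -
    have "closed {u. N u = 0}" unfolding N_def
      by (intro closed_Collect_eq continuous_intros) (auto intro: \<tau>)
    moreover have "- Z \<subseteq> {u. N u = 0}" using N0 by auto
    ultimately have "closure (- Z) \<subseteq> {u. N u = 0}" by (rule closure_minimal[rotated])
    moreover have "interior Z = {}" using Zl interior_limit_point by blast
    ultimately show ?thesis by (auto simp: closure_complement)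
  qed
  then have Nz: "N = (\<lambda>_. 0)" by auto
  note d = th_deriv_u[OF \<tau>]
  define N1 where "N1 u = ?t 0 u * ?t 5 u - 3 * ?t 1 u * ?t 4 u + 2 * ?t 2 u * ?t 3 u
     - 4 * Yc \<tau> * (?t 0 u * ?t 3 u - ?t 1 u * ?t 2 u) - 2 * K * ?t 0 u * ?t 1 u" for u
  have e: "(2::nat) = Suc (Suc 0)" "(3::nat) = Suc (Suc (Suc 0))" "(4::nat) = Suc (Suc (Suc (Suc 0)))"
    "(5::nat) = Suc (Suc (Suc (Suc (Suc 0))))" "(6::nat) = Suc (Suc (Suc (Suc (Suc (Suc 0)))))" by auto
  have D1: "(N has_field_derivative N1 u) (at u)" for u
  proof -
    have "(N has_field_derivative (?t 0 u * ?t 5 u + ?t 1 u * ?t 4 u - 4 * (?t 1 u * ?t 4 u + ?t 2 u * ?t 3 u) + 6 * ?t 2 u * ?t 3 u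
      - 4 * Yc \<tau> * (?t 0 u * ?t 3 u + ?t 1 u * ?t 2 u - 2 * ?t 1 u * ?t 2 u) - K * (2 * ?t 0 u * ?t 1 u))) (at u)"
      unfolding N_def e One_nat_def power2_eq_square[folded e, unfolded e]
      by (rule derivative_eq_intros d refl)+ (simp add: algebra_simps)
    then show ?thesis by (rule DERIV_cong) (simp add: N1_def algebra_simps)
  qed
  then have "N1 u = 0" for u
    using DERIV_unique[OF D1[of u], unfolded Nz, OF DERIV_const] by simp
  then have N1z: "N1 = (\<lambda>_. 0)" by auto
  have "(N1 has_field_derivative (?t 0 0 * ?t 6 0 + ?t 1 0 * ?t 5 0 - 3 * (?t 1 0 * ?t 5 0 + ?t 2 0 * ?t 4 0) + 2 * (?t 2 0 * ?t 4 0 + ?t 3 0 * ?t 3 0)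
      - 4 * Yc \<tau> * (?t 0 0 * ?t 4 0 + ?t 1 0 * ?t 3 0 - (?t 1 0 * ?t 3 0 + ?t 2 0 * ?t 2 0)) - 2 * K * (?t 0 0 * ?t 2 0 + ?t 1 0 * ?t 1 0))) (at 0)"
    unfolding N1_def e One_nat_def
    by (rule derivative_eq_intros d refl)+ (simp add: algebra_simps)
  \<comment> \<open>\<open>N1\<close> vanishes identically, hence so does its derivative; at 0 only
    the theta derivatives of odd order survive in it.\<close>
  from DERIV_unique[OF this, unfolded N1z, OF DERIV_const]
  have "- 2 * ?t 1 0 * ?t 5 0 + 2 * (?t 3 0)\<^sup>2 = 2 * K * (?t 1 0)\<^sup>2"
    by (simp add: th_even_0 power2_eq_square mult.assoc)
  then have "K * (?t 1 0)\<^sup>2 = (?t 3 0)\<^sup>2 - ?t 1 0 * ?t 5 0" by algebra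
  moreover have nz: "?t 1 0 \<noteq> 0" using th1_0_nonzero[OF \<tau>] by (simp add: One_nat_def)
  ultimately have "K = ((?t 3 0)\<^sup>2 - ?t 1 0 * ?t 5 0) / (?t 1 0)\<^sup>2"
    by (simp add: eq_divide_eq)
  then have "K = (Yc \<tau>)\<^sup>2 - Zc \<tau>"
    using nz by (simp add: Yc_def Zc_def power2_eq_square diff_divide_distrib)
  then show ?thesis by (simp add: K_def)
qed

section \<open>Parameters, punctures and the entries of the connection matrix\<close>

text \<open>The two rows of the Gauss--Manin matrix, as identities between functions on the torus;
  \<open>Gt\<close> is \<open>\<partial>\<^sub>\<tau> log T\<close> at fixed \<open>u\<close>, and \<open>e0\<close>, \<open>e1\<close> are the primitives split off in the two rows.\<close>

locale params =
  fixes \<alpha> a0 ai :: real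
  assumes al_pos: "0 < \<alpha>" and al_lt1: "\<alpha> < 1"
    and nonint: "\<not> (\<exists>m n :: int. a0 = \<alpha> * of_int m \<and> ai = \<alpha> * of_int n)"
begin

abbreviation tt :: "complex \<Rightarrow> complex" where "tt \<tau> \<equiv> tpt \<alpha> a0 ai \<tau>"
abbreviation al :: complex where "al \<equiv> of_real \<alpha>"
abbreviation be :: complex where "be \<equiv> kap * of_real a0"
abbreviation PP :: "complex set" where "PP \<equiv> punctures \<alpha> a0 ai"
abbreviation (input) Tbr :: "'x::topological_space set \<Rightarrow> ('x \<Rightarrow> complex \<times> complex) \<Rightarrow> ('x \<Rightarrow> complex) \<Rightarrow> bool"
  where "Tbr \<equiv> is_T_branch \<alpha> a0 ai"
abbreviation (input) along :: "(real \<Rightarrow> complex) \<Rightarrow> complex \<times> real \<Rightarrow> complex \<times> complex"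
  where "along g \<equiv> (\<lambda>(\<tau>, x). (\<tau>, mark \<tau> (g x)))"

lemma al_nonzero [simp]: "\<alpha> \<noteq> 0" using al_pos by simp

lemma tt_mark: "tt \<tau> = mark \<tau> (tmark \<alpha> a0 ai)"
  by (simp add: tpt_def tmark_def mark_Complex field_simps)

lemma tmark_notin: "tmark \<alpha> a0 ai \<notin> gauss_lattice"
proof
  assume "tmark \<alpha> a0 ai \<in> gauss_lattice"
  then obtain m n where "- ai / \<alpha> = of_int m" "a0 / \<alpha> = of_int n"
    by (auto simp: tmark_def gauss_lattice_iff)
  then have "a0 = \<alpha> * of_int n \<and> ai = \<alpha> * of_int (- m)" by (simp add: field_simps)
  then show False using nonint by blast
qed

lemma th0_mark_eq_0: "Im \<tau> > 0 \<Longrightarrow> th 0 (mark \<tau> z) \<tau> = 0 \<longleftrightarrow> z \<in> gauss_lattice"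
  using th0_eq_0_iff[of \<tau> "mark \<tau> z"] inj_mark[of \<tau>] by (auto simp: inj_def)

lemma th0_tt: "Im \<tau> > 0 \<Longrightarrow> th 0 (tt \<tau>) \<tau> \<noteq> 0"
  using th0_mark_eq_0[of \<tau> "tmark \<alpha> a0 ai"] tmark_notin by (simp add: tt_mark)

lemma punctures_iff: "z \<in> PP \<longleftrightarrow> z \<in> gauss_lattice \<or> z - tmark \<alpha> a0 ai \<in> gauss_lattice"
proof -
  have "z \<in> (+) w ` gauss_lattice \<longleftrightarrow> z - w \<in> gauss_lattice" for w
    by (auto simp: image_iff intro: bexI[of _ "z - w"])
  then show ?thesis by (simp add: punctures_def)
qed

lemma in_mark_punctures:
  "Im \<tau> > 0 \<Longrightarrow> u \<in> mark \<tau> ` PP \<longleftrightarrow> th 0 u \<tau> = 0 \<or> th 0 (u - tt \<tau>) \<tau> = 0"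
proof -
  assume \<tau>: "Im \<tau> > 0"
  define z where "z = unmark \<tau> u"
  have u: "u = mark \<tau> z" using \<tau> by (simp add: z_def)
  have a: "u \<in> mark \<tau> ` PP \<longleftrightarrow> z \<in> PP" unfolding u using inj_mark[OF \<tau>] by (auto simp: inj_def)
  have b: "u - tt \<tau> = mark \<tau> (z - tmark \<alpha> a0 ai)" by (simp add: u tt_mark)
  show ?thesis
    unfolding a b punctures_iff using th0_mark_eq_0[OF \<tau>, of z, folded u] th0_mark_eq_0[OF \<tau>, of "z - tmark \<alpha> a0 ai"] by (simp only:)
qed

lemma not_puncture:
  assumes "Im \<tau> > 0" "u \<notin> mark \<tau> ` PP"
  shows "th 0 u \<tau> \<noteq> 0" "th 0 (u - tt \<tau>) \<tau> \<noteq> 0"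
  using assms in_mark_punctures by auto

lemma not_islimpt_punctures: "Im \<tau> > 0 \<Longrightarrow> \<not> z islimpt mark \<tau> ` PP"
proof -
  assume \<tau>: "Im \<tau> > 0"
  have "mark \<tau> ` PP = mark \<tau> ` gauss_lattice \<union> (\<lambda>l. tt \<tau> + mark \<tau> l) ` gauss_lattice"
    by (auto simp: punctures_def image_Un image_image tt_mark)
  then show ?thesis
    using not_islimpt_Lam[OF \<tau>] not_islimpt_lattice_coset[OF \<tau>] by (simp add: islimpt_Un)
qed

lemma not_islimpt_PP: "\<not> z islimpt PP"
  using not_islimpt_punctures[of \<i> z] by simp

lemma open_compl_punctures: "Im \<tau> > 0 \<Longrightarrow> open (- mark \<tau> ` PP)"
  using not_islimpt_punctures closed_limpt by (metis open_Compl)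

lemma punctures_shift: "l \<in> gauss_lattice \<Longrightarrow> z + l \<in> PP \<longleftrightarrow> z \<in> PP"
proof -
  assume l: "l \<in> gauss_lattice"
  have "w + l \<in> gauss_lattice \<longleftrightarrow> w \<in> gauss_lattice" for w
    using l gauss_lattice_closed(2)[of w l] gauss_lattice_closed(3)[of "w + l" l] by auto
  from this[of z] this[of "z - tmark \<alpha> a0 ai"] show ?thesis
    by (simp add: punctures_iff algebra_simps)
qed

definition om :: "complex \<Rightarrow> complex \<Rightarrow> complex" where
  "om u \<tau> = be + al * (qq 1 u \<tau> - qq 1 (u - tt \<tau>) \<tau>)"

lemma omega_eq_om: "Im \<tau> > 0 \<Longrightarrow> omega \<alpha> a0 ai \<tau> u = om u \<tau>"
  by (simp add: omega_def om_def rho_eq_qq kap_def)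

definition Gt :: "complex \<Rightarrow> complex \<Rightarrow> complex" where
  "Gt u \<tau> = al * (qq 2 u \<tau> - qq 2 (u - tt \<tau>) \<tau>) / (2 * kap) + of_real a0 * qq 1 (u - tt \<tau>) \<tau>"

definition AA :: "complex \<Rightarrow> complex" where
  "AA \<tau> = of_real a0 * qq 1 (tt \<tau>) \<tau> + al / (2 * kap) * (qq 2 (tt \<tau>) \<tau> - Yc \<tau>)"

definition p0 :: complex where "p0 = kap * of_real (a0\<^sup>2 / \<alpha>)"

definition M11 :: "complex \<Rightarrow> complex" where "M11 \<tau> = p0 + AA \<tau>"
definition M12 :: complex where "M12 = (al - 1) / kap"
definition M21 :: "complex \<Rightarrow> complex" where
  "M21 \<tau> = (let r = qq 1 (tt \<tau>) \<tau>; s1 = r1 (tt \<tau>) \<tau>; s2 = r2 (tt \<tau>) \<tau> in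
     (al * (r3 (tt \<tau>) \<tau> + 2 * r * s2 + 2 * r\<^sup>2 * s1 + 4 * s1\<^sup>2 - 2 * Yc \<tau> * s1)
       + 2 * be * (s2 + 2 * r * s1) + 2 * be\<^sup>2 / al * s1) / (2 * kap))"
definition M22 :: "complex \<Rightarrow> complex" where "M22 \<tau> = - AA \<tau>"

lemma GM_matrix_eq:
  assumes "Im \<tau> > 0"
  shows "GM_matrix \<alpha> a0 ai \<tau> $ 1 $ 1 = M11 \<tau>" "GM_matrix \<alpha> a0 ai \<tau> $ 1 $ 2 = M12"
    "GM_matrix \<alpha> a0 ai \<tau> $ 2 $ 1 = M21 \<tau>" "GM_matrix \<alpha> a0 ai \<tau> $ 2 $ 2 = M22 \<tau>"
proof -
  have k: "kap = 2 * \<i> * of_real pi" "2 * kap = 4 * \<i> * of_real pi" by (simp_all add: kap_def)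
  have Y: "theta_Y \<tau> = Yc \<tau>" by (simp add: theta_Y_def Yc_def jtheta_d_eq_th assms)
  have q: "jtheta_d 2 (tt \<tau>) \<tau> / jtheta (tt \<tau>) \<tau> = qq 2 (tt \<tau>) \<tau>"
    by (simp add: qq_def jtheta_eq_th jtheta_d_eq_th assms)
  note R = rho_eq_qq[OF assms] rho_d_eq[OF assms th0_tt[OF assms]]
  show "GM_matrix \<alpha> a0 ai \<tau> $ 1 $ 1 = M11 \<tau>"
    by (simp add: GM_matrix_def Let_def Y q R M11_def AA_def p0_def k)
  show "GM_matrix \<alpha> a0 ai \<tau> $ 1 $ 2 = M12"
    by (simp add: GM_matrix_def Let_def M12_def k)
  show "GM_matrix \<alpha> a0 ai \<tau> $ 2 $ 1 = M21 \<tau>"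
    by (simp add: GM_matrix_def Let_def Y q R M21_def k)
  show "GM_matrix \<alpha> a0 ai \<tau> $ 2 $ 2 = M22 \<tau>"
    by (simp add: GM_matrix_def Let_def Y q R M22_def AA_def k)
qed

text \<open>The additive constant is forced by the residues at \<open>t\<close>: there
  \<open>Gt\<close> has residue \<open>a0\<close> and \<open>om\<close> has residue
  \<open>- \<alpha>\<close>, so the primitive must take the value \<open>- a0 / \<alpha>\<close>.
  The constant of \<open>e1\<close> is fixed in the same way by the residue of
  \<open>r1 * Gt\<close>.\<close>

definition e0 :: "complex \<Rightarrow> complex \<Rightarrow> complex" where
  "e0 u \<tau> = (qq 1 u \<tau> - qq 1 (tt \<tau>) \<tau> - be / al) / kap"

text \<open>The derivative of \<open>qq 2\<close> in \<open>u\<close>; by the heat equation it is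
  also \<open>2 * kap\<close> times the derivative of \<rho> in \<tau>.\<close>

definition q2' :: "complex \<Rightarrow> complex \<Rightarrow> complex" where
  "q2' u \<tau> = qq 3 u \<tau> - qq 2 u \<tau> * qq 1 u \<tau>"

definition e1 :: "complex \<Rightarrow> complex \<Rightarrow> complex" where
  "e1 u \<tau> = (q2' u \<tau> - q2' (tt \<tau>) \<tau> - 2 * r1 (tt \<tau>) \<tau> * be / al) / (2 * kap)"

lemma q2'_eq: "q2' u \<tau> = r2 u \<tau> + 2 * qq 1 u \<tau> * r1 u \<tau>"
  unfolding q2'_def r2_def r1_def by algebra

lemma qq2_eq: "qq 2 u \<tau> = r1 u \<tau> + (qq 1 u \<tau>)\<^sup>2"
  by (simp add: r1_def)

lemma row0:
  assumes "Im \<tau> > 0" "th 0 u \<tau> \<noteq> 0" "th 0 (u - tt \<tau>) \<tau> \<noteq> 0"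
  shows "Gt u \<tau> = M11 \<tau> + al / kap * r1 u \<tau> + om u \<tau> * e0 u \<tau>"
proof -
  define x x1 v v1 r s1 Y where "x = qq 1 u \<tau>" "x1 = r1 u \<tau>" "v = qq 1 (u - tt \<tau>) \<tau>" "v1 = r1 (u - tt \<tau>) \<tau>"
    "r = qq 1 (tt \<tau>) \<tau>" "s1 = r1 (tt \<tau>) \<tau>" "Y = Yc \<tau>"
  note defs = this
  have I0: "Y = (x - v - r)\<^sup>2 + x1 + v1 + s1"
    using rho_addition[OF assms(1) th0_tt[OF assms(1)] assms(2,3)] unfolding defs by simp
  \<comment> \<open>Once \<open>Y\<close> is replaced through the addition theorem and denominators
    are cleared, this is a polynomial identity in the values of \<rho> and \<open>\<rho>'\<close> at
    the three points.\<close>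
  have "2 * kap * al * Gt u \<tau> = 2 * kap * al * (M11 \<tau> + al / kap * r1 u \<tau> + om u \<tau> * e0 u \<tau>)"
    unfolding Gt_def M11_def AA_def p0_def om_def e0_def qq2_eq defs[symmetric] I0
    by (simp add: field_simps) (simp add: algebra_simps power2_eq_square)
  then show ?thesis by simp
qed

lemma row1:
  assumes "Im \<tau> > 0" "th 0 u \<tau> \<noteq> 0" "th 0 (u - tt \<tau>) \<tau> \<noteq> 0"
  shows "r1 u \<tau> * Gt u \<tau> = M21 \<tau> + M22 \<tau> * r1 u \<tau> + om u \<tau> * e1 u \<tau>"
proof -
  define x x1 x2 v v1 r s1 s2 s3 Y where "x = qq 1 u \<tau>" "x1 = r1 u \<tau>" "x2 = r2 u \<tau>" "v = qq 1 (u - tt \<tau>) \<tau>" "v1 = r1 (u - tt \<tau>) \<tau>"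
    "r = qq 1 (tt \<tau>) \<tau>" "s1 = r1 (tt \<tau>) \<tau>" "s2 = r2 (tt \<tau>) \<tau>" "s3 = r3 (tt \<tau>) \<tau>" "Y = Yc \<tau>"
  note defs = this
  note as = assms(1) th0_tt[OF assms(1)] assms(2,3)
  have I0: "Y = (x - v - r)\<^sup>2 + x1 + v1 + s1"
    using rho_addition[OF as] unfolding defs by simp
  have I2: "x2 = - s2 - 2 * (x - v - r) * (x1 - s1)"
    using rho_addition_t[OF as] unfolding defs by algebra
  have C: "s3 = 2 * (x - v - r) * s2 + 2 * (x1 - s1) * (s1 - v1)"
    using rho_addition_tt[OF as] unfolding defs by simp
  \<comment> \<open>The second row needs the addition theorem and both derived identities: they
    eliminate \<open>Y\<close>, \<open>\<rho>''(u)\<close> and \<open>\<rho>'''(t)\<close>, and the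
    remaining quantities are treated as independent.\<close>
  have "2 * kap * al * (r1 u \<tau> * Gt u \<tau>) = 2 * kap * al * (M21 \<tau> + M22 \<tau> * r1 u \<tau> + om u \<tau> * e1 u \<tau>)"
    unfolding Gt_def M21_def M22_def AA_def p0_def om_def e1_def q2'_eq qq2_eq Let_def defs[symmetric] I2 C I0
    by (simp add: field_simps) (simp add: algebra_simps power2_eq_square power3_eq_cube)
  then show ?thesis by simp
qed

end

text \<open>The second derivative of \<open>qq 2\<close> in \<open>u\<close>. Its companion
  \<open>q2t\<close> is the derivative of \<open>qq 2\<close> in \<tau>.\<close>

definition q2'' :: "complex \<Rightarrow> complex \<Rightarrow> complex" where
  "q2'' u \<tau> = r3 u \<tau> + 2 * (r1 u \<tau>)\<^sup>2 + 2 * qq 1 u \<tau> * r2 u \<tau>"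

definition q2t :: "complex \<Rightarrow> complex \<Rightarrow> complex" where
  "q2t u \<tau> = (qq 4 u \<tau> - (qq 2 u \<tau>)\<^sup>2) / (2 * kap)"

lemma Suc_numerals: "Suc 1 = 2" "Suc (Suc 1) = 3" "Suc (Suc 2) = 4" "Suc 2 = 3" "Suc 3 = 4"
  by auto

lemma (in params) qq1_chain:
  assumes "(U has_field_derivative U') (at s within S)" "(V has_field_derivative V') (at s within S)"
    and "Im (V s) > 0" "th 0 (U s) (V s) \<noteq> 0"
  shows "((\<lambda>s. qq 1 (U s) (V s)) has_field_derivative (r1 (U s) (V s) * U' + q2' (U s) (V s) / (2 * kap) * V')) (at s within S)"
  by (rule DERIV_cong[OF qq_chain[OF assms]])
     (simp add: r1_def q2'_def Suc_numerals power2_eq_square algebra_simps)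

section \<open>Derivatives in the modulus and the differential equation of \<open>T\<close>\<close>

context params
begin

lemma qq2_chain:
  assumes "(U has_field_derivative U') (at s within S)" "(V has_field_derivative V') (at s within S)"
    and "Im (V s) > 0" "th 0 (U s) (V s) \<noteq> 0"
  shows "((\<lambda>s. qq 2 (U s) (V s)) has_field_derivative (q2' (U s) (V s) * U' + q2t (U s) (V s) * V')) (at s within S)"
  by (rule DERIV_cong[OF qq_chain[OF assms]])
     (simp add: q2t_def q2'_def Suc_numerals power2_eq_square algebra_simps)

lemma q2'_deriv_u:
  assumes "Im \<tau> > 0" "(U has_field_derivative U') (at s within S)" "th 0 (U s) \<tau> \<noteq> 0"
  shows "((\<lambda>s. q2' (U s) \<tau>) has_field_derivative q2'' (U s) \<tau> * U') (at s within S)"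
  unfolding q2'_eq
  by (rule DERIV_cong, (rule DERIV_cdivide derivative_intros rho_derivs[OF assms])+) (simp add: q2''_def power2_eq_square algebra_simps)

lemma r1_chain:
  assumes "(U has_field_derivative U') (at s within S)" "(V has_field_derivative V') (at s within S)"
    and "Im (V s) > 0" "th 0 (U s) (V s) \<noteq> 0"
  shows "((\<lambda>s. r1 (U s) (V s)) has_field_derivative (r2 (U s) (V s) * U' + q2'' (U s) (V s) / (2 * kap) * V')) (at s within S)"
proof -
  have q2t: "q2t (U s) (V s) = (q2'' (U s) (V s) + 2 * qq 1 (U s) (V s) * q2' (U s) (V s)) / (2 * kap)"
    unfolding q2t_def q2''_def q2'_def r3_def r2_def r1_def by (simp add: field_simps power2_eq_square power3_eq_cube power4_eq_xxxx)
  have "((\<lambda>s. r1 (U s) (V s)) has_field_derivative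
      (q2' (U s) (V s) * U' + q2t (U s) (V s) * V' - 2 * (r1 (U s) (V s) * U' + q2' (U s) (V s) / (2 * kap) * V') * qq 1 (U s) (V s))) (at s within S)"
    unfolding r1_def[of "U _"]
    by (rule DERIV_cong, (rule DERIV_cdivide derivative_intros qq1_chain[OF assms] qq2_chain[OF assms])+) (simp add: r1_def)
  then show ?thesis
    unfolding q2t q2'_eq by (elim DERIV_cong) (simp add: field_simps)
qed

lemma tt_deriv: "(tt has_field_derivative of_real a0 / al) (at \<tau> within S)"
  unfolding tpt_def by (auto intro!: derivative_eq_intros)

definition rdot :: "complex \<Rightarrow> complex" where
  "rdot \<tau> = r1 (tt \<tau>) \<tau> * (of_real a0 / al) + q2' (tt \<tau>) \<tau> / (2 * kap)"

lemma rdot: "Im \<tau> > 0 \<Longrightarrow> ((\<lambda>\<tau>. qq 1 (tt \<tau>) \<tau>) has_field_derivative rdot \<tau>) (at \<tau>)"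
  by (rule DERIV_cong[OF qq1_chain[OF tt_deriv DERIV_ident _ th0_tt]]) (auto simp: rdot_def)

definition M11d :: "complex \<Rightarrow> complex" where
  "M11d \<tau> = of_real a0 * rdot \<tau> + al / (2 * kap) *
     (q2' (tt \<tau>) \<tau> * (of_real a0 / al) + q2t (tt \<tau>) \<tau> - (Zc \<tau> - (Yc \<tau>)\<^sup>2) / (2 * kap))"

lemma Yc_deriv:
  assumes "Im \<tau> > 0"
  shows "(Yc has_field_derivative (Zc \<tau> - (Yc \<tau>)\<^sup>2) / (2 * kap)) (at \<tau>)"
proof -
  have nz: "th 1 0 \<tau> \<noteq> 0" using th1_0_nonzero[OF assms] by (simp add: One_nat_def)
  have n: "(3::nat) + 2 = 5" "(1::nat) + 2 = 3" by auto
  have "((\<lambda>\<tau>. th 3 0 \<tau> / th 1 0 \<tau>) has_field_derivative (Zc \<tau> - (Yc \<tau>)\<^sup>2) / (2 * kap)) (at \<tau>)"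
    by (rule DERIV_cong[OF DERIV_divide[OF th_deriv_tau[OF assms] th_deriv_tau[OF assms] nz]])
       (use nz in \<open>simp add: n Zc_def Yc_def field_simps power2_eq_square\<close>)
  then show ?thesis by (simp add: Yc_def[abs_def])
qed

lemma M11_deriv:
  assumes "Im \<tau> > 0"
  shows "(M11 has_field_derivative M11d \<tau>) (at \<tau>)"
proof -
  have q2: "((\<lambda>\<tau>. qq 2 (tt \<tau>) \<tau>) has_field_derivative (q2' (tt \<tau>) \<tau> * (of_real a0 / al) + q2t (tt \<tau>) \<tau> * 1)) (at \<tau>)"
    using qq2_chain[OF tt_deriv DERIV_ident _ th0_tt[OF assms]] assms by simp
  show ?thesis
    unfolding M11_def[abs_def] AA_def
    by (rule DERIV_cong, (rule DERIV_cdivide derivative_intros rdot[OF assms] q2 Yc_deriv[OF assms])+) (simp add: M11d_def)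
qed

lemma trace_M: "M11 \<tau> + M22 \<tau> = p0"
  by (simp add: M11_def M22_def)

text \<open>Since \<open>M12\<close> is constant, the second unknown of the linear system can be
  eliminated without further derivatives; the trace \<open>p0\<close> becomes the coefficient of the
  first derivative and this function that of the unknown itself.\<close>

definition phi :: "complex \<Rightarrow> complex" where
  "phi \<tau> = M11 \<tau> * M22 \<tau> - M12 * M21 \<tau> - M11d \<tau>"

text \<open>The derivative of \<open>Y\<close> brings in the fifth derivative of \<theta> at 0.
  \<open>rho_ode\<close> converts it into values at \<open>t\<close>, and both sides become
  polynomials in \<open>r\<close>, \<open>s1\<close>, \<open>s2\<close>, \<open>s3\<close> and
  \<open>Y\<close>.\<close>

lemma phi_pot_eq:
  assumes "Im \<tau> > 0"
  shows "phi_pot \<alpha> a0 ai \<tau> = phi \<tau>"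
proof -
  have Y: "theta_Y \<tau> = Yc \<tau>" by (simp add: theta_Y_def Yc_def jtheta_d_eq_th assms)
  have q: "jtheta_d n (tt \<tau>) \<tau> / jtheta (tt \<tau>) \<tau> = qq n (tt \<tau>) \<tau>" for n
    by (simp add: qq_def jtheta_eq_th jtheta_d_eq_th assms)
  have Z: "jtheta_d 5 0 \<tau> / jtheta_d 1 0 \<tau> = Zc \<tau>" by (simp add: Zc_def jtheta_d_eq_th assms)
  have be: "2 * \<i> * of_real pi * of_real a0 = be" by (simp add: kap_def)
  have pi: "16 * of_real (pi\<^sup>2) = - 4 * kap\<^sup>2" by (simp add: kap_def power_mult_distrib)
  define r s1 s2 s3 Y where "r = qq 1 (tt \<tau>) \<tau>" "s1 = r1 (tt \<tau>) \<tau>" "s2 = r2 (tt \<tau>) \<tau>" "s3 = r3 (tt \<tau>) \<tau>" "Y = Yc \<tau>"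
  note defs = this
  have q2: "qq 2 (tt \<tau>) \<tau> = s1 + r\<^sup>2" and q3: "qq 3 (tt \<tau>) \<tau> = s2 + 3 * r * s1 + r ^ 3"
    and q4: "qq 4 (tt \<tau>) \<tau> = s3 + 4 * r * s2 + 3 * s1\<^sup>2 + 6 * r\<^sup>2 * s1 + r ^ 4"
    unfolding defs r1_def r2_def r3_def by (simp_all add: algebra_simps power2_eq_square power3_eq_cube power4_eq_xxxx)
  have Zc: "Zc \<tau> = Y\<^sup>2 - s3 - 6 * s1\<^sup>2 + 4 * Y * s1"
    using rho_ode[OF assms th0_tt[OF assms]] unfolding defs by (simp add: algebra_simps)
  have q2': "q2' (tt \<tau>) \<tau> = s2 + 2 * r * s1" by (simp add: q2'_eq defs)
  define b where "b = be"
  have p0: "p0 = b\<^sup>2 / (kap * al)" by (simp add: b_def p0_def power2_eq_square field_simps)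
  have a0: "complex_of_real a0 = b / kap" by (simp add: b_def)
  define X where "X = (4 * b ^ 3 / al * r + b\<^sup>2 * (6 * qq 2 (tt \<tau>) \<tau> - 2 * Y)
         + 4 * al * b * (qq 3 (tt \<tau>) \<tau> - Y * r)
         + al\<^sup>2 * (qq 4 (tt \<tau>) \<tau> - 2 * Y * qq 2 (tt \<tau>) \<tau> + 2 * Y\<^sup>2 - Zc \<tau>)) / (- 4 * kap\<^sup>2)"
  have "4 * kap\<^sup>2 * al * phi \<tau> = 4 * kap\<^sup>2 * al * X"
    unfolding X_def phi_def M11_def M12_def M21_def M22_def AA_def M11d_def rdot_def q2t_def Let_def p0 q2' a0
      defs[symmetric] q2 q3 q4 Zc
    by (simp add: field_simps) (simp add: algebra_simps power2_eq_square power3_eq_cube power4_eq_xxxx)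
  then have "phi \<tau> = X" by simp
  then show ?thesis
    unfolding phi_pot_def Let_def Y q Z be pi X_def defs b_def by simp
qed

text \<open>\<open>De0\<close> and \<open>Gtt\<close> are the derivatives of \<open>e0\<close> and \<open>Gt\<close> with respect to \<open>\<tau>\<close> at fixed \<open>u\<close>.\<close>

definition De0 :: "complex \<Rightarrow> complex \<Rightarrow> complex" where
  "De0 u \<tau> = (q2' u \<tau> / (2 * kap) - rdot \<tau>) / kap"

definition Gtu :: "complex \<Rightarrow> complex \<Rightarrow> complex" where
  "Gtu u \<tau> = al * (q2' u \<tau> - q2' (u - tt \<tau>) \<tau>) / (2 * kap) + of_real a0 * r1 (u - tt \<tau>) \<tau>"

definition Gtt :: "complex \<Rightarrow> complex \<Rightarrow> complex" where
  "Gtt u \<tau> = al * (q2t u \<tau> - (q2t (u - tt \<tau>) \<tau> - q2' (u - tt \<tau>) \<tau> * (of_real a0 / al))) / (2 * kap)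
     + of_real a0 * (q2' (u - tt \<tau>) \<tau> / (2 * kap) - r1 (u - tt \<tau>) \<tau> * (of_real a0 / al))"

text \<open>The primitives collected when the elimination is performed on \<open>T\<close> and not
  on its class: \<open>e0 * Gt + De0\<close> is the \<tau>-derivative of the exact term of the first
  row, \<open>M12 * e1\<close> is the exact term of the second row, and \<open>- e0 * M22\<close>
  appears when \<open>r1 * T\<close> is expressed through the first row.\<close>

definition Rr :: "complex \<Rightarrow> complex \<Rightarrow> complex" where
  "Rr u \<tau> = e0 u \<tau> * (Gt u \<tau> - M22 \<tau>) + De0 u \<tau> + M12 * e1 u \<tau>"

context
  fixes U V s S U' V'
  assumes UV: "(U has_field_derivative U') (at s within S)" "(V has_field_derivative V') (at s within S)"
    and V: "Im (V s) > 0" and nz: "th 0 (U s) (V s) \<noteq> 0" "th 0 (U s - tt (V s)) (V s) \<noteq> 0"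
begin

lemma shift_chain: "((\<lambda>s. U s - tt (V s)) has_field_derivative U' - of_real a0 / al * V') (at s within S)"
  by (intro derivative_intros UV DERIV_chain2[OF tt_deriv])

lemmas basic_chains = qq1_chain[OF UV V nz(1)] qq2_chain[OF UV V nz(1)]
  qq1_chain[OF shift_chain UV(2) V nz(2)] qq2_chain[OF shift_chain UV(2) V nz(2)]

lemma Gt_chain: "((\<lambda>s. Gt (U s) (V s)) has_field_derivative Gtu (U s) (V s) * U' + Gtt (U s) (V s) * V') (at s within S)"
  unfolding Gt_def
  by (rule DERIV_cong, (rule DERIV_cdivide derivative_intros basic_chains)+, simp)
     (simp add: Gtu_def Gtt_def field_simps)

lemma om_chain: "((\<lambda>s. om (U s) (V s)) has_field_derivative
    al * (r1 (U s) (V s) - r1 (U s - tt (V s)) (V s)) * U' + Gtu (U s) (V s) * V') (at s within S)"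
  unfolding om_def
  by (rule DERIV_cong, (rule DERIV_cdivide derivative_intros basic_chains)+) (simp add: Gtu_def field_simps)

end

lemma e0_deriv_u:
  assumes "Im \<tau> > 0" "th 0 u \<tau> \<noteq> 0"
  shows "((\<lambda>u. e0 u \<tau>) has_field_derivative r1 u \<tau> / kap) (at u)"
  unfolding e0_def
  by (rule DERIV_cong, (rule DERIV_cdivide derivative_intros rho_derivs(1)[OF assms(1) DERIV_ident assms(2)])+) auto

lemma e0_deriv_tau:
  assumes "Im \<tau> > 0" "th 0 u \<tau> \<noteq> 0"
  shows "((\<lambda>\<tau>. e0 u \<tau>) has_field_derivative De0 u \<tau>) (at \<tau>)"
  unfolding e0_def
  by (rule DERIV_cong, (rule DERIV_cdivide derivative_intros qq1_chain[OF DERIV_const DERIV_ident assms] rdot[OF assms(1)])+)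
     (auto simp: De0_def)

lemma e1_deriv_u:
  assumes "Im \<tau> > 0" "th 0 u \<tau> \<noteq> 0"
  shows "((\<lambda>u. e1 u \<tau>) has_field_derivative q2'' u \<tau> / (2 * kap)) (at u)"
  unfolding e1_def
  by (rule DERIV_cong, (rule DERIV_cdivide derivative_intros q2'_deriv_u[OF assms(1) DERIV_ident assms(2)])+) auto

lemma De0_deriv_u:
  assumes "Im \<tau> > 0" "th 0 u \<tau> \<noteq> 0"
  shows "((\<lambda>u. De0 u \<tau>) has_field_derivative q2'' u \<tau> / (2 * kap\<^sup>2)) (at u)"
  unfolding De0_def
  by (rule DERIV_cong, (rule DERIV_cdivide derivative_intros q2'_deriv_u[OF assms(1) DERIV_ident assms(2)])+)
     (auto simp: power2_eq_square)

lemma Rr_deriv_u: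
  assumes "Im \<tau> > 0" "th 0 u \<tau> \<noteq> 0" "th 0 (u - tt \<tau>) \<tau> \<noteq> 0"
  shows "((\<lambda>u. Rr u \<tau>) has_field_derivative r1 u \<tau> / kap * (Gt u \<tau> - M22 \<tau>) + e0 u \<tau> * Gtu u \<tau>
     + q2'' u \<tau> / (2 * kap\<^sup>2) + M12 * (q2'' u \<tau> / (2 * kap))) (at u)"
  unfolding Rr_def
  by (rule DERIV_cong, (rule DERIV_cdivide derivative_intros Gt_chain[OF DERIV_ident DERIV_const assms]
     e0_deriv_u[OF assms(1,2)] e1_deriv_u[OF assms(1,2)] De0_deriv_u[OF assms(1,2)])+) simp

text \<open>\<open>(\<partial>\<^sub>\<tau>\<^sup>2 - p \<partial>\<^sub>\<tau> + \<phi>) T = \<partial>\<^sub>u (T R)\<close>, divided by \<open>T\<close>.\<close>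

lemma T_ode:
  assumes "Im \<tau> > 0" "th 0 u \<tau> \<noteq> 0" "th 0 (u - tt \<tau>) \<tau> \<noteq> 0"
  shows "((\<lambda>u. Rr u \<tau>) has_field_derivative
     Gtt u \<tau> + (Gt u \<tau>)\<^sup>2 - p0 * Gt u \<tau> + phi \<tau> - om u \<tau> * Rr u \<tau>) (at u)"
proof -
  \<comment> \<open>The first row is to be differentiated in \<tau> at fixed \<open>u\<close>, so
    \<open>u\<close> has to avoid the punctures for all nearby \<tau>.\<close>
  have op: "open {\<tau>. \<tau> \<in> UHP \<and> th 0 u \<tau> \<noteq> 0 \<and> th 0 (u - tt \<tau>) \<tau> \<noteq> 0}"
  proof -
    have "open {\<tau> \<in> UHP. (th 0 u \<tau>, th 0 (u - tt \<tau>) \<tau>) \<in> (- {0}) \<times> (- {0})}"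
      by (intro continuous_open_preimage[OF _ open_UHP, unfolded vimage_def Int_def mem_Collect_eq]
            open_Times continuous_intros) (auto simp: tpt_def intro!: continuous_intros)
    moreover have "{\<tau> \<in> UHP. (th 0 u \<tau>, th 0 (u - tt \<tau>) \<tau>) \<in> (- {0}) \<times> (- {0})} =
        {\<tau>. \<tau> \<in> UHP \<and> th 0 u \<tau> \<noteq> 0 \<and> th 0 (u - tt \<tau>) \<tau> \<noteq> 0}" by auto
    ultimately show ?thesis by simp
  qed
  have "((\<lambda>\<tau>. M11 \<tau> + al / kap * r1 u \<tau> + om u \<tau> * e0 u \<tau>) has_field_derivative Gtt u \<tau>) (at \<tau>)"
    by (rule has_field_derivative_transform_within_open[OF
        Gt_chain[OF DERIV_const[of u] DERIV_ident assms, simplified] op])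
       (use assms row0 in auto)
  moreover have "((\<lambda>\<tau>. M11 \<tau> + al / kap * r1 u \<tau> + om u \<tau> * e0 u \<tau>) has_field_derivative
      M11d \<tau> + al / kap * (q2'' u \<tau> / (2 * kap)) + (Gtu u \<tau> * e0 u \<tau> + De0 u \<tau> * om u \<tau>)) (at \<tau>)"
    by (rule DERIV_cong, (rule DERIV_cdivide derivative_intros M11_deriv[OF assms(1)] r1_chain[OF DERIV_const DERIV_ident assms(1,2)]
      om_chain[OF DERIV_const DERIV_ident assms] e0_deriv_tau[OF assms(1,2)])+) (simp add: mult_ac)
  ultimately have G: "Gtt u \<tau> = M11d \<tau> + al / kap * (q2'' u \<tau> / (2 * kap)) + (Gtu u \<tau> * e0 u \<tau> + De0 u \<tau> * om u \<tau>)"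
    by (rule DERIV_unique)
  have m22: "M22 \<tau> = p0 - M11 \<tau>" using trace_M[of \<tau>] by (simp add: algebra_simps)
  have om0: "om u \<tau> * e0 u \<tau> = Gt u \<tau> - M11 \<tau> - al / kap * r1 u \<tau>" using row0[OF assms] by simp
  have om1: "om u \<tau> * e1 u \<tau> = r1 u \<tau> * Gt u \<tau> - M21 \<tau> - M22 \<tau> * r1 u \<tau>" using row1[OF assms] by simp
  have omR: "om u \<tau> * Rr u \<tau> = (om u \<tau> * e0 u \<tau>) * (Gt u \<tau> - M22 \<tau>) + om u \<tau> * De0 u \<tau> + M12 * (om u \<tau> * e1 u \<tau>)"
    unfolding Rr_def by (simp add: algebra_simps)
  show ?thesis
    by (rule DERIV_cong[OF Rr_deriv_u[OF assms]])
       (simp only: omR om0 om1, simp add: G phi_def m22 M12_def field_simps power2_eq_square)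
qed

end

section \<open>Branches of the multivalued function T\<close>

text \<open>Near \<open>x\<close> the continuous logarithm coincides with
  \<open>L x + Ln (f y / f x)\<close>: by continuity \<open>L y - L x\<close> has imaginary part
  below \<pi> in modulus there, so the principal branch recovers it. Hence \<open>L\<close> inherits
  differentiability from \<open>f\<close>.\<close>

lemma log_has_derivative:
  fixes f L :: "'a::real_normed_vector \<Rightarrow> complex"
  assumes L: "continuous_on S L" "\<And>y. y \<in> S \<Longrightarrow> exp (L y) = f y"
    and f: "(f has_derivative f') (at x within S)" and x: "x \<in> S"
  shows "(L has_derivative (\<lambda>h. f' h / f x)) (at x within S)"
proof -
  have fx: "f x \<noteq> 0" using L(2)[OF x] exp_not_eq_zero by metis
  have lim: "(L \<longlongrightarrow> L x) (at x within S)" using L(1) x by (auto simp: continuous_on_def)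
  have "((\<lambda>y. L x + Ln (f y / f x)) has_derivative (\<lambda>h. f' h / f x)) (at x within S)"
  proof -
    have "((\<lambda>y. f y / f x) has_derivative (\<lambda>h. f' h / f x)) (at x within S)"
      using f fx by (auto intro!: derivative_eq_intros simp: field_simps)
    moreover have "(Ln has_derivative (*) (inverse (f x / f x))) (at (f x / f x))"
      using has_field_derivative_Ln[of "f x / f x"] fx by (simp add: has_field_derivative_def)
    ultimately have "((\<lambda>y. Ln (f y / f x)) has_derivative (\<lambda>h. inverse (f x / f x) * (f' h / f x))) (at x within S)"
      by (rule has_derivative_compose)
    then show ?thesis using fx by (auto intro!: derivative_eq_intros)
  qed
  moreover have "\<forall>\<^sub>F y in at x within S. L x + Ln (f y / f x) = L y"
  proof -
    have "\<forall>\<^sub>F y in at x within S. dist (L y) (L x) < pi" using tendstoD[OF lim, of pi] by simp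
    moreover have "\<forall>\<^sub>F y in at x within S. y \<in> S" by (simp add: eventually_at_filter)
    ultimately show ?thesis
    proof eventually_elim
      case (elim y)
      have "\<bar>Im (L y - L x)\<bar> < pi"
        using elim(1) abs_Im_le_cmod[of "L y - L x"] by (simp add: dist_norm)
      then have "Ln (exp (L y - L x)) = L y - L x" by (intro Ln_exp) auto
      then show ?case using L(2)[OF x] L(2)[OF elim(2)] by (simp add: exp_diff)
    qed
  qed
  ultimately show ?thesis
    by (rule has_derivative_transform_eventually) (use fx x in auto)
qed

lemma connected_integer_valued:
  fixes f :: "'a::topological_space \<Rightarrow> complex"
  assumes "connected S" "continuous_on S f" "\<And>x. x \<in> S \<Longrightarrow> f x \<in> \<int>"
  obtains n :: int where "\<And>x. x \<in> S \<Longrightarrow> f x = of_int n"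
proof -
  have "f constant_on S"
  proof (rule continuous_discrete_range_constant[OF assms(1,2)])
    fix x assume "x \<in> S"
    have "1 \<le> norm (f y - f x)" if "y \<in> S" "f y \<noteq> f x" for y
    proof -
      have "f x \<in> \<int>" "f y \<in> \<int>" using assms(3) \<open>x \<in> S\<close> that(1) by auto
      then obtain m n where mn: "f x = of_int m" "f y = of_int n" by (elim Ints_cases)
      then have "norm (f y - f x) = \<bar>of_int (n - m)\<bar>" by (metis norm_of_int of_int_diff)
      moreover have "n - m \<noteq> 0" using mn that(2) by auto
      ultimately show ?thesis by linarith
    qed
    then show "\<exists>e>0. \<forall>y. y \<in> S \<and> f y \<noteq> f x \<longrightarrow> e \<le> norm (f y - f x)" by (intro exI[of _ 1]) auto
  qed
  then obtain c where c: "\<And>x. x \<in> S \<Longrightarrow> f x = c" by (auto simp: constant_on_def)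
  show ?thesis
  proof (cases "S = {}")
    case False
    then obtain x where "x \<in> S" by blast
    then show ?thesis using c assms(3)[of x] that by (metis Ints_cases)
  qed (use that in auto)
qed

lemma exp_eq_imp_kap:
  assumes "exp a = exp b"
  shows "(a - b) / kap \<in> \<int>"
proof -
  obtain n :: int where "a = b + of_int (2 * n) * of_real pi * \<i>"
    using assms by (auto simp: exp_eq)
  then have "a - b = of_int n * kap" by (simp add: kap_def)
  then have "(a - b) / kap = of_int n" by simp
  then show ?thesis by simp
qed

lemma th_pair_has_derivative:
  fixes U V :: "'a::real_normed_vector \<Rightarrow> complex"
  assumes "(U has_derivative U') (at s within S)" "(V has_derivative V') (at s within S)" "Im (V s) > 0"
  shows "((\<lambda>s. th n (U s) (V s)) has_derivative
     (\<lambda>h. th (Suc n) (U s) (V s) * U' h + th (n + 2) (U s) (V s) / (2 * kap) * V' h)) (at s within S)"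
  using has_derivative_compose[OF has_derivative_Pair[OF assms(1,2)] th_has_derivative[OF assms(3), of n "U s"]]
  by simp

context params
begin

lemma branchE:
  assumes "Tbr X p B"
  obtains L L' where "continuous_on X L" "continuous_on X L'"
    "\<And>x. x \<in> X \<Longrightarrow> exp (L x) = th 0 (snd (p x)) (fst (p x))"
    "\<And>x. x \<in> X \<Longrightarrow> exp (L' x) = th 0 (snd (p x) - tt (fst (p x))) (fst (p x))"
    "\<And>x. x \<in> X \<Longrightarrow> B x = exp (be * snd (p x) + al * L x - al * L' x)"
  using assms unfolding is_T_branch_def jtheta_eq_th kap_def by (force simp: case_prod_unfold Let_def)

lemma branchI:
  assumes "continuous_on X L" "continuous_on X L'"
    "\<And>x. x \<in> X \<Longrightarrow> exp (L x) = th 0 (snd (p x)) (fst (p x))"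
    "\<And>x. x \<in> X \<Longrightarrow> exp (L' x) = th 0 (snd (p x) - tt (fst (p x))) (fst (p x))"
    "\<And>x. x \<in> X \<Longrightarrow> B x = exp (be * snd (p x) + al * L x - al * L' x)"
  shows "Tbr X p B"
  unfolding is_T_branch_def jtheta_eq_th
  by (rule exI[of _ L], rule exI[of _ L']) (use assms in \<open>auto simp: kap_def case_prod_unfold Let_def\<close>)

lemma branch_comp:
  assumes "Tbr X p B" "continuous_on Y f" "f ` Y \<subseteq> X"
  shows "Tbr Y (\<lambda>y. p (f y)) (\<lambda>y. B (f y))"
proof -
  obtain L L' where L: "continuous_on X L" "continuous_on X L'"
    "\<And>x. x \<in> X \<Longrightarrow> exp (L x) = th 0 (snd (p x)) (fst (p x))"
    "\<And>x. x \<in> X \<Longrightarrow> exp (L' x) = th 0 (snd (p x) - tt (fst (p x))) (fst (p x))"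
    "\<And>x. x \<in> X \<Longrightarrow> B x = exp (be * snd (p x) + al * L x - al * L' x)"
    using branchE[OF assms(1)] by metis
  have f: "f y \<in> X" if "y \<in> Y" for y using assms(3) that by auto
  show ?thesis
    by (rule branchI[of Y "\<lambda>y. L (f y)" "\<lambda>y. L' (f y)"])
       (simp_all add: L(3-5) f continuous_on_compose2[OF L(1) assms(2,3)] continuous_on_compose2[OF L(2) assms(2,3)])
qed

lemma branch_cong:
  assumes "Tbr X p B" "\<And>x. x \<in> X \<Longrightarrow> p x = p' x" "\<And>x. x \<in> X \<Longrightarrow> B x = B' x"
  shows "Tbr X p' B'"
proof -
  obtain L L' where L: "continuous_on X L" "continuous_on X L'"
    "\<And>x. x \<in> X \<Longrightarrow> exp (L x) = th 0 (snd (p x)) (fst (p x))"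
    "\<And>x. x \<in> X \<Longrightarrow> exp (L' x) = th 0 (snd (p x) - tt (fst (p x))) (fst (p x))"
    "\<And>x. x \<in> X \<Longrightarrow> B x = exp (be * snd (p x) + al * L x - al * L' x)"
    using branchE[OF assms(1)] by metis
  show ?thesis
    by (rule branchI[OF L(1,2)]) (simp_all add: L(3-5) assms(2,3)[symmetric])
qed

lemma branch_nonzero: "Tbr X p B \<Longrightarrow> x \<in> X \<Longrightarrow> B x \<noteq> 0"
  by (erule branchE) auto

lemma branch_th_nonzero:
  assumes "Tbr X p B" "x \<in> X"
  shows "th 0 (snd (p x)) (fst (p x)) \<noteq> 0" "th 0 (snd (p x) - tt (fst (p x))) (fst (p x)) \<noteq> 0"
  using branchE[OF assms(1)] assms(2) exp_not_eq_zero by metis+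

lemma branch_continuous:
  assumes "Tbr X p B" "continuous_on X p"
  shows "continuous_on X B"
proof -
  obtain L L' where L: "continuous_on X L" "continuous_on X L'"
    "\<And>x. x \<in> X \<Longrightarrow> B x = exp (be * snd (p x) + al * L x - al * L' x)"
    using branchE[OF assms(1)] by metis
  have "continuous_on X (\<lambda>x. exp (be * snd (p x) + al * L x - al * L' x))"
    by (intro continuous_intros L assms(2))
  then show ?thesis using L(3) by simp
qed

text \<open>The modulus of \<open>T\<close> does not depend on the branch, because all exponents are
  real except in \<open>exp (be * u)\<close>. Every estimate at a puncture rests on this.\<close>

lemma branch_norm:
  assumes "Tbr X p B" "x \<in> X"
  shows "norm (B x) = exp (Re (be * snd (p x))) * norm (th 0 (snd (p x)) (fst (p x))) powr \<alpha>
     * norm (th 0 (snd (p x) - tt (fst (p x))) (fst (p x))) powr (- \<alpha>)"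
proof -
  obtain L L' where L: "exp (L x) = th 0 (snd (p x)) (fst (p x))"
    "exp (L' x) = th 0 (snd (p x) - tt (fst (p x))) (fst (p x))"
    "B x = exp (be * snd (p x) + al * L x - al * L' x)"
    using branchE[OF assms(1)] assms(2) by metis
  show ?thesis
    unfolding L(1,2)[symmetric] L(3) norm_exp_eq_Re by (simp add: powr_def exp_add exp_diff exp_minus field_simps)
qed

text \<open>On a connected space the logarithms behind two branches differ by constant integer
  multiples of \<open>kap\<close>.\<close>

lemma branch_unique:
  assumes "connected X" "Tbr X p B1" "Tbr X p B2"
  obtains c where "c \<noteq> 0" "\<And>x. x \<in> X \<Longrightarrow> B2 x = c * B1 x"
proof -
  obtain L1 L1' where L1: "continuous_on X L1" "continuous_on X L1'"
    "\<And>x. x \<in> X \<Longrightarrow> exp (L1 x) = th 0 (snd (p x)) (fst (p x))"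
    "\<And>x. x \<in> X \<Longrightarrow> exp (L1' x) = th 0 (snd (p x) - tt (fst (p x))) (fst (p x))"
    "\<And>x. x \<in> X \<Longrightarrow> B1 x = exp (be * snd (p x) + al * L1 x - al * L1' x)"
    using branchE[OF assms(2)] by metis
  obtain L2 L2' where L2: "continuous_on X L2" "continuous_on X L2'"
    "\<And>x. x \<in> X \<Longrightarrow> exp (L2 x) = th 0 (snd (p x)) (fst (p x))"
    "\<And>x. x \<in> X \<Longrightarrow> exp (L2' x) = th 0 (snd (p x) - tt (fst (p x))) (fst (p x))"
    "\<And>x. x \<in> X \<Longrightarrow> B2 x = exp (be * snd (p x) + al * L2 x - al * L2' x)"
    using branchE[OF assms(3)] by metis
  obtain m where m: "\<And>x. x \<in> X \<Longrightarrow> (L2 x - L1 x) / kap = of_int m"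
    by (rule connected_integer_valued[OF assms(1), of "\<lambda>x. (L2 x - L1 x) / kap"])
       (use L1 L2 exp_eq_imp_kap in \<open>auto intro!: continuous_intros\<close>)
  obtain n where n: "\<And>x. x \<in> X \<Longrightarrow> (L2' x - L1' x) / kap = of_int n"
    by (rule connected_integer_valued[OF assms(1), of "\<lambda>x. (L2' x - L1' x) / kap"])
       (use L1 L2 exp_eq_imp_kap in \<open>auto intro!: continuous_intros\<close>)
  show ?thesis
  proof (rule that)
    show "exp (al * (kap * of_int m) - al * (kap * of_int n)) \<noteq> 0" by simp
    fix x assume x: "x \<in> X"
    have "L2 x = L1 x + kap * of_int m" "L2' x = L1' x + kap * of_int n"
      using m[OF x] n[OF x] by (auto simp: field_simps)
    then show "B2 x = exp (al * (kap * of_int m) - al * (kap * of_int n)) * B1 x"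
      unfolding L1(5)[OF x] L2(5)[OF x] exp_add [symmetric] by (simp add: algebra_simps)
  qed
qed

text \<open>The branch of \<open>T\<close> at \<open>u + m + n \<tau>\<close> is \<open>exp (2 \<pi> i (a\<^sub>0 m + a\<^sub>\<infinity> n))\<close> times one at \<open>u\<close>.\<close>

lemma branch_shift:
  assumes B: "Tbr X p B" and p: "continuous_on X p" and l: "l \<in> gauss_lattice"
    and p': "\<And>x. x \<in> X \<Longrightarrow> p' x = (fst (p x), snd (p x) + mark (fst (p x)) l)"
  shows "\<exists>c. norm c = 1 \<and> Tbr X p' (\<lambda>x. c * B x)"
proof -
  obtain m n where mn: "l = Complex (of_int m) (of_int n)" using l by (auto simp: gauss_lattice_iff)
  define f where "f \<tau> u = kap * ((of_int m + of_int n) / 2 - of_int n ^ 2 * \<tau> / 2 - of_int n * u)" for \<tau> u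
  obtain L L' where L: "continuous_on X L" "continuous_on X L'"
    "\<And>x. x \<in> X \<Longrightarrow> exp (L x) = th 0 (snd (p x)) (fst (p x))"
    "\<And>x. x \<in> X \<Longrightarrow> exp (L' x) = th 0 (snd (p x) - tt (fst (p x))) (fst (p x))"
    "\<And>x. x \<in> X \<Longrightarrow> B x = exp (be * snd (p x) + al * L x - al * L' x)"
    using branchE[OF B] by metis
  define c where "c = exp (\<i> * of_real (2 * pi * (a0 * of_int m + ai * of_int n)))"
  have c: "c = exp (kap * (of_real a0 * of_int m + of_real ai * of_int n))"
    by (simp add: c_def kap_def algebra_simps)
  have "Tbr X p' (\<lambda>x. c * B x)"
  proof (rule branchI)
    show "continuous_on X (\<lambda>x. L x + f (fst (p x)) (snd (p x)))"
      "continuous_on X (\<lambda>x. L' x + f (fst (p x)) (snd (p x) - tt (fst (p x))))"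
      unfolding f_def tpt_def by (intro continuous_intros L p; simp)+
    fix x assume x: "x \<in> X"
    obtain \<tau> u where tu: "p x = (\<tau>, u)" by fastforce
    have p'x: "fst (p' x) = \<tau>" "snd (p' x) = u + mark \<tau> l" using p'[OF x] tu by auto
    show "exp (L x + f (fst (p x)) (snd (p x))) = th 0 (snd (p' x)) (fst (p' x))"
      unfolding p'x mn th0_shift_lattice by (simp add: exp_add L(3)[OF x] tu f_def)
    have e: "u + mark \<tau> l - tt \<tau> = (u - tt \<tau>) + mark \<tau> l" by simp
    show "exp (L' x + f (fst (p x)) (snd (p x) - tt (fst (p x)))) = th 0 (snd (p' x) - tt (fst (p' x))) (fst (p' x))"
      unfolding p'x e unfolding mn th0_shift_lattice by (simp add: exp_add L(4)[OF x] tu f_def)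
    \<comment> \<open>This is where the choice of \<open>t\<close> matters: the multipliers of the
      theta quotient and of \<open>exp (be * u)\<close> cancel up to a constant of modulus 1 that
      does not depend on \<tau>.\<close>
    have "al * tt \<tau> = of_real a0 * \<tau> - of_real ai" by (simp add: tpt_def)
    moreover have "f \<tau> u - f \<tau> (u - tt \<tau>) = - kap * of_int n * tt \<tau>" by (simp add: f_def algebra_simps)
    ultimately have E: "al * f \<tau> u - al * f \<tau> (u - tt \<tau>) = - kap * of_int n * (of_real a0 * \<tau> - of_real ai)"
      by (metis (no_types, opaque_lifting) mult.left_commute right_diff_distrib')
    have "be * mark \<tau> l + (al * f \<tau> u - al * f \<tau> (u - tt \<tau>)) = kap * (of_real a0 * of_int m + of_real ai * of_int n)"
      unfolding E mn mark_Complex by (simp add: algebra_simps)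
    then have "be * (u + mark \<tau> l) + al * (L x + f \<tau> u) - al * (L' x + f \<tau> (u - tt \<tau>)) =
       kap * (of_real a0 * of_int m + of_real ai * of_int n) + (be * u + al * L x - al * L' x)"
      by (simp add: algebra_simps)
    then show "c * B x = exp (be * snd (p' x) + al * (L x + f (fst (p x)) (snd (p x)))
        - al * (L' x + f (fst (p x)) (snd (p x) - tt (fst (p x)))))"
      unfolding p'x tu fst_conv snd_conv L(5)[OF x] c by (simp add: exp_add)
  qed
  moreover have "norm c = 1" unfolding c_def by simp
  ultimately show ?thesis by blast
qed

lemma branch_exists:
  fixes X :: "'x::real_normed_vector set"
  assumes "contractible X" "continuous_on X p" "\<And>x. x \<in> X \<Longrightarrow> Im (fst (p x)) > 0"
    "\<And>x. x \<in> X \<Longrightarrow> snd (p x) \<notin> mark (fst (p x)) ` PP"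
  obtains B where "Tbr X p B"
proof -
  have nz: "th 0 (snd (p x)) (fst (p x)) \<noteq> 0" "th 0 (snd (p x) - tt (fst (p x))) (fst (p x)) \<noteq> 0" if "x \<in> X" for x
    using not_puncture[OF assms(3,4)] that by auto
  have c: "continuous_on X (\<lambda>x. th 0 (snd (p x)) (fst (p x)))"
    "continuous_on X (\<lambda>x. th 0 (snd (p x) - tt (fst (p x))) (fst (p x)))"
    unfolding tpt_def by (intro continuous_intros assms; simp)+
  obtain L where "continuous_on X L" "\<And>x. x \<in> X \<Longrightarrow> th 0 (snd (p x)) (fst (p x)) = exp (L x)"
    using continuous_logarithm_on_contractible[OF c(1) assms(1)] nz by blast
  moreover obtain L' where "continuous_on X L'" "\<And>x. x \<in> X \<Longrightarrow> th 0 (snd (p x) - tt (fst (p x))) (fst (p x)) = exp (L' x)"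
    using continuous_logarithm_on_contractible[OF c(2) assms(1)] nz by blast
  ultimately show ?thesis
    using that[OF branchI[of X L L' p "\<lambda>x. exp (be * snd (p x) + al * L x - al * L' x)"]] by metis
qed

text \<open>In short \<open>dT = T (om du + Gt d\<tau>)\<close>, pulled back to an arbitrary
  parameter space. The single formula then serves for motion along a path, in \<tau>, and in
  \<open>u\<close>.\<close>

lemma branch_has_derivative:
  fixes S :: "'s::real_normed_vector set"
  assumes B: "Tbr S p B" and s: "s \<in> S"
    and V: "((\<lambda>x. fst (p x)) has_derivative V') (at s within S)"
    and U: "((\<lambda>x. snd (p x)) has_derivative U') (at s within S)" and im: "Im (fst (p s)) > 0"
  shows "(B has_derivative (\<lambda>h. B s * (om (snd (p s)) (fst (p s)) * U' h + Gt (snd (p s)) (fst (p s)) * V' h))) (at s within S)"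
proof -
  obtain L L' where L: "continuous_on S L" "continuous_on S L'"
    "\<And>x. x \<in> S \<Longrightarrow> exp (L x) = th 0 (snd (p x)) (fst (p x))"
    "\<And>x. x \<in> S \<Longrightarrow> exp (L' x) = th 0 (snd (p x) - tt (fst (p x))) (fst (p x))"
    "\<And>x. x \<in> S \<Longrightarrow> B x = exp (be * snd (p x) + al * L x - al * L' x)"
    using branchE[OF B] by metis
  define \<tau> u where "\<tau> = fst (p s)" "u = snd (p s)"
  have nz: "th 0 u \<tau> \<noteq> 0" "th 0 (u - tt \<tau>) \<tau> \<noteq> 0"
    using branch_th_nonzero[OF B s] by (simp_all add: \<tau>_u_def)
  have eq: "(th (Suc 0) u \<tau> * a + th (0 + 2) u \<tau> / (2 * kap) * b) / th 0 u \<tau> = qq 1 u \<tau> * a + qq 2 u \<tau> / (2 * kap) * b"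
    if "th 0 u \<tau> \<noteq> 0" for u \<tau> a b :: complex
  proof -
    have "(0::nat) + 2 = 2" "Suc 0 = 1" by simp_all
    then show ?thesis using that by (simp only: qq_def) (simp add: field_simps)
  qed
  have U2: "((\<lambda>x. snd (p x) - tt (fst (p x))) has_derivative (\<lambda>h. U' h - of_real a0 / al * V' h)) (at s within S)"
  proof -
    have "snd (p x) - tt (fst (p x)) = snd (p x) - (of_real a0 / al * fst (p x) - of_real ai / al)" for x
      by (simp add: tpt_def diff_divide_distrib)
    then show ?thesis
      by (simp only:) (rule has_derivative_eq_rhs, (rule has_derivative_diff has_derivative_mult_right U V has_derivative_const)+, simp)
  qed
  have dL: "(L has_derivative (\<lambda>h. qq 1 u \<tau> * U' h + qq 2 u \<tau> / (2 * kap) * V' h)) (at s within S)"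
    using log_has_derivative[OF L(1,3) th_pair_has_derivative[OF U V im, of 0] s]
    by (rule has_derivative_eq_rhs)
       (assumption, rule ext, unfold \<tau>_u_def [symmetric], rule eq, rule nz)
  have dL': "(L' has_derivative (\<lambda>h. qq 1 (u - tt \<tau>) \<tau> * (U' h - of_real a0 / al * V' h) + qq 2 (u - tt \<tau>) \<tau> / (2 * kap) * V' h)) (at s within S)"
    using log_has_derivative[OF L(2,4) th_pair_has_derivative[OF U2 V im, of 0] s]
    by (rule has_derivative_eq_rhs)
       (assumption, rule ext, unfold \<tau>_u_def [symmetric], rule eq, rule nz)
  have "((\<lambda>x. exp (be * snd (p x) + al * L x - al * L' x)) has_derivative
      (\<lambda>h. B s * (om u \<tau> * U' h + Gt u \<tau> * V' h))) (at s within S)"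
  proof (rule has_derivative_eq_rhs, rule has_derivative_compose[OF _ DERIV_exp[unfolded has_field_derivative_def]])
    show "((\<lambda>x. be * snd (p x) + al * L x - al * L' x) has_derivative
      (\<lambda>h. be * U' h + al * (qq 1 u \<tau> * U' h + qq 2 u \<tau> / (2 * kap) * V' h)
        - al * (qq 1 (u - tt \<tau>) \<tau> * (U' h - of_real a0 / al * V' h) + qq 2 (u - tt \<tau>) \<tau> / (2 * kap) * V' h))) (at s within S)"
      by (intro has_derivative_diff has_derivative_add has_derivative_mult_right U dL dL')
  qed (simp add: fun_eq_iff L(5)[OF s] om_def Gt_def field_simps)
  then show ?thesis
    unfolding \<tau>_u_def by (rule has_derivative_transform_within[OF _ zero_less_one s]) (simp add: L(5))
qed

end

section \<open>Differentiating twisted integrals in the modulus\<close>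

lemma has_vector_derivative_mark:
  assumes "(g has_vector_derivative g') (at x within S)"
  shows "((\<lambda>x. mark \<tau> (g x)) has_vector_derivative mark \<tau> g') (at x within S)"
  using bounded_linear.has_vector_derivative[OF linear_conv_bounded_linear[THEN iffD1, OF linear_mark] assms] .

lemma mark_deriv_tau: "((\<lambda>\<tau>. mark \<tau> z) has_field_derivative of_real (Im z)) (at \<tau> within S)"
  unfolding mark_def by (auto intro!: derivative_eq_intros)

context params
begin

text \<open>The pairs are \<open>(u, \<tau>)\<close>, in the order of the arguments of
  \<open>qq\<close> and \<open>om\<close>, whereas branches are parametrised by pairs
  \<open>(\<tau>, u)\<close>.\<close>

definition dom :: "(complex \<times> complex) set" where
  "dom = {(u, \<tau>). Im \<tau> > 0 \<and> u \<notin> mark \<tau> ` PP}"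

lemma mark_notin: "Im \<tau> > 0 \<Longrightarrow> mark \<tau> z \<in> mark \<tau> ` PP \<longleftrightarrow> z \<in> PP"
  using inj_mark[of \<tau>] by (auto simp: inj_def)

lemma mark_image_PP: "Im \<tau> > 0 \<Longrightarrow> z \<notin> PP \<Longrightarrow> mark \<tau> z \<notin> mark \<tau> ` PP"
  using mark_notin by blast

lemma mark_in_dom: "Im \<tau> > 0 \<Longrightarrow> z \<notin> PP \<Longrightarrow> (mark \<tau> z, \<tau>) \<in> dom"
  unfolding dom_def using mark_notin by blast

lemma branch_path_deriv:
  fixes S :: "real set"
  assumes "Tbr S (\<lambda>x. (\<tau>, mark \<tau> (g x))) B" "x \<in> S" "Im \<tau> > 0"
    and "(g has_vector_derivative g') (at x within S)"
  shows "(B has_vector_derivative B x * om (mark \<tau> (g x)) \<tau> * mark \<tau> g') (at x within S)"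
  using branch_has_derivative[OF assms(1,2), of "\<lambda>_. 0" "\<lambda>h. h *\<^sub>R mark \<tau> g'"] has_vector_derivative_mark[OF assms(4), of \<tau>] assms(3)
  by (simp add: has_vector_derivative_def mult.assoc)

lemma branch_tau_deriv:
  assumes "Tbr UHP (\<lambda>\<tau>. (\<tau>, mark \<tau> z)) B" "Im \<tau> > 0"
  shows "(B has_field_derivative B \<tau> * (om (mark \<tau> z) \<tau> * of_real (Im z) + Gt (mark \<tau> z) \<tau>)) (at \<tau>)"
proof -
  have "(B has_derivative (\<lambda>h. B \<tau> * (om (mark \<tau> z) \<tau> * (of_real (Im z) * h) + Gt (mark \<tau> z) \<tau> * h))) (at \<tau> within UHP)"
    using branch_has_derivative[OF assms(1), of \<tau> "\<lambda>h. h" "\<lambda>h. of_real (Im z) * h"] assms(2) mark_deriv_tau[of z \<tau> UHP]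
    by (simp add: has_field_derivative_def)
  then show ?thesis
    using assms(2) at_within_open[OF _ open_UHP, of \<tau>]
    by (auto simp: has_field_derivative_def algebra_simps elim!: has_derivative_eq_rhs)
qed

lemma branch_u_deriv:
  assumes "Tbr S (\<lambda>u. (\<tau>, u)) B" "u \<in> S" "Im \<tau> > 0"
  shows "(B has_field_derivative B u * om u \<tau>) (at u within S)"
  using branch_has_derivative[OF assms(1,2), of "\<lambda>_. 0" "\<lambda>h. h"] assms(3)
  by (auto simp: has_field_derivative_def mult.assoc elim!: has_derivative_eq_rhs)

lemma om_continuous: "continuous_on dom (\<lambda>p. om (fst p) (snd p))"
  unfolding om_def tpt_def
  by (intro continuous_intros) (auto simp: dom_def not_puncture not_puncture(2)[unfolded tpt_def])

lemma Gt_continuous: "continuous_on dom (\<lambda>p. Gt (fst p) (snd p))"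
  unfolding Gt_def tpt_def
  by (intro continuous_intros) (auto simp: dom_def not_puncture not_puncture(2)[unfolded tpt_def])

text \<open>\<open>H\<close> is a function of \<open>(u, \<tau>)\<close> with partial derivatives \<open>Hu\<close>, \<open>Ht\<close>; the points \<open>mark \<tau> z\<close> move with
  \<open>\<tau>\<close>, whence the term with \<open>Im z\<close>. By \<open>Gt = \<partial>\<^sub>\<tau> log T\<close>, \<open>\<partial>\<^sub>\<tau> (T H) = T \<cdot> TH H Ht\<close>.\<close>

definition nice :: "(complex \<Rightarrow> complex \<Rightarrow> complex) \<Rightarrow> (complex \<Rightarrow> complex \<Rightarrow> complex) \<Rightarrow> (complex \<Rightarrow> complex \<Rightarrow> complex) \<Rightarrow> bool" where
  "nice H Hu Ht \<longleftrightarrow>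
    (\<forall>\<tau> u. Im \<tau> > 0 \<longrightarrow> u \<notin> mark \<tau> ` PP \<longrightarrow> ((\<lambda>u. H u \<tau>) has_field_derivative Hu u \<tau>) (at u)) \<and>
    (\<forall>\<tau> z. Im \<tau> > 0 \<longrightarrow> z \<notin> PP \<longrightarrow>
       ((\<lambda>\<tau>. H (mark \<tau> z) \<tau>) has_field_derivative (Hu (mark \<tau> z) \<tau> * of_real (Im z) + Ht (mark \<tau> z) \<tau>)) (at \<tau>)) \<and>
    continuous_on dom (\<lambda>p. H (fst p) (snd p)) \<and> continuous_on dom (\<lambda>p. Hu (fst p) (snd p)) \<and>
    continuous_on dom (\<lambda>p. Ht (fst p) (snd p)) \<and>
    (\<forall>\<tau>. Im \<tau> > 0 \<longrightarrow> (\<lambda>u. Ht u \<tau>) holomorphic_on - mark \<tau> ` PP)"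

lemma nice_hol:
  assumes "nice H Hu Ht" "Im \<tau> > 0"
  shows "(\<lambda>u. H u \<tau>) holomorphic_on - mark \<tau> ` PP"
  using assms unfolding nice_def holomorphic_on_def field_differentiable_def
  by (metis ComplD has_field_derivative_at_within)

lemma Gt_hol:
  assumes "Im \<tau> > 0"
  shows "(\<lambda>u. Gt u \<tau>) holomorphic_on - mark \<tau> ` PP"
  unfolding holomorphic_on_def field_differentiable_def
proof (intro ballI exI)
  fix u assume "u \<in> - mark \<tau> ` PP"
  then have nz: "th 0 u \<tau> \<noteq> 0" "th 0 (u - tt \<tau>) \<tau> \<noteq> 0" using not_puncture[OF assms] by auto
  show "((\<lambda>u. Gt u \<tau>) has_field_derivative Gtu u \<tau> * 1 + Gtt u \<tau> * 0) (at u within - mark \<tau> ` PP)"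
    by (rule Gt_chain[OF DERIV_ident DERIV_const assms nz])
qed

definition TH :: "(complex \<Rightarrow> complex \<Rightarrow> complex) \<Rightarrow> (complex \<Rightarrow> complex \<Rightarrow> complex) \<Rightarrow> complex \<Rightarrow> complex \<Rightarrow> complex" where
  "TH H Ht u \<tau> = Ht u \<tau> + H u \<tau> * Gt u \<tau>"

lemma TH_hol: "nice H Hu Ht \<Longrightarrow> Im \<tau> > 0 \<Longrightarrow> (\<lambda>u. TH H Ht u \<tau>) holomorphic_on - mark \<tau> ` PP"
  unfolding TH_def using nice_hol[of H Hu Ht \<tau>] Gt_hol[of \<tau>]
  by (intro holomorphic_intros) (auto simp: nice_def)

abbreviation pm :: "complex \<times> complex \<Rightarrow> complex \<times> complex" where
  "pm \<equiv> (\<lambda>(\<tau>, z). (\<tau>, mark \<tau> z))"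

text \<open>A primitive of \<open>T h\<close> on a disc without punctures, written as an integral
  over the segment from \<open>c\<close> to \<open>z\<close> in real coordinates. The segment is
  smooth, so differentiation under the integral sign is available for it.\<close>

definition QQ :: "(complex \<times> complex \<Rightarrow> complex) \<Rightarrow> complex \<Rightarrow> (complex \<Rightarrow> complex \<Rightarrow> complex) \<Rightarrow> complex \<Rightarrow> complex \<Rightarrow> complex" where
  "QQ B c h \<tau> z = integral {0..1} (\<lambda>y. B (\<tau>, c + y *\<^sub>R (z - c)) * h (mark \<tau> (c + y *\<^sub>R (z - c))) \<tau> * mark \<tau> (z - c))"

context
  fixes D B c
  assumes D: "convex D" "open D" "D \<inter> PP = {}" and c: "c \<in> D"
    and B: "Tbr (UHP \<times> D) pm B"
begin

lemma seg_in: "z \<in> D \<Longrightarrow> 0 \<le> y \<Longrightarrow> y \<le> 1 \<Longrightarrow> c + y *\<^sub>R (z - c) \<in> D"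
  using convexD[OF D(1) c, of z "1 - y" y] by (simp add: algebra_simps)

lemma B_cont: "continuous_on (UHP \<times> D) B"
  by (rule branch_continuous[OF B]) (auto simp: case_prod_unfold intro!: continuous_intros)

lemma seg_cont:
  assumes "z \<in> D" "continuous_on dom (\<lambda>p. h (fst p) (snd p))"
  shows "continuous_on (UHP \<times> {0..1}) (\<lambda>(\<tau>, y). h (mark \<tau> (c + y *\<^sub>R (z - c))) \<tau>)"
proof -
  have "continuous_on (UHP \<times> {0..1}) (\<lambda>p. (\<lambda>p. h (fst p) (snd p)) (mark (fst p) (c + snd p *\<^sub>R (z - c)), fst p))"
  proof (rule continuous_on_compose2[OF assms(2)])
    show "(\<lambda>p. (mark (fst p) (c + snd p *\<^sub>R (z - c)), fst p)) ` (UHP \<times> {0..1}) \<subseteq> dom"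
      by (intro image_subsetI mark_in_dom) (use seg_in[OF assms(1)] D(3) in \<open>auto simp: disjoint_iff\<close>)
  qed (intro continuous_intros)
  then show ?thesis by (simp add: case_prod_unfold)
qed

lemma seg_cont_B:
  assumes "z \<in> D"
  shows "continuous_on (UHP \<times> {0..1}) (\<lambda>(\<tau>, y). B (\<tau>, c + y *\<^sub>R (z - c)))"
proof -
  have "continuous_on (UHP \<times> {0..1}) (\<lambda>p. B (fst p, c + snd p *\<^sub>R (z - c)))"
    by (rule continuous_on_compose2[OF B_cont])
       (use seg_in[OF assms(1)] in \<open>auto intro!: continuous_intros\<close>)
  then show ?thesis by (simp add: case_prod_unfold)
qed

text \<open>The derivative of the integrand in \<tau> splits into \<open>f1 + f2\<close>. Here
  \<open>f1\<close> is the derivative at fixed \<open>u\<close>, while \<open>f2\<close> comes from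
  the motion of the points and is the total derivative of \<open>T H Im w\<close> along the segment,
  hence yields only end point terms.\<close>

lemma QQ_tau:
  assumes z: "z \<in> D" and \<tau>: "Im \<tau> > 0" and H: "nice H Hu Ht"
  shows "((\<lambda>\<tau>. QQ B c H \<tau> z) has_field_derivative
     (QQ B c (TH H Ht) \<tau> z + (B (\<tau>, z) * H (mark \<tau> z) \<tau> * of_real (Im z) - B (\<tau>, c) * H (mark \<tau> c) \<tau> * of_real (Im c)))) (at \<tau>)"
proof -
  define w where "w y = c + y *\<^sub>R (z - c)" for y
  have w: "w y \<in> D" if "y \<in> {0..1}" for y using seg_in[OF z, of y] that by (simp add: w_def)
  have wP: "w y \<notin> PP" if "y \<in> {0..1}" for y using w[OF that] D(3) by auto
  define f where "f \<tau> y = B (\<tau>, w y) * H (mark \<tau> (w y)) \<tau> * mark \<tau> (z - c)" for \<tau> y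
  define f1 where "f1 \<tau> y = B (\<tau>, w y) * TH H Ht (mark \<tau> (w y)) \<tau> * mark \<tau> (z - c)" for \<tau> y
  define f2 where "f2 \<tau> y = (B (\<tau>, w y) * om (mark \<tau> (w y)) \<tau> * mark \<tau> (z - c)) * H (mark \<tau> (w y)) \<tau> * of_real (Im (w y))
      + B (\<tau>, w y) * (Hu (mark \<tau> (w y)) \<tau> * mark \<tau> (z - c)) * of_real (Im (w y))
      + B (\<tau>, w y) * H (mark \<tau> (w y)) \<tau> * of_real (Im (z - c))" for \<tau> y
  have Hn: "\<And>\<tau> u. Im \<tau> > 0 \<Longrightarrow> u \<notin> mark \<tau> ` PP \<Longrightarrow> ((\<lambda>u. H u \<tau>) has_field_derivative Hu u \<tau>) (at u)"
    "\<And>\<tau> z. Im \<tau> > 0 \<Longrightarrow> z \<notin> PP \<Longrightarrow>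
       ((\<lambda>\<tau>. H (mark \<tau> z) \<tau>) has_field_derivative (Hu (mark \<tau> z) \<tau> * of_real (Im z) + Ht (mark \<tau> z) \<tau>)) (at \<tau>)"
    "continuous_on dom (\<lambda>p. H (fst p) (snd p))" "continuous_on dom (\<lambda>p. Hu (fst p) (snd p))"
    "continuous_on dom (\<lambda>p. Ht (fst p) (snd p))"
    using H by (auto simp: nice_def)
  have cTH: "continuous_on dom (\<lambda>p. TH H Ht (fst p) (snd p))"
    unfolding TH_def by (intro continuous_intros Hn Gt_continuous)
  note sc = seg_cont[OF z, folded w_def, unfolded case_prod_unfold]
  note cB = seg_cont_B[OF z, folded w_def, unfolded case_prod_unfold]
  have cw: "continuous_on S w" for S unfolding w_def by (intro continuous_intros)
  have cf1: "continuous_on (UHP \<times> {0..1}) (\<lambda>p. f1 (fst p) (snd p))"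
    unfolding f1_def by (intro continuous_intros cB sc[OF cTH])
  have cf2: "continuous_on (UHP \<times> {0..1}) (\<lambda>p. f2 (fst p) (snd p))"
    unfolding f2_def by (intro continuous_intros cB sc[OF om_continuous] sc[OF Hn(3)] sc[OF Hn(4)] continuous_on_compose2[OF cw[of UNIV]]) auto
  have cf: "continuous_on (UHP \<times> {0..1}) (\<lambda>p. f (fst p) (snd p))"
    unfolding f_def by (intro continuous_intros cB sc[OF Hn(3)])
  have slice: "continuous_on {0..1} (F \<tau>)" if "continuous_on (UHP \<times> {0..1}) (\<lambda>p. F (fst p) (snd p))" "Im \<tau> > 0"
    for F :: "complex \<Rightarrow> real \<Rightarrow> complex" and \<tau>
  proof -
    have "continuous_on {0..1} (\<lambda>y. (\<lambda>p. F (fst p) (snd p)) (\<tau>, y))"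
      by (rule continuous_on_compose2[OF that(1)]) (use that(2) in \<open>auto intro!: continuous_intros\<close>)
    then show ?thesis by simp
  qed
  have lz: "((\<lambda>\<tau>. integral (cbox 0 1) (f \<tau>)) has_field_derivative integral (cbox 0 1) (\<lambda>y. f1 \<tau> y + f2 \<tau> y)) (at \<tau> within UHP)"
  proof (rule leibniz_rule_field_derivative)
    fix \<tau> and y :: real assume \<tau>: "\<tau> \<in> UHP" and y: "y \<in> cbox 0 1"
    then have y': "y \<in> {0..1}" by simp
    have "Tbr UHP (\<lambda>\<tau>. pm (\<tau>, w y)) (\<lambda>\<tau>. B (\<tau>, w y))"
      by (rule branch_comp[OF B]) (use w[OF y'] in \<open>auto intro!: continuous_intros\<close>)
    then have dB: "((\<lambda>\<tau>. B (\<tau>, w y)) has_field_derivative B (\<tau>, w y) * (om (mark \<tau> (w y)) \<tau> * of_real (Im (w y)) + Gt (mark \<tau> (w y)) \<tau>)) (at \<tau>)"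
      using branch_tau_deriv[of "w y" "\<lambda>\<tau>. B (\<tau>, w y)" \<tau>] \<tau> by simp
    have "(f' \<tau> has_field_derivative f1 \<tau> y + f2 \<tau> y) (at \<tau>)" if "f' = (\<lambda>_ \<tau>. f \<tau> y)" for f'
      unfolding that f_def
      by (rule DERIV_cong[OF DERIV_mult[OF DERIV_mult[OF dB Hn(2)] mark_deriv_tau]])
         (use \<tau> wP[OF y'] in \<open>auto simp: f1_def f2_def TH_def algebra_simps\<close>)
    then show "((\<lambda>\<tau>. f \<tau> y) has_field_derivative f1 \<tau> y + f2 \<tau> y) (at \<tau> within UHP)"
      by (auto intro: has_field_derivative_at_within)
  next
    show "f \<tau> integrable_on cbox 0 1" if "\<tau> \<in> UHP" for \<tau>
      using slice[OF cf, of \<tau>] that by (auto intro: integrable_continuous_interval)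
  next
    show "continuous_on (UHP \<times> cbox 0 1) (\<lambda>(\<tau>, y). f1 \<tau> y + f2 \<tau> y)"
      using cf1 cf2 by (auto simp: case_prod_unfold intro!: continuous_intros)
  qed (use \<tau> convex_UHP in auto)
  then have D1: "((\<lambda>\<tau>. QQ B c H \<tau> z) has_field_derivative integral {0..1} (\<lambda>y. f1 \<tau> y + f2 \<tau> y)) (at \<tau>)"
  proof -
    have "(\<lambda>\<tau>. QQ B c H \<tau> z) = (\<lambda>\<tau>. integral (cbox 0 1) (f \<tau>))"
      unfolding QQ_def f_def[abs_def] w_def cbox_interval ..
    then show ?thesis
      using lz at_within_open[OF _ open_UHP, of \<tau>] \<tau> by (simp only: UHP_iff cbox_interval)
  qed
  have I2: "(f2 \<tau> has_integral B (\<tau>, w 1) * H (mark \<tau> (w 1)) \<tau> * of_real (Im (w 1)) - B (\<tau>, w 0) * H (mark \<tau> (w 0)) \<tau> * of_real (Im (w 0))) {0..1}"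
  proof (rule fundamental_theorem_of_calculus)
    fix y :: real assume y: "y \<in> {0..1}"
    have dw: "(w has_vector_derivative (z - c)) (at y within {0..1})"
      unfolding w_def by (auto intro!: derivative_eq_intros)
    have "Tbr {0..1} (\<lambda>y. pm (\<tau>, w y)) (\<lambda>y. B (\<tau>, w y))"
      by (rule branch_comp[OF B]) (use w \<tau> in \<open>auto intro!: continuous_intros cw\<close>)
    then have dB: "((\<lambda>y. B (\<tau>, w y)) has_vector_derivative B (\<tau>, w y) * om (mark \<tau> (w y)) \<tau> * mark \<tau> (z - c)) (at y within {0..1})"
      using branch_path_deriv[of "{0..1}" \<tau> w "\<lambda>y. B (\<tau>, w y)" y "z - c"] y \<tau> dw by simp
    have dH: "((\<lambda>y. H (mark \<tau> (w y)) \<tau>) has_vector_derivative mark \<tau> (z - c) * Hu (mark \<tau> (w y)) \<tau>) (at y within {0..1})"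
      using field_vector_diff_chain_within[of "\<lambda>y. mark \<tau> (w y)" "mark \<tau> (z - c)" y "{0..1}" "\<lambda>u. H u \<tau>" "Hu (mark \<tau> (w y)) \<tau>"]
        has_vector_derivative_mark[OF dw, of \<tau>] Hn(1)[OF \<tau>, of "mark \<tau> (w y)"] mark_notin[OF \<tau>] wP[OF y]
      by (auto simp: o_def intro: has_field_derivative_at_within)
    have dIm: "((\<lambda>y. of_real (Im (w y)) :: complex) has_vector_derivative of_real (Im (z - c))) (at y within {0..1})"
      unfolding w_def by (auto intro!: derivative_eq_intros simp: scaleR_conv_of_real)
    show "((\<lambda>y. B (\<tau>, w y) * H (mark \<tau> (w y)) \<tau> * of_real (Im (w y))) has_vector_derivative f2 \<tau> y) (at y within {0..1})"
      by (rule has_vector_derivative_eq_rhs[OF has_vector_derivative_mult[OF has_vector_derivative_mult[OF dB dH] dIm]])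
         (simp add: f2_def algebra_simps)
  qed auto
  have I1: "f1 \<tau> integrable_on {0..1}" using slice[OF cf1 \<tau>] by (rule integrable_continuous_interval)
  have "integral {0..1} (\<lambda>y. f1 \<tau> y + f2 \<tau> y) = integral {0..1} (f1 \<tau>) + integral {0..1} (f2 \<tau>)"
    using I1 I2 by (intro integral_add) auto
  also have "integral {0..1} (f2 \<tau>) = B (\<tau>, z) * H (mark \<tau> z) \<tau> * of_real (Im z) - B (\<tau>, c) * H (mark \<tau> c) \<tau> * of_real (Im c)"
    using integral_unique[OF I2] by (simp add: w_def)
  also have "integral {0..1} (f1 \<tau>) = QQ B c (TH H Ht) \<tau> z"
    unfolding QQ_def f1_def[abs_def] w_def ..
  finally show ?thesis using D1 by simp
qed

lemma QQ_primitive: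
  assumes \<tau>: "Im \<tau> > 0" and h: "(\<lambda>u. h u \<tau>) holomorphic_on - mark \<tau> ` PP"
  obtains P where "\<And>z. z \<in> D \<Longrightarrow> (P has_field_derivative B (\<tau>, z) * h (mark \<tau> z) \<tau>) (at (mark \<tau> z))"
    "\<And>z. z \<in> D \<Longrightarrow> QQ B c h \<tau> z = P (mark \<tau> z) - P (mark \<tau> c)"
proof -
  define E where "E = mark \<tau> ` D"
  have E: "convex E" "open E" unfolding E_def using D \<tau> convex_mark_image open_mark_image by auto
  have EP: "E \<subseteq> - mark \<tau> ` PP" unfolding E_def using D(3) mark_notin[OF \<tau>] by auto
  have br: "Tbr E (\<lambda>u. (\<tau>, u)) (\<lambda>u. B (\<tau>, unmark \<tau> u))"
    by (rule branch_cong[OF branch_comp[OF B, of E "\<lambda>u. (\<tau>, unmark \<tau> u)"]])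
       (use \<tau> in \<open>auto simp: E_def intro!: continuous_intros continuous_on_unmark\<close>)
  have "(\<lambda>u. B (\<tau>, unmark \<tau> u)) holomorphic_on E"
    unfolding holomorphic_on_def field_differentiable_def using branch_u_deriv[OF br _ \<tau>] by blast
  then have "(\<lambda>u. B (\<tau>, unmark \<tau> u) * h u \<tau>) holomorphic_on E"
    by (intro holomorphic_intros holomorphic_on_subset[OF h EP])
  then obtain P where P: "\<And>u. u \<in> E \<Longrightarrow> (P has_field_derivative B (\<tau>, unmark \<tau> u) * h u \<tau>) (at u within E)"
    using holomorphic_convex_primitive'[OF E] by blast
  have P': "(P has_field_derivative B (\<tau>, z) * h (mark \<tau> z) \<tau>) (at (mark \<tau> z))" if "z \<in> D" for z
    using P[of "mark \<tau> z"] that at_within_open[OF _ E(2), of "mark \<tau> z"] \<tau> by (simp add: E_def)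
  show ?thesis
  proof (rule that[OF P'])
    fix z assume z: "z \<in> D"
    define w where "w y = c + y *\<^sub>R (z - c)" for y
    have "((\<lambda>y. B (\<tau>, w y) * h (mark \<tau> (w y)) \<tau> * mark \<tau> (z - c)) has_integral P (mark \<tau> (w 1)) - P (mark \<tau> (w 0))) {0..1}"
    proof (rule fundamental_theorem_of_calculus)
      fix y :: real assume y: "y \<in> {0..1}"
      have dw: "(w has_vector_derivative (z - c)) (at y within {0..1})"
        unfolding w_def by (auto intro!: derivative_eq_intros)
      have "w y \<in> D" using seg_in[OF z, of y] y by (simp add: w_def)
      from field_vector_diff_chain_within[OF has_vector_derivative_mark[OF dw] has_field_derivative_at_within[OF P'[OF this]]]
      show "((\<lambda>y. P (mark \<tau> (w y))) has_vector_derivative B (\<tau>, w y) * h (mark \<tau> (w y)) \<tau> * mark \<tau> (z - c)) (at y within {0..1})"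
        by (simp add: o_def mult.commute)
    qed auto
    then show "QQ B c h \<tau> z = P (mark \<tau> z) - P (mark \<tau> c)"
      unfolding QQ_def by (intro integral_unique) (simp add: w_def)
  qed
qed

end

lemma branch_on_convex:
  assumes "convex D" "D \<inter> PP = {}"
  obtains B where "Tbr (UHP \<times> D) pm B"
proof (rule branch_exists[of "UHP \<times> D" pm])
  show "contractible (UHP \<times> D)" by (intro convex_imp_contractible convex_Times convex_UHP assms)
  show "snd (pm x) \<notin> mark (fst (pm x)) ` PP" if "x \<in> UHP \<times> D" for x
  proof -
    have "Im (fst x) > 0" "snd x \<notin> PP" using that assms(2) by auto
    from mark_image_PP[OF this] show ?thesis by (simp add: case_prod_unfold)
  qed
qed (use that in \<open>auto simp: case_prod_unfold intro!: continuous_intros\<close>)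

text \<open>The derivative \<open>g'\<close> is a separate argument since a path is differentiable
  only off a finite set, and the integral ignores the values there.\<close>

definition Ii :: "(complex \<times> real \<Rightarrow> complex) \<Rightarrow> (real \<Rightarrow> complex) \<Rightarrow> (real \<Rightarrow> complex) \<Rightarrow> real \<Rightarrow> real \<Rightarrow> (complex \<Rightarrow> complex) \<Rightarrow> complex \<Rightarrow> complex" where
  "Ii s g g' a b h \<tau> = integral {a..b} (\<lambda>x. s (\<tau>, x) * h (mark \<tau> (g x)) * mark \<tau> (g' x))"

text \<open>\<open>T (f' + om f) du\<close> is the differential of \<open>T f\<close>. Only
  continuity of the path and its derivative off a finite set are available, which suffices for the
  fundamental theorem.\<close>

lemma exact_integral:
  assumes ab: "a \<le> b" and g: "continuous_on {a..b} g" and K: "finite K"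
    and g': "\<And>x. x \<in> {a<..<b} - K \<Longrightarrow> (g has_vector_derivative g' x) (at x)"
    and P: "g ` {a..b} \<inter> PP = {}" and s: "Tbr (UHP \<times> {a..b}) (along g) s"
    and \<tau>: "Im \<tau> > 0" and f: "\<And>u. u \<notin> mark \<tau> ` PP \<Longrightarrow> (f has_field_derivative f' u) (at u)"
  shows "((\<lambda>x. s (\<tau>, x) * (f' (mark \<tau> (g x)) + om (mark \<tau> (g x)) \<tau> * f (mark \<tau> (g x))) * mark \<tau> (g' x)) has_integral
     s (\<tau>, b) * f (mark \<tau> (g b)) - s (\<tau>, a) * f (mark \<tau> (g a))) {a..b}"
proof (rule fundamental_theorem_of_calculus_interior_strong[OF K ab])
  have br: "Tbr {a..b} (\<lambda>x. (\<tau>, mark \<tau> (g x))) (\<lambda>x. s (\<tau>, x))"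
    by (rule branch_cong[OF branch_comp[OF s, of "{a..b}" "\<lambda>x. (\<tau>, x)"]])
       (use \<tau> in \<open>auto intro!: continuous_intros\<close>)
  have np: "mark \<tau> (g x) \<notin> mark \<tau> ` PP" if "x \<in> {a..b}" for x
    by (rule mark_image_PP[OF \<tau>]) (use P that in blast)
  have cs: "continuous_on {a..b} (\<lambda>x. s (\<tau>, x))"
    by (rule branch_continuous[OF br]) (intro continuous_intros g)
  have cf: "continuous_on (- mark \<tau> ` PP) f"
    by (intro continuous_at_imp_continuous_on ballI DERIV_isCont[OF f]) auto
  show "continuous_on {a..b} (\<lambda>x. s (\<tau>, x) * f (mark \<tau> (g x)))"
    by (rule continuous_on_mult[OF cs continuous_on_compose2[OF cf continuous_on_mark[OF continuous_on_const g]]])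
       (rule image_subsetI, rule ComplI, drule np, erule notE)
  fix x assume x: "x \<in> {a<..<b} - K"
  have xin: "at x within {a..b} = at x" using x by (simp add: at_within_Icc_at)
  have ds: "((\<lambda>x. s (\<tau>, x)) has_vector_derivative s (\<tau>, x) * om (mark \<tau> (g x)) \<tau> * mark \<tau> (g' x)) (at x)"
    using branch_path_deriv[OF br, of x "g' x"] x \<tau> g'[OF x] by (simp add: xin)
  have df: "((\<lambda>x. f (mark \<tau> (g x))) has_vector_derivative mark \<tau> (g' x) * f' (mark \<tau> (g x))) (at x)"
    using field_vector_diff_chain_at[OF has_vector_derivative_mark[OF g'[OF x]] f[OF np]] x by (auto simp: o_def)
  show "((\<lambda>x. s (\<tau>, x) * f (mark \<tau> (g x))) has_vector_derivative
      s (\<tau>, x) * (f' (mark \<tau> (g x)) + om (mark \<tau> (g x)) \<tau> * f (mark \<tau> (g x))) * mark \<tau> (g' x)) (at x)"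
    by (rule has_vector_derivative_eq_rhs[OF has_vector_derivative_mult[OF ds df]]) (simp add: algebra_simps)
qed

text \<open>A path is cut into pieces lying in discs without punctures, where \<open>QQ_tau\<close> applies; no integrability
  of the derivative of the path is assumed, so differentiation under the integral is not available.\<close>

lemma path_integral_tau:
  assumes ab: "a \<le> b" and g: "continuous_on {a..b} g" and K: "finite K"
    and g': "\<And>x. x \<in> {a<..<b} - K \<Longrightarrow> (g has_vector_derivative g' x) (at x)"
    and P: "g ` {a..b} \<inter> PP = {}" and s: "Tbr (UHP \<times> {a..b}) (along g) s"
  shows path_integrable: "\<And>h \<tau>. Im \<tau> > 0 \<Longrightarrow> h holomorphic_on - mark \<tau> ` PP \<Longrightarrow>
      (\<lambda>x. s (\<tau>, x) * h (mark \<tau> (g x)) * mark \<tau> (g' x)) integrable_on {a..b}"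
    and path_deriv: "\<And>H Hu Ht \<tau>. Im \<tau> > 0 \<Longrightarrow> nice H Hu Ht \<Longrightarrow>
      ((\<lambda>\<tau>. Ii s g g' a b (\<lambda>u. H u \<tau>) \<tau>) has_field_derivative
        (Ii s g g' a b (\<lambda>u. TH H Ht u \<tau>) \<tau> + (s (\<tau>, b) * H (mark \<tau> (g b)) \<tau> * of_real (Im (g b))
          - s (\<tau>, a) * H (mark \<tau> (g a)) \<tau> * of_real (Im (g a))))) (at \<tau>)"
proof -
  define Pr where "Pr c d \<longleftrightarrow> (a \<le> c \<and> d \<le> b \<longrightarrow>
     (\<forall>h \<tau>. Im \<tau> > 0 \<longrightarrow> h holomorphic_on - mark \<tau> ` PP \<longrightarrow>
      (\<lambda>x. s (\<tau>, x) * h (mark \<tau> (g x)) * mark \<tau> (g' x)) integrable_on {c..d}) \<and>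
     (\<forall>H Hu Ht \<tau>. Im \<tau> > 0 \<longrightarrow> nice H Hu Ht \<longrightarrow>
      ((\<lambda>\<tau>. Ii s g g' c d (\<lambda>u. H u \<tau>) \<tau>) has_field_derivative
        (Ii s g g' c d (\<lambda>u. TH H Ht u \<tau>) \<tau> + (s (\<tau>, d) * H (mark \<tau> (g d)) \<tau> * of_real (Im (g d))
          - s (\<tau>, c) * H (mark \<tau> (g c)) \<tau> * of_real (Im (g c))))) (at \<tau>)))" for c d
  have additive: "Ii s g g' x y h \<tau> + Ii s g g' y z h \<tau> = Ii s g g' x z h \<tau>"
    if "Pr x y" "Pr y z" "a \<le> x" "x \<le> y" "y \<le> z" "z \<le> b" "Im \<tau> > 0" "h holomorphic_on - mark \<tau> ` PP" for x y z h \<tau>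
    unfolding Ii_def using that unfolding Pr_def
    by (intro Henstock_Kurzweil_Integration.integral_combine Henstock_Kurzweil_Integration.integrable_combine[of x y z]) auto
  have "Pr a b"
    using ab
  \<comment> \<open>Bisection: the property passes to the union of adjacent intervals and holds for
    all short intervals around any point.\<close>
  proof (rule Bolzano[where P = Pr])
    fix x y z assume xyz: "Pr x y" "Pr y z" "x \<le> y" "y \<le> z"
    show "Pr x z" unfolding Pr_def
    proof (intro impI conjI allI)
      fix h \<tau> assume *: "a \<le> x \<and> z \<le> b" "Im \<tau> > 0" "h holomorphic_on - mark \<tau> ` PP"
      then show "(\<lambda>x. s (\<tau>, x) * h (mark \<tau> (g x)) * mark \<tau> (g' x)) integrable_on {x..z}"
        using xyz unfolding Pr_def by (intro Henstock_Kurzweil_Integration.integrable_combine[of x y z]) auto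
    next
      fix H Hu Ht \<tau> assume *: "a \<le> x \<and> z \<le> b" "Im \<tau> > 0" "nice H Hu Ht"
      have d1: "((\<lambda>\<tau>. Ii s g g' x y (\<lambda>u. H u \<tau>) \<tau>) has_field_derivative
        (Ii s g g' x y (\<lambda>u. TH H Ht u \<tau>) \<tau> + (s (\<tau>, y) * H (mark \<tau> (g y)) \<tau> * of_real (Im (g y))
          - s (\<tau>, x) * H (mark \<tau> (g x)) \<tau> * of_real (Im (g x))))) (at \<tau>)"
        and d2: "((\<lambda>\<tau>. Ii s g g' y z (\<lambda>u. H u \<tau>) \<tau>) has_field_derivative
        (Ii s g g' y z (\<lambda>u. TH H Ht u \<tau>) \<tau> + (s (\<tau>, z) * H (mark \<tau> (g z)) \<tau> * of_real (Im (g z))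
          - s (\<tau>, y) * H (mark \<tau> (g y)) \<tau> * of_real (Im (g y))))) (at \<tau>)"
        using xyz * unfolding Pr_def by auto
      show "((\<lambda>\<tau>. Ii s g g' x z (\<lambda>u. H u \<tau>) \<tau>) has_field_derivative
        (Ii s g g' x z (\<lambda>u. TH H Ht u \<tau>) \<tau> + (s (\<tau>, z) * H (mark \<tau> (g z)) \<tau> * of_real (Im (g z))
          - s (\<tau>, x) * H (mark \<tau> (g x)) \<tau> * of_real (Im (g x))))) (at \<tau>)"
      proof (rule has_field_derivative_transform_within_open[OF DERIV_cong[OF DERIV_add[OF d1 d2]] open_UHP])
        show "Ii s g g' x y (\<lambda>u. H u \<tau>) \<tau> + Ii s g g' y z (\<lambda>u. H u \<tau>) \<tau> = Ii s g g' x z (\<lambda>u. H u \<tau>) \<tau>"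
          if "\<tau> \<in> UHP" for \<tau>
          using additive[OF xyz(1,2) _ xyz(3,4)] * that nice_hol by auto
      qed (use additive[OF xyz(1,2) _ xyz(3,4)] * TH_hol in \<open>auto simp: algebra_simps\<close>)
    qed
  next
    fix x assume x: "a \<le> x" "x \<le> b"
    have "open (- PP)" using open_compl_punctures[of \<i>] by simp
    moreover have "g x \<in> - PP" using P x by (auto simp: disjoint_iff)
    ultimately obtain e where e: "e > 0" "ball (g x) e \<subseteq> - PP" by (meson open_contains_ball)
    obtain d where d: "d > 0" "\<And>y. y \<in> {a..b} \<Longrightarrow> dist y x < d \<Longrightarrow> dist (g y) (g x) < e"
      using g x e(1) unfolding continuous_on_iff by (metis atLeastAtMost_iff)
    define D where "D = ball (g x) e"
    have D: "convex D" "open D" "D \<inter> PP = {}" "g x \<in> D" using e by (auto simp: D_def)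
    obtain B where B: "Tbr (UHP \<times> D) pm B"
      using branch_on_convex[OF D(1,3)] by blast
    have "Pr c d'" if cd: "c \<le> x" "x \<le> d'" "d' - c < d" for c d'
      unfolding Pr_def
    proof (rule impI)
      assume lim: "a \<le> c \<and> d' \<le> b"
      have gD: "g y \<in> D" if "y \<in> {c..d'}" for y
        using d(2)[of y] that cd lim by (auto simp: D_def dist_commute dist_real_def)
      have sub: "{c..d'} \<subseteq> {a..b}" using lim cd by auto
      have b1: "Tbr (UHP \<times> {c..d'}) (along g) s"
        by (rule branch_cong[OF branch_comp[OF s, of "UHP \<times> {c..d'}" "\<lambda>x. x"]])
           (use sub in \<open>auto intro!: continuous_intros\<close>)
      have b2: "Tbr (UHP \<times> {c..d'}) (along g) (\<lambda>p. B (fst p, g (snd p)))"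
      proof (rule branch_cong[OF branch_comp[OF B, of "UHP \<times> {c..d'}" "\<lambda>p. (fst p, g (snd p))"]])
        show "continuous_on (UHP \<times> {c..d'}) (\<lambda>p. (fst p, g (snd p)))"
          by (intro continuous_intros continuous_on_compose2[OF continuous_on_subset[OF g sub]]) auto
      qed (use gD in auto)
      have "connected (UHP \<times> {c..d'})"
        by (intro connected_Times convex_connected convex_UHP) auto
      \<comment> \<open>Along a short piece the given branch is a constant multiple of a branch over
        the disc, so the integral is \<open>k\<close> times a difference of values of
        \<open>QQ\<close>.\<close>
      then obtain k where k: "\<And>p. p \<in> UHP \<times> {c..d'} \<Longrightarrow> s p = k * B (fst p, g (snd p))"
        using branch_unique[OF _ b2 b1] by metis
      have sk: "s (\<tau>, y) = k * B (\<tau>, g y)" if "y \<in> {c..d'}" "Im \<tau> > 0" for \<tau> y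
        using k[of "(\<tau>, y)"] that by simp
      have HI: "((\<lambda>y. s (\<tau>, y) * h (mark \<tau> (g y)) \<tau> * mark \<tau> (g' y)) has_integral
          k * (QQ B (g x) h \<tau> (g d') - QQ B (g x) h \<tau> (g c))) {c..d'}"
        if \<tau>: "Im \<tau> > 0" and h: "(\<lambda>u. h u \<tau>) holomorphic_on - mark \<tau> ` PP" for \<tau> h
      proof -
        obtain Q where Q: "\<And>z. z \<in> D \<Longrightarrow> (Q has_field_derivative B (\<tau>, z) * h (mark \<tau> z) \<tau>) (at (mark \<tau> z))"
          "\<And>z. z \<in> D \<Longrightarrow> QQ B (g x) h \<tau> z = Q (mark \<tau> z) - Q (mark \<tau> (g x))"
          using QQ_primitive[OF D B \<tau>, where h = h, OF h] by blast
        have "((\<lambda>y. s (\<tau>, y) * h (mark \<tau> (g y)) \<tau> * mark \<tau> (g' y)) has_integral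
            k * Q (mark \<tau> (g d')) - k * Q (mark \<tau> (g c))) {c..d'}"
        proof (rule fundamental_theorem_of_calculus_interior_strong[OF K])
          have "isCont Q (mark \<tau> (g y))" if "y \<in> {c..d'}" for y
            using Q(1)[OF gD[OF that]] DERIV_isCont by blast
          then have cQ: "continuous_on ((\<lambda>y. mark \<tau> (g y)) ` {c..d'}) Q"
            by (intro continuous_at_imp_continuous_on) auto
          show "continuous_on {c..d'} (\<lambda>y. k * Q (mark \<tau> (g y)))"
            by (rule continuous_on_mult[OF continuous_on_const continuous_on_compose2[OF cQ
                  continuous_on_mark[OF continuous_on_const continuous_on_subset[OF g sub]] subset_refl]])
          fix y assume y: "y \<in> {c<..<d'} - K"
          have gy: "(g has_vector_derivative g' y) (at y)" using g'[of y] y lim by auto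
          show "((\<lambda>y. k * Q (mark \<tau> (g y))) has_vector_derivative s (\<tau>, y) * h (mark \<tau> (g y)) \<tau> * mark \<tau> (g' y)) (at y)"
            by (rule has_vector_derivative_eq_rhs[OF has_vector_derivative_mult_right[OF
                  field_vector_diff_chain_at[OF has_vector_derivative_mark[OF gy] Q(1)[OF gD], unfolded o_def]]])
               (use y sk[of y] \<tau> in auto)
        qed (use cd in auto)
        moreover have "QQ B (g x) h \<tau> (g d') = Q (mark \<tau> (g d')) - Q (mark \<tau> (g x))"
          "QQ B (g x) h \<tau> (g c) = Q (mark \<tau> (g c)) - Q (mark \<tau> (g x))"
          using cd by (auto intro!: Q(2) gD)
        ultimately show ?thesis by (simp add: right_diff_distrib)
      qed
      have IH: "Ii s g g' c d' (\<lambda>u. h u \<tau>) \<tau> = k * (QQ B (g x) h \<tau> (g d') - QQ B (g x) h \<tau> (g c))"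
        if \<tau>: "Im \<tau> > 0" and h: "(\<lambda>u. h u \<tau>) holomorphic_on - mark \<tau> ` PP" for \<tau> h
        unfolding Ii_def by (rule integral_unique, rule HI[OF \<tau>, of h], rule h)
      show "(\<forall>h \<tau>. Im \<tau> > 0 \<longrightarrow> h holomorphic_on - mark \<tau> ` PP \<longrightarrow>
      (\<lambda>x. s (\<tau>, x) * h (mark \<tau> (g x)) * mark \<tau> (g' x)) integrable_on {c..d'}) \<and>
     (\<forall>H Hu Ht \<tau>. Im \<tau> > 0 \<longrightarrow> nice H Hu Ht \<longrightarrow>
      ((\<lambda>\<tau>. Ii s g g' c d' (\<lambda>u. H u \<tau>) \<tau>) has_field_derivative
        (Ii s g g' c d' (\<lambda>u. TH H Ht u \<tau>) \<tau> + (s (\<tau>, d') * H (mark \<tau> (g d')) \<tau> * of_real (Im (g d'))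
          - s (\<tau>, c) * H (mark \<tau> (g c)) \<tau> * of_real (Im (g c))))) (at \<tau>))"
      proof (intro conjI allI impI)
        fix h \<tau> assume "Im \<tau> > 0" "h holomorphic_on - mark \<tau> ` PP"
        then show "(\<lambda>x. s (\<tau>, x) * h (mark \<tau> (g x)) * mark \<tau> (g' x)) integrable_on {c..d'}"
          using HI[of \<tau> "\<lambda>u _. h u"] by blast
      next
        fix H Hu Ht \<tau> assume \<tau>: "Im \<tau> > 0" and H: "nice H Hu Ht"
        have gc: "g c \<in> D" "g d' \<in> D" using gD cd by auto
        show "((\<lambda>\<tau>. Ii s g g' c d' (\<lambda>u. H u \<tau>) \<tau>) has_field_derivative
        (Ii s g g' c d' (\<lambda>u. TH H Ht u \<tau>) \<tau> + (s (\<tau>, d') * H (mark \<tau> (g d')) \<tau> * of_real (Im (g d'))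
          - s (\<tau>, c) * H (mark \<tau> (g c)) \<tau> * of_real (Im (g c))))) (at \<tau>)"
        proof (rule has_field_derivative_transform_within_open[OF DERIV_cong[OF
              DERIV_cmult[OF DERIV_diff[OF QQ_tau[OF D B gc(2) \<tau> H] QQ_tau[OF D B gc(1) \<tau> H]], of k]] open_UHP])
          show "k * (QQ B (g x) H \<tau> (g d') - QQ B (g x) H \<tau> (g c)) = Ii s g g' c d' (\<lambda>u. H u \<tau>) \<tau>"
            if "\<tau> \<in> UHP" for \<tau>
            using IH[of \<tau> H] that nice_hol[OF H] by simp
        qed (use IH[of \<tau> "TH H Ht"] TH_hol[OF H \<tau>] \<tau> sk[of c] sk[of d'] cd in \<open>auto simp: algebra_simps\<close>)
      qed
    qed
    then show "\<exists>d>0. \<forall>a b. a \<le> x \<and> x \<le> b \<and> b - a < d \<longrightarrow> Pr a b" using d(1) by blast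
  qed
  then show "\<And>h \<tau>. Im \<tau> > 0 \<Longrightarrow> h holomorphic_on - mark \<tau> ` PP \<Longrightarrow>
      (\<lambda>x. s (\<tau>, x) * h (mark \<tau> (g x)) * mark \<tau> (g' x)) integrable_on {a..b}"
    "\<And>H Hu Ht \<tau>. Im \<tau> > 0 \<Longrightarrow> nice H Hu Ht \<Longrightarrow>
      ((\<lambda>\<tau>. Ii s g g' a b (\<lambda>u. H u \<tau>) \<tau>) has_field_derivative
        (Ii s g g' a b (\<lambda>u. TH H Ht u \<tau>) \<tau> + (s (\<tau>, b) * H (mark \<tau> (g b)) \<tau> * of_real (Im (g b))
          - s (\<tau>, a) * H (mark \<tau> (g a)) \<tau> * of_real (Im (g a))))) (at \<tau>)"
    unfolding Pr_def by blast+
qed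

end

section \<open>Twisted cycles and classes\<close>

lemma sum_list_sum_swap:
  fixes f :: "'a \<Rightarrow> 'b \<Rightarrow> 'c::comm_monoid_add"
  shows "(\<Sum>x\<leftarrow>xs. \<Sum>v\<in>V. f x v) = (\<Sum>v\<in>V. \<Sum>x\<leftarrow>xs. f x v)"
  by (induction xs) (auto simp: sum.distrib)

definition lrep :: "complex \<Rightarrow> complex" where
  "lrep z = Complex (frac (Re z)) (frac (Im z))"

lemma lrep_diff: "z - lrep z \<in> gauss_lattice"
  by (simp add: lrep_def gauss_lattice_ReIm frac_def)

lemma lrep_eq_iff: "lrep a = lrep b \<longleftrightarrow> a - b \<in> gauss_lattice"
proof
  assume "lrep a = lrep b"
  then have "(a - lrep a) - (b - lrep b) = a - b" by simp
  then show "a - b \<in> gauss_lattice" using lrep_diff gauss_lattice_closed(3) by metis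
next
  assume "a - b \<in> gauss_lattice"
  then obtain m n where "a = b + Complex (of_int m) (of_int n)" by (auto simp: gauss_lattice_iff algebra_simps)
  then show "lrep a = lrep b" by (simp add: lrep_def frac_def)
qed

lemma lrep_idem: "lrep (lrep z) = lrep z"
  using lrep_eq_iff[of z "lrep z"] lrep_diff[of z] by simp

context params
begin

lemma flat_cycleD:
  assumes "flat_twisted_cycle \<alpha> a0 ai \<gamma>" "(c, g, s) \<in> set \<gamma>"
  shows "valid_path g" "g ` {0..1} \<inter> PP = {}"
    "Tbr (UHP \<times> {0..1}) (along g) s"
proof -
  have "\<forall>(c, g, s)\<in>set \<gamma>. valid_path g \<and> path_image g \<inter> PP = {} \<and>
        Tbr (UHP \<times> {0..1}) (along g) s"
    using assms(1) unfolding flat_twisted_cycle_def by blast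
  from bspec[OF this assms(2)]
  show "valid_path g" "g ` {0..1} \<inter> PP = {}"
    "Tbr (UHP \<times> {0..1}) (along g) s"
    by (simp_all add: path_image_def)
qed

text \<open>Sorting the end points by their classes modulo the lattice, with \<open>lrep\<close> as
  representatives, turns the sum into a combination of boundary conditions. The weights are values
  of \<open>F\<close>, which depend on the class only.\<close>

lemma cycle_sum:
  assumes cyc: "flat_twisted_cycle \<alpha> a0 ai \<gamma>" and \<tau>: "Im \<tau> > 0"
    and F: "\<And>z l. z \<notin> PP \<Longrightarrow> l \<in> gauss_lattice \<Longrightarrow> F (z + l) = F z"
  shows "(\<Sum>(c, g, s)\<leftarrow>\<gamma>. c * (s (\<tau>, 1) * F (g 1) - s (\<tau>, 0) * F (g 0))) = 0"
proof -
  define V where "V = (\<Union>(c, g, s)\<in>set \<gamma>. {lrep (g 1), lrep (g 0)})"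
  have fin: "finite V" by (auto simp: V_def)
  define t :: "complex \<Rightarrow> complex \<times> (real \<Rightarrow> complex) \<times> (complex \<times> real \<Rightarrow> complex) \<Rightarrow> complex"
    where "t v = (\<lambda>(c, g, s). c * ((if g 1 - v \<in> gauss_lattice then s (\<tau>, 1) else 0)
           - (if g 0 - v \<in> gauss_lattice then s (\<tau>, 0) else 0)))" for v
  have bd: "(\<Sum>x\<leftarrow>\<gamma>. t v x) = 0" for v
    using cyc \<tau> unfolding flat_twisted_cycle_def t_def by auto
  have e: "c * (s (\<tau>, 1) * F (g 1) - s (\<tau>, 0) * F (g 0)) = (\<Sum>v\<in>V. F v * t v (c, g, s))"
    if "(c, g, s) \<in> set \<gamma>" for c g s
  proof -
    have np: "g 1 \<notin> PP" "g 0 \<notin> PP"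
      using flat_cycleD(2)[OF cyc that] by (auto simp: disjoint_iff)
    have Fr: "F (lrep z) = F z" if "z \<notin> PP" for z
      using F[OF that, of "lrep z - z"] lrep_diff[of z] gauss_lattice_closed(4)[of "z - lrep z"] by simp
    have in1: "lrep (g 1) \<in> V" "lrep (g 0) \<in> V" using that by (force simp: V_def)+
    have pick: "(\<Sum>v\<in>V. F v * (if z - v \<in> gauss_lattice then w else 0)) = F z * w"
      if "lrep z \<in> V" "z \<notin> PP" for z w
    proof -
      have "z - v \<in> gauss_lattice \<longleftrightarrow> v = lrep z" if "v \<in> V" for v
      proof -
        have "lrep v = v" using that lrep_idem by (auto simp: V_def)
        then show ?thesis using lrep_eq_iff[of z v] by auto
      qed
      then have "(\<Sum>v\<in>V. F v * (if z - v \<in> gauss_lattice then w else 0)) = (\<Sum>v\<in>V. if v = lrep z then F v * w else 0)"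
        by (intro sum.cong) auto
      also have "\<dots> = F z * w" using fin that Fr by simp
      finally show ?thesis .
    qed
    have "(\<Sum>v\<in>V. F v * t v (c, g, s)) = c * ((\<Sum>v\<in>V. F v * (if g 1 - v \<in> gauss_lattice then s (\<tau>, 1) else 0))
        - (\<Sum>v\<in>V. F v * (if g 0 - v \<in> gauss_lattice then s (\<tau>, 0) else 0)))"
      unfolding t_def by (simp add: sum_distrib_left sum_subtractf right_diff_distrib mult.left_commute)
    then show ?thesis using pick in1 np by (simp add: mult.commute)
  qed
  have "(\<Sum>(c, g, s)\<leftarrow>\<gamma>. c * (s (\<tau>, 1) * F (g 1) - s (\<tau>, 0) * F (g 0))) = (\<Sum>x\<leftarrow>\<gamma>. \<Sum>v\<in>V. F v * t v x)"
    by (rule arg_cong[where f = sum_list], rule map_cong[OF refl]) (use e in auto)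
  also have "\<dots> = (\<Sum>v\<in>V. F v * (\<Sum>x\<leftarrow>\<gamma>. t v x))"
    by (simp add: sum_list_sum_swap sum_list_const_mult)
  finally show ?thesis by (simp add: bd)
qed

definition pd :: "(real \<Rightarrow> complex) \<Rightarrow> real \<Rightarrow> complex" where
  "pd g x = vector_derivative g (at x)"

lemma valid_path_pd:
  assumes "valid_path g"
  obtains K where "finite K" "\<And>x. x \<in> {0<..<1} - K \<Longrightarrow> (g has_vector_derivative pd g x) (at x)"
proof -
  obtain K where K: "finite K" "g C1_differentiable_on ({0..1} - K)"
    using assms by (auto simp: valid_path_def piecewise_C1_differentiable_on_def)
  have "(g has_vector_derivative pd g x) (at x)" if "x \<in> {0<..<1} - K" for x
    using K(2) that unfolding C1_differentiable_on_eq pd_def by (auto simp: vector_derivative_works)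
  with K(1) show ?thesis using that by blast
qed

lemma valid_path_cont: "valid_path g \<Longrightarrow> continuous_on {0..1} g"
  by (auto simp: valid_path_def piecewise_C1_differentiable_on_def)

lemma form_integral_eq:
  assumes "valid_path g"
  shows "integral {0..1} (\<lambda>x. s (\<tau>, x) * h (mark \<tau> (g x)) * vector_derivative (\<lambda>y. mark \<tau> (g y)) (at x within {0..1}))
    = Ii s g (pd g) 0 1 h \<tau>"
proof -
  obtain K where K: "finite K" "\<And>x. x \<in> {0<..<1} - K \<Longrightarrow> (g has_vector_derivative pd g x) (at x)"
    using valid_path_pd[OF assms] by blast
  show ?thesis unfolding Ii_def
  proof (rule integral_spike[of "K \<union> {0, 1}"])
    show "negligible (K \<union> {0, 1})" using K(1) by (intro negligible_finite) auto
    fix x assume "x \<in> {0..1} - (K \<union> {0, 1})"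
    then have "x \<in> {0<..<1} - K" by auto
    then have "vector_derivative (\<lambda>y. mark \<tau> (g y)) (at x within {0..1}) = mark \<tau> (pd g x)"
      using vector_derivative_at[OF has_vector_derivative_mark[OF K(2)], of x \<tau>] by (simp add: at_within_Icc_at)
    then show "s (\<tau>, x) * h (mark \<tau> (g x)) * mark \<tau> (pd g x) =
      s (\<tau>, x) * h (mark \<tau> (g x)) * vector_derivative (\<lambda>y. mark \<tau> (g y)) (at x within {0..1})" by simp
  qed
qed

lemma form_pairing_Ii:
  assumes "flat_twisted_cycle \<alpha> a0 ai \<gamma>"
  shows "form_pairing \<tau> h \<gamma> = (\<Sum>(c, g, s)\<leftarrow>\<gamma>. c * Ii s g (pd g) 0 1 h \<tau>)"
  unfolding form_pairing_def
  by (rule arg_cong[where f = sum_list], rule map_cong[OF refl])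
     (use assms form_integral_eq in \<open>auto simp: flat_twisted_cycle_def\<close>)

lemma cycle_integrable:
  assumes "flat_twisted_cycle \<alpha> a0 ai \<gamma>" "(c, g, s) \<in> set \<gamma>" "Im \<tau> > 0" "h holomorphic_on - mark \<tau> ` PP"
  shows "(\<lambda>x. s (\<tau>, x) * h (mark \<tau> (g x)) * mark \<tau> (pd g x)) integrable_on {0..1}"
proof -
  note c = flat_cycleD[OF assms(1,2)]
  obtain K where K: "finite K" "\<And>x. x \<in> {0<..<1} - K \<Longrightarrow> (g has_vector_derivative pd g x) (at x)"
    using valid_path_pd[OF c(1)] by blast
  show ?thesis
    by (rule path_integrable[OF _ valid_path_cont[OF c(1)] K c(2,3) assms(3,4)]) auto
qed

lemma Ii_linear:
  assumes "flat_twisted_cycle \<alpha> a0 ai \<gamma>" "(c, g, s) \<in> set \<gamma>" "Im \<tau> > 0"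
    "h holomorphic_on - mark \<tau> ` PP" "k holomorphic_on - mark \<tau> ` PP"
  shows "Ii s g (pd g) 0 1 (\<lambda>u. a * h u + b * k u) \<tau> = a * Ii s g (pd g) 0 1 h \<tau> + b * Ii s g (pd g) 0 1 k \<tau>"
proof -
  have "((\<lambda>x. a * (s (\<tau>, x) * h (mark \<tau> (g x)) * mark \<tau> (pd g x)) + b * (s (\<tau>, x) * k (mark \<tau> (g x)) * mark \<tau> (pd g x))) has_integral
     a * Ii s g (pd g) 0 1 h \<tau> + b * Ii s g (pd g) 0 1 k \<tau>) {0..1}"
    unfolding Ii_def using cycle_integrable[OF assms(1-3)] assms(4,5)
    by (intro has_integral_add has_integral_mult_right integrable_integral)
  then show ?thesis unfolding Ii_def by (intro integral_unique) (simp add: algebra_simps)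
qed

lemma form_pairing_linear:
  assumes "flat_twisted_cycle \<alpha> a0 ai \<gamma>" "Im \<tau> > 0"
    "h holomorphic_on - mark \<tau> ` PP" "k holomorphic_on - mark \<tau> ` PP"
  shows "form_pairing \<tau> (\<lambda>u. a * h u + b * k u) \<gamma> = a * form_pairing \<tau> h \<gamma> + b * form_pairing \<tau> k \<gamma>"
proof -
  have "form_pairing \<tau> (\<lambda>u. a * h u + b * k u) \<gamma> =
     (\<Sum>x\<leftarrow>\<gamma>. a * (case x of (c, g, s) \<Rightarrow> c * Ii s g (pd g) 0 1 h \<tau>) + b * (case x of (c, g, s) \<Rightarrow> c * Ii s g (pd g) 0 1 k \<tau>))"
    unfolding form_pairing_Ii[OF assms(1)]
    by (rule arg_cong[where f = sum_list], rule map_cong[OF refl])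
       (use Ii_linear[OF assms(1) _ assms(2-4)] in \<open>auto simp: algebra_simps\<close>)
  then show ?thesis
    unfolding form_pairing_Ii[OF assms(1)] by (simp add: sum_list_addf sum_list_const_mult)
qed

lemma Ii_cong:
  assumes "g ` {0..1} \<inter> PP = {}" "Im \<tau> > 0" "\<And>u. u \<notin> mark \<tau> ` PP \<Longrightarrow> h u = k u"
  shows "Ii s g g' 0 1 h \<tau> = Ii s g g' 0 1 k \<tau>"
  unfolding Ii_def by (rule integral_cong) (use assms mark_image_PP[OF assms(2)] in \<open>force simp: disjoint_iff\<close>)

text \<open>The primitive \<open>f\<close> need not be periodic; only the boundary term matters.\<close>

lemma form_pairing_exact:
  assumes cyc: "flat_twisted_cycle \<alpha> a0 ai \<gamma>" and \<tau>: "Im \<tau> > 0"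
    and f: "\<And>u. u \<notin> mark \<tau> ` PP \<Longrightarrow> (f has_field_derivative f' u) (at u)"
    and h: "\<And>u. u \<notin> mark \<tau> ` PP \<Longrightarrow> h u = f' u + om u \<tau> * f u"
  shows "form_pairing \<tau> h \<gamma> = (\<Sum>(c, g, s)\<leftarrow>\<gamma>. c * (s (\<tau>, 1) * f (mark \<tau> (g 1)) - s (\<tau>, 0) * f (mark \<tau> (g 0))))"
proof -
  have "Ii s g (pd g) 0 1 h \<tau> = s (\<tau>, 1) * f (mark \<tau> (g 1)) - s (\<tau>, 0) * f (mark \<tau> (g 0))"
    if "(c, g, s) \<in> set \<gamma>" for c g s
  proof -
    note c = flat_cycleD[OF cyc that]
    obtain K where K: "finite K" "\<And>x. x \<in> {0<..<1} - K \<Longrightarrow> (g has_vector_derivative pd g x) (at x)"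
      using valid_path_pd[OF c(1)] by blast
    have "Ii s g (pd g) 0 1 h \<tau> = Ii s g (pd g) 0 1 (\<lambda>u. f' u + om u \<tau> * f u) \<tau>"
      by (rule Ii_cong[OF c(2) \<tau> h])
    also have "\<dots> = s (\<tau>, 1) * f (mark \<tau> (g 1)) - s (\<tau>, 0) * f (mark \<tau> (g 0))"
      unfolding Ii_def
      by (rule integral_unique[OF exact_integral[OF _ valid_path_cont[OF c(1)] K c(2,3) \<tau> f]]) auto
    finally show ?thesis .
  qed
  then show ?thesis
    unfolding form_pairing_Ii[OF cyc]
    by (intro arg_cong[where f = sum_list] map_cong) auto
qed

abbreviation hf :: "complex \<Rightarrow> (complex \<Rightarrow> complex) set" where "hf \<equiv> hol_fun \<alpha> a0 ai"
abbreviation cl :: "complex \<Rightarrow> (complex \<Rightarrow> complex) \<Rightarrow> (complex \<Rightarrow> complex) set" where "cl \<equiv> H1_class \<alpha> a0 ai"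

lemma hf_linear: "h \<in> hf \<tau> \<Longrightarrow> k \<in> hf \<tau> \<Longrightarrow> (\<lambda>u. a * h u + b * k u) \<in> hf \<tau>"
  unfolding hol_fun_def by (simp add: holomorphic_on_add holomorphic_on_mult)

lemma hf_zero: "(\<lambda>u. 0) \<in> hf \<tau>" and hf_one: "(\<lambda>u. 1) \<in> hf \<tau>"
  by (auto simp: hol_fun_def)

lemma hf_add: "h \<in> hf \<tau> \<Longrightarrow> k \<in> hf \<tau> \<Longrightarrow> (\<lambda>u. h u + k u) \<in> hf \<tau>"
  and hf_diff: "h \<in> hf \<tau> \<Longrightarrow> k \<in> hf \<tau> \<Longrightarrow> (\<lambda>u. h u - k u) \<in> hf \<tau>"
  and hf_cmult: "h \<in> hf \<tau> \<Longrightarrow> (\<lambda>u. a * h u) \<in> hf \<tau>"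
  using hf_linear[of h \<tau> k 1 1] hf_linear[of h \<tau> k 1 "-1"] hf_linear[of h \<tau> h a 0] by simp_all

definition exact :: "complex \<Rightarrow> (complex \<Rightarrow> complex) \<Rightarrow> bool" where
  "exact \<tau> h \<longleftrightarrow> (\<exists>f\<in>hf \<tau>. \<forall>u\<in>- mark \<tau> ` PP. h u = deriv f u + om u \<tau> * f u)"

lemma hf_deriv:
  assumes "f \<in> hf \<tau>" "Im \<tau> > 0" "u \<in> - mark \<tau> ` PP"
  shows "(f has_field_derivative deriv f u) (at u)"
  using assms open_compl_punctures by (auto simp: hol_fun_def intro: holomorphic_derivI)

lemma exact_linear:
  assumes \<tau>: "Im \<tau> > 0" and "exact \<tau> h" "exact \<tau> k"
  shows "exact \<tau> (\<lambda>u. a * h u + b * k u)"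
proof -
  obtain f1 f2 where f: "f1 \<in> hf \<tau>" "f2 \<in> hf \<tau>"
    "\<And>u. u \<in> - mark \<tau> ` PP \<Longrightarrow> h u = deriv f1 u + om u \<tau> * f1 u"
    "\<And>u. u \<in> - mark \<tau> ` PP \<Longrightarrow> k u = deriv f2 u + om u \<tau> * f2 u"
    using assms(2,3) unfolding exact_def by blast
  have "deriv (\<lambda>u. a * f1 u + b * f2 u) u = a * deriv f1 u + b * deriv f2 u" if "u \<in> - mark \<tau> ` PP" for u
    by (intro DERIV_imp_deriv DERIV_add DERIV_cmult hf_deriv[OF f(1) \<tau> that] hf_deriv[OF f(2) \<tau> that])
  then show ?thesis unfolding exact_def
    by (intro bexI[of _ "\<lambda>u. a * f1 u + b * f2 u"]) (auto simp: f algebra_simps intro!: hf_linear)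
qed

lemma in_cl_iff: "Im \<tau> > 0 \<Longrightarrow> k \<in> cl \<tau> h \<longleftrightarrow> k \<in> hf \<tau> \<and> exact \<tau> (\<lambda>u. k u - h u)"
  by (auto simp: H1_class_def exact_def omega_eq_om)

lemma exact_zero: "exact \<tau> (\<lambda>u. 0)"
  unfolding exact_def by (intro bexI[OF _ hf_zero]) auto

lemma cl_self: "Im \<tau> > 0 \<Longrightarrow> h \<in> hf \<tau> \<Longrightarrow> h \<in> cl \<tau> h"
  using exact_zero by (simp add: in_cl_iff)

lemma exact_cong: "(\<And>u. u \<in> - mark \<tau> ` PP \<Longrightarrow> h u = k u) \<Longrightarrow> exact \<tau> h \<longleftrightarrow> exact \<tau> k"
  by (simp add: exact_def)

lemma cl_eqI:
  assumes \<tau>: "Im \<tau> > 0" and e: "exact \<tau> (\<lambda>u. h u - k u)"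
  shows "cl \<tau> h = cl \<tau> k"
proof -
  have "exact \<tau> (\<lambda>u. m u - h u) \<longleftrightarrow> exact \<tau> (\<lambda>u. m u - k u)" for m
    using exact_linear[OF \<tau> _ e, of "\<lambda>u. m u - h u" 1 1] exact_linear[OF \<tau> _ e, of "\<lambda>u. m u - k u" 1 "-1"]
    by (auto simp: algebra_simps)
  then show ?thesis using in_cl_iff[OF \<tau>] by blast
qed

lemma H1_scale_cl:
  assumes \<tau>: "Im \<tau> > 0" and h: "h \<in> hf \<tau>"
  shows "H1_scale \<alpha> a0 ai \<tau> c (cl \<tau> h) = cl \<tau> (\<lambda>u. c * h u)"
proof -
  have "cl \<tau> (\<lambda>u. c * h' u) = cl \<tau> (\<lambda>u. c * h u)" if "h' \<in> cl \<tau> h" for h'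
    using that exact_linear[OF \<tau>, of "\<lambda>u. h' u - h u" "\<lambda>u. h' u - h u" c 0]
    by (intro cl_eqI[OF \<tau>]) (simp add: in_cl_iff[OF \<tau>] right_diff_distrib)
  then have "(\<Union>h'\<in>cl \<tau> h. cl \<tau> (\<lambda>u. c * h' u)) = (\<Union>h'\<in>cl \<tau> h. cl \<tau> (\<lambda>u. c * h u))"
    by (rule SUP_cong[OF refl])
  also have "\<dots> = cl \<tau> (\<lambda>u. c * h u)" using cl_self[OF \<tau> h] by blast
  finally show ?thesis unfolding H1_scale_def .
qed

lemma H1_add_cl:
  assumes \<tau>: "Im \<tau> > 0" and h: "h \<in> hf \<tau>" and k: "k \<in> hf \<tau>"
  shows "H1_add (cl \<tau> h) (cl \<tau> k) = cl \<tau> (\<lambda>u. h u + k u)"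
proof (intro equalityI subsetI)
  fix m assume "m \<in> H1_add (cl \<tau> h) (cl \<tau> k)"
  then obtain h' k' where m: "m = (\<lambda>u. h' u + k' u)" "h' \<in> cl \<tau> h" "k' \<in> cl \<tau> k" by (auto simp: H1_add_def)
  then show "m \<in> cl \<tau> (\<lambda>u. h u + k u)"
    using exact_linear[OF \<tau>, of "\<lambda>u. h' u - h u" "\<lambda>u. k' u - k u" 1 1] hf_add
    by (auto simp: in_cl_iff[OF \<tau>] algebra_simps)
next
  fix m assume m: "m \<in> cl \<tau> (\<lambda>u. h u + k u)"
  then have "(\<lambda>u. m u - k u) \<in> cl \<tau> h"
    using hf_diff k by (auto simp: in_cl_iff[OF \<tau>] algebra_simps)
  then show "m \<in> H1_add (cl \<tau> h) (cl \<tau> k)"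
    unfolding H1_add_def mem_Collect_eq using cl_self[OF \<tau> k]
    by (intro exI[of _ "\<lambda>u. m u - k u"] exI[of _ k]) simp
qed

lemma form_pairing_exact_zero:
  assumes cyc: "flat_twisted_cycle \<alpha> a0 ai \<gamma>" and \<tau>: "Im \<tau> > 0" and h: "exact \<tau> h"
  shows "form_pairing \<tau> h \<gamma> = 0"
proof -
  obtain f where f: "f \<in> hf \<tau>" "\<And>u. u \<in> - mark \<tau> ` PP \<Longrightarrow> h u = deriv f u + om u \<tau> * f u"
    using h by (auto simp: exact_def)
  have "form_pairing \<tau> h \<gamma> = (\<Sum>(c, g, s)\<leftarrow>\<gamma>. c * (s (\<tau>, 1) * f (mark \<tau> (g 1)) - s (\<tau>, 0) * f (mark \<tau> (g 0))))"
    by (rule form_pairing_exact[OF cyc \<tau> hf_deriv[OF f(1) \<tau>]]) (use f in auto)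
  also have "\<dots> = 0"
    by (rule cycle_sum[OF cyc \<tau>]) (use f(1) mark_image_PP[OF \<tau>] in \<open>auto simp: hol_fun_def\<close>)
  finally show ?thesis .
qed

lemma H1_pairing_cl:
  assumes cyc: "flat_twisted_cycle \<alpha> a0 ai \<gamma>" and \<tau>: "Im \<tau> > 0" and h: "h \<in> hf \<tau>"
  shows "H1_pairing \<tau> (cl \<tau> h) \<gamma> = form_pairing \<tau> h \<gamma>"
proof -
  have "form_pairing \<tau> k \<gamma> = form_pairing \<tau> h \<gamma>" if k: "k \<in> cl \<tau> h" for k
  proof -
    have kh: "k \<in> hf \<tau>" "exact \<tau> (\<lambda>u. k u - h u)" using k by (auto simp: in_cl_iff[OF \<tau>])
    have "form_pairing \<tau> (\<lambda>u. 1 * k u + (-1) * h u) \<gamma> = 1 * form_pairing \<tau> k \<gamma> + (-1) * form_pairing \<tau> h \<gamma>"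
      by (rule form_pairing_linear[OF cyc \<tau>]) (use kh h in \<open>auto simp: hol_fun_def\<close>)
    then show ?thesis using form_pairing_exact_zero[OF cyc \<tau> kh(2)] by simp
  qed
  then show ?thesis unfolding H1_pairing_def
    using cl_self[OF \<tau> h] by (intro the_equality ballI) (blast, metis)
qed

end

section \<open>The derivative of the pairing with a flat cycle\<close>

lemma DERIV_sum_list:
  assumes "\<And>x. x \<in> set xs \<Longrightarrow> (f x has_field_derivative f' x) (at t)"
  shows "((\<lambda>t. \<Sum>x\<leftarrow>xs. f x t) has_field_derivative (\<Sum>x\<leftarrow>xs. f' x)) (at t)"
  using assms by (induction xs) (auto intro!: DERIV_add)

context params
begin

text \<open>The additional argument is the second real coordinate of the point. Several
  combinations, such as \<open>Gt + y om\<close>, are periodic only if \<open>y\<close> increases by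
  1 together with the shift by \<tau>.\<close>

lemma mark_periodic:
  fixes F :: "complex \<Rightarrow> real \<Rightarrow> 'a"
  assumes "\<And>u y. u \<notin> mark \<tau> ` PP \<Longrightarrow> F (u + 1) y = F u y"
    and "\<And>u y. u \<notin> mark \<tau> ` PP \<Longrightarrow> F (u + \<tau>) (y + 1) = F u y"
    and "Im \<tau> > 0" "z \<notin> PP" "l \<in> gauss_lattice"
  shows "F (mark \<tau> (z + l)) (Im (z + l)) = F (mark \<tau> z) (Im z)"
proof -
  \<comment> \<open>A constant dummy value at the punctures makes the function periodic everywhere;
    in real coordinates the shifts are by \<open>1\<close> and \<open>\<i>\<close>.\<close>
  define f where "f z = (if z \<in> PP then undefined else F (mark \<tau> z) (Im z))" for z
  have l1: "1 \<in> gauss_lattice" "\<i> \<in> gauss_lattice" by (auto simp: gauss_lattice_ReIm)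
  have m: "mark \<tau> 1 = 1" "mark \<tau> \<i> = \<tau>" by (simp_all add: mark_def)
  have "f (z + mark \<i> l) = f z"
  proof (rule periodic_lattice[OF _ _ assms(5)])
    show "f (u + 1) = f u" for u
      using punctures_shift[OF l1(1), of u] assms(1)[of "mark \<tau> u" "Im u"] mark_image_PP[OF assms(3), of u]
      by (auto simp: f_def m)
    show "f (u + \<i>) = f u" for u
      using punctures_shift[OF l1(2), of u] assms(2)[of "mark \<tau> u" "Im u"] mark_image_PP[OF assms(3), of u]
      by (auto simp: f_def m)
  qed
  then show ?thesis using assms(4) punctures_shift[OF assms(5), of z] by (simp add: f_def)
qed

lemma r1_hf: "Im \<tau> > 0 \<Longrightarrow> (\<lambda>u. r1 u \<tau>) \<in> hf \<tau>"
  unfolding hol_fun_def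
proof (intro CollectI conjI ballI)
  assume \<tau>: "Im \<tau> > 0"
  show "(\<lambda>u. r1 u \<tau>) holomorphic_on - mark \<tau> ` PP"
    unfolding holomorphic_on_def field_differentiable_def
  proof (intro ballI exI)
    fix u assume "u \<in> - mark \<tau> ` PP"
    then show "((\<lambda>u. r1 u \<tau>) has_field_derivative r2 u \<tau> * 1) (at u within - mark \<tau> ` PP)"
      using not_puncture[OF \<tau>] by (intro rho_derivs(2)[OF \<tau> DERIV_ident]) auto
  qed
  fix u l assume u: "u \<in> - mark \<tau> ` PP" and l: "l \<in> gauss_lattice"
  define z where "z = unmark \<tau> u"
  have uz: "u = mark \<tau> z" using \<tau> by (simp add: z_def)
  then have "z \<notin> PP" using u by auto
  from mark_periodic[of \<tau> "\<lambda>u y. r1 u \<tau>", OF _ _ \<tau> this l]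
  show "r1 (u + mark \<tau> l) \<tau> = r1 u \<tau>"
    using r_shift_1(1) r_shift_tau(1)[OF \<tau>] not_puncture[OF \<tau>] by (simp add: uz)
qed

lemma nice_one: "nice (\<lambda>u \<tau>. 1) (\<lambda>u \<tau>. 0) (\<lambda>u \<tau>. 0)"
  by (auto simp: nice_def)

lemma qq_dom_continuous: "continuous_on dom (\<lambda>p. qq n (fst p) (snd p))"
  by (intro continuous_intros) (auto simp: dom_def not_puncture)

lemma nice_r1: "nice r1 r2 (\<lambda>u \<tau>. q2'' u \<tau> / (2 * kap))"
  unfolding nice_def
proof (intro conjI allI impI)
  fix \<tau> u assume \<tau>: "Im \<tau> > 0" and "u \<notin> mark \<tau> ` PP"
  then show "((\<lambda>u. r1 u \<tau>) has_field_derivative r2 u \<tau>) (at u)"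
    using rho_derivs(2)[OF \<tau> DERIV_ident, of u] not_puncture by simp
next
  fix \<tau> z assume \<tau>: "Im \<tau> > 0" and "z \<notin> PP"
  then have "th 0 (mark \<tau> z) \<tau> \<noteq> 0" using not_puncture[OF \<tau> mark_image_PP[OF \<tau>]] by auto
  from r1_chain[OF mark_deriv_tau DERIV_ident \<tau> this]
  show "((\<lambda>\<tau>. r1 (mark \<tau> z) \<tau>) has_field_derivative r2 (mark \<tau> z) \<tau> * of_real (Im z) + q2'' (mark \<tau> z) \<tau> / (2 * kap)) (at \<tau>)"
    by simp
next
  fix \<tau> :: complex assume \<tau>: "Im \<tau> > 0"
  have "(\<lambda>u. q2' u \<tau>) holomorphic_on - mark \<tau> ` PP"
    using q2'_deriv_u[OF \<tau> DERIV_ident] not_puncture[OF \<tau>]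
    by (auto simp: holomorphic_on_def field_differentiable_def)
  then have "deriv (\<lambda>u. q2' u \<tau>) holomorphic_on - mark \<tau> ` PP"
    using open_compl_punctures[OF \<tau>] by (rule holomorphic_deriv)
  moreover have "deriv (\<lambda>u. q2' u \<tau>) u = q2'' u \<tau>" if "u \<in> - mark \<tau> ` PP" for u
    using q2'_deriv_u[OF \<tau> DERIV_ident, of u] not_puncture[OF \<tau>] that by (intro DERIV_imp_deriv) auto
  ultimately have "(\<lambda>u. q2'' u \<tau>) holomorphic_on - mark \<tau> ` PP"
    by (rule holomorphic_transform)
  then show "(\<lambda>u. q2'' u \<tau> / (2 * kap)) holomorphic_on - mark \<tau> ` PP"
    by (intro holomorphic_intros) auto
qed (auto simp: r1_def r2_def r3_def q2''_def intro!: continuous_intros qq_dom_continuous)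

text \<open>Two boundary sums appear, one from the moving end points with weight
  \<open>Im z * H\<close> and one from the primitive \<open>e\<close>. The hypothesis on
  \<open>e (u + \<tau>)\<close> says exactly that \<open>e + Im z * H\<close> is periodic, so
  together they vanish on a cycle.\<close>

lemma pairing_deriv:
  assumes cyc: "flat_twisted_cycle \<alpha> a0 ai \<gamma>" and \<tau>: "Im \<tau> > 0" and H: "nice H Hu Ht"
    and e: "\<And>u. u \<notin> mark \<tau> ` PP \<Longrightarrow> (e has_field_derivative e' u) (at u)"
    and M: "M holomorphic_on - mark \<tau> ` PP"
    and T: "\<And>u. u \<notin> mark \<tau> ` PP \<Longrightarrow> TH H Ht u \<tau> = M u + (e' u + om u \<tau> * e u)"
    and per: "\<And>u. u \<notin> mark \<tau> ` PP \<Longrightarrow> e (u + 1) = e u" "\<And>u. u \<notin> mark \<tau> ` PP \<Longrightarrow> e (u + \<tau>) = e u - H u \<tau>"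
      "\<And>u. u \<notin> mark \<tau> ` PP \<Longrightarrow> H (u + 1) \<tau> = H u \<tau>" "\<And>u. u \<notin> mark \<tau> ` PP \<Longrightarrow> H (u + \<tau>) \<tau> = H u \<tau>"
  shows "((\<lambda>\<tau>. form_pairing \<tau> (\<lambda>u. H u \<tau>) \<gamma>) has_field_derivative form_pairing \<tau> M \<gamma>) (at \<tau>)"
proof -
  let ?b = "\<lambda>s g. s (\<tau>, 1) * H (mark \<tau> (g 1)) \<tau> * of_real (Im (g 1)) - s (\<tau>, 0) * H (mark \<tau> (g 0)) \<tau> * of_real (Im (g 0))"
  have d: "((\<lambda>\<tau>. c * Ii s g (pd g) 0 1 (\<lambda>u. H u \<tau>) \<tau>) has_field_derivative
      c * (Ii s g (pd g) 0 1 (\<lambda>u. TH H Ht u \<tau>) \<tau> + ?b s g)) (at \<tau>)" if "(c, g, s) \<in> set \<gamma>" for c g s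
  proof -
    note cc = flat_cycleD[OF cyc that]
    obtain K where K: "finite K" "\<And>x. x \<in> {0<..<1} - K \<Longrightarrow> (g has_vector_derivative pd g x) (at x)"
      using valid_path_pd[OF cc(1)] by blast
    show ?thesis
      by (intro DERIV_cmult path_deriv[OF _ valid_path_cont[OF cc(1)] K cc(2,3) \<tau> H]) auto
  qed
  have "((\<lambda>\<tau>. \<Sum>(c, g, s)\<leftarrow>\<gamma>. c * Ii s g (pd g) 0 1 (\<lambda>u. H u \<tau>) \<tau>) has_field_derivative
      (\<Sum>(c, g, s)\<leftarrow>\<gamma>. c * (Ii s g (pd g) 0 1 (\<lambda>u. TH H Ht u \<tau>) \<tau> + ?b s g))) (at \<tau>)"
    unfolding case_prod_unfold
    by (rule DERIV_sum_list[where f = "\<lambda>x \<tau>. fst x * Ii (snd (snd x)) (fst (snd x)) (pd (fst (snd x))) 0 1 (\<lambda>u. H u \<tau>) \<tau>"])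
       (use d in auto)
  moreover have "(\<Sum>(c, g, s)\<leftarrow>\<gamma>. c * (Ii s g (pd g) 0 1 (\<lambda>u. TH H Ht u \<tau>) \<tau> + ?b s g)) =
      form_pairing \<tau> (\<lambda>u. TH H Ht u \<tau>) \<gamma> + (\<Sum>(c, g, s)\<leftarrow>\<gamma>. c * ?b s g)"
    unfolding form_pairing_Ii[OF cyc] by (simp add: case_prod_unfold distrib_left sum_list_addf)
  moreover have "form_pairing \<tau> (\<lambda>u. TH H Ht u \<tau>) \<gamma> = form_pairing \<tau> M \<gamma> +
      (\<Sum>(c, g, s)\<leftarrow>\<gamma>. c * (s (\<tau>, 1) * e (mark \<tau> (g 1)) - s (\<tau>, 0) * e (mark \<tau> (g 0))))"
  proof -
    have "form_pairing \<tau> (\<lambda>u. 1 * TH H Ht u \<tau> + (-1) * M u) \<gamma> = 1 * form_pairing \<tau> (\<lambda>u. TH H Ht u \<tau>) \<gamma> + (-1) * form_pairing \<tau> M \<gamma>"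
      by (rule form_pairing_linear[OF cyc \<tau> TH_hol[OF H \<tau>] M])
    moreover have "form_pairing \<tau> (\<lambda>u. 1 * TH H Ht u \<tau> + (-1) * M u) \<gamma> =
      (\<Sum>(c, g, s)\<leftarrow>\<gamma>. c * (s (\<tau>, 1) * e (mark \<tau> (g 1)) - s (\<tau>, 0) * e (mark \<tau> (g 0))))"
      by (rule form_pairing_exact[OF cyc \<tau> e]) (use T in auto)
    ultimately show ?thesis by (simp add: algebra_simps)
  qed
  moreover have "(\<Sum>(c, g, s)\<leftarrow>\<gamma>. c * (s (\<tau>, 1) * e (mark \<tau> (g 1)) - s (\<tau>, 0) * e (mark \<tau> (g 0)))) + (\<Sum>(c, g, s)\<leftarrow>\<gamma>. c * ?b s g) = 0"
  proof -
    define F where "F z = e (mark \<tau> z) + H (mark \<tau> z) \<tau> * of_real (Im z)" for z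
    have "(\<Sum>(c, g, s)\<leftarrow>\<gamma>. c * (s (\<tau>, 1) * F (g 1) - s (\<tau>, 0) * F (g 0))) = 0"
    proof (rule cycle_sum[OF cyc \<tau>])
      fix z l assume z: "z \<notin> PP" and l: "l \<in> gauss_lattice"
      show "F (z + l) = F z" unfolding F_def
        by (rule mark_periodic[of \<tau> "\<lambda>u y. e u + H u \<tau> * of_real y", OF _ _ \<tau> z l])
           (use per in \<open>auto simp: algebra_simps\<close>)
    qed
    then show ?thesis
      by (simp add: F_def case_prod_unfold sum_list_addf [symmetric] algebra_simps)
  qed
  ultimately show ?thesis unfolding form_pairing_Ii[OF cyc] by (simp add: add.assoc)
qed

lemma e0_shift:
  assumes "Im \<tau> > 0" "u \<notin> mark \<tau> ` PP"
  shows "e0 (u + 1) \<tau> = e0 u \<tau>" "e0 (u + \<tau>) \<tau> = e0 u \<tau> - 1"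
  using qq_shift_1[of 1 u \<tau>] qq_shift_tau(1)[OF assms(1) not_puncture(1)[OF assms]]
  by (simp_all add: e0_def diff_divide_distrib)

lemma q2'_shift:
  assumes "Im \<tau> > 0" "u \<notin> mark \<tau> ` PP"
  shows "q2' (u + 1) \<tau> = q2' u \<tau>" "q2' (u + \<tau>) \<tau> = q2' u \<tau> - 2 * kap * r1 u \<tau>"
  unfolding q2'_eq r_shift_1 qq_shift_1 r_shift_tau[OF assms(1) not_puncture(1)[OF assms]] qq_shift_tau(1)[OF assms(1) not_puncture(1)[OF assms]]
  by (simp_all add: algebra_simps)

lemma e1_shift:
  assumes "Im \<tau> > 0" "u \<notin> mark \<tau> ` PP"
  shows "e1 (u + 1) \<tau> = e1 u \<tau>" "e1 (u + \<tau>) \<tau> = e1 u \<tau> - r1 u \<tau>"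
  unfolding e1_def q2'_shift[OF assms] by (simp_all add: diff_divide_distrib)

definition N0 :: "complex \<Rightarrow> complex \<Rightarrow> complex" where "N0 \<tau> u = M11 \<tau> * 1 + M12 * r1 u \<tau>"
definition N1 :: "complex \<Rightarrow> complex \<Rightarrow> complex" where "N1 \<tau> u = M21 \<tau> * 1 + M22 \<tau> * r1 u \<tau>"

lemma N_hf: "Im \<tau> > 0 \<Longrightarrow> N0 \<tau> \<in> hf \<tau>" "Im \<tau> > 0 \<Longrightarrow> N1 \<tau> \<in> hf \<tau>"
  unfolding N0_def[abs_def] N1_def[abs_def] by (intro hf_linear hf_one r1_hf; simp)+

lemma pairing_deriv_0:
  assumes cyc: "flat_twisted_cycle \<alpha> a0 ai \<gamma>" and \<tau>: "Im \<tau> > 0"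
  shows "((\<lambda>\<tau>. form_pairing \<tau> (\<lambda>u. 1) \<gamma>) has_field_derivative form_pairing \<tau> (N0 \<tau>) \<gamma>) (at \<tau>)"
proof (rule pairing_deriv[OF cyc \<tau> nice_one e0_deriv_u[OF \<tau>]])
  show "N0 \<tau> holomorphic_on - mark \<tau> ` PP" using N_hf[OF \<tau>] by (simp add: hol_fun_def)
  fix u assume u: "u \<notin> mark \<tau> ` PP"
  show "th 0 u \<tau> \<noteq> 0" using not_puncture[OF \<tau> u] by simp
  show "TH (\<lambda>u \<tau>. 1) (\<lambda>u \<tau>. 0) u \<tau> = N0 \<tau> u + (r1 u \<tau> / kap + om u \<tau> * e0 u \<tau>)"
    using row0[OF \<tau> not_puncture[OF \<tau> u]] by (simp add: TH_def N0_def M12_def field_simps)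
qed (use e0_shift[OF \<tau>] in auto)

lemma pairing_deriv_1:
  assumes cyc: "flat_twisted_cycle \<alpha> a0 ai \<gamma>" and \<tau>: "Im \<tau> > 0"
  shows "((\<lambda>\<tau>. form_pairing \<tau> (\<lambda>u. r1 u \<tau>) \<gamma>) has_field_derivative form_pairing \<tau> (N1 \<tau>) \<gamma>) (at \<tau>)"
proof (rule pairing_deriv[OF cyc \<tau> nice_r1 e1_deriv_u[OF \<tau>]])
  show "N1 \<tau> holomorphic_on - mark \<tau> ` PP" using N_hf[OF \<tau>] by (simp add: hol_fun_def)
  fix u assume u: "u \<notin> mark \<tau> ` PP"
  show "th 0 u \<tau> \<noteq> 0" using not_puncture[OF \<tau> u] by simp
  show "TH r1 (\<lambda>u \<tau>. q2'' u \<tau> / (2 * kap)) u \<tau> = N1 \<tau> u + (q2'' u \<tau> / (2 * kap) + om u \<tau> * e1 u \<tau>)"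
    using row1[OF \<tau> not_puncture[OF \<tau> u]] by (simp add: TH_def N1_def)
qed (use e1_shift[OF \<tau>] r_shift_1 r_shift_tau(1)[OF \<tau>] not_puncture[OF \<tau>] in auto)

lemma sec_eq:
  assumes "Im \<tau> > 0"
  shows "sec0 \<alpha> a0 ai \<tau> = cl \<tau> (\<lambda>u. 1)" "sec1 \<alpha> a0 ai \<tau> = cl \<tau> (\<lambda>u. r1 u \<tau>)"
proof -
  show "sec0 \<alpha> a0 ai \<tau> = cl \<tau> (\<lambda>u. 1)" using assms by (simp add: sec0_def)
  have "exact \<tau> (\<lambda>u. rho_d 1 u \<tau> - r1 u \<tau>)"
    using exact_zero[of \<tau>] rho_d_eq(1)[OF assms] not_puncture[OF assms] by (subst exact_cong) auto
  then show "sec1 \<alpha> a0 ai \<tau> = cl \<tau> (\<lambda>u. r1 u \<tau>)"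
    using cl_eqI[OF assms] assms by (simp add: sec1_def)
qed

section \<open>The Gauss--Manin connection\<close>

lemma branch_end:
  assumes "Tbr (UHP \<times> {0..1::real}) (along g) s" "y \<in> {0..1}"
  shows "Tbr UHP (\<lambda>\<tau>. (\<tau>, mark \<tau> (g y))) (\<lambda>\<tau>. s (\<tau>, y))"
  by (rule branch_cong[OF branch_comp[OF assms(1), of UHP "\<lambda>\<tau>. (\<tau>, y)"]])
     (use assms(2) in \<open>auto intro!: continuous_intros\<close>)

text \<open>A flat cycle has to close for every \<tau> at once. Over the connected half-plane the
  ratio of two branches at end points that agree modulo the lattice is constant, so closing at one
  \<tau> suffices.\<close>

lemma branch_ratio:
  assumes B: "Tbr UHP (\<lambda>\<tau>. (\<tau>, mark \<tau> z)) B" "Tbr UHP (\<lambda>\<tau>. (\<tau>, mark \<tau> w)) C"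
    and l: "w - z \<in> gauss_lattice"
  obtains k where "k \<noteq> 0" "\<And>\<tau>. Im \<tau> > 0 \<Longrightarrow> C \<tau> = k * B \<tau>"
proof -
  obtain c where c: "norm c = 1" "Tbr UHP (\<lambda>\<tau>. (\<tau>, mark \<tau> w)) (\<lambda>\<tau>. c * B \<tau>)"
  proof -
    have "continuous_on UHP (\<lambda>\<tau>. (\<tau>, mark \<tau> z))" by (intro continuous_intros)
    from branch_shift[OF B(1) this l, of "\<lambda>\<tau>. (\<tau>, mark \<tau> w)"] show ?thesis using that by auto
  qed
  obtain d where "d \<noteq> 0" "\<And>\<tau>. \<tau> \<in> UHP \<Longrightarrow> C \<tau> = d * (c * B \<tau>)"
    using branch_unique[OF convex_connected[OF convex_UHP] c(2) B(2)] by metis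
  then show ?thesis using c(1) that[of "d * c"] by force
qed

text \<open>The loop is a small circle around 0 in real coordinates. Along it the logarithm of
  \<open>\<theta>(u)\<close> increases by \<open>2 \<pi> i\<close>, whereas that of
  \<open>\<theta>(u - t)\<close> returns to its value, because the disc contains no translate of
  \<open>t\<close>.\<close>

lemma circle_cycle:
  obtains g s where "valid_path g" "g 0 = g 1" "g ` {0..1} \<inter> PP = {}"
    "Tbr (UHP \<times> {0..1::real}) (along g) s"
    "\<And>\<tau>. Im \<tau> > 0 \<Longrightarrow> s (\<tau>, 1) = exp (al * kap) * s (\<tau>, 0)"
proof -
  obtain e where e: "e > 0" "\<And>z. z \<in> PP \<Longrightarrow> z \<noteq> 0 \<Longrightarrow> e \<le> norm z"
  proof -
    have "\<not> 0 islimpt PP" by (rule not_islimpt_PP)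
    then obtain e where "e > 0" "\<forall>z\<in>PP. z \<noteq> 0 \<longrightarrow> e \<le> dist z 0" unfolding islimpt_approachable by (auto simp: not_less)
    then show ?thesis using that by auto
  qed
  have t0: "tmark \<alpha> a0 ai \<notin> gauss_lattice" by (rule tmark_notin)
  define r where "r = e / 2"
  define D where "D = ball (0::complex) e"
  have r: "0 < r" "r < e" using e(1) by (auto simp: r_def)
  define g where "g = circlepath 0 r"
  have gx: "g x = of_real r * exp (kap * of_real x)" for x by (simp add: g_def circlepath kap_def mult_ac)
  have ng: "norm (g x) = r" for x
    unfolding gx using r by (simp add: norm_mult kap_def)
  have gP: "g ` {0..1} \<inter> PP = {}"
    using ng e(2) r by (force simp: disjoint_iff)
  have gD: "g x \<in> D" for x using ng r by (simp add: D_def)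
  have cg: "continuous_on S g" for S unfolding gx[abs_def] by (intro continuous_intros)
  obtain s where s: "Tbr (UHP \<times> {0..1::real}) (along g) s"
  proof (rule branch_exists[of "UHP \<times> {0..1::real}" "\<lambda>(\<tau>, x). (\<tau>, mark \<tau> (g x))"])
    show "contractible (UHP \<times> {0..1::real})" by (intro convex_imp_contractible convex_Times convex_UHP) auto
    show "continuous_on (UHP \<times> {0..1}) (along g)"
      unfolding case_prod_unfold by (intro continuous_intros continuous_on_compose2[OF cg[of UNIV]]) auto
    show "snd (case p of (\<tau>, x) \<Rightarrow> (\<tau>, mark \<tau> (g x))) \<notin> mark (fst (case p of (\<tau>, x) \<Rightarrow> (\<tau>, mark \<tau> (g x)))) ` PP"
      if "p \<in> UHP \<times> {0..1}" for p
    proof -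
      have "Im (fst p) > 0" "g (snd p) \<notin> PP" using that gP by (auto simp: disjoint_iff)
      from mark_image_PP[OF this] show ?thesis by (simp add: case_prod_unfold)
    qed
  qed auto
  obtain L L' where L: "continuous_on (UHP \<times> {0..1::real}) L" "continuous_on (UHP \<times> {0..1::real}) L'"
    "\<And>\<tau> x. Im \<tau> > 0 \<Longrightarrow> x \<in> {0..1} \<Longrightarrow> exp (L (\<tau>, x)) = th 0 (mark \<tau> (g x)) \<tau>"
    "\<And>\<tau> x. Im \<tau> > 0 \<Longrightarrow> x \<in> {0..1} \<Longrightarrow> exp (L' (\<tau>, x)) = th 0 (mark \<tau> (g x) - tt \<tau>) \<tau>"
    "\<And>\<tau> x. Im \<tau> > 0 \<Longrightarrow> x \<in> {0..1} \<Longrightarrow> s (\<tau>, x) = exp (be * mark \<tau> (g x) + al * L (\<tau>, x) - al * L' (\<tau>, x))"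
  proof -
    obtain L L' where "continuous_on (UHP \<times> {0..1::real}) L" "continuous_on (UHP \<times> {0..1::real}) L'"
      "\<And>x. x \<in> UHP \<times> {0..1::real} \<Longrightarrow> exp (L x) = th 0 (snd (case x of (\<tau>, x) \<Rightarrow> (\<tau>, mark \<tau> (g x)))) (fst (case x of (\<tau>, x) \<Rightarrow> (\<tau>, mark \<tau> (g x))))"
      "\<And>x. x \<in> UHP \<times> {0..1::real} \<Longrightarrow> exp (L' x) = th 0 (snd (case x of (\<tau>, x) \<Rightarrow> (\<tau>, mark \<tau> (g x))) - tt (fst (case x of (\<tau>, x) \<Rightarrow> (\<tau>, mark \<tau> (g x))))) (fst (case x of (\<tau>, x) \<Rightarrow> (\<tau>, mark \<tau> (g x))))"
      "\<And>x. x \<in> UHP \<times> {0..1::real} \<Longrightarrow> s x = exp (be * snd (case x of (\<tau>, x) \<Rightarrow> (\<tau>, mark \<tau> (g x))) + al * L x - al * L' x)"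
      using branchE[OF s] by blast
    then show ?thesis by (intro that[of L L']) auto
  qed
  have g01: "g 0 = g 1" using exp_kap_of_int[of 1] by (simp add: gx)
  have conU: "connected UHP" by (rule convex_connected[OF convex_UHP])
  have conU1: "connected (UHP \<times> {0..1::real})" by (intro connected_Times conU) auto
  \<comment> \<open>The second theta factor has no zero over the whole disc, so its logarithm exists
    there and takes equal values at the coinciding ends of the circle.\<close>
  have L'1: "L' (\<tau>, 1) = L' (\<tau>, 0)" if \<tau>: "Im \<tau> > 0" for \<tau>
  proof -
    have "convex (UHP \<times> D)" by (auto simp: D_def intro!: convex_Times convex_UHP)
    moreover have "continuous_on (UHP \<times> D) (\<lambda>p. th 0 (mark (fst p) (snd p) - tt (fst p)) (fst p))"
      unfolding tpt_def by (intro continuous_intros) auto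
    moreover have "th 0 (mark (fst p) (snd p) - tt (fst p)) (fst p) \<noteq> 0" if "p \<in> UHP \<times> D" for p
    proof
      assume "th 0 (mark (fst p) (snd p) - tt (fst p)) (fst p) = 0"
      then have "snd p - tmark \<alpha> a0 ai \<in> gauss_lattice"
        using that th0_mark_eq_0[of "fst p" "snd p - tmark \<alpha> a0 ai"] by (auto simp: tt_mark)
      moreover have "- tmark \<alpha> a0 ai \<notin> gauss_lattice"
        using t0 gauss_lattice_closed(4)[of "- tmark \<alpha> a0 ai"] by auto
      ultimately have "snd p \<in> PP" "snd p \<noteq> 0" by (auto simp: punctures_iff)
      then show False using e(2)[of "snd p"] that by (auto simp: D_def)
    qed
    ultimately obtain N where N: "continuous_on (UHP \<times> D) N" "\<And>p. p \<in> UHP \<times> D \<Longrightarrow> th 0 (mark (fst p) (snd p) - tt (fst p)) (fst p) = exp (N p)"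
      using continuous_logarithm_on_contractible[OF _ convex_imp_contractible] by blast
    have cN: "continuous_on (UHP \<times> {0..1::real}) (\<lambda>p. N (fst p, g (snd p)))"
      by (rule continuous_on_compose2[OF N(1)])
         (use gD in \<open>auto intro!: continuous_intros continuous_on_compose2[OF cg[of UNIV]]\<close>)
    obtain n where n: "\<And>p. p \<in> UHP \<times> {0..1::real} \<Longrightarrow> (L' p - N (fst p, g (snd p))) / kap = of_int n"
    proof (rule connected_integer_valued[OF conU1, of "\<lambda>p. (L' p - N (fst p, g (snd p))) / kap"])
      show "continuous_on (UHP \<times> {0..1}) (\<lambda>p. (L' p - N (fst p, g (snd p))) / kap)"
        by (intro continuous_intros L cN) auto
      show "(L' p - N (fst p, g (snd p))) / kap \<in> \<int>" if "p \<in> UHP \<times> {0..1}" for p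
        using exp_eq_imp_kap[of "L' p" "N (fst p, g (snd p))"] L(4)[of "fst p" "snd p"] N(2)[of "(fst p, g (snd p))"] that gD by auto
    qed blast
    from n[of "(\<tau>, 0)"] n[of "(\<tau>, 1)"] show ?thesis using \<tau> g01 by (simp add: divide_eq_eq diff_eq_eq)
  qed
  obtain n where n: "\<And>\<tau>. \<tau> \<in> UHP \<Longrightarrow> (L (\<tau>, 1) - L (\<tau>, 0)) / kap = of_int n"
  proof (rule connected_integer_valued[OF conU, of "\<lambda>\<tau>. (L (\<tau>, 1) - L (\<tau>, 0)) / kap"])
    show "continuous_on UHP (\<lambda>\<tau>. (L (\<tau>, 1) - L (\<tau>, 0)) / kap)"
      by (intro continuous_intros continuous_on_compose2[OF L(1)]) auto
    show "(L (\<tau>, 1) - L (\<tau>, 0)) / kap \<in> \<int>" if "\<tau> \<in> UHP" for \<tau>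
      using exp_eq_imp_kap[of "L (\<tau>, 1)" "L (\<tau>, 0)"] L(3)[of \<tau> 0] L(3)[of \<tau> 1] that g01 by auto
  qed blast
  \<comment> \<open>The winding number does not depend on \<tau>. At \<open>\<i>\<close> the loop is
    a genuine circle, and \<theta> is \<open>u\<close> times a function without zeros on the
    disc.\<close>
  have n1: "n = 1"
  proof -
    have i: "Im \<i> > 0" by simp
    obtain W where W: "W holomorphic_on UNIV" "\<And>u. th 0 u \<i> = u * W u" "W 0 = th 1 0 \<i>"
      using th0_factor_at_0[OF i] by metis
    have W0: "W z \<noteq> 0" if "z \<in> D" for z
    proof (cases "z = 0")
      case True
      then show ?thesis using W(3) th1_0_nonzero[OF i] by (simp add: One_nat_def)
    next
      case False
      show ?thesis
      proof
        assume "W z = 0"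
        then have "th 0 (mark \<i> z) \<i> = 0" using W(2)[of z] by simp
        then have "z \<in> PP" using th0_mark_eq_0[OF i] by (simp add: punctures_iff)
        then show False using e(2)[of z] that False by (simp add: D_def)
      qed
    qed
    have "convex D" by (simp add: D_def)
    then obtain N where N: "continuous_on D N" "\<And>z. z \<in> D \<Longrightarrow> W z = exp (N z)"
      using continuous_logarithm_on_contractible[OF holomorphic_on_imp_continuous_on[OF holomorphic_on_subset[OF W(1)]] convex_imp_contractible] W0
      by (metis subset_UNIV)
    define Q where "Q x = of_real (ln r) + kap * of_real x + N (g x)" for x
    have cQ: "continuous_on {0..1} Q" unfolding Q_def
      by (intro continuous_intros continuous_on_compose2[OF N(1) cg]) (use gD in auto)
    have Qe: "exp (Q x) = th 0 (mark \<i> (g x)) \<i>" for x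
      unfolding Q_def exp_add using N(2)[OF gD[of x]] r W(2)[of "g x"] by (simp add: gx exp_of_real)
    obtain m where m: "\<And>x. x \<in> {0..1::real} \<Longrightarrow> (L (\<i>, x) - Q x) / kap = of_int m"
    proof (rule connected_integer_valued[of "{0..1::real}" "\<lambda>x. (L (\<i>, x) - Q x) / kap"])
      show "continuous_on {0..1} (\<lambda>x. (L (\<i>, x) - Q x) / kap)"
        by (intro continuous_intros continuous_on_compose2[OF L(1)] cQ) auto
      show "(L (\<i>, x) - Q x) / kap \<in> \<int>" if "x \<in> {0..1}" for x
        using exp_eq_imp_kap[of "L (\<i>, x)" "Q x"] L(3)[OF i that] Qe by simp
    qed auto
    have "L (\<i>, 1) - L (\<i>, 0) = Q 1 - Q 0" using m[of 0] m[of 1] by (simp add: divide_eq_eq diff_eq_eq)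
    also have "\<dots> = kap" using g01 by (simp add: Q_def)
    finally show ?thesis using n[of \<i>] by simp
  qed
  show ?thesis
  proof (rule that[OF _ g01 gP s])
    show "valid_path g" by (simp add: g_def)
    fix \<tau> :: complex assume \<tau>: "Im \<tau> > 0"
    have "L (\<tau>, 1) = L (\<tau>, 0) + kap" using n[of \<tau>] \<tau> n1 by (simp add: divide_eq_eq diff_eq_eq)
    then show "s (\<tau>, 1) = exp (al * kap) * s (\<tau>, 0)"
      using L(5)[OF \<tau>, of 0] L(5)[OF \<tau>, of 1] L'1[OF \<tau>] g01
      by (simp add: exp_add [symmetric] algebra_simps)
  qed
qed

lemma exp_al_kap: "exp (al * kap) \<noteq> 1"
proof
  assume "exp (al * kap) = 1"
  then obtain n :: int where "2 * pi * \<alpha> = of_int (2 * n) * pi"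
    by (auto simp: exp_eq_1 kap_def)
  then have "\<alpha> = of_int n" by simp
  then show False using al_pos al_lt1 by simp
qed

text \<open>A form \<open>h\<close> with vanishing twisted periods has the primitive \<open>f = T\<^sup>-\<^sup>1 (\<integral> T h)\<close>, where the integral
  starts with \<open>(e\<^sup>2\<^sup>\<pi>\<^sup>i\<^sup>\<alpha> - 1)\<^sup>-\<^sup>1\<close> times a loop around the puncture \<open>0\<close>, so that it has no boundary there.\<close>

lemma pairing_nondegenerate:
  assumes \<tau>: "Im \<tau> > 0" and h: "h \<in> hf \<tau>"
    and zero: "\<And>\<gamma>. flat_twisted_cycle \<alpha> a0 ai \<gamma> \<Longrightarrow> form_pairing \<tau> h \<gamma> = 0"
  shows "exact \<tau> h"
proof -
  obtain g0 s0 where g0: "valid_path g0" "g0 0 = g0 1" "g0 ` {0..1} \<inter> PP = {}"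
    "Tbr (UHP \<times> {0..1::real}) (along g0) s0"
    "\<And>\<tau>. Im \<tau> > 0 \<Longrightarrow> s0 (\<tau>, 1) = exp (al * kap) * s0 (\<tau>, 0)"
    using circle_cycle by blast
  define d0 where "d0 = exp (al * kap) - 1"
  have d0: "d0 \<noteq> 0" using exp_al_kap by (simp add: d0_def)
  have hol: "h holomorphic_on - mark \<tau> ` PP" using h by (simp add: hol_fun_def)
  have opP: "open (- PP)" using open_compl_punctures[of \<i>] by simp
  have cntG: "countable gauss_lattice"
  proof -
    have "gauss_lattice = (\<lambda>(m, n). Complex (of_int m) (of_int n)) ` (UNIV :: (int \<times> int) set)"
      by (auto simp: gauss_lattice_def)
    then show ?thesis by (metis countable_image countableI_type)
  qed
  have cntP: "countable PP"
    unfolding punctures_def by (intro countable_Un countable_image cntG)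
  have conP: "connected (- PP)"
    using path_connected_complement_countable[OF _ cntP] path_connected_imp_connected by (simp add: DIM_complex)
  have ex: "\<exists>p s. valid_path p \<and> p 0 = g0 0 \<and> p 1 = z \<and> p ` {0..1} \<inter> PP = {} \<and>
      Tbr (UHP \<times> {0..1::real}) (along p) s" if z: "z \<notin> PP" for z
  proof -
    have "g0 0 \<in> - PP" using g0(3) by (auto simp: disjoint_iff)
    then obtain p where p: "polynomial_function p" "path_image p \<subseteq> - PP" "pathstart p = g0 0" "pathfinish p = z"
      using connected_open_polynomial_connected[OF opP conP, of "g0 0" z] z by auto
    have vp: "valid_path p" using p(1) by (rule valid_path_polynomial_function)
    have pP: "p ` {0..1} \<inter> PP = {}" using p(2) by (auto simp: path_image_def)
    obtain s where "Tbr (UHP \<times> {0..1::real}) (along p) s"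
    proof (rule branch_exists[of "UHP \<times> {0..1::real}" "\<lambda>(\<tau>, x). (\<tau>, mark \<tau> (p x))"])
      show "contractible (UHP \<times> {0..1::real})" by (intro convex_imp_contractible convex_Times convex_UHP) auto
      show "continuous_on (UHP \<times> {0..1}) (along p)"
        unfolding case_prod_unfold by (intro continuous_intros continuous_on_compose2[OF valid_path_cont[OF vp]]) auto
      show "snd (case q of (\<tau>, x) \<Rightarrow> (\<tau>, mark \<tau> (p x))) \<notin> mark (fst (case q of (\<tau>, x) \<Rightarrow> (\<tau>, mark \<tau> (p x)))) ` PP"
        if "q \<in> UHP \<times> {0..1}" for q
      proof -
        have "Im (fst q) > 0" "p (snd q) \<notin> PP" using that pP by (auto simp: disjoint_iff)
        from mark_image_PP[OF this] show ?thesis by (simp add: case_prod_unfold)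
      qed
    qed auto
    then show ?thesis using vp pP p(3,4) by (auto simp: pathstart_def pathfinish_def)
  qed
  define Pth where "Pth z = (SOME ps. valid_path (fst ps) \<and> fst ps 0 = g0 0 \<and> fst ps 1 = z \<and> fst ps ` {0..1} \<inter> PP = {} \<and>
      Tbr (UHP \<times> {0..1::real}) (along (fst ps)) (snd ps))" for z
  define p where "p z = fst (Pth z)" for z
  define s where "s z = snd (Pth z)" for z
  have ps: "valid_path (p z)" "p z 0 = g0 0" "p z 1 = z" "p z ` {0..1} \<inter> PP = {}"
      "Tbr (UHP \<times> {0..1::real}) (along (p z)) (s z)" if z: "z \<notin> PP" for z
  proof -
    have "\<exists>ps. valid_path (fst ps) \<and> fst ps 0 = g0 0 \<and> fst ps 1 = z \<and> fst ps ` {0..1} \<inter> PP = {} \<and>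
      Tbr (UHP \<times> {0..1::real}) (along (fst ps)) (snd ps)"
      using ex[OF z] by auto
    from someI_ex[OF this, folded Pth_def] show "valid_path (p z)" "p z 0 = g0 0" "p z 1 = z" "p z ` {0..1} \<inter> PP = {}"
      "Tbr (UHP \<times> {0..1::real}) (along (p z)) (s z)"
      by (auto simp: p_def s_def)
  qed
  define I where "I g s = Ii s g (pd g) 0 1 h \<tau>" for g s
  have z01: "(0::real) \<in> {0..1}" "(1::real) \<in> {0..1}" by auto
  \<comment> \<open>With weight \<open>a z / d0\<close> the boundary of the loop is the initial
    value of the branch along the path to \<open>z\<close>, which cancels the start of that
    path.\<close>
  define a where "a z = s z (\<tau>, 0) / s0 (\<tau>, 0)" for z
  have a: "s z (\<tau>', 0) = a z * s0 (\<tau>', 0)" if zP: "z \<notin> PP" and t: "Im \<tau>' > 0" for z \<tau>'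
  proof -
    obtain k where "k \<noteq> 0" "\<And>\<tau>. Im \<tau> > 0 \<Longrightarrow> s z (\<tau>, 0) = k * s0 (\<tau>, 0)"
      using branch_ratio[OF branch_end[OF g0(4) z01(1)] branch_end[OF ps(5)[OF zP] z01(1)]] ps(2)[OF zP] by auto
    then show ?thesis
      using t \<tau> branch_nonzero[OF branch_end[OF g0(4) z01(1)], of \<tau>] by (simp add: a_def)
  qed
  define f where "f z = (a z / d0 * I g0 s0 + I (p z) (s z)) / s z (\<tau>, 1)" for z
  \<comment> \<open>The continuation law behind all properties of \<open>f\<close>: along any path,
    \<open>T f\<close> changes by the integral of \<open>T h\<close>, and the end of the path
    matters only modulo the lattice. A constant path gives periodicity, a short segment the
    differential equation.\<close>
  have CL: "f (z2) * sq (\<tau>, 1) = f (q 0) * sq (\<tau>, 0) + I q sq"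
    if q: "valid_path q" "q ` {0..1} \<inter> PP = {}" "Tbr (UHP \<times> {0..1::real}) (along q) sq"
      and z2: "q 1 - z2 \<in> gauss_lattice" for q sq z2
  proof -
    have qP: "q 0 \<notin> PP" "q 1 \<notin> PP" using q(2) by (auto simp: disjoint_iff)
    have z2P: "z2 \<notin> PP" using punctures_shift[OF z2, of z2] qP by simp
    obtain k1 where k1: "k1 \<noteq> 0" "\<And>\<tau>. Im \<tau> > 0 \<Longrightarrow> s (q 0) (\<tau>, 1) = k1 * sq (\<tau>, 0)"
      using branch_ratio[OF branch_end[OF q(3) z01(1)] branch_end[OF ps(5)[OF qP(1)] z01(2)]] ps(3)[OF qP(1)] by auto
    obtain k where k: "k \<noteq> 0" "\<And>\<tau>. Im \<tau> > 0 \<Longrightarrow> k1 * sq (\<tau>, 1) = k * s z2 (\<tau>, 1)"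
    proof -
      obtain k' where "k' \<noteq> 0" "\<And>\<tau>. Im \<tau> > 0 \<Longrightarrow> sq (\<tau>, 1) = k' * s z2 (\<tau>, 1)"
        using branch_ratio[OF branch_end[OF ps(5)[OF z2P] z01(2)] branch_end[OF q(3) z01(2)]] ps(3)[OF z2P] z2 by auto
      then show ?thesis using k1(1) that[of "k1 * k'"] by simp
    qed
    \<comment> \<open>The regularised path to the start of \<open>q\<close>, then \<open>q\<close>,
      then the regularised path to \<open>z2\<close> backwards. The factors \<open>k1\<close> and
      \<open>k\<close> match the branches at the two junctions, so the vanishing pairing with this
      cycle is the continuation law.\<close>
    define \<gamma> where "\<gamma> = [(a (q 0) / d0, g0, s0), (1, p (q 0), s (q 0)), (k1, q, sq),
        (- k * a z2 / d0, g0, s0), (- k, p z2, s z2)]"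
    have "flat_twisted_cycle \<alpha> a0 ai \<gamma>"
      unfolding flat_twisted_cycle_def
    proof (intro conjI ballI allI)
      fix x assume "x \<in> set \<gamma>"
      then show "case x of (c, g, s) \<Rightarrow> valid_path g \<and> path_image g \<inter> PP = {} \<and>
          Tbr (UHP \<times> {0..1}) (along g) s"
        using g0 ps[OF qP(1)] ps[OF z2P] q unfolding \<gamma>_def path_image_def by auto
    next
      fix \<tau>' z assume "\<tau>' \<in> UHP"
      then have t: "Im \<tau>' > 0" by simp
      have zz: "q 1 - z \<in> gauss_lattice \<longleftrightarrow> z2 - z \<in> gauss_lattice"
      proof
        assume "q 1 - z \<in> gauss_lattice"
        from gauss_lattice_closed(3)[OF this z2] show "z2 - z \<in> gauss_lattice" by simp
      next
        assume "z2 - z \<in> gauss_lattice"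
        from gauss_lattice_closed(2)[OF this z2] show "q 1 - z \<in> gauss_lattice" by simp
      qed
      have e: "s0 (\<tau>', 1) = s0 (\<tau>', 0) + d0 * s0 (\<tau>', 0)" using g0(5)[OF t] by (simp add: d0_def algebra_simps)
      have "a (q 0) / d0 * (s0 (\<tau>', 1) - s0 (\<tau>', 0)) = s (q 0) (\<tau>', 0)" "k * a z2 / d0 * (s0 (\<tau>', 1) - s0 (\<tau>', 0)) = k * s z2 (\<tau>', 0)"
        unfolding e a[OF qP(1) t] a[OF z2P t] using d0 by simp_all
      then have A: "a (q 0) / d0 * s0 (\<tau>', 1) = a (q 0) / d0 * s0 (\<tau>', 0) + s (q 0) (\<tau>', 0)"
        "k * a z2 / d0 * s0 (\<tau>', 1) = k * a z2 / d0 * s0 (\<tau>', 0) + k * s z2 (\<tau>', 0)"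
        by (simp_all add: algebra_simps)
      show "(\<Sum>(c, g, s)\<leftarrow>\<gamma>. c * ((if g 1 - z \<in> gauss_lattice then s (\<tau>', 1) else 0)
           - (if g 0 - z \<in> gauss_lattice then s (\<tau>', 0) else 0))) = 0"
        unfolding \<gamma>_def using A k1(2)[OF t] k(2)[OF t]
        by (auto simp: g0(2)[symmetric] ps(2,3)[OF qP(1)] ps(2,3)[OF z2P] zz algebra_simps)
    qed
    then have "form_pairing \<tau> h \<gamma> = 0" "form_pairing \<tau> h \<gamma> = (\<Sum>(c, g, s)\<leftarrow>\<gamma>. c * Ii s g (pd g) 0 1 h \<tau>)"
      using zero form_pairing_Ii by auto
    then have eq: "a (q 0) / d0 * I g0 s0 + I (p (q 0)) (s (q 0)) + k1 * I q sq = k * (a z2 / d0 * I g0 s0 + I (p z2) (s z2))"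
      by (simp add: \<gamma>_def I_def algebra_simps)
    have nz: "s (q 0) (\<tau>, 1) \<noteq> 0" "s z2 (\<tau>, 1) \<noteq> 0"
      using branch_nonzero[OF branch_end[OF ps(5)[OF qP(1)] z01(2)]] branch_nonzero[OF branch_end[OF ps(5)[OF z2P] z01(2)]] \<tau> by auto
    have "k1 * (f z2 * sq (\<tau>, 1)) = f z2 * (k * s z2 (\<tau>, 1))" using k(2)[OF \<tau>] by (simp add: mult_ac)
    also have "\<dots> = k * (a z2 / d0 * I g0 s0 + I (p z2) (s z2))" using nz by (simp add: f_def)
    also have "\<dots> = f (q 0) * s (q 0) (\<tau>, 1) + k1 * I q sq" using nz eq by (simp add: f_def)
    also have "\<dots> = k1 * (f (q 0) * sq (\<tau>, 0) + I q sq)" using k1(2)[OF \<tau>] by (simp add: algebra_simps)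
    finally show ?thesis using k1(1) by simp
  qed
  \<comment> \<open>The constant path at \<open>z\<close> ends at \<open>z + l\<close> modulo the
    lattice and has integral 0.\<close>
  have per: "f (z + l) = f z" if z: "z \<notin> PP" and l: "l \<in> gauss_lattice" for z l
  proof -
    obtain B where B: "Tbr (UHP \<times> {z}) pm B" using branch_on_convex[of "{z}"] z by auto
    have br: "Tbr (UHP \<times> {0..1::real}) (\<lambda>(\<tau>, x). (\<tau>, mark \<tau> ((\<lambda>_. z) x))) (\<lambda>(\<tau>, x). B (\<tau>, z))"
      by (rule branch_cong[OF branch_comp[OF B, of "UHP \<times> {0..1::real}" "\<lambda>(\<tau>, x). (\<tau>, z)"]])
         (auto simp: case_prod_unfold intro!: continuous_intros)
    have "I (\<lambda>_. z) (\<lambda>(\<tau>, x). B (\<tau>, z)) = 0"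
      by (simp add: I_def Ii_def pd_def)
    moreover have "valid_path (\<lambda>_::real. z)" using valid_path_polynomial_function[of "\<lambda>_. z"] by simp
    ultimately have "f (z + l) * B (\<tau>, z) = f z * B (\<tau>, z)"
      using CL[OF _ _ br, of "z + l"] z gauss_lattice_closed(4)[OF l] by auto
    moreover have "B (\<tau>, z) \<noteq> 0" using branch_nonzero[OF B, of "(\<tau>, z)"] \<tau> by simp
    ultimately show ?thesis by simp
  qed
  define F where "F u = f (unmark \<tau> u)" for u
  have FD: "(F has_field_derivative (h u - om u \<tau> * F u)) (at u)" if u: "u \<in> - mark \<tau> ` PP" for u
  proof -
    define z1 where "z1 = unmark \<tau> u"
    have uz: "u = mark \<tau> z1" using \<tau> by (simp add: z1_def)
    have z1: "z1 \<in> - PP" using u uz by auto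
    obtain e where e: "e > 0" "ball z1 e \<subseteq> - PP" using opP z1 by (meson open_contains_ball)
    define D where "D = ball z1 e"
    have D: "convex D" "open D" "D \<inter> PP = {}" "z1 \<in> D" using e by (auto simp: D_def)
    obtain B where B: "Tbr (UHP \<times> D) pm B" using branch_on_convex[OF D(1,3)] by blast
    obtain Q where Q: "\<And>z. z \<in> D \<Longrightarrow> (Q has_field_derivative B (\<tau>, z) * h (mark \<tau> z)) (at (mark \<tau> z))"
      "\<And>z. z \<in> D \<Longrightarrow> QQ B z1 (\<lambda>u _. h u) \<tau> z = Q (mark \<tau> z) - Q (mark \<tau> z1)"
      using QQ_primitive[OF D B \<tau>, where h = "\<lambda>u _. h u"] hol by auto
    have nzB: "B (\<tau>, z) \<noteq> 0" if "z \<in> D" for z using branch_nonzero[OF B, of "(\<tau>, z)"] \<tau> that by simp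
    have val: "f z = (f z1 * B (\<tau>, z1) + Q (mark \<tau> z) - Q (mark \<tau> z1)) / B (\<tau>, z)" if z: "z \<in> D" for z
    proof -
      define q where "q = linepath z1 z"
      have qx: "q y = z1 + y *\<^sub>R (z - z1)" for y by (simp add: q_def linepath_def algebra_simps)
      have qD: "q y \<in> D" if "y \<in> {0..1}" for y
        unfolding qx using seg_in[OF D B z, of y] that by simp
      have br: "Tbr (UHP \<times> {0..1::real}) (along q) (\<lambda>(\<tau>, x). B (\<tau>, q x))"
      proof (rule branch_cong[OF branch_comp[OF B, of "UHP \<times> {0..1::real}" "\<lambda>(\<tau>, x). (\<tau>, q x)"]])
        show "continuous_on (UHP \<times> {0..1}) (\<lambda>(\<tau>, x). (\<tau>, q x))"
          unfolding qx case_prod_unfold by (intro continuous_intros)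
      qed (use qD in auto)
      have pdq: "pd q y = z - z1" for y
        unfolding pd_def q_def by (rule vector_derivative_at) (rule has_vector_derivative_linepath_within)
      have "I q (\<lambda>(\<tau>, x). B (\<tau>, q x)) = QQ B z1 (\<lambda>u _. h u) \<tau> z"
        unfolding I_def Ii_def QQ_def pdq by (simp add: qx)
      moreover have "valid_path q" by (simp add: q_def)
      moreover have "q ` {0..1} \<inter> PP = {}" using qD D(3) by (auto simp: disjoint_iff)
      moreover have "q 1 = z" "q 0 = z1" by (simp_all add: qx)
      ultimately have "f z * B (\<tau>, z) = f z1 * B (\<tau>, z1) + QQ B z1 (\<lambda>u _. h u) \<tau> z"
        using CL[OF _ _ br, of z] by simp
      then show ?thesis using nzB[OF z] Q(2)[OF z] by (simp add: field_simps)
    qed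
    define E where "E = mark \<tau> ` D"
    have E: "open E" unfolding E_def using D \<tau> open_mark_image by auto
    have br: "Tbr E (\<lambda>u. (\<tau>, u)) (\<lambda>u. B (\<tau>, unmark \<tau> u))"
      by (rule branch_cong[OF branch_comp[OF B, of E "\<lambda>u. (\<tau>, unmark \<tau> u)"]])
         (use \<tau> in \<open>auto simp: E_def intro!: continuous_intros continuous_on_unmark\<close>)
    have uE: "u \<in> E" using D(4) by (simp add: E_def uz)
    have dB: "((\<lambda>u. B (\<tau>, unmark \<tau> u)) has_field_derivative B (\<tau>, z1) * om u \<tau>) (at u)"
      using branch_u_deriv[OF br uE \<tau>] at_within_open[OF uE E] by (simp add: z1_def)
    have dQ: "(Q has_field_derivative B (\<tau>, z1) * h u) (at u)" using Q(1)[OF D(4)] by (simp add: uz)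
    have "((\<lambda>u. (f z1 * B (\<tau>, z1) + Q u - Q (mark \<tau> z1)) / B (\<tau>, unmark \<tau> u)) has_field_derivative (h u - om u \<tau> * F u)) (at u)"
    proof (rule DERIV_cong[OF DERIV_divide[OF DERIV_diff[OF DERIV_add[OF DERIV_const dQ] DERIV_const] dB]])
      show "B (\<tau>, unmark \<tau> u) \<noteq> 0" using nzB[OF D(4)] by (simp add: z1_def)
    next
      have "F u = f z1" by (simp add: F_def z1_def)
      then show "((0 + B (\<tau>, z1) * h u - 0) * B (\<tau>, unmark \<tau> u) -
        (f z1 * B (\<tau>, z1) + Q u - Q (mark \<tau> z1)) * (B (\<tau>, z1) * om u \<tau>)) / (B (\<tau>, unmark \<tau> u) * B (\<tau>, unmark \<tau> u)) = h u - om u \<tau> * F u"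
        using nzB[OF D(4)] by (simp add: z1_def [symmetric] uz [symmetric] field_simps)
    qed
    then show ?thesis
    proof (rule has_field_derivative_transform_within_open[OF _ E uE])
      fix v assume "v \<in> E"
      then obtain z where "z \<in> D" "v = mark \<tau> z" by (auto simp: E_def)
      then show "(f z1 * B (\<tau>, z1) + Q v - Q (mark \<tau> z1)) / B (\<tau>, unmark \<tau> v) = F v"
        using val[of z] \<tau> by (simp add: F_def)
    qed
  qed
  have "F \<in> hf \<tau>"
    unfolding hol_fun_def
  proof (intro CollectI conjI ballI)
    show "F holomorphic_on - mark \<tau> ` PP"
      unfolding holomorphic_on_def field_differentiable_def using FD has_field_derivative_at_within by blast
    fix u l assume u: "u \<in> - mark \<tau> ` PP" and l: "l \<in> gauss_lattice"
    have "unmark \<tau> (u + mark \<tau> l) = unmark \<tau> u + l"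
      using \<tau> by (metis mark_add mark_unmark unmark_mark)
    moreover have "unmark \<tau> u \<notin> PP" using u \<tau> by (metis ComplD imageI mark_unmark)
    ultimately show "F (u + mark \<tau> l) = F u" using per[OF _ l] by (simp add: F_def)
  qed
  moreover have "h u = deriv F u + om u \<tau> * F u" if "u \<in> - mark \<tau> ` PP" for u
    using DERIV_imp_deriv[OF FD[OF that]] by simp
  ultimately show ?thesis unfolding exact_def by blast
qed

text \<open>The connection is a definite description. Existence is the derivative formula;
  uniqueness is nondegeneracy of the pairing, applied at each \<tau> to the difference of
  representatives of two candidates.\<close>

lemma gauss_manin_eq:
  assumes b: "\<And>\<tau>. Im \<tau> > 0 \<Longrightarrow> b \<tau> = cl \<tau> (H \<tau>)" "\<And>\<tau>. Im \<tau> > 0 \<Longrightarrow> H \<tau> \<in> hf \<tau>" "\<And>\<tau>. Im \<tau> > 0 \<Longrightarrow> N \<tau> \<in> hf \<tau>"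
    and d: "\<And>\<gamma> \<tau>. flat_twisted_cycle \<alpha> a0 ai \<gamma> \<Longrightarrow> Im \<tau> > 0 \<Longrightarrow>
      ((\<lambda>\<tau>. form_pairing \<tau> (H \<tau>) \<gamma>) has_field_derivative form_pairing \<tau> (N \<tau>) \<gamma>) (at \<tau>)"
    and \<tau>: "Im \<tau> > 0"
  shows "gauss_manin \<alpha> a0 ai b \<tau> = cl \<tau> (N \<tau>)"
proof -
  define c where "c = (\<lambda>\<tau>\<in>UHP. cl \<tau> (N \<tau>))"
  have D: "((\<lambda>\<tau>'. H1_pairing \<tau>' (b \<tau>') \<gamma>) has_field_derivative form_pairing \<tau> (N \<tau>) \<gamma>) (at \<tau>)"
    if "flat_twisted_cycle \<alpha> a0 ai \<gamma>" "Im \<tau> > 0" for \<gamma> \<tau>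
    by (rule has_field_derivative_transform_within_open[OF d[OF that] open_UHP])
       (use that b H1_pairing_cl[OF that(1)] in auto)
  have "gauss_manin \<alpha> a0 ai b = c"
    unfolding gauss_manin_def
  proof (rule the_equality)
    show "c \<in> (\<Pi>\<^sub>E \<tau>\<in>UHP. H1 \<alpha> a0 ai \<tau>) \<and>
     (\<forall>\<gamma>. flat_twisted_cycle \<alpha> a0 ai \<gamma> \<longrightarrow> (\<forall>\<tau>\<in>UHP.
        ((\<lambda>\<tau>'. H1_pairing \<tau>' (b \<tau>') \<gamma>) has_field_derivative H1_pairing \<tau> (c \<tau>) \<gamma>) (at \<tau>)))"
      using D b(3) H1_pairing_cl by (auto simp: c_def H1_def)
  next
    fix c' assume c': "c' \<in> (\<Pi>\<^sub>E \<tau>\<in>UHP. H1 \<alpha> a0 ai \<tau>) \<and>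
     (\<forall>\<gamma>. flat_twisted_cycle \<alpha> a0 ai \<gamma> \<longrightarrow> (\<forall>\<tau>\<in>UHP.
        ((\<lambda>\<tau>'. H1_pairing \<tau>' (b \<tau>') \<gamma>) has_field_derivative H1_pairing \<tau> (c' \<tau>) \<gamma>) (at \<tau>)))"
    show "c' = c"
    proof (rule PiE_ext[OF conjunct1[OF c']])
      show "c \<in> (\<Pi>\<^sub>E \<tau>\<in>UHP. H1 \<alpha> a0 ai \<tau>)" using b(3) by (auto simp: c_def H1_def)
      fix \<tau> assume t: "\<tau> \<in> UHP"
      then have \<tau>: "Im \<tau> > 0" by simp
      have "c' \<tau> \<in> H1 \<alpha> a0 ai \<tau>" using c' t by (blast dest: PiE_mem)
      then obtain k where k: "k \<in> hf \<tau>" "c' \<tau> = cl \<tau> k" by (auto simp: H1_def)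
      have "exact \<tau> (\<lambda>u. 1 * k u + (-1) * N \<tau> u)"
      proof (rule pairing_nondegenerate[OF \<tau> hf_linear[OF k(1) b(3)[OF \<tau>]]])
        fix \<gamma> assume cyc: "flat_twisted_cycle \<alpha> a0 ai \<gamma>"
        have "((\<lambda>\<tau>'. H1_pairing \<tau>' (b \<tau>') \<gamma>) has_field_derivative H1_pairing \<tau> (c' \<tau>) \<gamma>) (at \<tau>)"
          using c' cyc t by blast
        then have "form_pairing \<tau> k \<gamma> = form_pairing \<tau> (N \<tau>) \<gamma>"
          using D[OF cyc \<tau>] DERIV_unique unfolding k(2) H1_pairing_cl[OF cyc \<tau> k(1)] by blast
        moreover have "form_pairing \<tau> (\<lambda>u. 1 * k u + (-1) * N \<tau> u) \<gamma> = 1 * form_pairing \<tau> k \<gamma> + (-1) * form_pairing \<tau> (N \<tau>) \<gamma>"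
          by (rule form_pairing_linear[OF cyc \<tau>]) (use k b(3)[OF \<tau>] in \<open>auto simp: hol_fun_def\<close>)
        ultimately show "form_pairing \<tau> (\<lambda>u. 1 * k u + (-1) * N \<tau> u) \<gamma> = 0" by simp
      qed
      then have "cl \<tau> k = cl \<tau> (N \<tau>)" by (intro cl_eqI[OF \<tau>]) simp
      then show "c' \<tau> = c \<tau>" using k t by (simp add: c_def)
    qed
  qed
  then show ?thesis using \<tau> by (simp add: c_def)
qed

lemma H1_combination:
  assumes "Im \<tau> > 0"
  shows "H1_add (H1_scale \<alpha> a0 ai \<tau> x (sec0 \<alpha> a0 ai \<tau>)) (H1_scale \<alpha> a0 ai \<tau> y (sec1 \<alpha> a0 ai \<tau>))
    = cl \<tau> (\<lambda>u. x * 1 + y * r1 u \<tau>)"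
  unfolding sec_eq[OF assms] H1_scale_cl[OF assms hf_one] H1_scale_cl[OF assms r1_hf[OF assms]]
  by (rule H1_add_cl[OF assms hf_cmult[OF hf_one] hf_cmult[OF r1_hf[OF assms]]])

theorem gauss_manin_rows:
  assumes "Im \<tau> > 0"
  shows "gauss_manin \<alpha> a0 ai (sec0 \<alpha> a0 ai) \<tau> =
          H1_add (H1_scale \<alpha> a0 ai \<tau> (GM_matrix \<alpha> a0 ai \<tau> $ 1 $ 1) (sec0 \<alpha> a0 ai \<tau>))
                 (H1_scale \<alpha> a0 ai \<tau> (GM_matrix \<alpha> a0 ai \<tau> $ 1 $ 2) (sec1 \<alpha> a0 ai \<tau>))"
    and "gauss_manin \<alpha> a0 ai (sec1 \<alpha> a0 ai) \<tau> =
          H1_add (H1_scale \<alpha> a0 ai \<tau> (GM_matrix \<alpha> a0 ai \<tau> $ 2 $ 1) (sec0 \<alpha> a0 ai \<tau>))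
                 (H1_scale \<alpha> a0 ai \<tau> (GM_matrix \<alpha> a0 ai \<tau> $ 2 $ 2) (sec1 \<alpha> a0 ai \<tau>))"
proof -
  have "(\<lambda>u. M11 \<tau> * 1 + M12 * r1 u \<tau>) = N0 \<tau>" "(\<lambda>u. M21 \<tau> * 1 + M22 \<tau> * r1 u \<tau>) = N1 \<tau>"
    by (simp_all add: N0_def N1_def fun_eq_iff)
  note eq = H1_combination[OF assms] GM_matrix_eq[OF assms] this
  show "gauss_manin \<alpha> a0 ai (sec0 \<alpha> a0 ai) \<tau> =
          H1_add (H1_scale \<alpha> a0 ai \<tau> (GM_matrix \<alpha> a0 ai \<tau> $ 1 $ 1) (sec0 \<alpha> a0 ai \<tau>))
                 (H1_scale \<alpha> a0 ai \<tau> (GM_matrix \<alpha> a0 ai \<tau> $ 1 $ 2) (sec1 \<alpha> a0 ai \<tau>))"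
    unfolding eq by (rule gauss_manin_eq[OF sec_eq(1) hf_one N_hf(1) pairing_deriv_0 assms])
  show "gauss_manin \<alpha> a0 ai (sec1 \<alpha> a0 ai) \<tau> =
          H1_add (H1_scale \<alpha> a0 ai \<tau> (GM_matrix \<alpha> a0 ai \<tau> $ 2 $ 1) (sec0 \<alpha> a0 ai \<tau>))
                 (H1_scale \<alpha> a0 ai \<tau> (GM_matrix \<alpha> a0 ai \<tau> $ 2 $ 2) (sec1 \<alpha> a0 ai \<tau>))"
    unfolding eq by (rule gauss_manin_eq[OF sec_eq(2) r1_hf N_hf(2) pairing_deriv_1 assms])
qed

end

section \<open>The differential equation of the periods\<close>

lemma bigo_of_DERIV:
  fixes f :: "complex \<Rightarrow> complex"
  assumes "(f has_field_derivative D) (at 0)"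
  shows "(\<lambda>u. f u - f 0) \<in> O[at 0](\<lambda>u. u)"
  using assms
  by (intro bigoI_tendsto[where c = D]) (auto simp: has_field_derivative_iff eventually_at_filter)

lemma bigo_of_isCont:
  fixes f :: "complex \<Rightarrow> complex"
  assumes "isCont f 0"
  shows "f \<in> O[at 0](\<lambda>_. 1)"
  using assms by (intro bigoI_tendsto[where c = "f 0"]) (auto simp: isCont_def)

context params
begin

lemma qq_hol:
  assumes \<tau>: "Im \<tau> > 0"
  shows "(\<lambda>u. qq n u \<tau>) holomorphic_on - mark \<tau> ` PP" "(\<lambda>u. qq n (u - tt \<tau>) \<tau>) holomorphic_on - mark \<tau> ` PP"
  unfolding holomorphic_on_def field_differentiable_def
proof (intro ballI exI)
  fix u assume "u \<in> - mark \<tau> ` PP"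
  then show "((\<lambda>u. qq n u \<tau>) has_field_derivative (qq (Suc n) u \<tau> - qq n u \<tau> * qq 1 u \<tau>) * 1) (at u within - mark \<tau> ` PP)"
    using not_puncture[OF \<tau>] by (intro qq_deriv_u[OF DERIV_ident \<tau>]) auto
next
  show "\<forall>u\<in>- mark \<tau> ` PP. \<exists>d. ((\<lambda>u. qq n (u - tt \<tau>) \<tau>) has_field_derivative d) (at u within - mark \<tau> ` PP)"
  proof (intro ballI exI)
    fix u assume "u \<in> - mark \<tau> ` PP"
    then show "((\<lambda>u. qq n (u - tt \<tau>) \<tau>) has_field_derivative (qq (Suc n) (u - tt \<tau>) \<tau> - qq n (u - tt \<tau>) \<tau> * qq 1 (u - tt \<tau>) \<tau>) * 1) (at u within - mark \<tau> ` PP)"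
      using not_puncture[OF \<tau>] by (intro qq_deriv_u[OF _ \<tau>]) (auto intro!: derivative_eq_intros)
  qed
qed

lemma qq_shift_dom_continuous: "continuous_on dom (\<lambda>p. qq n (fst p - tt (snd p)) (snd p))"
  unfolding tpt_def by (intro continuous_intros) (auto simp: dom_def not_puncture(2)[unfolded tpt_def])

lemma nice_Gt: "nice Gt Gtu Gtt"
  unfolding nice_def
proof (intro conjI allI impI)
  fix \<tau> u assume \<tau>: "Im \<tau> > 0" and u: "u \<notin> mark \<tau> ` PP"
  show "((\<lambda>u. Gt u \<tau>) has_field_derivative Gtu u \<tau>) (at u)"
    using Gt_chain[OF DERIV_ident DERIV_const \<tau> not_puncture[OF \<tau> u]] by simp
next
  fix \<tau> z assume \<tau>: "Im \<tau> > 0" and "z \<notin> PP"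
  then have "mark \<tau> z \<notin> mark \<tau> ` PP" by (rule mark_image_PP)
  from Gt_chain[OF mark_deriv_tau DERIV_ident \<tau> not_puncture[OF \<tau> this]]
  show "((\<lambda>\<tau>. Gt (mark \<tau> z) \<tau>) has_field_derivative Gtu (mark \<tau> z) \<tau> * of_real (Im z) + Gtt (mark \<tau> z) \<tau>) (at \<tau>)"
    by simp
next
  fix \<tau> :: complex assume \<tau>: "Im \<tau> > 0"
  show "(\<lambda>u. Gtt u \<tau>) holomorphic_on - mark \<tau> ` PP"
    unfolding Gtt_def q2t_def q2'_def r1_def by (intro holomorphic_intros qq_hol[OF \<tau>]) auto
qed (auto simp: Gt_def Gtu_def Gtt_def q2t_def q2'_def r1_def intro!: continuous_intros qq_dom_continuous qq_shift_dom_continuous)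

text \<open>\<open>[T BB]\<close> is the boundary term left by \<open>T_ode\<close> when \<open>\<partial>\<^sub>\<tau>\<^sup>2 - p \<partial>\<^sub>\<tau> + \<phi>\<close> is applied to the integral of \<open>T du\<close> along a
  path which is fixed in real coordinates; \<open>y\<close> is the second real coordinate of \<open>u\<close>.\<close>

definition BB :: "complex \<Rightarrow> complex \<Rightarrow> real \<Rightarrow> complex" where
  "BB \<tau> u y = Rr u \<tau> + 2 * Gt u \<tau> * of_real y + om u \<tau> * (of_real y)\<^sup>2 - p0 * of_real y"

lemma shift_eq: "u + 1 - tt \<tau> = (u - tt \<tau>) + 1" "u + \<tau> - tt \<tau> = (u - tt \<tau>) + \<tau>"
  by simp_all

lemma om_shift:
  assumes "Im \<tau> > 0" "u \<notin> mark \<tau> ` PP"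
  shows "om (u + 1) \<tau> = om u \<tau>" "om (u + \<tau>) \<tau> = om u \<tau>"
proof -
  note nz = not_puncture[OF assms]
  show "om (u + 1) \<tau> = om u \<tau>" unfolding om_def shift_eq qq_shift_1 ..
  show "om (u + \<tau>) \<tau> = om u \<tau>"
    unfolding om_def shift_eq qq_shift_tau(1)[OF assms(1) nz(1)] qq_shift_tau(1)[OF assms(1) nz(2)] by simp
qed

lemma Gt_shift:
  assumes "Im \<tau> > 0" "u \<notin> mark \<tau> ` PP"
  shows "Gt (u + 1) \<tau> = Gt u \<tau>" "Gt (u + \<tau>) \<tau> = Gt u \<tau> - om u \<tau>"
proof -
  note nz = not_puncture[OF assms]
  show "Gt (u + 1) \<tau> = Gt u \<tau>" unfolding Gt_def shift_eq qq_shift_1 ..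
  show "Gt (u + \<tau>) \<tau> = Gt u \<tau> - om u \<tau>"
    unfolding Gt_def om_def shift_eq qq_shift_tau(1,2)[OF assms(1) nz(1)] qq_shift_tau(1,2)[OF assms(1) nz(2)]
    by (simp add: field_simps power2_eq_square)
qed

text \<open>Under \<open>u + \<tau>\<close> the function \<open>Rr\<close> changes by
  \<open>- 2 Gt + p0 + om\<close>, and the terms with \<open>y\<close> are there to undo this. Hence
  estimates of \<open>BB\<close> at 0 carry over to every lattice point.\<close>

lemma BB_shift:
  assumes "Im \<tau> > 0" "u \<notin> mark \<tau> ` PP"
  shows "BB \<tau> (u + 1) y = BB \<tau> u y" "BB \<tau> (u + \<tau>) (y + 1) = BB \<tau> u y"
proof -
  have De0: "De0 (u + 1) \<tau> = De0 u \<tau>" "De0 (u + \<tau>) \<tau> = De0 u \<tau> - r1 u \<tau> / kap"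
    unfolding De0_def q2'_shift[OF assms] by (simp_all add: diff_divide_distrib)
  show "BB \<tau> (u + 1) y = BB \<tau> u y"
    unfolding BB_def Rr_def om_shift[OF assms] Gt_shift[OF assms] De0 e0_shift[OF assms] e1_shift[OF assms] ..
  have "Rr (u + \<tau>) \<tau> = Rr u \<tau> - 2 * Gt u \<tau> + p0 + om u \<tau>"
  proof -
    have "om u \<tau> * e0 u \<tau> = Gt u \<tau> - M11 \<tau> - al / kap * r1 u \<tau>"
      using row0[OF assms(1) not_puncture[OF assms]] by simp
    moreover have "M22 \<tau> = p0 - M11 \<tau>" using trace_M[of \<tau>] by (simp add: algebra_simps)
    moreover have "M12 * r1 u \<tau> = al / kap * r1 u \<tau> - r1 u \<tau> / kap"
      unfolding M12_def by (simp add: diff_divide_distrib left_diff_distrib)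
    ultimately show ?thesis
      unfolding Rr_def Gt_shift[OF assms] De0 e0_shift[OF assms] e1_shift[OF assms]
      by (simp add: ring_distribs mult.commute[of "e0 u \<tau>"])
  qed
  then show "BB \<tau> (u + \<tau>) (y + 1) = BB \<tau> u y"
    unfolding BB_def om_shift[OF assms] Gt_shift[OF assms] by (simp add: algebra_simps power2_eq_square)
qed

lemma th0_minus_tt:
  assumes "Im \<tau> > 0"
  shows "th 0 (0 - tt \<tau>) \<tau> \<noteq> 0"
  using th0_tt[OF assms] th_minus[of 0 "tt \<tau>" \<tau>] by simp

lemma qq_shift_deriv_0:
  assumes "Im \<tau> > 0"
  shows "((\<lambda>u. qq n (u - tt \<tau>) \<tau>) has_field_derivative
     (qq (Suc n) (0 - tt \<tau>) \<tau> - qq n (0 - tt \<tau>) \<tau> * qq 1 (0 - tt \<tau>) \<tau>)) (at 0)"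
proof -
  have "((\<lambda>u. u - tt \<tau>) has_field_derivative 1) (at 0)" by (auto intro!: derivative_eq_intros)
  from qq_deriv_u[OF this assms th0_minus_tt[OF assms], of n] show ?thesis by simp
qed

text \<open>At the puncture \<open>0\<close> the function \<open>Gt\<close> is regular with value \<open>M22\<close>, which compensates the pole of \<open>e0\<close> in \<open>Rr\<close>.\<close>

lemma local_at_0:
  assumes \<tau>: "Im \<tau> > 0"
  shows qq1_bigo: "(\<lambda>u. qq 1 u \<tau>) \<in> O[at 0](\<lambda>u. 1 / u)"
    and Gt_bigo: "(\<lambda>u. Gt u \<tau> - M22 \<tau>) \<in> O[at 0](\<lambda>u. u)"
    and q2'_bigo: "(\<lambda>u. q2' u \<tau>) \<in> O[at 0](\<lambda>_. 1)"
proof -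
  obtain W where W: "W holomorphic_on UNIV" "\<And>u. th 0 u \<tau> = u * W u" "W 0 = th 1 0 \<tau>"
    using th0_factor_at_0[OF \<tau>] by metis
  have W0: "W 0 \<noteq> 0" using W(3) th1_0_nonzero[OF \<tau>] by (simp add: One_nat_def)
  define W2 where "W2 z = (if z = 0 then deriv (\<lambda>u. th 2 u \<tau>) 0 else (th 2 z \<tau> - th 2 0 \<tau>) / (z - 0))" for z
  have W2: "W2 holomorphic_on UNIV"
    unfolding W2_def
    by (rule pole_lemma) (use th_deriv_u[OF \<tau>] in \<open>auto simp: holomorphic_on_def field_differentiable_def\<close>)
  have t2: "th 2 u \<tau> = u * W2 u" for u by (simp add: W2_def th_even_0)
  have W20: "W2 0 = th 3 0 \<tau>"
    using DERIV_imp_deriv[OF th_deriv_u[OF \<tau>, of 2 0]] by (simp add: W2_def)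
  define m where "m u = W2 u / W u" for u
  have opW: "open {u. W u \<noteq> 0}"
    by (intro open_Collect_neq continuous_intros holomorphic_on_imp_continuous_on[OF W(1)])
  have mhol: "m holomorphic_on {u. W u \<noteq> 0}"
    unfolding m_def by (intro holomorphic_intros holomorphic_on_subset[OF W(1)] holomorphic_on_subset[OF W2]) auto
  have ev: "\<forall>\<^sub>F u in at 0. W u \<noteq> 0 \<and> u \<noteq> 0"
    using eventually_at_in_open[OF opW, of 0] W0 by (auto elim: eventually_mono simp: eventually_at_filter)
  have qm: "qq 2 u \<tau> = m u" if "W u \<noteq> 0" "u \<noteq> 0" for u using that by (simp add: qq_def t2 W(2) m_def)
  have dm: "(m has_field_derivative deriv m u) (at u)" if "W u \<noteq> 0" for u
    using holomorphic_derivI[OF mhol opW] that by auto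
  have q2'm: "q2' u \<tau> = deriv m u" if "W u \<noteq> 0" "u \<noteq> 0" for u
  proof -
    have "open {u. W u \<noteq> 0 \<and> u \<noteq> 0}" by (intro open_Collect_conj opW open_Collect_neq continuous_intros)
    then have "((\<lambda>u. qq 2 u \<tau>) has_field_derivative deriv m u) (at u)"
      by (rule has_field_derivative_transform_within_open[OF dm[OF that(1)]]) (use that qm in auto)
    moreover have "((\<lambda>u. qq 2 u \<tau>) has_field_derivative q2' u \<tau>) (at u)"
      using qq2_chain[OF DERIV_ident DERIV_const \<tau>, of u] that by (simp add: W(2))
    ultimately show ?thesis by (rule DERIV_unique[symmetric])
  qed
  have "isCont (deriv m) 0"
    using holomorphic_deriv[OF mhol opW] holomorphic_on_imp_continuous_on continuous_on_eq_continuous_at[OF opW] W0 by blast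
  then have "deriv m \<in> O[at 0](\<lambda>_. 1)" by (rule bigo_of_isCont)
  moreover have "\<forall>\<^sub>F u in at 0. q2' u \<tau> = deriv m u" using ev by eventually_elim (use q2'm in auto)
  ultimately show "(\<lambda>u. q2' u \<tau>) \<in> O[at 0](\<lambda>_. 1)" by (simp cong: landau_o.big.in_cong)
  have "((\<lambda>u. th 1 u \<tau> / W u) \<longlongrightarrow> th 1 0 \<tau> / W 0) (at 0)"
    using W0 DERIV_isCont[OF th_deriv_u[OF \<tau>, of 1 0]] holomorphic_on_imp_continuous_on[OF W(1)]
    by (intro tendsto_divide) (auto simp: isCont_def continuous_on_def)
  moreover have "\<forall>\<^sub>F u in at 0. th 1 u \<tau> / W u = qq 1 u \<tau> / (1 / u)"
    using ev by eventually_elim (simp add: qq_def W(2))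
  ultimately have "((\<lambda>u. qq 1 u \<tau> / (1 / u)) \<longlongrightarrow> th 1 0 \<tau> / W 0) (at 0)" by (rule Lim_transform_eventually)
  then show "(\<lambda>u. qq 1 u \<tau>) \<in> O[at 0](\<lambda>u. 1 / u)"
    by (rule bigoI_tendsto) (auto simp: eventually_at_filter)
  \<comment> \<open>\<open>G\<close> continues \<open>Gt\<close> across 0, with the removable
    singularity of \<open>qq 2\<close> filled in by \<open>m\<close>. As \<open>m 0 = Y\<close>, its
    value there is \<open>M22\<close>.\<close>
  define G where "G u = al * (m u - qq 2 (u - tt \<tau>) \<tau>) / (2 * kap) + of_real a0 * qq 1 (u - tt \<tau>) \<tau>" for u
  have "m 0 = Yc \<tau>" by (simp add: m_def W20 W(3) Yc_def)
  then have G0: "G 0 = M22 \<tau>"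
    using qq_minus[of 1 "tt \<tau>" \<tau>] qq_minus[of 2 "tt \<tau>" \<tau>] by (simp add: G_def M22_def AA_def field_simps)
  have "\<exists>D. (G has_field_derivative D) (at 0)"
    unfolding G_def by (rule exI, (rule DERIV_cdivide derivative_intros dm[OF W0] qq_shift_deriv_0[OF \<tau>])+)
  then have "(\<lambda>u. G u - M22 \<tau>) \<in> O[at 0](\<lambda>u. u)" using bigo_of_DERIV G0 by metis
  moreover have "\<forall>\<^sub>F u in at 0. Gt u \<tau> - M22 \<tau> = G u - M22 \<tau>"
    using ev by eventually_elim (simp add: Gt_def G_def qm)
  ultimately show "(\<lambda>u. Gt u \<tau> - M22 \<tau>) \<in> O[at 0](\<lambda>u. u)"
    using landau_o.big.in_cong[of "\<lambda>u. Gt u \<tau> - M22 \<tau>" "\<lambda>u. G u - M22 \<tau>" "at 0" "\<lambda>u. u"] by blast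
qed

text \<open>Every simple pole is paired with a zero: that of \<open>e0\<close> with
  \<open>Gt - M22\<close>, and that of \<open>om\<close> with the square of
  \<open>y = Im u / Im \<tau>\<close>, which is of order \<open>u\<close>.\<close>

lemma BB_bounded_at_0:
  assumes \<tau>: "Im \<tau> > 0"
  shows "(\<lambda>u. BB \<tau> u (Im u / Im \<tau>)) \<in> O[at 0](\<lambda>_. 1)"
proof -
  have one: "(\<lambda>_. c) \<in> O[at 0](\<lambda>u::complex. 1 / u)" for c :: complex
  proof (rule bigoI_tendsto[where c = 0])
    show "((\<lambda>u. c / (1 / u)) \<longlongrightarrow> 0) (at (0::complex))" by (auto intro!: tendsto_eq_intros)
  qed (auto simp: eventually_at_filter)
  have u1: "(\<lambda>u::complex. u) \<in> O[at 0](\<lambda>_. 1)" by (rule bigo_of_isCont) auto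
  have c1: "(\<lambda>_. c) \<in> O[at (0::complex)](\<lambda>_. 1)" for c :: complex by (rule bigo_of_isCont) auto
  have uu: "(\<lambda>u. f u * g u) \<in> O[at 0](\<lambda>_. 1)"
    if "f \<in> O[at 0](\<lambda>u. 1 / u)" "g \<in> O[at 0](\<lambda>u. u)" for f g :: "complex \<Rightarrow> complex"
    by (rule landau_o.big_trans[OF landau_o.big.mult[OF that]], rule bigoI_tendsto[where c = 1])
      (auto intro!: tendsto_eventually simp: eventually_at_filter)
  have y: "(\<lambda>u. of_real (Im u / Im \<tau>) :: complex) \<in> O[at 0](\<lambda>u. u)"
  proof (rule bigoI[where c = "1 / Im \<tau>"])
    show "\<forall>\<^sub>F u in at 0. norm (of_real (Im u / Im \<tau>) :: complex) \<le> 1 / Im \<tau> * norm u"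
      using \<tau> abs_Im_le_cmod by (intro always_eventually) (auto simp: norm_divide divide_right_mono)
  qed
  have e0: "(\<lambda>u. e0 u \<tau>) \<in> O[at 0](\<lambda>u. 1 / u)"
  proof -
    have "(\<lambda>u. 1 / kap * (qq 1 u \<tau> - (qq 1 (tt \<tau>) \<tau> + be / al))) \<in> O[at 0](\<lambda>u. 1 / u)"
      by (intro landau_o.big.cmult_in_iff[THEN iffD2] sum_in_bigo qq1_bigo[OF \<tau>] one) auto
    then show ?thesis by (simp add: e0_def diff_diff_add)
  qed
  have e1: "(\<lambda>u. M12 * e1 u \<tau>) \<in> O[at 0](\<lambda>_. 1)"
  proof -
    have "(\<lambda>u. (M12 / (2 * kap)) * (q2' u \<tau> - (q2' (tt \<tau>) \<tau> + 2 * r1 (tt \<tau>) \<tau> * be / al))) \<in> O[at 0](\<lambda>_. 1)"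
      by (intro landau_o.big.mult_in_1 c1 sum_in_bigo q2'_bigo[OF \<tau>])
    then show ?thesis by (simp add: e1_def diff_diff_add)
  qed
  have De0: "(\<lambda>u. De0 u \<tau>) \<in> O[at 0](\<lambda>_. 1)"
  proof -
    have "(\<lambda>u. 1 / (2 * kap * kap) * q2' u \<tau> - rdot \<tau> / kap) \<in> O[at 0](\<lambda>_. 1)"
      by (intro landau_o.big.mult_in_1 c1 sum_in_bigo q2'_bigo[OF \<tau>])
    then show ?thesis by (simp add: De0_def diff_divide_distrib)
  qed
  have om: "(\<lambda>u. om u \<tau>) \<in> O[at 0](\<lambda>u. 1 / u)"
  proof -
    have v: "(\<lambda>u. qq 1 (u - tt \<tau>) \<tau>) \<in> O[at 0](\<lambda>_. 1)"
      using DERIV_isCont[OF qq_shift_deriv_0[OF \<tau>]] by (rule bigo_of_isCont)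
    have "(\<lambda>u. qq 1 (u - tt \<tau>) \<tau>) \<in> O[at 0](\<lambda>u. 1 / u)"
      by (rule landau_o.big_trans[OF v one[of 1]])
    then have "(\<lambda>u. be + al * (qq 1 u \<tau> - qq 1 (u - tt \<tau>) \<tau>)) \<in> O[at 0](\<lambda>u. 1 / u)"
      by (intro sum_in_bigo one landau_o.big.cmult_in_iff[THEN iffD2] qq1_bigo[OF \<tau>]) auto
    then show ?thesis by (simp add: om_def)
  qed
  have y1: "(\<lambda>u. of_real (Im u / Im \<tau>) :: complex) \<in> O[at 0](\<lambda>_. 1)"
    by (rule landau_o.big_trans[OF y u1])
  have G: "(\<lambda>u. Gt u \<tau>) \<in> O[at 0](\<lambda>_. 1)"
    using sum_in_bigo(1)[OF landau_o.big_trans[OF Gt_bigo[OF \<tau>] u1] c1[of "M22 \<tau>"]] by simp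
  have omyy: "(\<lambda>u. om u \<tau> * (of_real (Im u / Im \<tau>))\<^sup>2) \<in> O[at 0](\<lambda>_. 1)"
    using landau_o.big.mult_in_1[OF uu[OF om y] y1] by (simp add: power2_eq_square mult.assoc)
  have "(\<lambda>u. (e0 u \<tau> * (Gt u \<tau> - M22 \<tau>) + De0 u \<tau> + M12 * e1 u \<tau>) + (2 * Gt u \<tau>) * of_real (Im u / Im \<tau>)
      + om u \<tau> * (of_real (Im u / Im \<tau>))\<^sup>2 - p0 * of_real (Im u / Im \<tau>)) \<in> O[at 0](\<lambda>_. 1)"
    by (intro sum_in_bigo uu[OF e0 Gt_bigo[OF \<tau>]] De0 e1 omyy landau_o.big.mult_in_1 G y1 c1)
  then show ?thesis by (simp add: BB_def Rr_def)
qed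

end

section \<open>Periods along paths between lattice points\<close>

lemma mark_in_UHP_Im: "Im \<tau> > 0 \<Longrightarrow> Im (mark \<tau> z) / Im \<tau> = Im z"
  by (simp add: mark_def)

context params
begin

text \<open>On paths between lattice points \<open>T\<close> extends continuously by \<open>0\<close> to the end points because \<open>\<alpha> > 0\<close>.\<close>

definition ext0 :: "(complex \<times> real \<Rightarrow> complex) \<Rightarrow> complex \<times> real \<Rightarrow> complex" where
  "ext0 s p = (if snd p \<in> {0<..<1} then s p else 0)"

definition period :: "(complex \<times> real \<Rightarrow> complex) \<Rightarrow> (real \<Rightarrow> complex) \<Rightarrow> complex \<Rightarrow> complex" where
  "period s g' \<tau> = integral {0..1} (\<lambda>x. ext0 s (\<tau>, x) * mark \<tau> (g' x))"

text \<open>The offset 3 keeps \<open>eps n\<close> below 1/2, so the truncated interval from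
  \<open>eps n\<close> to \<open>1 - eps n\<close> is never degenerate.\<close>

definition eps :: "nat \<Rightarrow> real" where "eps n = 1 / (real n + 3)"

lemma eps: "0 < eps n" "eps n < 1 / 2" "eps \<longlonglongrightarrow> 0"
proof -
  have "eps = (\<lambda>n. inverse (real (Suc (n + 2))))" by (auto simp: eps_def field_simps)
  then show "eps \<longlonglongrightarrow> 0"
    using LIMSEQ_ignore_initial_segment[OF LIMSEQ_inverse_real_of_nat, of 2] by simp
qed (auto simp: eps_def field_simps)

context
  fixes s :: "complex \<times> real \<Rightarrow> complex" and g g' :: "real \<Rightarrow> complex"
  assumes g: "\<And>x. (g has_vector_derivative g' x) (at x)" and g'c: "continuous_on UNIV g'"
    and g0: "g 0 = 0" and g1: "g 1 \<in> gauss_lattice"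
    and gP: "\<And>x. 0 < x \<Longrightarrow> x < 1 \<Longrightarrow> g x \<notin> PP"
    and s: "Tbr (UHP \<times> {0<..<1::real}) (along g) s"
begin

lemma g_cont: "continuous_on S g"
  using g by (intro continuous_at_imp_continuous_on) (auto dest: has_vector_derivative_continuous)

lemma ext0_cont: "continuous_on (UHP \<times> {0..1}) (ext0 s)"
proof -
  define N where "N p = exp (Re (be * mark (fst p) (g (snd p)))) * norm (th 0 (mark (fst p) (g (snd p))) (fst p)) powr \<alpha>
     * norm (th 0 (mark (fst p) (g (snd p)) - tt (fst p)) (fst p)) powr (- \<alpha>)" for p
  have gl: "g x \<in> gauss_lattice" if "x \<in> {0, 1}" for x using that g0 g1 by auto
  have nz: "th 0 (mark \<tau> (g x) - tt \<tau>) \<tau> \<noteq> 0" if "Im \<tau> > 0" "x \<in> {0..1}" for \<tau> x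
  proof (cases "x \<in> {0, 1}")
    case True
    have "g x - tmark \<alpha> a0 ai \<notin> gauss_lattice"
      using gl[OF True] tmark_notin gauss_lattice_closed(3)[of "g x" "g x - tmark \<alpha> a0 ai"] by auto
    then show ?thesis using th0_mark_eq_0[OF that(1), of "g x - tmark \<alpha> a0 ai"] by (simp add: tt_mark)
  next
    case False
    then have "g x \<notin> PP" using gP that(2) by force
    from mark_image_PP[OF that(1) this] show ?thesis using not_puncture[OF that(1)] by blast
  qed
  have Nc: "continuous_on (UHP \<times> {0..1}) N"
    unfolding N_def tpt_def
    by (intro continuous_intros continuous_on_powr' continuous_on_compose2[OF g_cont[of UNIV]])
       (use al_pos nz in \<open>auto simp: tpt_def\<close>)
  have sN: "norm (ext0 s p) = N p" if "p \<in> UHP \<times> {0..1}" for p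
  proof (cases "snd p \<in> {0<..<1}")
    case True
    then show ?thesis
      using branch_norm[OF s, of p] that by (auto simp: N_def ext0_def case_prod_unfold)
  next
    case False
    then have "snd p \<in> {0, 1}" using that by force
    then have "th 0 (mark (fst p) (g (snd p))) (fst p) = 0"
      using gl th0_mark_eq_0[of "fst p"] that by auto
    then show ?thesis using False by (simp add: N_def ext0_def del: greaterThanLessThan_iff)
  qed
  have op: "open (UHP \<times> {0<..<1::real})" by (intro open_Times open_UHP) auto
  have sc: "continuous_on (UHP \<times> {0<..<1}) s"
    by (rule branch_continuous[OF s])
       (auto simp: case_prod_unfold intro!: continuous_intros continuous_on_compose2[OF g_cont[of UNIV]])
  show ?thesis
    unfolding continuous_on_def
  proof
    fix p assume p: "p \<in> UHP \<times> {0..1::real}"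
    show "(ext0 s \<longlongrightarrow> ext0 s p) (at p within UHP \<times> {0..1})"
    proof (cases "snd p \<in> {0<..<1}")
      case True
      then have pin: "p \<in> UHP \<times> {0<..<1}" using p by (cases p) auto
      then have "(s \<longlongrightarrow> s p) (at p)"
        using sc unfolding continuous_on_eq_continuous_at[OF op] isCont_def by blast
      moreover have "\<forall>\<^sub>F q in at p. s q = ext0 s q"
        using eventually_at_in_open'[OF op pin] by eventually_elim (auto simp: ext0_def)
      ultimately have "(ext0 s \<longlongrightarrow> s p) (at p)" by (rule Lim_transform_eventually)
      then show ?thesis using True by (auto simp: ext0_def[of s p] intro: tendsto_mono[OF at_le])
    next
      case False
      then have 0: "ext0 s p = 0" by (simp add: ext0_def del: greaterThanLessThan_iff)
      then have "N p = 0" using sN[OF p] by simp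
      then have "(N \<longlongrightarrow> 0) (at p within UHP \<times> {0..1})" using Nc p unfolding continuous_on_def by metis
      moreover have "\<forall>\<^sub>F q in at p within UHP \<times> {0..1}. N q = norm (ext0 s q)"
        by (auto simp: eventually_at_filter sN intro!: always_eventually)
      ultimately have "((\<lambda>q. norm (ext0 s q)) \<longlongrightarrow> 0) (at p within UHP \<times> {0..1})"
        by (rule Lim_transform_eventually)
      then show ?thesis unfolding 0 by (rule tendsto_norm_zero_cancel)
    qed
  qed
qed

lemma s_end:
  assumes \<tau>: "Im \<tau> > 0" and x: "\<And>n. 0 < x n \<and> x n < 1" and lim: "x \<longlonglongrightarrow> y" and y: "y \<in> {0, 1}"
  shows "(\<lambda>n. s (\<tau>, x n)) \<longlonglongrightarrow> 0"
proof -
  have "(\<lambda>n. ext0 s (\<tau>, x n)) \<longlonglongrightarrow> ext0 s (\<tau>, y)"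
    by (rule continuous_on_tendsto_compose[OF ext0_cont])
       (use \<tau> x y lim in \<open>auto intro!: tendsto_intros always_eventually simp: less_imp_le\<close>)
  then show ?thesis using x y by (auto simp: ext0_def)
qed

text \<open>Translation by the lattice point at the end moves the question to the puncture 0, where
  \<open>BB\<close> is bounded, while the branch tends to 0.\<close>

lemma BB_end:
  assumes \<tau>: "Im \<tau> > 0" and x: "\<And>n. 0 < x n \<and> x n < 1" and lim: "x \<longlonglongrightarrow> y" and y: "y \<in> {0, 1}"
  shows "(\<lambda>n. s (\<tau>, x n) * BB \<tau> (mark \<tau> (g (x n))) (Im (g (x n)))) \<longlonglongrightarrow> 0"
proof -
  define l where "l = g y"
  have l: "l \<in> gauss_lattice" using y g0 g1 by (auto simp: l_def)
  have np: "g (x n) - l \<notin> PP" for n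
    using gP[of "x n"] x[of n] punctures_shift[of "- l" "g (x n)"] l by auto
  obtain C where C: "\<forall>\<^sub>F u in at 0. norm (BB \<tau> u (Im u / Im \<tau>)) \<le> C"
    using BB_bounded_at_0[OF \<tau>] by (auto elim!: landau_o.bigE)
  have "(\<lambda>n. g (x n)) \<longlonglongrightarrow> g y"
    by (rule continuous_on_tendsto_compose[OF g_cont[of UNIV] lim]) auto
  then have "(\<lambda>n. g (x n) - l) \<longlonglongrightarrow> 0" unfolding l_def by (rule LIM_zero)
  then have "(\<lambda>n. mark \<tau> (g (x n) - l)) \<longlonglongrightarrow> mark \<tau> 0"
    by (intro continuous_on_tendsto_compose[of UNIV "mark \<tau>"] continuous_intros) auto
  moreover have "mark \<tau> (g (x n) - l) \<noteq> 0" for n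
    using np[of n] inj_mark[OF \<tau>, THEN injD, of "g (x n) - l" 0] by (auto simp: punctures_iff)
  ultimately have "filterlim (\<lambda>n. mark \<tau> (g (x n) - l)) (at 0) sequentially"
    by (auto simp: filterlim_at simp del: mark_diff)
  from eventually_compose_filterlim[OF C this]
  have "\<forall>\<^sub>F n in sequentially. norm (BB \<tau> (mark \<tau> (g (x n) - l)) (Im (g (x n) - l))) \<le> C"
    unfolding mark_in_UHP_Im[OF \<tau>] .
  moreover have "BB \<tau> (mark \<tau> (g (x n) - l)) (Im (g (x n) - l)) = BB \<tau> (mark \<tau> (g (x n))) (Im (g (x n)))" for n
    using mark_periodic[of \<tau> "BB \<tau>", OF BB_shift(1)[OF \<tau>] BB_shift(2)[OF \<tau>] \<tau> np[of n] l] by simp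
  ultimately have "Bfun (\<lambda>n. BB \<tau> (mark \<tau> (g (x n))) (Im (g (x n)))) sequentially"
    by (auto intro!: BfunI)
  then show ?thesis
    using bounded_bilinear.Zfun_prod_Bfun[OF bounded_bilinear_mult, of "\<lambda>n. s (\<tau>, x n)"] s_end[OF assms]
    by (simp add: tendsto_Zfun_iff)
qed

definition tr :: "nat \<Rightarrow> (complex \<Rightarrow> complex) \<Rightarrow> complex \<Rightarrow> complex" where
  "tr n h \<tau> = Ii s g g' (eps n) (1 - eps n) h \<tau>"

lemma eps_le: "eps n \<le> 1 - eps n" using eps(2)[of n] by simp

lemma tr_conds:
  shows "continuous_on {eps n..1 - eps n} g" "finite {}"
    "\<And>x. x \<in> {eps n<..<1 - eps n} - {} \<Longrightarrow> (g has_vector_derivative g' x) (at x)"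
    "g ` {eps n..1 - eps n} \<inter> PP = {}"
    "Tbr (UHP \<times> {eps n..1 - eps n}) (along g) s"
proof -
  show "Tbr (UHP \<times> {eps n..1 - eps n}) (along g) s"
    by (rule branch_cong[OF branch_comp[OF s, of "UHP \<times> {eps n..1 - eps n}" "\<lambda>x. x"]])
       (use eps(1,2)[of n] in \<open>auto intro!: continuous_intros\<close>)
  show "g ` {eps n..1 - eps n} \<inter> PP = {}"
  proof -
    have "g x \<notin> PP" if "x \<in> {eps n..1 - eps n}" for x using that gP[of x] eps(1)[of n] by auto
    then show ?thesis by auto
  qed
qed (use g g_cont in auto)

definition bd :: "nat \<Rightarrow> (complex \<Rightarrow> complex \<Rightarrow> complex) \<Rightarrow> complex \<Rightarrow> complex" where
  "bd n H \<tau> = s (\<tau>, 1 - eps n) * H (mark \<tau> (g (1 - eps n))) (of_real (Im (g (1 - eps n))))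
     - s (\<tau>, eps n) * H (mark \<tau> (g (eps n))) (of_real (Im (g (eps n))))"

lemmas tr_path = path_deriv[OF eps_le tr_conds(1,2) g tr_conds(4,5), folded tr_def] path_integrable[OF eps_le tr_conds(1,2) g tr_conds(4,5)]
lemmas tr_exact = exact_integral[OF eps_le tr_conds(1,2) g tr_conds(4,5)]

lemma tr_has_integral:
  assumes "Im \<tau> > 0" "h holomorphic_on - mark \<tau> ` PP"
  shows "((\<lambda>x. s (\<tau>, x) * h (mark \<tau> (g x)) * mark \<tau> (g' x)) has_integral tr n h \<tau>) {eps n..1 - eps n}"
  using tr_path(2)[OF assms, of n] unfolding tr_def Ii_def by (rule integrable_integral)

lemma tr_deriv1:
  assumes "Im \<tau> > 0"
  shows "(tr n (\<lambda>u. 1) has_field_derivative tr n (\<lambda>u. Gt u \<tau>) \<tau> + bd n (\<lambda>u y. y) \<tau>) (at \<tau>)"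
  using tr_path(1)[OF assms nice_one, of n] by (simp add: TH_def bd_def)

lemma tr_deriv2:
  assumes \<tau>: "Im \<tau> > 0"
  shows "((\<lambda>\<tau>. tr n (\<lambda>u. Gt u \<tau>) \<tau> + bd n (\<lambda>u y. y) \<tau>) has_field_derivative
     tr n (\<lambda>u. Gtt u \<tau> + (Gt u \<tau>)\<^sup>2) \<tau> + bd n (\<lambda>u y. 2 * Gt u \<tau> * y + om u \<tau> * y\<^sup>2) \<tau>) (at \<tau>)"
proof -
  have d: "((\<lambda>\<tau>. s (\<tau>, x)) has_field_derivative s (\<tau>, x) * (om (mark \<tau> (g x)) \<tau> * of_real (Im (g x)) + Gt (mark \<tau> (g x)) \<tau>)) (at \<tau>)"
    if "0 < x" "x < 1" for x
  proof (rule branch_tau_deriv[OF _ \<tau>])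
    show "Tbr UHP (\<lambda>\<tau>. (\<tau>, mark \<tau> (g x))) (\<lambda>\<tau>. s (\<tau>, x))"
      by (rule branch_cong[OF branch_comp[OF s, of UHP "\<lambda>\<tau>. (\<tau>, x)"]]) (use that in \<open>auto intro!: continuous_intros\<close>)
  qed
  have "0 < 1 - eps n" "1 - eps n < 1" "0 < eps n" "eps n < 1" using eps(1,2)[of n] by auto
  note d = d[OF this(1,2)] d[OF this(3,4)]
  show ?thesis
    unfolding bd_def
    by (rule DERIV_cong, rule DERIV_add[OF tr_path(1)[OF \<tau> nice_Gt, of n] DERIV_diff[OF DERIV_cmult_right[OF d(1)] DERIV_cmult_right[OF d(2)]]])
       (simp add: TH_def power2_eq_square algebra_simps)
qed

lemma tr_ode:
  assumes \<tau>: "Im \<tau> > 0"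
  shows "(tr n (\<lambda>u. Gtt u \<tau> + (Gt u \<tau>)\<^sup>2) \<tau> + bd n (\<lambda>u y. 2 * Gt u \<tau> * y + om u \<tau> * y\<^sup>2) \<tau>)
     - p0 * (tr n (\<lambda>u. Gt u \<tau>) \<tau> + bd n (\<lambda>u y. y) \<tau>) + phi \<tau> * tr n (\<lambda>u. 1) \<tau>
     = s (\<tau>, 1 - eps n) * BB \<tau> (mark \<tau> (g (1 - eps n))) (Im (g (1 - eps n)))
       - s (\<tau>, eps n) * BB \<tau> (mark \<tau> (g (eps n))) (Im (g (eps n)))"
proof -
  have hol: "(\<lambda>u. Gtt u \<tau> + (Gt u \<tau>)\<^sup>2) holomorphic_on - mark \<tau> ` PP" "(\<lambda>u. Gt u \<tau>) holomorphic_on - mark \<tau> ` PP"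
    "(\<lambda>u. 1) holomorphic_on - mark \<tau> ` PP"
    using nice_Gt Gt_hol[OF \<tau>] \<tau> by (auto simp: nice_def intro!: holomorphic_intros)
  note hi = hol[THEN tr_has_integral[OF \<tau>]]
  have a: "((\<lambda>x. s (\<tau>, x) * (Gtt (mark \<tau> (g x)) \<tau> + (Gt (mark \<tau> (g x)) \<tau>)\<^sup>2) * mark \<tau> (g' x)
      - p0 * (s (\<tau>, x) * Gt (mark \<tau> (g x)) \<tau> * mark \<tau> (g' x)) + phi \<tau> * (s (\<tau>, x) * 1 * mark \<tau> (g' x)))
     has_integral tr n (\<lambda>u. Gtt u \<tau> + (Gt u \<tau>)\<^sup>2) \<tau> - p0 * tr n (\<lambda>u. Gt u \<tau>) \<tau> + phi \<tau> * tr n (\<lambda>u. 1) \<tau>) {eps n..1 - eps n}"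
    by (intro has_integral_add has_integral_diff has_integral_mult_right hi)
  have b: "((\<lambda>x. s (\<tau>, x) * ((Gtt (mark \<tau> (g x)) \<tau> + (Gt (mark \<tau> (g x)) \<tau>)\<^sup>2 - p0 * Gt (mark \<tau> (g x)) \<tau> + phi \<tau>
        - om (mark \<tau> (g x)) \<tau> * Rr (mark \<tau> (g x)) \<tau>) + om (mark \<tau> (g x)) \<tau> * Rr (mark \<tau> (g x)) \<tau>) * mark \<tau> (g' x)) has_integral
     s (\<tau>, 1 - eps n) * Rr (mark \<tau> (g (1 - eps n))) \<tau> - s (\<tau>, eps n) * Rr (mark \<tau> (g (eps n))) \<tau>) {eps n..1 - eps n}"
    by (rule tr_exact[OF \<tau>, of "\<lambda>u. Rr u \<tau>" "\<lambda>u. Gtt u \<tau> + (Gt u \<tau>)\<^sup>2 - p0 * Gt u \<tau> + phi \<tau> - om u \<tau> * Rr u \<tau>"])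
       (use T_ode[OF \<tau>] not_puncture[OF \<tau>] in blast)
  have "tr n (\<lambda>u. Gtt u \<tau> + (Gt u \<tau>)\<^sup>2) \<tau> - p0 * tr n (\<lambda>u. Gt u \<tau>) \<tau> + phi \<tau> * tr n (\<lambda>u. 1) \<tau>
     = s (\<tau>, 1 - eps n) * Rr (mark \<tau> (g (1 - eps n))) \<tau> - s (\<tau>, eps n) * Rr (mark \<tau> (g (eps n))) \<tau>"
    by (rule has_integral_unique[OF a]) (rule has_integral_eq[OF _ b], simp add: algebra_simps)
  then have "tr n (\<lambda>u. Gtt u \<tau> + (Gt u \<tau>)\<^sup>2) \<tau> = s (\<tau>, 1 - eps n) * Rr (mark \<tau> (g (1 - eps n))) \<tau> - s (\<tau>, eps n) * Rr (mark \<tau> (g (eps n))) \<tau>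
     + p0 * tr n (\<lambda>u. Gt u \<tau>) \<tau> - phi \<tau> * tr n (\<lambda>u. 1) \<tau>" by (simp add: algebra_simps)
  then show ?thesis unfolding bd_def BB_def by (simp add: algebra_simps)
qed

lemma period_integrand_continuous:
  assumes "Im \<tau> > 0"
  shows "continuous_on {0..1} (\<lambda>x. ext0 s (\<tau>, x) * mark \<tau> (g' x))"
proof -
  have "continuous_on {0..1} (\<lambda>x. ext0 s (\<tau>, x))"
    by (rule continuous_on_compose2[OF ext0_cont]) (use assms in \<open>auto intro!: continuous_intros\<close>)
  then show ?thesis by (intro continuous_intros continuous_on_subset[OF g'c]) auto
qed

text \<open>The extended integrand is bounded over a compact set of \<tau>, so the two omitted ends
  contribute at most \<open>2 C eps n\<close>. Locally uniform convergence of holomorphic functions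
  carries derivatives to the limit, so only truncated integrals have to be differentiated.\<close>

lemma period_uniform_limit:
  assumes K: "compact K" "K \<subseteq> UHP"
  shows "uniform_limit K (\<lambda>n. tr n (\<lambda>u. 1)) (period s g') sequentially"
proof -
  have cont: "continuous_on (K \<times> {0..1}) (\<lambda>p. ext0 s p * mark (fst p) (g' (snd p)))"
    by (intro continuous_intros continuous_on_compose2[OF g'c] continuous_on_subset[OF ext0_cont]) (use K in auto)
  have "bounded ((\<lambda>p. ext0 s p * mark (fst p) (g' (snd p))) ` (K \<times> {0..1}))"
    by (intro compact_imp_bounded compact_continuous_image cont compact_Times K(1)) auto
  then obtain C where C: "C > 0" "\<And>\<tau> x. \<tau> \<in> K \<Longrightarrow> x \<in> {0..1} \<Longrightarrow> norm (ext0 s (\<tau>, x) * mark \<tau> (g' x)) \<le> C"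
    unfolding bounded_pos by force
  have est: "norm (tr n (\<lambda>u. 1) \<tau> - period s g' \<tau>) \<le> 2 * C * eps n" if \<tau>: "\<tau> \<in> K" for n \<tau>
  proof -
    define f where "f x = ext0 s (\<tau>, x) * mark \<tau> (g' x)" for x
    have "Im \<tau> > 0" using \<tau> K by auto
    note fc = period_integrand_continuous[OF this, folded f_def]
    have fi: "f integrable_on {a..b}" if "0 \<le> a" "b \<le> 1" for a b
      by (rule integrable_continuous_interval, rule continuous_on_subset[OF fc]) (use that in auto)
    have "integral {0..1} f = integral {0..eps n} f + (integral {eps n..1 - eps n} f + integral {1 - eps n..1} f)"
      using eps(1,2)[of n]
      by (simp add: Henstock_Kurzweil_Integration.integral_combine fi)
    moreover have "integral {eps n..1 - eps n} f = tr n (\<lambda>u. 1) \<tau>"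
      unfolding tr_def Ii_def f_def using eps(1,2)[of n] by (intro integral_cong) (auto simp: ext0_def)
    moreover have "norm (integral {0..eps n} f) \<le> C * (eps n - 0)"
      by (rule integral_bound[OF _ continuous_on_subset[OF fc]]) (use eps(1,2)[of n] C(2)[OF \<tau>] in \<open>auto simp: f_def\<close>)
    moreover have "norm (integral {1 - eps n..1} f) \<le> C * (1 - (1 - eps n))"
      by (rule integral_bound[OF _ continuous_on_subset[OF fc]]) (use eps(1,2)[of n] C(2)[OF \<tau>] in \<open>auto simp: f_def\<close>)
    ultimately have "period s g' \<tau> - tr n (\<lambda>u. 1) \<tau> = integral {0..eps n} f + integral {1 - eps n..1} f"
      by (simp add: period_def f_def[abs_def, symmetric])
    then have "norm (period s g' \<tau> - tr n (\<lambda>u. 1) \<tau>) \<le> C * eps n + C * eps n"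
      using norm_triangle_ineq[of "integral {0..eps n} f" "integral {1 - eps n..1} f"]
        \<open>norm (integral {0..eps n} f) \<le> _\<close> \<open>norm (integral {1 - eps n..1} f) \<le> _\<close> by simp
    then show ?thesis by (simp add: norm_minus_commute)
  qed
  show ?thesis
  proof (rule uniform_limitI)
    fix e :: real assume e: "e > 0"
    have "(\<lambda>n. 2 * C * eps n) \<longlonglongrightarrow> 2 * C * 0" by (intro tendsto_intros eps)
    then have "\<forall>\<^sub>F n in sequentially. 2 * C * eps n < e" using e by (simp add: order_tendsto_iff)
    then show "\<forall>\<^sub>F n in sequentially. \<forall>x\<in>K. dist (tr n (\<lambda>u. 1) x) (period s g' x) < e"
      by eventually_elim (auto simp: dist_norm intro: le_less_trans[OF est])
  qed
qed

lemma tr_hol: "tr n (\<lambda>u. 1) holomorphic_on UHP"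
  unfolding holomorphic_on_def field_differentiable_def
  using has_field_derivative_at_within[OF tr_deriv1] by fastforce

lemma period_hol: "period s g' holomorphic_on UHP"
proof (rule holomorphic_uniform_sequence[OF open_UHP tr_hol])
  fix \<tau> assume "\<tau> \<in> UHP"
  then obtain r where "r > 0" "cball \<tau> r \<subseteq> UHP" using open_contains_cball_eq[OF open_UHP] by blast
  then show "\<exists>r>0. cball \<tau> r \<subseteq> UHP \<and> uniform_limit (cball \<tau> r) (\<lambda>n. tr n (\<lambda>u. 1)) (period s g') sequentially"
    using period_uniform_limit[OF compact_cball] by blast
qed

lemma period_limits:
  assumes \<tau>: "Im \<tau> > 0"
  shows "(\<lambda>n. tr n (\<lambda>u. 1) \<tau>) \<longlonglongrightarrow> period s g' \<tau>"
    "(\<lambda>n. (deriv ^^ k) (tr n (\<lambda>u. 1)) \<tau>) \<longlonglongrightarrow> (deriv ^^ k) (period s g') \<tau>"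
proof -
  obtain r where r: "r > 0" "cball \<tau> r \<subseteq> UHP" using open_contains_cball_eq[OF open_UHP] \<tau> by (metis UHP_iff)
  note ul = period_uniform_limit[OF compact_cball r(2)]
  have t: "\<tau> \<in> ball \<tau> r" using r by simp
  show "(\<lambda>n. (deriv ^^ k) (tr n (\<lambda>u. 1)) \<tau>) \<longlonglongrightarrow> (deriv ^^ k) (period s g') \<tau>"
    by (rule higher_deriv_complex_uniform_limit[OF uniform_limit_on_subset[OF ul ball_subset_cball]])
       (use t r(2) in \<open>auto intro!: always_eventually holomorphic_on_subset[OF tr_hol]\<close>)
  show "(\<lambda>n. tr n (\<lambda>u. 1) \<tau>) \<longlonglongrightarrow> period s g' \<tau>"
    using tendsto_uniform_limitI[OF ul, of \<tau>] t by auto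
qed

lemma seq_ends:
  "\<And>n. 0 < eps n \<and> eps n < 1" "\<And>n. 0 < 1 - eps n \<and> 1 - eps n < 1" "(\<lambda>n. 1 - eps n) \<longlonglongrightarrow> 1"
proof -
  show "0 < eps n \<and> eps n < 1" "0 < 1 - eps n \<and> 1 - eps n < 1" for n using eps(1,2)[of n] by auto
  show "(\<lambda>n. 1 - eps n) \<longlonglongrightarrow> 1" using tendsto_diff[OF tendsto_const[of 1] eps(3)] by simp
qed

lemma deriv_tr:
  assumes "Im \<tau> > 0"
  shows "deriv (tr n (\<lambda>u. 1)) \<tau> = tr n (\<lambda>u. Gt u \<tau>) \<tau> + bd n (\<lambda>u y. y) \<tau>"
    "deriv (deriv (tr n (\<lambda>u. 1))) \<tau> = tr n (\<lambda>u. Gtt u \<tau> + (Gt u \<tau>)\<^sup>2) \<tau> + bd n (\<lambda>u y. 2 * Gt u \<tau> * y + om u \<tau> * y\<^sup>2) \<tau>"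
proof -
  have d: "deriv (tr n (\<lambda>u. 1)) \<tau> = tr n (\<lambda>u. Gt u \<tau>) \<tau> + bd n (\<lambda>u y. y) \<tau>" if "Im \<tau> > 0" for \<tau>
    by (rule DERIV_imp_deriv[OF tr_deriv1[OF that]])
  then show "deriv (tr n (\<lambda>u. 1)) \<tau> = tr n (\<lambda>u. Gt u \<tau>) \<tau> + bd n (\<lambda>u y. y) \<tau>" using assms by blast
  show "deriv (deriv (tr n (\<lambda>u. 1))) \<tau> = tr n (\<lambda>u. Gtt u \<tau> + (Gt u \<tau>)\<^sup>2) \<tau> + bd n (\<lambda>u y. 2 * Gt u \<tau> * y + om u \<tau> * y\<^sup>2) \<tau>"
    by (rule DERIV_imp_deriv, rule has_field_derivative_transform_within_open[OF tr_deriv2[OF assms] open_UHP])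
       (use d assms in auto)
qed

lemma period_ode:
  assumes \<tau>: "Im \<tau> > 0"
  shows "deriv (deriv (period s g')) \<tau> - p0 * deriv (period s g') \<tau> + phi \<tau> * period s g' \<tau> = 0"
proof -
  have d1: "(\<lambda>n. deriv (tr n (\<lambda>u. 1)) \<tau>) \<longlonglongrightarrow> deriv (period s g') \<tau>"
    using period_limits(2)[OF \<tau>, of "Suc 0"] by simp
  have d2: "(\<lambda>n. deriv (deriv (tr n (\<lambda>u. 1))) \<tau>) \<longlonglongrightarrow> deriv (deriv (period s g')) \<tau>"
    using period_limits(2)[OF \<tau>, of "Suc (Suc 0)"] by simp
  have L1: "(\<lambda>n. deriv (deriv (tr n (\<lambda>u. 1))) \<tau> - p0 * deriv (tr n (\<lambda>u. 1)) \<tau> + phi \<tau> * tr n (\<lambda>u. 1) \<tau>)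
    \<longlonglongrightarrow> deriv (deriv (period s g')) \<tau> - p0 * deriv (period s g') \<tau> + phi \<tau> * period s g' \<tau>"
    by (intro tendsto_intros period_limits(1)[OF \<tau>] d1 d2)
  have L2: "(\<lambda>n. deriv (deriv (tr n (\<lambda>u. 1))) \<tau> - p0 * deriv (tr n (\<lambda>u. 1)) \<tau> + phi \<tau> * tr n (\<lambda>u. 1) \<tau>) \<longlonglongrightarrow> 0 - 0"
    unfolding deriv_tr[OF \<tau>] tr_ode[OF \<tau>]
    by (intro tendsto_diff BB_end[OF \<tau> seq_ends(1) eps(3)] BB_end[OF \<tau> seq_ends(2,3)]) auto
  show ?thesis using LIMSEQ_unique[OF L1 L2] by simp
qed

text \<open>The end point term \<open>bd\<close> vanishes in the limit together with the branch, so
  the derivative of a period is the improper integral of \<open>T Gt\<close>. A linear relation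
  between a period and its derivative thus says that a twisted integral vanishes.\<close>

lemma period_deriv_limit:
  assumes \<tau>: "Im \<tau> > 0"
  shows "(\<lambda>n. tr n (\<lambda>u. c0 + \<mu> * Gt u \<tau>) \<tau>) \<longlonglongrightarrow> c0 * period s g' \<tau> + \<mu> * deriv (period s g') \<tau>"
proof -
  have gl: "(\<lambda>n. g (x n)) \<longlonglongrightarrow> g y" if "x \<longlonglongrightarrow> y" for x y
    by (rule continuous_on_tendsto_compose[OF g_cont[of UNIV] that]) auto
  have "(\<lambda>n. bd n (\<lambda>u y. y) \<tau>) \<longlonglongrightarrow> 0 * of_real (Im (g 1)) - 0 * of_real (Im (g 0))"
    unfolding bd_def by (intro tendsto_intros gl s_end[OF \<tau> seq_ends(1) eps(3)] s_end[OF \<tau> seq_ends(2,3)] seq_ends(3) eps(3)) auto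
  moreover have "(\<lambda>n. deriv (tr n (\<lambda>u. 1)) \<tau>) \<longlonglongrightarrow> deriv (period s g') \<tau>"
    using period_limits(2)[OF \<tau>, of "Suc 0"] by simp
  ultimately have "(\<lambda>n. c0 * tr n (\<lambda>u. 1) \<tau> + \<mu> * (deriv (tr n (\<lambda>u. 1)) \<tau> - bd n (\<lambda>u y. y) \<tau>))
    \<longlonglongrightarrow> c0 * period s g' \<tau> + \<mu> * (deriv (period s g') \<tau> - (0 * of_real (Im (g 1)) - 0 * of_real (Im (g 0))))"
    by (intro tendsto_intros period_limits(1)[OF \<tau>])
  moreover have "c0 * tr n (\<lambda>u. 1) \<tau> + \<mu> * (deriv (tr n (\<lambda>u. 1)) \<tau> - bd n (\<lambda>u y. y) \<tau>) = tr n (\<lambda>u. c0 + \<mu> * Gt u \<tau>) \<tau>" for n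
  proof -
    have hol: "(\<lambda>u. Gt u \<tau>) holomorphic_on - mark \<tau> ` PP" "(\<lambda>u. 1) holomorphic_on - mark \<tau> ` PP"
      using Gt_hol[OF \<tau>] by auto
    note hi = hol[THEN tr_has_integral[OF \<tau>]]
    have "((\<lambda>x. c0 * (s (\<tau>, x) * 1 * mark \<tau> (g' x)) + \<mu> * (s (\<tau>, x) * Gt (mark \<tau> (g x)) \<tau> * mark \<tau> (g' x)))
       has_integral (c0 * tr n (\<lambda>u. 1) \<tau> + \<mu> * tr n (\<lambda>u. Gt u \<tau>) \<tau>)) {eps n..1 - eps n}"
      by (intro has_integral_add has_integral_mult_right hi)
    then have "tr n (\<lambda>u. c0 + \<mu> * Gt u \<tau>) \<tau> = c0 * tr n (\<lambda>u. 1) \<tau> + \<mu> * tr n (\<lambda>u. Gt u \<tau>) \<tau>"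
      unfolding tr_def[of _ "\<lambda>u. c0 + \<mu> * Gt u \<tau>"] Ii_def by (intro integral_unique) (simp add: algebra_simps)
    then show ?thesis by (simp add: deriv_tr[OF \<tau>])
  qed
  ultimately show ?thesis by simp
qed

end

end

section \<open>Regular solutions at lattice points\<close>

text \<open>The open segment from the common point \<open>u\<close> to \<open>c\<close> lies in both
  sets and has \<open>c\<close> in its closure.\<close>

lemma closure_Int_convex_open:
  fixes c :: "'a::euclidean_space"
  assumes "open S" "convex S" "open T" "convex T" "u \<in> S \<inter> T" "c \<in> closure S" "c \<in> closure T" "c \<notin> S"
  shows "c \<in> closure (S \<inter> T)"
proof -
  have "open_segment u c \<subseteq> S" "open_segment u c \<subseteq> T"
    using in_interior_closure_convex_segment[of S u c] in_interior_closure_convex_segment[of T u c] assms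
    by (auto simp: interior_open)
  then have "closure (open_segment u c) \<subseteq> closure (S \<inter> T)" by (intro closure_mono) auto
  moreover have "c \<in> closure (open_segment u c)" using assms by (auto simp: closure_open_segment)
  ultimately show ?thesis by auto
qed

lemma positive_bounds:
  fixes E :: "complex \<Rightarrow> real"
  assumes "isCont E 0" "E 0 > 0"
  obtains r a b where "0 < r" "0 < a" "0 < b" "\<And>u. norm u < r \<Longrightarrow> a \<le> E u \<and> E u \<le> b"
proof -
  have "(E \<longlongrightarrow> E 0) (nhds 0)" using assms(1) by (simp add: isCont_def tendsto_at_iff_tendsto_nhds)
  then have "\<forall>\<^sub>F u in nhds 0. E u > E 0 / 2" "\<forall>\<^sub>F u in nhds 0. E u < 2 * E 0"
    using order_tendstoD(1)[of E "E 0" "nhds 0" "E 0 / 2"] order_tendstoD(2)[of E "E 0" "nhds 0" "2 * E 0"] assms(2) by auto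
  then have "\<forall>\<^sub>F u in nhds 0. E 0 / 2 \<le> E u \<and> E u \<le> 2 * E 0" by eventually_elim auto
  then obtain r where "r > 0" "\<And>u. dist u 0 < r \<Longrightarrow> E 0 / 2 \<le> E u \<and> E u \<le> 2 * E 0"
    unfolding eventually_nhds_metric by blast
  then show ?thesis using that[of r "E 0 / 2" "2 * E 0"] assms(2) by auto
qed

context params
begin

lemma Gt_lattice:
  assumes \<tau>: "Im \<tau> > 0" and u: "u \<notin> mark \<tau> ` PP" and l: "l \<in> gauss_lattice"
  shows "om (u + mark \<tau> l) \<tau> = om u \<tau>" "Gt (u + mark \<tau> l) \<tau> = Gt u \<tau> - of_real (Im l) * om u \<tau>"
    "u + mark \<tau> l \<notin> mark \<tau> ` PP"
proof -
  define z where "z = unmark \<tau> u"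
  have z: "u = mark \<tau> z" using \<tau> by (simp add: z_def)
  have zP: "z \<notin> PP" using u mark_notin[OF \<tau>, of z] by (simp add: z)
  show om: "om (u + mark \<tau> l) \<tau> = om u \<tau>"
    using mark_periodic[of \<tau> "\<lambda>u y. om u \<tau>", OF om_shift(1)[OF \<tau>] om_shift(2)[OF \<tau>] \<tau> zP l] by (simp add: z)
  \<comment> \<open>The combination \<open>Gt + y om\<close> is invariant when \<open>y\<close>
    grows by 1 with each shift by \<tau>.\<close>
  have "Gt (u + 1) \<tau> + om (u + 1) \<tau> * of_real y = Gt u \<tau> + om u \<tau> * of_real y"
     "Gt (u + \<tau>) \<tau> + om (u + \<tau>) \<tau> * of_real (y + 1) = Gt u \<tau> + om u \<tau> * of_real y"
    if "u \<notin> mark \<tau> ` PP" for u and y :: real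
    unfolding om_shift[OF \<tau> that] Gt_shift[OF \<tau> that] by (simp_all add: algebra_simps)
  from mark_periodic[of \<tau> "\<lambda>u y. Gt u \<tau> + om u \<tau> * of_real y", OF this \<tau> zP l]
  show "Gt (u + mark \<tau> l) \<tau> = Gt u \<tau> - of_real (Im l) * om u \<tau>" using om by (simp add: z algebra_simps)
  show "u + mark \<tau> l \<notin> mark \<tau> ` PP"
    using mark_notin[OF \<tau>, of "z + l"] zP punctures_shift[OF l, of z] by (simp add: z add.commute)
qed

context
  fixes \<tau> c0 \<mu> :: complex
  assumes \<tau>: "Im \<tau> > 0"
begin

definition hh :: "complex \<Rightarrow> complex" where "hh u = c0 + \<mu> * Gt u \<tau>"

definition sol :: "complex set \<Rightarrow> (complex \<Rightarrow> complex) \<Rightarrow> bool" where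
  "sol Q f \<longleftrightarrow> (\<forall>u\<in>Q. (f has_field_derivative hh u - om u \<tau> * f u) (at u))"

text \<open>
  The solution which is regular at the lattice point \<open>l\<close>. Its value there makes the family of regular
  solutions compatible with the translation behaviour \<open>Gt (u + \<tau>) = Gt u - om u\<close>.
\<close>

definition reg :: "complex \<Rightarrow> complex set \<Rightarrow> (complex \<Rightarrow> complex) \<Rightarrow> bool" where
  "reg l Q f \<longleftrightarrow> sol Q f \<and> (f \<longlongrightarrow> - \<mu> * of_real (Im l)) (at (mark \<tau> l) within Q)"

text \<open>Convexity and absence of punctures provide a branch and a primitive on \<open>Q\<close>;
  having the lattice point in the closure gives a meaning to regularity there, although it is never
  in \<open>Q\<close>.\<close>

definition good :: "complex \<Rightarrow> complex set \<Rightarrow> bool" where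
  "good l Q \<longleftrightarrow> l \<in> gauss_lattice \<and> open Q \<and> convex Q \<and> Q \<inter> mark \<tau> ` PP = {} \<and> mark \<tau> l \<in> closure Q"

lemma lattice_in_PP: "l \<in> gauss_lattice \<Longrightarrow> mark \<tau> l \<in> mark \<tau> ` PP"
  by (auto simp: punctures_iff)

lemma branch_ex:
  assumes "convex Q" "Q \<inter> mark \<tau> ` PP = {}"
  obtains B where "Tbr Q (\<lambda>u. (\<tau>, u)) B"
  by (rule branch_exists[of Q "\<lambda>u. (\<tau>, u)"])
     (use assms \<tau> in \<open>auto intro!: convex_imp_contractible continuous_intros\<close>)

lemma branch_D:
  assumes "Tbr Q (\<lambda>u. (\<tau>, u)) B" "open Q" "u \<in> Q"
  shows "(B has_field_derivative B u * om u \<tau>) (at u)"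
  using branch_u_deriv[OF assms(1,3) \<tau>] at_within_open[OF assms(3,2)] by simp

lemma branch_tendsto_0:
  assumes B: "Tbr Q (\<lambda>u. (\<tau>, u)) B" and l: "l \<in> gauss_lattice"
  shows "(B \<longlongrightarrow> 0) (at (mark \<tau> l) within Q)"
proof -
  define N where "N u = exp (Re (be * u)) * norm (th 0 u \<tau>) powr \<alpha> * norm (th 0 (u - tt \<tau>) \<tau>) powr (- \<alpha>)" for u
  have z: "th 0 (mark \<tau> l) \<tau> = 0" using th0_mark_eq_0[OF \<tau>] l by simp
  have "l - tmark \<alpha> a0 ai \<notin> gauss_lattice"
    using l tmark_notin gauss_lattice_closed(3)[of l "l - tmark \<alpha> a0 ai"] by auto
  then have nz: "th 0 (mark \<tau> l - tt \<tau>) \<tau> \<noteq> 0"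
    using th0_mark_eq_0[OF \<tau>, of "l - tmark \<alpha> a0 ai"] by (simp add: tt_mark)
  have cont: "isCont (\<lambda>u. th 0 u \<tau>) u" for u by (rule DERIV_isCont[OF th_deriv_u[OF \<tau>]])
  have "(\<lambda>u. th 0 (u - tt \<tau>) \<tau>) \<midarrow>mark \<tau> l\<rightarrow> th 0 (mark \<tau> l - tt \<tau>) \<tau>"
    by (rule isCont_tendsto_compose[OF cont]) (auto intro!: tendsto_intros)
  moreover have "(\<lambda>u. th 0 u \<tau>) \<midarrow>mark \<tau> l\<rightarrow> 0" using cont[of "mark \<tau> l"] z by (simp add: isCont_def)
  moreover have "((\<lambda>u. norm (th 0 u \<tau>) powr \<alpha>) \<longlongrightarrow> 0) (at (mark \<tau> l))"
    using tendsto_powr'[OF tendsto_norm_zero[OF \<open>(\<lambda>u. th 0 u \<tau>) \<midarrow>mark \<tau> l\<rightarrow> 0\<close>] tendsto_const[of \<alpha>]] al_pos by simp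
  ultimately have "(N \<longlongrightarrow> exp (Re (be * mark \<tau> l)) * 0 * norm (th 0 (mark \<tau> l - tt \<tau>) \<tau>) powr (- \<alpha>)) (at (mark \<tau> l))"
    unfolding N_def using nz by (intro tendsto_intros) auto
  then have "(N \<longlongrightarrow> 0) (at (mark \<tau> l) within Q)" by (auto intro: tendsto_mono[OF at_le])
  moreover have "\<forall>\<^sub>F u in at (mark \<tau> l) within Q. N u = norm (B u)"
    using branch_norm[OF B] by (auto simp: eventually_at_filter N_def intro!: always_eventually)
  ultimately show ?thesis by (rule tendsto_norm_zero_cancel[OF Lim_transform_eventually])
qed

lemma sol_D:
  assumes "Tbr Q (\<lambda>u. (\<tau>, u)) B" "open Q" "sol Q f" "u \<in> Q"
  shows "((\<lambda>u. B u * f u) has_field_derivative B u * hh u) (at u)"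
  by (rule DERIV_cong, rule DERIV_mult[OF branch_D[OF assms(1,2,4)]])
     (use assms(3,4) in \<open>auto simp: sol_def algebra_simps\<close>)

lemma sol_diff_const:
  assumes "Tbr Q (\<lambda>u. (\<tau>, u)) B" "open Q" "convex Q" "sol Q f" "sol Q k"
  obtains d where "\<And>u. u \<in> Q \<Longrightarrow> B u * (f u - k u) = d"
proof -
  have "((\<lambda>u. B u * f u - B u * k u) has_field_derivative 0) (at u within Q)" if "u \<in> Q" for u
    using DERIV_diff[OF sol_D[OF assms(1,2,4) that] sol_D[OF assms(1,2,5) that]]
    by (auto intro: has_field_derivative_at_within)
  from has_field_derivative_zero_constant[OF assms(3) this] obtain d where "\<And>u. u \<in> Q \<Longrightarrow> B u * f u - B u * k u = d" by blast
  then show ?thesis using that[of d] by (simp add: right_diff_distrib)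
qed

lemma good_nontrivial:
  assumes "good l Q"
  shows "at (mark \<tau> l) within Q \<noteq> bot"
proof -
  have "mark \<tau> l \<notin> Q" "mark \<tau> l \<in> closure Q" using assms lattice_in_PP by (auto simp: good_def)
  then show ?thesis by (simp add: trivial_limit_within islimpt_in_closure)
qed

text \<open>\<open>T (f - k)\<close> is constant on \<open>Q\<close> and tends to 0 at the lattice
  point, because \<open>T\<close> does and \<open>f\<close>, \<open>k\<close> have limits.\<close>

lemma sol_unique:
  assumes g: "good l Q" and f: "sol Q f" "sol Q k"
    and lim: "(f \<longlongrightarrow> x) (at (mark \<tau> l) within Q)" "(k \<longlongrightarrow> y) (at (mark \<tau> l) within Q)" and u: "u \<in> Q"
  shows "f u = k u"
proof -
  have Q: "open Q" "convex Q" "Q \<inter> mark \<tau> ` PP = {}" "l \<in> gauss_lattice" using g by (auto simp: good_def)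
  obtain B where B: "Tbr Q (\<lambda>u. (\<tau>, u)) B" using branch_ex[OF Q(2,3)] .
  obtain d where d: "\<And>u. u \<in> Q \<Longrightarrow> B u * (f u - k u) = d" using sol_diff_const[OF B Q(1,2) f] by blast
  have "((\<lambda>u. B u * (f u - k u)) \<longlongrightarrow> 0 * (x - y)) (at (mark \<tau> l) within Q)"
    by (intro tendsto_intros lim branch_tendsto_0[OF B Q(4)])
  moreover have "\<forall>\<^sub>F u in at (mark \<tau> l) within Q. B u * (f u - k u) = d"
    using d by (auto simp: eventually_at_filter)
  ultimately have "((\<lambda>u. d) \<longlongrightarrow> 0) (at (mark \<tau> l) within Q)" by (auto dest: Lim_transform_eventually)
  then have "d = 0" using good_nontrivial[OF g] by (simp add: tendsto_const_iff)
  then show ?thesis using d[OF u] branch_nonzero[OF B u] by simp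
qed

lemma reg_unique: "good l Q \<Longrightarrow> reg l Q f \<Longrightarrow> reg l Q k \<Longrightarrow> u \<in> Q \<Longrightarrow> f u = k u"
  unfolding reg_def using sol_unique by blast

lemma reg_mono: "reg l Q f \<Longrightarrow> Q' \<subseteq> Q \<Longrightarrow> reg l Q' f"
  unfolding reg_def sol_def by (auto intro: tendsto_within_subset)

lemma good_Int:
  assumes "good l Q" "good l Q'" "u \<in> Q \<inter> Q'"
  shows "good l (Q \<inter> Q')"
  using assms lattice_in_PP[of l] unfolding good_def
  by (auto intro!: closure_Int_convex_open[of Q Q' u] convex_Int)

lemma h_bounded: obtains r C where "r > 0" "\<And>u. norm u < r \<Longrightarrow> u \<noteq> 0 \<Longrightarrow> norm (hh u) \<le> C"
proof -
  obtain C where C: "\<forall>\<^sub>F u in at 0. norm (Gt u \<tau> - M22 \<tau>) \<le> C * norm u"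
    using Gt_bigo[OF \<tau>] by (elim landau_o.bigE) auto
  obtain r where r: "r > 0" "\<And>u. u \<noteq> 0 \<Longrightarrow> norm u < r \<Longrightarrow> norm (Gt u \<tau> - M22 \<tau>) \<le> C * norm u"
    using C unfolding eventually_at by (auto simp: dist_norm)
  show ?thesis
  proof (rule that[of r "norm c0 + norm \<mu> * (\<bar>C\<bar> * r + norm (M22 \<tau>))"])
    fix u :: complex assume u: "norm u < r" "u \<noteq> 0"
    have "norm (Gt u \<tau> - M22 \<tau>) \<le> \<bar>C\<bar> * r"
      by (rule order_trans[OF r(2)[OF u(2,1)]]) (use u in \<open>auto intro!: mult_mono\<close>)
    then have "norm (Gt u \<tau>) \<le> \<bar>C\<bar> * r + norm (M22 \<tau>)"
      using norm_triangle_sub[of "Gt u \<tau>" "M22 \<tau>"] by simp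
    then have "norm (\<mu> * Gt u \<tau>) \<le> norm \<mu> * (\<bar>C\<bar> * r + norm (M22 \<tau>))"
      unfolding norm_mult by (rule mult_left_mono) simp
    then show "norm (hh u) \<le> norm c0 + norm \<mu> * (\<bar>C\<bar> * r + norm (M22 \<tau>))"
      unfolding hh_def by (intro order_trans[OF norm_triangle_ineq]) simp
  qed (fact r)
qed

lemma hh_hol: "hh holomorphic_on - mark \<tau> ` PP"
  unfolding hh_def[abs_def] by (intro holomorphic_intros Gt_hol[OF \<tau>])

lemma branch_bounds_0:
  obtains r a b where "0 < r" "0 < a" "0 < b"
    "\<And>Q B u. Tbr Q (\<lambda>u. (\<tau>, u)) B \<Longrightarrow> u \<in> Q \<Longrightarrow> norm u < r \<Longrightarrow>
       a * norm u powr \<alpha> \<le> norm (B u) \<and> norm (B u) \<le> b * norm u powr \<alpha>"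
proof -
  obtain W where W: "W holomorphic_on UNIV" "\<And>u. th 0 u \<tau> = u * W u" "W 0 = th 1 0 \<tau>"
    using th0_factor_at_0[OF \<tau>] by metis
  define E where "E u = exp (Re (be * u)) * norm (W u) powr \<alpha> * norm (th 0 (u - tt \<tau>) \<tau>) powr (- \<alpha>)" for u
  have W0: "W 0 \<noteq> 0" using W(3) th1_0_nonzero[OF \<tau>] by (simp add: One_nat_def)
  have "isCont W 0" using holomorphic_on_imp_continuous_on[OF W(1)] by (simp add: continuous_on_eq_continuous_at)
  moreover have "isCont (\<lambda>u. th 0 (u - tt \<tau>) \<tau>) 0"
    by (rule isCont_o2[of 0 "\<lambda>u. u - tt \<tau>", OF _ DERIV_isCont[OF th_deriv_u[OF \<tau>]]]) auto
  ultimately have "isCont E 0"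
    unfolding E_def using W0 th0_minus_tt[OF \<tau>] by (intro continuous_intros) auto
  moreover have "E 0 > 0" using W0 th0_minus_tt[OF \<tau>] by (simp add: E_def)
  ultimately obtain r a b where rab: "0 < r" "0 < a" "0 < b" "\<And>u. norm u < r \<Longrightarrow> a \<le> E u \<and> E u \<le> b"
    using positive_bounds by metis
  show ?thesis
  proof (rule that[OF rab(1-3)])
    fix Q B u assume B: "Tbr Q (\<lambda>u. (\<tau>, u)) B" "u \<in> Q" and u: "norm u < r"
    have "norm (B u) = E u * norm u powr \<alpha>"
      using branch_norm[OF B] by (simp add: E_def W(2) norm_mult powr_mult)
    then show "a * norm u powr \<alpha> \<le> norm (B u) \<and> norm (B u) \<le> b * norm u powr \<alpha>"
      using rab(4)[OF u] by (auto intro!: mult_right_mono)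
  qed
qed

text \<open>Near 0 the integrand \<open>T h\<close> is of order \<open>|u|\<close> to the power
  \<alpha>, so its primitive \<open>P\<close> has a limit \<open>L\<close> there. Then
  \<open>P - L\<close> is of order \<open>\<alpha> + 1\<close>, and \<open>f = (P - L) / T\<close>
  is of order \<open>|u|\<close>, since \<open>T\<close> is bounded below by a multiple of
  \<open>|u|\<close> to the power \<alpha>.\<close>

lemma ex_reg_0:
  assumes g: "good 0 Q"
  shows "\<exists>f. reg 0 Q f"
proof -
  have Q: "open Q" "convex Q" "Q \<inter> mark \<tau> ` PP = {}" "0 \<in> closure Q" using g by (auto simp: good_def)
  have 0: "0 \<notin> Q" using lattice_in_PP[of 0] Q(3) by auto
  obtain B where B: "Tbr Q (\<lambda>u. (\<tau>, u)) B" using branch_ex[OF Q(2,3)] .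
  have Bhol: "B holomorphic_on Q"
    using branch_D[OF B Q(1)] by (auto simp: holomorphic_on_open[OF Q(1)])
  have "(\<lambda>u. B u * hh u) holomorphic_on Q"
    using Q(3) by (intro holomorphic_intros Bhol holomorphic_on_subset[OF hh_hol]) auto
  then obtain P where P: "\<And>u. u \<in> Q \<Longrightarrow> (P has_field_derivative B u * hh u) (at u within Q)"
    using holomorphic_convex_primitive'[OF Q(2,1)] by blast
  obtain r1 C1 where 1: "r1 > 0" "\<And>u. norm u < r1 \<Longrightarrow> u \<noteq> 0 \<Longrightarrow> norm (hh u) \<le> C1" using h_bounded by blast
  obtain r2 a b where 2: "0 < r2" "0 < a" "0 < b"
    "\<And>u. u \<in> Q \<Longrightarrow> norm u < r2 \<Longrightarrow> a * norm u powr \<alpha> \<le> norm (B u) \<and> norm (B u) \<le> b * norm u powr \<alpha>"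
    using branch_bounds_0 B by metis
  define r where "r = min r1 r2"
  have r: "r > 0" using 1 2 by (simp add: r_def)
  define C where "C = b * \<bar>C1\<bar>"
  have bnd: "norm (B u * hh u) \<le> C * \<rho> powr \<alpha>" if "u \<in> Q" "norm u \<le> \<rho>" "norm u < r" for u \<rho>
  proof -
    have "norm (B u) \<le> b * \<rho> powr \<alpha>"
      using 2(4)[OF that(1)] that 2(3) al_pos powr_mono2[of \<alpha> "norm u" \<rho>] unfolding r_def
      by (smt (verit) mult_left_mono norm_ge_zero)
    moreover have "norm (hh u) \<le> \<bar>C1\<bar>" using 1(2)[of u] that 0 by (force simp: r_def)
    ultimately have "norm (B u) * norm (hh u) \<le> (b * \<rho> powr \<alpha>) * \<bar>C1\<bar>"
      using 2(3) by (intro mult_mono) auto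
    then show ?thesis by (simp add: norm_mult C_def mult_ac)
  qed
  have lip: "norm (P u - P v) \<le> C * \<rho> powr \<alpha> * norm (u - v)"
    if "u \<in> Q" "v \<in> Q" "norm u \<le> \<rho>" "norm v \<le> \<rho>" "\<rho> < r" for u v \<rho>
  proof (rule field_differentiable_bound[of "Q \<inter> cball 0 \<rho>"])
    show "convex (Q \<inter> cball 0 \<rho>)" by (intro convex_Int Q(2)) auto
    show "(P has_field_derivative B z * hh z) (at z within Q \<inter> cball 0 \<rho>)" if "z \<in> Q \<inter> cball 0 \<rho>" for z
      using P that by (auto intro: DERIV_subset)
    show "norm (B z * hh z) \<le> C * \<rho> powr \<alpha>" if "z \<in> Q \<inter> cball 0 \<rho>" for z
      using bnd[of z \<rho>] that \<open>\<rho> < r\<close> by auto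
  qed (use that in auto)
  \<comment> \<open>On half the radius one Lipschitz constant serves for all pairs of points, so
    \<open>P\<close> extends to the boundary point 0.\<close>
  define X where "X = Q \<inter> ball 0 (r / 2)"
  have Xc: "0 \<in> closure X"
    using open_Int_closure_subset[of "ball 0 (r / 2)" Q] r Q(4) by (auto simp: X_def Int_commute)
  have "uniformly_continuous_on X P"
  proof (rule lipschitz_on_uniformly_continuous[OF lipschitz_onI])
    show "dist (P u) (P v) \<le> (\<bar>C\<bar> * (r / 2) powr \<alpha>) * dist u v" if "u \<in> X" "v \<in> X" for u v
    proof -
      have "norm (P u - P v) \<le> C * (r / 2) powr \<alpha> * norm (u - v)"
        by (rule lip) (use that r in \<open>auto simp: X_def\<close>)
      also have "\<dots> \<le> \<bar>C\<bar> * (r / 2) powr \<alpha> * norm (u - v)" by (intro mult_right_mono) auto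
      finally show ?thesis by (simp add: dist_norm)
    qed
  qed simp
  from uniformly_continuous_on_extension_at_closure[OF this Xc]
  obtain L where L: "(P \<longlongrightarrow> L) (at 0 within X)" .
  have nt: "at 0 within X \<noteq> bot" using Xc 0 by (simp add: trivial_limit_within islimpt_in_closure X_def)
  define f where "f u = (P u - L) / B u" for u
  have fb: "norm (f u) \<le> 2 * C / a * norm u" if u: "u \<in> Q" "norm u < r" for u
  proof -
    have "((\<lambda>v. norm (P u - P v)) \<longlongrightarrow> norm (P u - L)) (at 0 within X)" by (intro tendsto_intros L)
    moreover have "\<forall>\<^sub>F v in at 0 within X. norm (P u - P v) \<le> C * norm u powr \<alpha> * (2 * norm u)"
    proof -
      have "u \<noteq> 0" using u 0 by auto
      then have "\<forall>\<^sub>F v in at 0 within X. v \<in> ball 0 (norm u) \<and> v \<in> X"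
        by (auto simp: eventually_at_filter eventually_nhds_in_open intro!: eventually_mono[OF eventually_nhds_in_open[of "ball 0 (norm u)" 0]])
      then show ?thesis
      proof eventually_elim
        case (elim v)
        then have "norm (P u - P v) \<le> C * norm u powr \<alpha> * norm (u - v)" by (intro lip) (use u in \<open>auto simp: X_def\<close>)
        also have "\<dots> \<le> C * norm u powr \<alpha> * (2 * norm u)"
          using norm_triangle_ineq4[of u v] elim 2(3) by (intro mult_left_mono) (auto simp: C_def)
        finally show ?case .
      qed
    qed
    ultimately have PL: "norm (P u - L) \<le> C * norm u powr \<alpha> * (2 * norm u)"
      by (rule tendsto_upperbound[OF _ _ nt])
    have "0 < norm u powr \<alpha>" using u 0 by auto
    then have "0 < a * norm u powr \<alpha>" "a * norm u powr \<alpha> \<le> norm (B u)" using 2(2) 2(4)[OF u(1)] u by (auto simp: r_def)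
    then have "norm (f u) \<le> (C * norm u powr \<alpha> * (2 * norm u)) / (a * norm u powr \<alpha>)"
      unfolding f_def norm_divide using PL 2(3) by (intro frac_le) (auto simp: C_def)
    also have "\<dots> = 2 * C / a * norm u" using \<open>0 < norm u powr \<alpha>\<close> 2(2) by (simp add: field_simps)
    finally show ?thesis .
  qed
  have "(f \<longlongrightarrow> 0) (at 0 within Q)"
  proof (rule Lim_null_comparison)
    show "((\<lambda>u. 2 * C / a * norm u) \<longlongrightarrow> 0) (at 0 within Q)"
      by (intro tendsto_mult_right_zero tendsto_norm_zero tendsto_ident_at)
    show "\<forall>\<^sub>F u in at 0 within Q. norm (f u) \<le> 2 * C / a * norm u"
      using fb r unfolding eventually_at by (auto simp: dist_norm)
  qed
  moreover have "sol Q f"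
    unfolding sol_def
  proof
    fix u assume u: "u \<in> Q"
    have "(P has_field_derivative B u * hh u) (at u)" using P[OF u] at_within_open[OF u Q(1)] by simp
    moreover have "B u \<noteq> 0" using branch_nonzero[OF B u] .
    ultimately show "(f has_field_derivative hh u - om u \<tau> * f u) (at u)"
      unfolding f_def using branch_D[OF B Q(1) u]
      by (auto intro!: derivative_eq_intros simp: field_simps)
  qed
  ultimately show ?thesis by (auto simp: reg_def)
qed

lemma good_shift:
  assumes "good l Q" "k \<in> gauss_lattice"
  shows "good (l + k) ((+) (mark \<tau> k) ` Q)"
proof -
  have "(+) (mark \<tau> k) ` Q \<inter> mark \<tau> ` PP = {}"
    using assms Gt_lattice(3)[OF \<tau> _ assms(2)] by (auto simp: good_def add.commute disjoint_iff)
  moreover have "mark \<tau> (l + k) \<in> closure ((+) (mark \<tau> k) ` Q)"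
    unfolding closure_translation using assms(1) by (auto simp: good_def image_iff)
  ultimately show ?thesis
    using assms by (auto simp: good_def simp del: add.commute mark_add intro!: open_translation convex_translation)
qed

text \<open>Translation by \<open>k\<close> changes \<open>hh\<close> by
  \<open>- \<mu> Im k om\<close>, which is compensated by subtracting the constant
  \<open>\<mu> Im k\<close> from the solution.\<close>

lemma reg_shift:
  assumes g: "good l Q" and r: "reg l Q f" and k: "k \<in> gauss_lattice"
  shows "reg (l + k) ((+) (mark \<tau> k) ` Q) (\<lambda>w. f (w - mark \<tau> k) - \<mu> * of_real (Im k))"
  unfolding reg_def sol_def
proof (intro conjI ballI)
  fix w assume "w \<in> (+) (mark \<tau> k) ` Q"
  then obtain u where u: "u \<in> Q" "w = u + mark \<tau> k" by (auto simp: add.commute)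
  have uP: "u \<notin> mark \<tau> ` PP" using u g by (auto simp: good_def)
  have "(f has_field_derivative hh u - om u \<tau> * f u) (at (w - mark \<tau> k))" using r u by (auto simp: reg_def sol_def)
  then have "((\<lambda>w. f (w - mark \<tau> k)) has_field_derivative hh u - om u \<tau> * f u) (at w)"
    using DERIV_chain2[of f _ "\<lambda>w. w - mark \<tau> k" w 1 UNIV] by (force intro!: derivative_eq_intros)
  then show "((\<lambda>w. f (w - mark \<tau> k) - \<mu> * of_real (Im k)) has_field_derivative
      hh w - om w \<tau> * (f (w - mark \<tau> k) - \<mu> * of_real (Im k))) (at w)"
    by (rule DERIV_cong[OF DERIV_diff[OF _ DERIV_const]])
       (simp add: u(2) hh_def Gt_lattice[OF \<tau> uP k] algebra_simps)
next
  have "(f \<longlongrightarrow> - \<mu> * of_real (Im l)) (at (mark \<tau> l) within Q)" using r by (simp add: reg_def)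
  moreover have "filterlim (\<lambda>w. w - mark \<tau> k) (at (mark \<tau> l) within Q) (at (mark \<tau> (l + k)) within (+) (mark \<tau> k) ` Q)"
    unfolding filterlim_at
  proof
    show "\<forall>\<^sub>F w in at (mark \<tau> (l + k)) within (+) (mark \<tau> k) ` Q. w - mark \<tau> k \<in> Q \<and> w - mark \<tau> k \<noteq> mark \<tau> l"
      unfolding eventually_at_filter by (intro always_eventually) (auto simp: algebra_simps)
  qed (auto intro!: tendsto_eq_intros)
  ultimately have "((\<lambda>w. f (w - mark \<tau> k)) \<longlongrightarrow> - \<mu> * of_real (Im l)) (at (mark \<tau> (l + k)) within (+) (mark \<tau> k) ` Q)"
    by (rule filterlim_compose)
  from tendsto_diff[OF this tendsto_const[of "\<mu> * of_real (Im k)"]]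
  show "((\<lambda>w. f (w - mark \<tau> k) - \<mu> * of_real (Im k)) \<longlongrightarrow> - \<mu> * of_real (Im (l + k))) (at (mark \<tau> (l + k)) within (+) (mark \<tau> k) ` Q)"
    by (simp add: ring_distribs)
qed

lemma ex_reg:
  assumes g: "good l Q"
  shows "\<exists>f. reg l Q f"
proof -
  have l: "l \<in> gauss_lattice" using g by (simp add: good_def)
  then have ml: "- l \<in> gauss_lattice" by auto
  from good_shift[OF g ml] have g0: "good 0 ((+) (mark \<tau> (- l)) ` Q)" by simp
  from ex_reg_0[OF this] obtain f where "reg 0 ((+) (mark \<tau> (- l)) ` Q) f" ..
  from reg_shift[OF g0 this l]
  have "reg l ((+) (mark \<tau> l) ` (+) (mark \<tau> (- l)) ` Q) (\<lambda>w. f (w - mark \<tau> l) - \<mu> * of_real (Im l))" by simp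
  moreover have "mark \<tau> l + mark \<tau> (- l) = 0" using mark_add[of \<tau> l "- l"] by simp
  then have "(+) (mark \<tau> l) ` (+) (mark \<tau> (- l)) ` Q = Q" by (simp add: image_image add.assoc[symmetric])
  ultimately show ?thesis by auto
qed

text \<open>The regular solution at \<open>l\<close> without reference to a region. The value is
  unambiguous because two good regions containing \<open>u\<close> meet in a good region.\<close>

definition Fc :: "complex \<Rightarrow> complex \<Rightarrow> complex" where
  "Fc l u = (THE v. \<exists>Q f. good l Q \<and> u \<in> Q \<and> reg l Q f \<and> v = f u)"

lemma Fc_eq:
  assumes "good l Q" "reg l Q f" "u \<in> Q"
  shows "Fc l u = f u"
  unfolding Fc_def
proof (rule the_equality)
  show "\<exists>Q k. good l Q \<and> u \<in> Q \<and> reg l Q k \<and> f u = k u" using assms by blast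
  fix v assume "\<exists>Q f. good l Q \<and> u \<in> Q \<and> reg l Q f \<and> v = f u"
  then obtain Q' k where k: "good l Q'" "u \<in> Q'" "reg l Q' k" "v = k u" by blast
  have "good l (Q \<inter> Q')" by (rule good_Int) (use assms k in auto)
  from reg_unique[OF this reg_mono[OF k(3)] reg_mono[OF assms(2)]] show "v = f u" using k assms by simp
qed

lemma Fc_reg:
  assumes g: "good l Q"
  shows "reg l Q (Fc l)"
proof -
  obtain f where f: "reg l Q f" using ex_reg[OF g] ..
  have eq: "Fc l u = f u" if "u \<in> Q" for u by (rule Fc_eq[OF g f that])
  have op: "open Q" using g by (simp add: good_def)
  show ?thesis
    unfolding reg_def sol_def
  proof (intro conjI ballI)
    fix u assume u: "u \<in> Q"
    have "(f has_field_derivative hh u - om u \<tau> * f u) (at u)" using f u by (auto simp: reg_def sol_def)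
    from has_field_derivative_transform_within_open[OF this op u, of "Fc l"] show "(Fc l has_field_derivative hh u - om u \<tau> * Fc l u) (at u)"
      using eq u by simp
  next
    have "\<forall>\<^sub>F u in at (mark \<tau> l) within Q. f u = Fc l u" using eq by (auto simp: eventually_at_filter)
    then show "(Fc l \<longlongrightarrow> - \<mu> * of_real (Im l)) (at (mark \<tau> l) within Q)"
      by (rule Lim_transform_eventually[rotated]) (use f in \<open>auto simp: reg_def\<close>)
  qed
qed

lemma Fc_shift:
  assumes "good l Q" "u \<in> Q" "k \<in> gauss_lattice"
  shows "Fc (l + k) (u + mark \<tau> k) = Fc l u - \<mu> * of_real (Im k)"
  using Fc_eq[OF good_shift[OF assms(1,3)] reg_shift[OF assms(1) Fc_reg[OF assms(1)] assms(3)], of "u + mark \<tau> k"] assms(2)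
  by (simp add: add.commute)

text \<open>\<open>T (Fc l - Fc k)\<close> is constant on a region that is good for both lattice
  points, so one common value decides.\<close>

lemma Fc_agree_transfer:
  assumes g: "good l Q" "good k Q" and u: "u \<in> Q" "Fc l u = Fc k u" and v: "v \<in> Q"
  shows "Fc l v = Fc k v"
proof -
  have Q: "open Q" "convex Q" "Q \<inter> mark \<tau> ` PP = {}" using g by (auto simp: good_def)
  obtain B where B: "Tbr Q (\<lambda>u. (\<tau>, u)) B" using branch_ex[OF Q(2,3)] .
  have "sol Q (Fc l)" "sol Q (Fc k)" using Fc_reg g by (auto simp: reg_def)
  then obtain d where d: "\<And>u. u \<in> Q \<Longrightarrow> B u * (Fc l u - Fc k u) = d" using sol_diff_const[OF B Q(1,2)] by blast
  then show ?thesis using d[OF u(1)] d[OF v] u(2) branch_nonzero[OF B v] by simp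
qed

text \<open>Along the side, \<open>T Fc 0\<close> is a primitive of \<open>T h\<close>. It tends to
  0 at the start, so by the vanishing integral also at the end, where \<open>T Fc l\<close> tends to
  0 as well. Therefore the constant \<open>T (Fc 0 - Fc l)\<close> is 0.\<close>

lemma Fc_agree_side:
  assumes g: "\<And>x. (g has_vector_derivative g' x) (at x)"
    and g0: "g 0 = 0" and g1: "g 1 = l"
    and s: "Tbr (UHP \<times> {0<..<1::real}) (along g) s"
    and Q: "good 0 Q" "good l Q" and gQ: "\<And>x. 0 < x \<Longrightarrow> x < 1 \<Longrightarrow> mark \<tau> (g x) \<in> Q"
    and lim: "(\<lambda>n. Ii s g g' (eps n) (1 - eps n) hh \<tau>) \<longlonglongrightarrow> 0"
    and u: "u \<in> Q"
  shows "Fc 0 u = Fc l u"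
proof -
  have Q': "open Q" "convex Q" "Q \<inter> mark \<tau> ` PP = {}" "l \<in> gauss_lattice" using Q by (auto simp: good_def)
  obtain B where B: "Tbr Q (\<lambda>u. (\<tau>, u)) B" using branch_ex[OF Q'(2,3)] .
  have gc: "continuous_on S g" for S
    using g by (intro continuous_at_imp_continuous_on) (auto dest: has_vector_derivative_continuous)
  have s\<tau>: "Tbr {0<..<1::real} (\<lambda>x. (\<tau>, mark \<tau> (g x))) (\<lambda>x. s (\<tau>, x))"
    by (rule branch_cong[OF branch_comp[OF s, of "{0<..<1}" "\<lambda>x. (\<tau>, x)"]]) (use \<tau> in \<open>auto intro!: continuous_intros\<close>)
  have B\<tau>: "Tbr {0<..<1::real} (\<lambda>x. (\<tau>, mark \<tau> (g x))) (\<lambda>x. B (mark \<tau> (g x)))"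
    by (rule branch_comp[OF B]) (use gQ in \<open>auto intro!: continuous_intros gc\<close>)
  obtain k where k: "k \<noteq> 0" "\<And>x. x \<in> {0<..<1} \<Longrightarrow> s (\<tau>, x) = k * B (mark \<tau> (g x))"
    using branch_unique[OF connected_Ioo B\<tau> s\<tau>] by metis
  note sol0 = Fc_reg[OF Q(1), unfolded reg_def] and soll = Fc_reg[OF Q(2), unfolded reg_def]
  obtain d where d: "\<And>u. u \<in> Q \<Longrightarrow> B u * (Fc 0 u - Fc l u) = d"
    using sol_diff_const[OF B Q'(1,2)] sol0 soll by metis
  have I: "Ii s g g' (eps n) (1 - eps n) hh \<tau> = k * (B (mark \<tau> (g (1 - eps n))) * Fc 0 (mark \<tau> (g (1 - eps n))))
     - k * (B (mark \<tau> (g (eps n))) * Fc 0 (mark \<tau> (g (eps n))))" for n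
    unfolding Ii_def
  proof (rule integral_unique, rule fundamental_theorem_of_calculus)
    show "eps n \<le> 1 - eps n" using eps(2)[of n] by simp
    fix x assume x: "x \<in> {eps n..1 - eps n}"
    then have x01: "0 < x" "x < 1" using eps(1)[of n] by auto
    have "((\<lambda>x. B (mark \<tau> (g x)) * Fc 0 (mark \<tau> (g x))) has_vector_derivative
       mark \<tau> (g' x) * (B (mark \<tau> (g x)) * hh (mark \<tau> (g x)))) (at x)"
      using field_vector_diff_chain_at[OF has_vector_derivative_mark[OF g] sol_D[OF B Q'(1) conjunct1[OF sol0] gQ[OF x01]]]
      by (simp add: o_def)
    from has_vector_derivative_mult_right[OF this, of k]
    show "((\<lambda>x. k * (B (mark \<tau> (g x)) * Fc 0 (mark \<tau> (g x)))) has_vector_derivative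
        s (\<tau>, x) * hh (mark \<tau> (g x)) * mark \<tau> (g' x)) (at x within {eps n..1 - eps n})"
      using k(2)[of x] x01 by (auto simp: mult_ac intro: has_vector_derivative_at_within)
  qed
  have path: "filterlim (\<lambda>n. mark \<tau> (g (x n))) (at (mark \<tau> (g y)) within Q) sequentially"
    if "x \<longlonglongrightarrow> y" "\<And>n. 0 < x n \<and> x n < 1" "g y \<in> gauss_lattice" for x y
  proof -
    have "(\<lambda>n. mark \<tau> (g (x n))) \<longlonglongrightarrow> mark \<tau> (g y)"
      using that(1) by (intro continuous_on_tendsto_compose[of UNIV "\<lambda>x. mark \<tau> (g x)"] continuous_intros gc) auto
    moreover have "\<forall>\<^sub>F n in sequentially. mark \<tau> (g (x n)) \<in> Q \<and> mark \<tau> (g (x n)) \<noteq> mark \<tau> (g y)"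
    proof -
      have "mark \<tau> (g y) \<notin> Q" using lattice_in_PP[OF that(3)] Q'(3) by auto
      then show ?thesis using gQ that(2) by (intro always_eventually) metis
    qed
    ultimately show ?thesis by (simp add: filterlim_at)
  qed
  have e0: "\<And>n. 0 < eps n \<and> eps n < 1" and e1: "\<And>n. 0 < 1 - eps n \<and> 1 - eps n < 1"
    using eps(1,2) by (smt (verit) field_sum_of_halves)+
  have p0: "filterlim (\<lambda>n. mark \<tau> (g (eps n))) (at (mark \<tau> 0) within Q) sequentially"
    using path[OF eps(3) e0] g0 by simp
  have p1: "filterlim (\<lambda>n. mark \<tau> (g (1 - eps n))) (at (mark \<tau> l) within Q) sequentially"
    using path[OF tendsto_diff[OF tendsto_const[of 1] eps(3)] e1] g1 Q'(4) by simp
  have l0: "((\<lambda>u. B u * Fc 0 u) \<longlongrightarrow> 0 * (- \<mu> * of_real (Im 0))) (at (mark \<tau> 0) within Q)"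
    using branch_tendsto_0[OF B, of 0] sol0 by (intro tendsto_mult) auto
  have l1: "((\<lambda>u. B u * Fc l u) \<longlongrightarrow> 0 * (- \<mu> * of_real (Im l))) (at (mark \<tau> l) within Q)"
    using branch_tendsto_0[OF B Q'(4)] soll by (intro tendsto_mult) auto
  define A where "A n = B (mark \<tau> (g (1 - eps n))) * Fc 0 (mark \<tau> (g (1 - eps n)))" for n
  define A0 where "A0 n = B (mark \<tau> (g (eps n))) * Fc 0 (mark \<tau> (g (eps n)))" for n
  define A1 where "A1 n = B (mark \<tau> (g (1 - eps n))) * Fc l (mark \<tau> (g (1 - eps n)))" for n
  have "A0 \<longlonglongrightarrow> 0" using filterlim_compose[OF l0 p0] by (simp add: A0_def[abs_def])
  moreover have "A1 \<longlonglongrightarrow> 0" using filterlim_compose[OF l1 p1] by (simp add: A1_def[abs_def])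
  moreover have "(\<lambda>n. k * A n - k * A0 n) \<longlonglongrightarrow> 0" using lim unfolding I A_def A0_def .
  ultimately have "(\<lambda>n. ((k * A n - k * A0 n) + k * A0 n) / k - A1 n) \<longlonglongrightarrow> (0 + k * 0) / k - 0"
    by (intro tendsto_intros) (use k in auto)
  moreover have "((k * A n - k * A0 n) + k * A0 n) / k - A1 n = d" for n
    using d[OF gQ, of "1 - eps n"] e1[of n] k(1) by (simp add: A_def A1_def right_diff_distrib)
  ultimately have "d = 0" by (simp add: tendsto_const_iff)
  then show ?thesis using d[OF u] branch_nonzero[OF B u] by simp
qed

end

section \<open>Gluing regular solutions\<close>

context
  fixes \<tau> c0 \<mu> w1 w2 :: complex and x0 y0 :: real and \<zeta> :: "complex \<Rightarrow> complex"
  assumes \<tau>: "Im \<tau> > 0" and xy: "0 < x0" "x0 < 1" "0 < y0" "y0 < 1"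
    and \<zeta>: "\<And>z. \<zeta> z = Re z *\<^sub>R w1 + Im z *\<^sub>R w2" and bij: "bij \<zeta>"
    and lat: "\<And>z. \<zeta> z \<in> gauss_lattice \<longleftrightarrow> z \<in> gauss_lattice"
    and tlat: "tmark \<alpha> a0 ai - \<zeta> (Complex x0 y0) \<in> gauss_lattice"
begin

lemma \<zeta>_add: "\<zeta> (a + b) = \<zeta> a + \<zeta> b" and \<zeta>_diff: "\<zeta> (a - b) = \<zeta> a - \<zeta> b" and \<zeta>_0: "\<zeta> 0 = 0"
  and \<zeta>_1: "\<zeta> 1 = w1" and \<zeta>_i: "\<zeta> \<i> = w2"
  by (simp_all add: \<zeta> algebra_simps)

lemma linear_\<zeta>: "linear \<zeta>"
  by (rule linearI) (simp_all add: \<zeta> algebra_simps)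

abbreviation (input) mm :: "complex \<Rightarrow> complex" where "mm z \<equiv> mark \<tau> (\<zeta> z)"

lemma linear_mm: "linear (\<lambda>z. mm z)"
  using linear_compose[OF linear_\<zeta> linear_mark[of \<tau>]] by (simp add: o_def)

lemma surj_mark: "surj (mark \<tau>)"
  by (rule surjI[of _ "unmark \<tau>"]) (simp add: \<tau>)

lemma bij_mm: "bij (\<lambda>z. mm z)"
  using bij_comp[OF bij, of "mark \<tau>"] inj_mark[OF \<tau>] surj_mark by (simp add: bij_def o_def)

text \<open>The punctures in coordinates with respect to the lattice basis \<open>w1\<close>,
  \<open>w2\<close>. The basis is left free so that \<open>t\<close> can be given coordinates
  strictly between 0 and 1 even when it lies on a side of the parallelogram.\<close>

lemma PP_iff: "\<zeta> z \<in> PP \<longleftrightarrow> z \<in> gauss_lattice \<or> z - Complex x0 y0 \<in> gauss_lattice"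
proof -
  have "\<zeta> z - tmark \<alpha> a0 ai \<in> gauss_lattice \<longleftrightarrow> \<zeta> (z - Complex x0 y0) \<in> gauss_lattice"
    using tlat gauss_lattice_closed(2)[of "\<zeta> z - tmark \<alpha> a0 ai" "tmark \<alpha> a0 ai - \<zeta> (Complex x0 y0)"]
      gauss_lattice_closed(3)[of "\<zeta> z - \<zeta> (Complex x0 y0)" "tmark \<alpha> a0 ai - \<zeta> (Complex x0 y0)"]
    by (auto simp: \<zeta>_diff algebra_simps)
  then show ?thesis by (simp add: punctures_iff lat)
qed

text \<open>The open row and column around \<open>0\<close> between neighbouring translates of \<open>t\<close>; their lattice translates
  cover the punctured plane.\<close>

definition hs :: "complex \<Rightarrow> bool" where "hs z \<longleftrightarrow> \<bar>Re z\<bar> < 1 \<and> y0 - 1 < Im z \<and> Im z < y0"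
definition vs :: "complex \<Rightarrow> bool" where "vs z \<longleftrightarrow> \<bar>Im z\<bar> < 1 \<and> x0 - 1 < Re z \<and> Re z < x0"

lemma int_small: "\<bar>of_int m :: real\<bar> < 1 \<Longrightarrow> m = 0"
  by (metis of_int_abs of_int_less_1_iff zabs_less_one_iff)

lemma strip_no_puncture:
  assumes "hs z \<or> vs z" "z \<noteq> 0"
  shows "\<zeta> z \<notin> PP"
proof
  assume "\<zeta> z \<in> PP"
  then consider "z \<in> gauss_lattice" | "z - Complex x0 y0 \<in> gauss_lattice" using PP_iff by blast
  then show False
  proof cases
    case 1
    then obtain m n where z: "z = Complex (of_int m) (of_int n)" by (auto simp: gauss_lattice_iff)
    have "\<bar>real_of_int m\<bar> < 1" "\<bar>real_of_int n\<bar> < 1" using assms(1) xy by (auto simp: hs_def vs_def z)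
    then show False using int_small z assms(2) by (auto simp: complex_eq_iff)
  next
    case 2
    then obtain m n where "z - Complex x0 y0 = Complex (of_int m) (of_int n)" by (auto simp: gauss_lattice_iff)
    then have z: "Re z = x0 + of_int m" "Im z = y0 + of_int n" by (auto simp: complex_eq_iff)
    have "(-1 < real_of_int n \<and> real_of_int n < 0) \<or> (-1 < real_of_int m \<and> real_of_int m < 0)"
      using assms(1) by (auto simp: hs_def vs_def z)
    then have "n = 0 \<and> n < 0 \<or> m = 0 \<and> m < 0" using int_small[of n] int_small[of m] by auto
    then show False by auto
  qed
qed

definition rect :: "real \<Rightarrow> real \<Rightarrow> real \<Rightarrow> real \<Rightarrow> complex set" where
  "rect a b c d = (\<lambda>z. mm z) ` box (Complex a c) (Complex b d)"

lemma good_rect_at: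
  assumes "a < b" "c < d" "Complex p q \<in> gauss_lattice" "a \<le> p" "p \<le> b" "c \<le> q" "q \<le> d"
    and H: "\<And>z. z \<in> box (Complex a c) (Complex b d) \<Longrightarrow> (hs z \<or> vs z) \<and> z \<noteq> 0"
  shows "good \<tau> (\<zeta> (Complex p q)) (rect a b c d)"
  unfolding good_def[OF \<tau>]
proof (intro conjI)
  show "open (rect a b c d)"
    unfolding rect_def using bij_mm by (intro open_surjective_linear_image linear_mm open_box) (auto simp: bij_def)
  show "convex (rect a b c d)"
    unfolding rect_def by (intro convex_linear_image linear_mm convex_box)
  show "rect a b c d \<inter> mark \<tau> ` PP = {}"
    using H strip_no_puncture mark_image_PP[OF \<tau>] by (auto simp: rect_def)
  have "Complex ((a + b) / 2) ((c + d) / 2) \<in> box (Complex a c) (Complex b d)" using assms by (simp add: in_box_complex_iff)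
  then have "closure (box (Complex a c) (Complex b d)) = cbox (Complex a c) (Complex b d)" by (intro closure_box) blast
  then have "Complex p q \<in> closure (box (Complex a c) (Complex b d))" using assms by (simp add: in_cbox_complex_iff)
  moreover have "continuous_on UNIV (\<lambda>z. mm z)" using linear_mm by (rule linear_continuous_on[OF linear_conv_bounded_linear[THEN iffD1]])
  then have "(\<lambda>z. mm z) ` closure (box (Complex a c) (Complex b d)) \<subseteq> closure (rect a b c d)"
    unfolding rect_def by (intro image_closure_subset) (auto intro: continuous_on_subset closure_subset[THEN subsetD])
  ultimately show "mark \<tau> (\<zeta> (Complex p q)) \<in> closure (rect a b c d)" by blast
qed (use assms lat in auto)

lemma good_rect:
  assumes "a < b" "c < d" "a \<le> 0" "0 \<le> b" "c \<le> 0" "0 \<le> d"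
    and H: "\<And>z. z \<in> box (Complex a c) (Complex b d) \<Longrightarrow> (hs z \<or> vs z) \<and> z \<noteq> 0"
  shows "good \<tau> 0 (rect a b c d)"
  using good_rect_at[of a b c d 0 0] assms by (simp add: \<zeta>_0 zero_complex.code[symmetric])

lemma good_h: "good \<tau> 0 (rect (-1) 1 0 y0)" "good \<tau> 0 (rect (-1) 1 (y0 - 1) 0)"
    "good \<tau> 0 (rect 0 1 (y0 - 1) y0)" "good \<tau> 0 (rect (-1) 0 (y0 - 1) y0)"
  and good_v: "good \<tau> 0 (rect 0 x0 (-1) 1)" "good \<tau> 0 (rect (x0 - 1) 0 (-1) 1)"
    "good \<tau> 0 (rect (x0 - 1) x0 0 1)" "good \<tau> 0 (rect (x0 - 1) x0 (-1) 0)"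
  by (rule good_rect; use xy in \<open>auto simp: in_box_complex_iff hs_def vs_def\<close>)+

lemma mm_rect: "mm z \<in> rect a b c d \<longleftrightarrow> a < Re z \<and> Re z < b \<and> c < Im z \<and> Im z < d"
  unfolding rect_def inj_image_mem_iff[OF bij_is_inj[OF bij_mm]] by (auto simp: in_box_complex_iff)

text \<open>The punctured row and column are not convex; eight rectangles with 0 on their boundary
  cover them, the thin ones catching the points on an axis.\<close>

lemma strip_cases:
  assumes "hs d \<or> vs d" "d \<noteq> 0"
  obtains Q where "good \<tau> 0 Q" "mm d \<in> Q"
proof -
  have nz: "Re d \<noteq> 0 \<or> Im d \<noteq> 0" using assms(2) by (simp add: complex_eq_iff)
  show ?thesis
  proof (cases "hs d")
    case True
    consider "Im d > 0" | "Im d < 0" | "Im d = 0" "Re d > 0" | "Im d = 0" "Re d < 0" using nz by (metis linorder_neqE)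
    then show ?thesis
    proof cases
      case 1 then show ?thesis using that[OF good_h(1)] True by (auto simp: mm_rect hs_def abs_less_iff)
    next
      case 2 then show ?thesis using that[OF good_h(2)] True by (auto simp: mm_rect hs_def abs_less_iff)
    next
      case 3 then show ?thesis using that[OF good_h(3)] True by (auto simp: mm_rect hs_def abs_less_iff)
    next
      case 4 then show ?thesis using that[OF good_h(4)] True by (auto simp: mm_rect hs_def abs_less_iff)
    qed
  next
    case False
    then have v: "vs d" using assms by blast
    consider "Re d > 0" | "Re d < 0" | "Re d = 0" "Im d > 0" | "Re d = 0" "Im d < 0" using nz by (metis linorder_neqE)
    then show ?thesis
    proof cases
      case 1 then show ?thesis using that[OF good_v(1)] v by (auto simp: mm_rect vs_def abs_less_iff)
    next
      case 2 then show ?thesis using that[OF good_v(2)] v by (auto simp: mm_rect vs_def abs_less_iff)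
    next
      case 3 then show ?thesis using that[OF good_v(3)] v by (auto simp: mm_rect vs_def abs_less_iff)
    next
      case 4 then show ?thesis using that[OF good_v(4)] v by (auto simp: mm_rect vs_def abs_less_iff)
    qed
  qed
qed

text \<open>The counterpart of \<open>good_rect_at\<close> for the triangles: the segment from
  \<open>k\<close> to \<open>p\<close> witnesses that \<open>k\<close> lies in the closure.\<close>

lemma good_image:
  assumes "open S" "convex S" "k \<in> gauss_lattice" "p \<in> S"
    and ray: "\<And>t. 0 < t \<Longrightarrow> t \<le> 1 \<Longrightarrow> k + t *\<^sub>R (p - k) \<in> S" and np: "\<And>z. z \<in> S \<Longrightarrow> \<zeta> z \<notin> PP"
  shows "good \<tau> (\<zeta> k) ((\<lambda>z. mm z) ` S)"
  unfolding good_def[OF \<tau>]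
proof (intro conjI)
  show "open ((\<lambda>z. mm z) ` S)"
    using bij_mm assms(1) by (intro open_surjective_linear_image linear_mm) (auto simp: bij_def)
  show "convex ((\<lambda>z. mm z) ` S)"
    by (intro convex_linear_image linear_mm assms(2))
  show "(\<lambda>z. mm z) ` S \<inter> mark \<tau> ` PP = {}"
    using np mark_image_PP[OF \<tau>] by auto
  have "(\<lambda>n. k + inverse (real (Suc n)) *\<^sub>R (p - k)) \<longlonglongrightarrow> k + 0 *\<^sub>R (p - k)"
    by (intro tendsto_intros LIMSEQ_inverse_real_of_nat)
  then have "(\<lambda>n. mm (k + inverse (real (Suc n)) *\<^sub>R (p - k))) \<longlonglongrightarrow> mm k"
    using bounded_linear.tendsto[OF linear_conv_bounded_linear[THEN iffD1, OF linear_mm],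
      of "\<lambda>n. k + inverse (real (Suc n)) *\<^sub>R (p - k)" "k + 0 *\<^sub>R (p - k)" sequentially] by simp
  moreover have "mm (k + inverse (real (Suc n)) *\<^sub>R (p - k)) \<in> (\<lambda>z. mm z) ` S" for n
    by (intro imageI ray) (auto simp: inverse_le_1_iff)
  ultimately show "mm k \<in> closure ((\<lambda>z. mm z) ` S)"
    unfolding closure_sequential by (intro exI[of _ "\<lambda>n. mm (k + inverse (real (Suc n)) *\<^sub>R (p - k))"]) simp
qed (use assms lat in auto)

abbreviation (input) FF where "FF \<equiv> Fc \<tau> c0 \<mu>"

lemma good_1: "good \<tau> w1 (rect 0 1 (y0 - 1) y0)" and good_i: "good \<tau> w2 (rect (x0 - 1) x0 0 1)"
proof -
  have "good \<tau> (\<zeta> (Complex 1 0)) (rect 0 1 (y0 - 1) y0)" "good \<tau> (\<zeta> (Complex 0 1)) (rect (x0 - 1) x0 0 1)"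
    by (rule good_rect_at; use xy in \<open>auto simp: in_box_complex_iff hs_def vs_def gauss_lattice_ReIm\<close>)+
  then show "good \<tau> w1 (rect 0 1 (y0 - 1) y0)" "good \<tau> w2 (rect (x0 - 1) x0 0 1)" by (simp_all add: \<zeta>)
qed

context
  fixes s :: "complex \<times> real \<Rightarrow> complex" and g g' :: "real \<Rightarrow> complex" and l :: complex and q :: "real \<Rightarrow> complex"
  assumes g: "\<And>x. (g has_vector_derivative g' x) (at x)" and g0: "g 0 = 0" and g1: "g 1 = l"
    and s: "Tbr (UHP \<times> {0<..<1::real}) (along g) s"
    and gq: "\<And>x. g x = \<zeta> (q x)"
    and lim: "(\<lambda>n. Ii s g g' (eps n) (1 - eps n) (hh \<tau> c0 \<mu>) \<tau>) \<longlonglongrightarrow> 0"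
begin

lemmas agree_side = Fc_agree_side[OF \<tau> g g0 g1 s _ _ _ lim]

lemma direct_row:
  assumes "l = w1" "\<And>x. 0 < x \<Longrightarrow> x < 1 \<Longrightarrow> 0 < Re (q x) \<and> Re (q x) < 1 \<and> y0 - 1 < Im (q x) \<and> Im (q x) < y0"
    and "0 < Re z" "Re z < 1" "y0 - 1 < Im z" "Im z < y0"
  shows "FF 0 (mm z) = FF w1 (mm z)"
  using agree_side[of "rect 0 1 (y0 - 1) y0" "mm z"] good_h(3) good_1 assms gq by (simp add: mm_rect)

lemma direct_column:
  assumes "l = w2" "\<And>x. 0 < x \<Longrightarrow> x < 1 \<Longrightarrow> x0 - 1 < Re (q x) \<and> Re (q x) < x0 \<and> 0 < Im (q x) \<and> Im (q x) < 1"
    and "x0 - 1 < Re z" "Re z < x0" "0 < Im z" "Im z < 1"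
  shows "FF 0 (mm z) = FF w2 (mm z)"
  using agree_side[of "rect (x0 - 1) x0 0 1" "mm z"] good_v(3) good_i assms gq by (simp add: mm_rect)

lemma triangle_points:
  assumes "x0 = y0" "0 < Re z" "Re z < 1" "0 < Im z" "Im z < 1" "Re z \<noteq> Im z"
  shows "\<zeta> z \<notin> PP"
proof
  assume "\<zeta> z \<in> PP"
  then consider "z \<in> gauss_lattice" | "z - Complex x0 y0 \<in> gauss_lattice" using PP_iff by blast
  then show False
  proof cases
    case 1
    then obtain m n where z: "z = Complex (of_int m) (of_int n)" by (auto simp: gauss_lattice_iff)
    then show False using assms(2,3) int_small[of m] by simp
  next
    case 2
    then obtain m n where "z - Complex x0 y0 = Complex (of_int m) (of_int n)" by (auto simp: gauss_lattice_iff)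
    then have z: "Re z = x0 + of_int m" "Im z = y0 + of_int n" by (auto simp: complex_eq_iff)
    then have "\<bar>real_of_int m\<bar> < 1" "\<bar>real_of_int n\<bar> < 1" using assms xy by linarith+
    then show False using z assms int_small[of m] int_small[of n] by simp
  qed
qed

text \<open>
  In a basis in which \<open>t\<close> is on the diagonal of the fundamental cell, a pushed side is a path in one of
  the two triangles from \<open>0\<close> to \<open>w1 + w2\<close>; removing the translate of the other side leaves the missing edge.
\<close>

lemma triangle_row:
  assumes eq: "x0 = y0" and l: "l = w1 + w2"
    and q: "\<And>x. 0 < x \<Longrightarrow> x < 1 \<Longrightarrow> 0 < Im (q x) \<and> Im (q x) < Re (q x) \<and> Re (q x) < 1"
    and col: "\<And>z. x0 - 1 < Re z \<Longrightarrow> Re z < x0 \<Longrightarrow> 0 < Im z \<Longrightarrow> Im z < 1 \<Longrightarrow> FF 0 (mm z) = FF w2 (mm z)"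
    and z: "0 < Re z" "Re z < 1" "y0 - 1 < Im z" "Im z < y0"
  shows "FF 0 (mm z) = FF w1 (mm z)"
proof -
  define S where "S = {z. 0 < Im z \<and> Im z < Re z \<and> Re z < 1}"
  have op: "open S" unfolding S_def by (intro open_Collect_conj open_Collect_less continuous_intros)
  have cv: "convex S"
  proof -
    have "S = {z. Im z > 0} \<inter> {z. inner (Complex 1 (-1)) z > 0} \<inter> {z. Re z < 1}"
      by (auto simp: S_def inner_complex_def)
    then show ?thesis by (metis convex_Int convex_halfspace_Im_gt convex_halfspace_Re_lt convex_halfspace_gt)
  qed
  have np: "\<zeta> z \<notin> PP" if "z \<in> S" for z using that by (intro triangle_points[OF eq]) (auto simp: S_def)
  \<comment> \<open>A point of the triangle that lies both in the row around 0 and in the column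
    translated by 1, so all three relations can be compared there.\<close>
  define p where "p = Complex ((1 + x0) / 2) (y0 / 2)"
  have p: "p \<in> S" using xy eq by (auto simp: S_def p_def)
  have G: "good \<tau> (\<zeta> 0) ((\<lambda>z. mm z) ` S)" "good \<tau> (\<zeta> (1 + \<i>)) ((\<lambda>z. mm z) ` S)"
  proof -
    have r: "0 < Im p" "Im p < Re p" "Re p < 1" using p by (auto simp: S_def)
    show "good \<tau> (\<zeta> 0) ((\<lambda>z. mm z) ` S)"
    proof (rule good_image[OF op cv _ p _ np])
      fix t :: real assume t: "0 < t" "t \<le> 1"
      have "t * Re p < 1" using mult_left_le_one_le[of "Re p" t] t r by linarith
      then show "0 + t *\<^sub>R (p - 0) \<in> S" using t r by (auto simp: S_def)
    qed auto
    show "good \<tau> (\<zeta> (1 + \<i>)) ((\<lambda>z. mm z) ` S)"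
    proof (rule good_image[OF op cv _ p _ np])
      fix t :: real assume t: "0 < t" "t \<le> 1"
      have "t * (1 - Im p) < 1" using mult_left_le_one_le[of "1 - Im p" t] t r by linarith
      moreover have "t * (1 - Re p) > 0" "t * (Im p) < t * Re p" using t r by auto
      ultimately show "1 + \<i> + t *\<^sub>R (p - (1 + \<i>)) \<in> S" by (auto simp: S_def algebra_simps)
    qed (auto simp: gauss_lattice_ReIm)
  qed
  have zz: "\<zeta> 0 = 0" "\<zeta> (1 + \<i>) = w1 + w2" by (simp_all add: \<zeta>)
  have "FF 0 (mm p) = FF l (mm p)"
    by (rule agree_side[of "(\<lambda>z. mm z) ` S"]) (use G q p in \<open>auto simp: zz l gq S_def\<close>)
  \<comment> \<open>The column relation, translated by \<open>w1\<close>, identifies the solutions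
    at \<open>w1\<close> and \<open>w1 + w2\<close>; the shift constants are equal and drop
    out.\<close>
  also have "\<dots> = FF (0 + w1) (mm p)"
  proof -
    have w1: "w1 \<in> gauss_lattice" using lat[of 1] by (simp add: \<zeta> gauss_lattice_ReIm)
    have in_c: "mm (p - 1) \<in> rect (x0 - 1) x0 0 1" using xy by (simp add: mm_rect p_def)
    have e: "mm (p - 1) + mark \<tau> w1 = mm p" by (simp add: \<zeta>_diff \<zeta>_1)
    have "FF (0 + w1) (mm (p - 1) + mark \<tau> w1) = FF 0 (mm (p - 1)) - \<mu> * of_real (Im w1)"
      by (rule Fc_shift[OF \<tau> good_v(3) in_c w1])
    moreover have "FF (w2 + w1) (mm (p - 1) + mark \<tau> w1) = FF w2 (mm (p - 1)) - \<mu> * of_real (Im w1)"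
      by (rule Fc_shift[OF \<tau> good_i in_c w1])
    moreover have "FF 0 (mm (p - 1)) = FF w2 (mm (p - 1))" by (rule col) (use xy in \<open>auto simp: p_def\<close>)
    ultimately show ?thesis unfolding e l by (simp add: add.commute)
  qed
  finally have "FF 0 (mm p) = FF w1 (mm p)" by simp
  then show ?thesis
    by (rule Fc_agree_transfer[OF \<tau> good_h(3) good_1, rotated]) (use xy eq z in \<open>auto simp: mm_rect p_def\<close>)
qed

lemma triangle_column:
  assumes eq: "x0 = y0" and l: "l = w1 + w2"
    and q: "\<And>x. 0 < x \<Longrightarrow> x < 1 \<Longrightarrow> 0 < Re (q x) \<and> Re (q x) < Im (q x) \<and> Im (q x) < 1"
    and row: "\<And>z. 0 < Re z \<Longrightarrow> Re z < 1 \<Longrightarrow> y0 - 1 < Im z \<Longrightarrow> Im z < y0 \<Longrightarrow> FF 0 (mm z) = FF w1 (mm z)"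
    and z: "x0 - 1 < Re z" "Re z < x0" "0 < Im z" "Im z < 1"
  shows "FF 0 (mm z) = FF w2 (mm z)"
proof -
  define S where "S = {z. 0 < Re z \<and> Re z < Im z \<and> Im z < 1}"
  have op: "open S" unfolding S_def by (intro open_Collect_conj open_Collect_less continuous_intros)
  have cv: "convex S"
  proof -
    have "S = {z. Re z > 0} \<inter> {z. inner (Complex (-1) 1) z > 0} \<inter> {z. Im z < 1}"
      by (auto simp: S_def inner_complex_def)
    then show ?thesis by (metis convex_Int convex_halfspace_Re_gt convex_halfspace_Im_lt convex_halfspace_gt)
  qed
  have np: "\<zeta> z \<notin> PP" if "z \<in> S" for z using that by (intro triangle_points[OF eq]) (auto simp: S_def)
  \<comment> \<open>The mirror image: a point of the triangle that lies both in the column around 0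
    and in the row translated by \<open>\<i>\<close>.\<close>
  define p where "p = Complex (x0 / 2) ((1 + y0) / 2)"
  have p: "p \<in> S" using xy eq by (auto simp: S_def p_def)
  have G: "good \<tau> (\<zeta> 0) ((\<lambda>z. mm z) ` S)" "good \<tau> (\<zeta> (1 + \<i>)) ((\<lambda>z. mm z) ` S)"
  proof -
    have r: "0 < Re p" "Re p < Im p" "Im p < 1" using p by (auto simp: S_def)
    show "good \<tau> (\<zeta> 0) ((\<lambda>z. mm z) ` S)"
    proof (rule good_image[OF op cv _ p _ np])
      fix t :: real assume t: "0 < t" "t \<le> 1"
      have "t * Im p < 1" using mult_left_le_one_le[of "Im p" t] t r by linarith
      then show "0 + t *\<^sub>R (p - 0) \<in> S" using t r by (auto simp: S_def)
    qed auto
    show "good \<tau> (\<zeta> (1 + \<i>)) ((\<lambda>z. mm z) ` S)"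
    proof (rule good_image[OF op cv _ p _ np])
      fix t :: real assume t: "0 < t" "t \<le> 1"
      have "t * (1 - Re p) < 1" using mult_left_le_one_le[of "1 - Re p" t] t r by linarith
      moreover have "t * (1 - Im p) > 0" "t * (Re p) < t * Im p" using t r by auto
      ultimately show "1 + \<i> + t *\<^sub>R (p - (1 + \<i>)) \<in> S" by (auto simp: S_def algebra_simps)
    qed (auto simp: gauss_lattice_ReIm)
  qed
  have zz: "\<zeta> 0 = 0" "\<zeta> (1 + \<i>) = w1 + w2" by (simp_all add: \<zeta>)
  have "FF 0 (mm p) = FF l (mm p)"
    by (rule agree_side[of "(\<lambda>z. mm z) ` S"]) (use G q p in \<open>auto simp: zz l gq S_def\<close>)
  also have "\<dots> = FF (0 + w2) (mm p)"
  proof -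
    have w2: "w2 \<in> gauss_lattice" using lat[of \<i>] by (simp add: \<zeta> gauss_lattice_ReIm)
    have in_c: "mm (p - \<i>) \<in> rect 0 1 (y0 - 1) y0" using xy by (simp add: mm_rect p_def)
    have e: "mm (p - \<i>) + mark \<tau> w2 = mm p" by (simp add: \<zeta>_diff \<zeta>_i)
    have "FF (0 + w2) (mm (p - \<i>) + mark \<tau> w2) = FF 0 (mm (p - \<i>)) - \<mu> * of_real (Im w2)"
      by (rule Fc_shift[OF \<tau> good_h(3) in_c w2])
    moreover have "FF (w1 + w2) (mm (p - \<i>) + mark \<tau> w2) = FF w1 (mm (p - \<i>)) - \<mu> * of_real (Im w2)"
      by (rule Fc_shift[OF \<tau> good_1 in_c w2])
    moreover have "FF 0 (mm (p - \<i>)) = FF w1 (mm (p - \<i>))" by (rule row) (use xy in \<open>auto simp: p_def\<close>)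
    ultimately show ?thesis unfolding e l by simp
  qed
  finally have "FF 0 (mm p) = FF w2 (mm p)" by simp
  then show ?thesis
    by (rule Fc_agree_transfer[OF \<tau> good_v(3) good_i, rotated]) (use xy eq z in \<open>auto simp: mm_rect p_def\<close>)
qed

end

context
  assumes agree1: "\<And>z. 0 < Re z \<Longrightarrow> Re z < 1 \<Longrightarrow> y0 - 1 < Im z \<Longrightarrow> Im z < y0 \<Longrightarrow> FF 0 (mm z) = FF w1 (mm z)"
    and agree2: "\<And>z. x0 - 1 < Re z \<Longrightarrow> Re z < x0 \<Longrightarrow> 0 < Im z \<Longrightarrow> Im z < 1 \<Longrightarrow> FF 0 (mm z) = FF w2 (mm z)"
begin

lemma FF_move:
  assumes "hs d \<or> vs d" "d \<noteq> 0" "k \<in> gauss_lattice"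
  shows "FF (\<zeta> k) (mm (d + k)) = FF 0 (mm d) - \<mu> * of_real (Im (\<zeta> k))"
proof -
  obtain Q where "good \<tau> 0 Q" "mm d \<in> Q" using strip_cases[OF assms(1,2)] .
  from Fc_shift[OF \<tau> this, of "\<zeta> k" c0 \<mu>] show ?thesis using assms(3) by (simp add: lat \<zeta>_add)
qed

lemma agree1':
  assumes k: "k \<in> gauss_lattice" and z: "hs (z - k)" "hs (z - (k + 1))"
  shows "FF (\<zeta> k) (mm z) = FF (\<zeta> (k + 1)) (mm z)"
proof -
  have 1: "1 \<in> gauss_lattice" by (simp add: gauss_lattice_ReIm)
  have b: "0 < Re (z - k)" "Re (z - k) < 1" "y0 - 1 < Im (z - k)" "Im (z - k) < y0" using z by (auto simp: hs_def)
  have n: "z - k \<noteq> 0" "z - (k + 1) \<noteq> 0" using b by (auto simp: complex_eq_iff)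
  have "FF (\<zeta> k) (mm z) = FF 0 (mm (z - k)) - \<mu> * of_real (Im (\<zeta> k))"
    using FF_move[of "z - k" k] z(1) n k by simp
  also have "FF 0 (mm (z - k)) = FF w1 (mm (z - k))" by (rule agree1[OF b])
  also have "\<dots> = FF 0 (mm (z - (k + 1))) - \<mu> * of_real (Im w1)"
    using FF_move[of "z - (k + 1)" 1] z(2) n 1 by (simp add: \<zeta>_1)
  also have "FF 0 (mm (z - (k + 1))) - \<mu> * of_real (Im w1) - \<mu> * of_real (Im (\<zeta> k)) = FF (\<zeta> (k + 1)) (mm z)"
    using FF_move[of "z - (k + 1)" "k + 1"] z(2) n k 1 by (simp add: \<zeta>_add \<zeta>_1 algebra_simps)
  finally show ?thesis .
qed

lemma agree2':
  assumes k: "k \<in> gauss_lattice" and z: "vs (z - k)" "vs (z - (k + \<i>))"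
  shows "FF (\<zeta> k) (mm z) = FF (\<zeta> (k + \<i>)) (mm z)"
proof -
  have 1: "\<i> \<in> gauss_lattice" by (simp add: gauss_lattice_ReIm)
  have b: "x0 - 1 < Re (z - k)" "Re (z - k) < x0" "0 < Im (z - k)" "Im (z - k) < 1" using z by (auto simp: vs_def)
  have n: "z - k \<noteq> 0" "z - (k + \<i>) \<noteq> 0" using b by (auto simp: complex_eq_iff)
  have "FF (\<zeta> k) (mm z) = FF 0 (mm (z - k)) - \<mu> * of_real (Im (\<zeta> k))"
    using FF_move[of "z - k" k] z(1) n k by simp
  also have "FF 0 (mm (z - k)) = FF w2 (mm (z - k))" by (rule agree2[OF b])
  also have "\<dots> = FF 0 (mm (z - (k + \<i>))) - \<mu> * of_real (Im w2)"
    using FF_move[of "z - (k + \<i>)" \<i>] z(2) n 1 by (simp add: \<zeta>_i)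
  also have "FF 0 (mm (z - (k + \<i>))) - \<mu> * of_real (Im w2) - \<mu> * of_real (Im (\<zeta> k)) = FF (\<zeta> (k + \<i>)) (mm z)"
    using FF_move[of "z - (k + \<i>)" "k + \<i>"] z(2) n k 1 by (simp add: \<zeta>_add \<zeta>_i algebra_simps)
  finally show ?thesis .
qed

lemma row_agree:
  assumes "Complex (of_int p) (of_int q) = k" "Complex (of_int p') (of_int q) = k'" "hs (z - k)" "hs (z - k')"
  shows "FF (\<zeta> k) (mm z) = FF (\<zeta> k') (mm z)"
proof -
  have "\<bar>real_of_int (p - p')\<bar> < 2" using assms by (auto simp: hs_def)
  then have "\<bar>p - p'\<bar> < 2" by linarith
  then consider "p = p'" | "p' = p + 1" | "p = p' + 1" by linarith
  then show ?thesis
  proof cases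
    case 1 then show ?thesis using assms by simp
  next
    case 2
    then have "k' = k + 1" using assms(1,2) by (auto simp: complex_eq_iff)
    then show ?thesis using agree1'[of k z] assms by (auto simp: gauss_lattice_iff)
  next
    case 3
    then have "k = k' + 1" using assms(1,2) by (auto simp: complex_eq_iff)
    then show ?thesis using agree1'[of k' z] assms by (auto simp: gauss_lattice_iff)
  qed
qed

lemma column_agree:
  assumes "Complex (of_int p) (of_int q) = k" "Complex (of_int p) (of_int q') = k'" "vs (z - k)" "vs (z - k')"
  shows "FF (\<zeta> k) (mm z) = FF (\<zeta> k') (mm z)"
proof -
  have "\<bar>real_of_int (q - q')\<bar> < 2" using assms by (auto simp: vs_def)
  then have "\<bar>q - q'\<bar> < 2" by linarith
  then consider "q = q'" | "q' = q + 1" | "q = q' + 1" by linarith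
  then show ?thesis
  proof cases
    case 1 then show ?thesis using assms by simp
  next
    case 2
    then have "k' = k + \<i>" using assms(1,2) by (auto simp: complex_eq_iff)
    then show ?thesis using agree2'[of k z] assms by (auto simp: gauss_lattice_iff)
  next
    case 3
    then have "k = k' + \<i>" using assms(1,2) by (auto simp: complex_eq_iff)
    then show ?thesis using agree2'[of k' z] assms by (auto simp: gauss_lattice_iff)
  qed
qed

text \<open>A point in a row around \<open>k\<close> and a column around \<open>k'\<close> lies in the cell around their crossing.\<close>

lemma all_agree:
  assumes k: "k \<in> gauss_lattice" "k' \<in> gauss_lattice" and z: "hs (z - k) \<or> vs (z - k)" "hs (z - k') \<or> vs (z - k')"
  shows "FF (\<zeta> k) (mm z) = FF (\<zeta> k') (mm z)"
proof -
  have cross: "FF (\<zeta> k) (mm z) = FF (\<zeta> k') (mm z)"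
    if kk: "k \<in> gauss_lattice" "k' \<in> gauss_lattice" and zz: "hs (z - k)" "vs (z - k')" for k k'
  proof -
    obtain p q p' q' where pq: "k = Complex (of_int p) (of_int q)" "k' = Complex (of_int p') (of_int q')"
      using kk by (auto simp: gauss_lattice_iff)
    define c where "c = Complex (of_int p') (of_int q)"
    have "hs (z - c)" "vs (z - c)" using zz xy by (auto simp: hs_def vs_def pq c_def)
    then show ?thesis
      using row_agree[of p q k p' c z] column_agree[of p' q c q' k' z] zz by (simp add: pq c_def)
  qed
  obtain p q p' q' where pq: "k = Complex (of_int p) (of_int q)" "k' = Complex (of_int p') (of_int q')"
    using k by (auto simp: gauss_lattice_iff)
  consider "hs (z - k)" "hs (z - k')" | "hs (z - k)" "vs (z - k')" | "vs (z - k)" "hs (z - k')" | "vs (z - k)" "vs (z - k')"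
    using z by blast
  then show ?thesis
  proof cases
    case 1
    have "\<bar>real_of_int (q - q')\<bar> < 1" using 1 by (auto simp: hs_def pq)
    then have "q' = q" using int_small[of "q - q'"] by simp
    then show ?thesis using row_agree[of p q k p' k' z] 1 by (simp add: pq)
  next
    case 4
    have "\<bar>real_of_int (p - p')\<bar> < 1" using 4 by (auto simp: vs_def pq)
    then have "p' = p" using int_small[of "p - p'"] by simp
    then show ?thesis using column_agree[of p q k q' k' z] 4 by (simp add: pq)
  qed (use cross k in auto)
qed

text \<open>A point misses all open rows only if its second coordinate agrees with \<open>y0\<close>
  modulo 1. Not being a translate of \<open>t\<close>, it then has first coordinate different from
  \<open>x0\<close> modulo 1 and lies in an open column.\<close>

lemma strip_cover:
  assumes "\<zeta> z \<notin> PP"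
  obtains k where "k \<in> gauss_lattice" "hs (z - k) \<or> vs (z - k)"
proof (cases "Im z - y0 \<in> \<int>")
  case False
  define q where "q = \<lfloor>Im z - y0\<rfloor> + 1"
  have "Im z - y0 \<noteq> of_int \<lfloor>Im z - y0\<rfloor>" using False by (metis Ints_of_int)
  then have "y0 - 1 < Im z - of_int q" "Im z - of_int q < y0" unfolding q_def by linarith+
  moreover have "\<bar>Re z - of_int \<lfloor>Re z\<rfloor>\<bar> < 1" by linarith
  ultimately show ?thesis using that[of "Complex (of_int \<lfloor>Re z\<rfloor>) (of_int q)"] by (auto simp: hs_def gauss_lattice_iff)
next
  case True
  then have "Re z - x0 \<notin> \<int>" using assms by (auto simp: PP_iff gauss_lattice_ReIm)
  define p where "p = \<lfloor>Re z - x0\<rfloor> + 1"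
  have "Re z - x0 \<noteq> of_int \<lfloor>Re z - x0\<rfloor>" using \<open>Re z - x0 \<notin> \<int>\<close> by (metis Ints_of_int)
  then have "x0 - 1 < Re z - of_int p" "Re z - of_int p < x0" unfolding p_def by linarith+
  moreover have "\<bar>Im z - of_int \<lfloor>Im z\<rfloor>\<bar> < 1" by linarith
  ultimately show ?thesis using that[of "Complex (of_int p) (of_int \<lfloor>Im z\<rfloor>)"] by (auto simp: vs_def gauss_lattice_iff)
qed

lemma glued_solution:
  obtains G where "sol \<tau> c0 \<mu> (- mark \<tau> ` PP) G"
    "\<And>u k. u \<notin> mark \<tau> ` PP \<Longrightarrow> k \<in> gauss_lattice \<Longrightarrow> G (u + mark \<tau> k) = G u - \<mu> * of_real (Im k)"
    "(G \<longlongrightarrow> 0) (at 0)"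
proof -
  \<comment> \<open>Any admissible \<open>k\<close> may be chosen, since \<open>all_agree\<close>
    makes the value independent of it.\<close>
  define G where "G u = FF (\<zeta> (SOME k. k \<in> gauss_lattice \<and> (\<exists>z. u = mm z \<and> (hs (z - k) \<or> vs (z - k))))) u" for u
  have inj: "a = b" if "mm a = mm b" for a b using bij_mm that by (auto simp: bij_def inj_def)
  have G: "G (mm z) = FF (\<zeta> k) (mm z)" if k: "k \<in> gauss_lattice" "hs (z - k) \<or> vs (z - k)" for z k
  proof -
    define k' where "k' = (SOME k. k \<in> gauss_lattice \<and> (\<exists>z'. mm z = mm z' \<and> (hs (z' - k) \<or> vs (z' - k))))"
    have "k' \<in> gauss_lattice \<and> (\<exists>z'. mm z = mm z' \<and> (hs (z' - k') \<or> vs (z' - k')))"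
      unfolding k'_def by (rule someI_ex) (use k in blast)
    then have "k' \<in> gauss_lattice" "hs (z - k') \<or> vs (z - k')" using inj by blast+
    from all_agree[OF this(1) k(1) this(2) k(2)] show ?thesis by (simp add: G_def k'_def)
  qed
  have ex: "\<exists>z k. u = mm z \<and> \<zeta> z \<notin> PP \<and> k \<in> gauss_lattice \<and> (hs (z - k) \<or> vs (z - k)) \<and> z - k \<noteq> 0" if u: "u \<notin> mark \<tau> ` PP" for u
  proof -
    obtain z where z: "u = mm z" using bij_mm unfolding bij_def surj_def by metis
    have zP: "\<zeta> z \<notin> PP" using u z by blast
    obtain k where k: "k \<in> gauss_lattice" "hs (z - k) \<or> vs (z - k)" using strip_cover[OF zP] .
    have "z \<noteq> k" using zP k by (auto simp: PP_iff)
    then show ?thesis using z zP k by auto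
  qed
  have op: "open ((\<lambda>z. mm z) ` {z. hs (z - k) \<or> vs (z - k)})" for k
    unfolding hs_def vs_def using bij_mm
    by (intro open_surjective_linear_image linear_mm open_Collect_disj open_Collect_conj open_Collect_less continuous_intros)
       (auto simp: bij_def)
  show ?thesis
  proof (rule that)
    show "sol \<tau> c0 \<mu> (- mark \<tau> ` PP) G"
      unfolding sol_def[OF \<tau>]
    proof
      fix u assume "u \<in> - mark \<tau> ` PP"
      then obtain z k where zk: "u = mm z" "\<zeta> z \<notin> PP" "k \<in> gauss_lattice" "hs (z - k) \<or> vs (z - k)" "z - k \<noteq> 0"
        using ex[of u] by auto
      obtain Q where Q: "good \<tau> 0 Q" "mm (z - k) \<in> Q" using strip_cases[OF zk(4,5)] .
      have "\<zeta> k \<in> gauss_lattice" using zk lat by simp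
      from good_shift[OF \<tau> Q(1) this] have g: "good \<tau> (\<zeta> k) ((+) (mm k) ` Q)" by simp
      have "u = mm k + mm (z - k)" by (simp add: zk(1) \<zeta>_diff)
      then have uQ: "u \<in> (+) (mm k) ` Q" using Q(2) by blast
      have D: "(FF (\<zeta> k) has_field_derivative hh \<tau> c0 \<mu> u - om u \<tau> * FF (\<zeta> k) u) (at u)"
        using Fc_reg[OF \<tau> g, of c0 \<mu>] uQ by (auto simp: reg_def[OF \<tau>] sol_def[OF \<tau>])
      have "(G has_field_derivative hh \<tau> c0 \<mu> u - om u \<tau> * FF (\<zeta> k) u) (at u)"
        by (rule has_field_derivative_transform_within_open[OF D op[of k]]) (use G zk in auto)
      then show "(G has_field_derivative hh \<tau> c0 \<mu> u - om u \<tau> * G u) (at u)" using G zk by simp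
    qed
  next
    fix u l assume u: "u \<notin> mark \<tau> ` PP" and l: "l \<in> gauss_lattice"
    obtain z k where zk: "u = mm z" "\<zeta> z \<notin> PP" "k \<in> gauss_lattice" "hs (z - k) \<or> vs (z - k)" "z - k \<noteq> 0"
      using ex[OF u] by auto
    obtain \<kappa> where \<kappa>: "l = \<zeta> \<kappa>" using bij unfolding bij_def surj_def by metis
    have \<kappa>l: "\<kappa> \<in> gauss_lattice" using l lat by (simp add: \<kappa>)
    have "G (mm (z + \<kappa>)) = FF (\<zeta> (k + \<kappa>)) (mm (z + \<kappa>))" by (rule G) (use zk \<kappa>l in auto)
    also have "\<dots> = FF 0 (mm (z - k)) - \<mu> * of_real (Im (\<zeta> (k + \<kappa>)))"
      using FF_move[OF zk(4,5), of "k + \<kappa>"] zk \<kappa>l by (simp add: algebra_simps)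
    also have "\<dots> = FF (\<zeta> k) (mm z) - \<mu> * of_real (Im (\<zeta> \<kappa>))"
      using FF_move[OF zk(4,5,3)] by (simp add: \<zeta>_add algebra_simps)
    also have "FF (\<zeta> k) (mm z) = G (mm z)" by (rule G[symmetric]) (use zk in auto)
    finally show "G (u + mark \<tau> l) = G u - \<mu> * of_real (Im l)" by (simp add: zk(1) \<kappa> \<zeta>_add)
  next
    have lim: "(FF 0 \<longlongrightarrow> 0) (at 0 within Q)" if "good \<tau> 0 Q" for Q
      using Fc_reg[OF \<tau> that, of c0 \<mu>] by (simp add: reg_def[OF \<tau>])
    \<comment> \<open>Regularity is known only within each convex region; four rectangles of the row
      fill a punctured neighbourhood of 0, so the limits combine to a full limit.\<close>
    define S where "S = rect (-1) 1 0 y0 \<union> (rect (-1) 1 (y0 - 1) 0 \<union> (rect 0 1 (y0 - 1) y0 \<union> rect (-1) 0 (y0 - 1) y0))"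
    have "(FF 0 \<longlongrightarrow> 0) (at 0 within S)"
      unfolding S_def at_within_union by (intro filterlim_sup lim good_h)
    moreover have SG: "FF 0 u = G u \<and> (u \<in> S \<or> u = 0)" if u: "u \<in> (\<lambda>z. mm z) ` {z. hs z}" for u
    proof -
      obtain z where z: "u = mm z" "hs z" using u by blast
      have "G (mm z) = FF (\<zeta> 0) (mm z)" by (rule G) (use z in auto)
      moreover have "mm z \<in> S \<or> z = 0" using z(2) by (auto simp: S_def mm_rect hs_def complex_eq_iff)
      ultimately show ?thesis using z by (auto simp: \<zeta>_0)
    qed
    have oph: "open ((\<lambda>z. mm z) ` {z. hs z})" "0 \<in> (\<lambda>z. mm z) ` {z. hs z}"
    proof -
      show "open ((\<lambda>z. mm z) ` {z. hs z})"
        unfolding hs_def using bij_mm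
        by (intro open_surjective_linear_image linear_mm open_Collect_conj open_Collect_less continuous_intros) (auto simp: bij_def)
      have "hs 0" "mm 0 = 0" using xy by (auto simp: hs_def \<zeta>_0)
      then show "0 \<in> (\<lambda>z. mm z) ` {z. hs z}" by force
    qed
    have "at 0 within S = at 0"
    proof (rule at_within_nhd[OF oph(2,1)])
      show "S \<inter> (\<lambda>z. mm z) ` {z. hs z} - {0} = UNIV \<inter> (\<lambda>z. mm z) ` {z. hs z} - {0}" using SG by blast
    qed
    ultimately have "(FF 0 \<longlongrightarrow> 0) (at 0)" by simp
    moreover have "\<forall>\<^sub>F u in at 0. FF 0 u = G u"
      using eventually_at_in_open'[OF oph] by eventually_elim (use SG in blast)
    ultimately show "(G \<longlongrightarrow> 0) (at 0)" by (rule Lim_transform_eventually)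
  qed
qed

end

end

section \<open>Behaviour at \<open>t\<close> and absence of quasi-periodic solutions\<close>

lemma qq2_bigo:
  assumes \<tau>: "Im \<tau> > 0"
  shows "(\<lambda>u. qq 2 u \<tau>) \<in> O[at 0](\<lambda>_. 1)"
proof -
  have c1: "(\<lambda>_. c) \<in> O[at (0::complex)](\<lambda>_. 1)" for c :: complex by (rule bigo_of_isCont) auto
  have u1: "(\<lambda>u::complex. u) \<in> O[at 0](\<lambda>_. 1)" by (rule bigo_of_isCont) auto
  have G: "(\<lambda>u. Gt u \<tau> - M22 \<tau>) \<in> O[at 0](\<lambda>_. 1)" by (rule landau_o.big_trans[OF Gt_bigo[OF \<tau>] u1])
  have v: "(\<lambda>u. qq n (u - tt \<tau>) \<tau>) \<in> O[at 0](\<lambda>_. 1)" for n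
    using DERIV_isCont[OF qq_shift_deriv_0[OF \<tau>]] by (rule bigo_of_isCont)
  have "(\<lambda>u. 2 * kap / al * ((Gt u \<tau> - M22 \<tau>) + M22 \<tau> - of_real a0 * qq 1 (u - tt \<tau>) \<tau>) + qq 2 (u - tt \<tau>) \<tau>) \<in> O[at 0](\<lambda>_. 1)"
    by (intro sum_in_bigo landau_o.big.mult_in_1 c1 G v)
  moreover have "2 * kap / al * ((Gt u \<tau> - M22 \<tau>) + M22 \<tau> - of_real a0 * qq 1 (u - tt \<tau>) \<tau>) + qq 2 (u - tt \<tau>) \<tau> = qq 2 u \<tau>" for u
    using al_pos by (simp add: Gt_def field_simps)
  ultimately show ?thesis by simp
qed

lemma branch_bounds_tt:
  assumes \<tau>: "Im \<tau> > 0"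
  obtains r a b where "0 < r" "0 < a" "0 < b"
    "\<And>Q B v. Tbr Q (\<lambda>u. (\<tau>, u)) B \<Longrightarrow> tt \<tau> + v \<in> Q \<Longrightarrow> norm v < r \<Longrightarrow>
       a * norm v powr (- \<alpha>) \<le> norm (B (tt \<tau> + v)) \<and> norm (B (tt \<tau> + v)) \<le> b * norm v powr (- \<alpha>)"
proof -
  obtain W where W: "W holomorphic_on UNIV" "\<And>u. th 0 u \<tau> = u * W u" "W 0 = th 1 0 \<tau>"
    using th0_factor_at_0[OF \<tau>] by metis
  define E where "E v = exp (Re (be * (tt \<tau> + v))) * norm (th 0 (tt \<tau> + v) \<tau>) powr \<alpha> * norm (W v) powr (- \<alpha>)" for v
  have W0: "W 0 \<noteq> 0" using W(3) th1_0_nonzero[OF \<tau>] by (simp add: One_nat_def)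
  have "isCont W 0" using holomorphic_on_imp_continuous_on[OF W(1)] by (simp add: continuous_on_eq_continuous_at)
  moreover have "isCont (\<lambda>v. th 0 (tt \<tau> + v) \<tau>) 0"
    by (rule isCont_o2[of 0 "\<lambda>v. tt \<tau> + v", OF _ DERIV_isCont[OF th_deriv_u[OF \<tau>]]]) auto
  ultimately have "isCont E 0"
    unfolding E_def using W0 th0_tt[OF \<tau>] by (intro continuous_intros) auto
  moreover have "E 0 > 0" using W0 th0_tt[OF \<tau>] by (simp add: E_def)
  ultimately obtain r a b where rab: "0 < r" "0 < a" "0 < b" "\<And>u. norm u < r \<Longrightarrow> a \<le> E u \<and> E u \<le> b"
    using positive_bounds by metis
  show ?thesis
  proof (rule that[OF rab(1-3)])
    fix Q B v assume B: "Tbr Q (\<lambda>u. (\<tau>, u)) B" "tt \<tau> + v \<in> Q" and v: "norm v < r"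
    have "norm (B (tt \<tau> + v)) = E v * norm v powr (- \<alpha>)"
      using branch_norm[OF B] by (simp add: E_def W(2)[of v] norm_mult powr_mult)
    then show "a * norm v powr (- \<alpha>) \<le> norm (B (tt \<tau> + v)) \<and> norm (B (tt \<tau> + v)) \<le> b * norm v powr (- \<alpha>)"
      using rab(4)[OF v] by (auto intro!: mult_right_mono)
  qed
qed

context
  fixes \<tau> c0 \<mu> :: complex and G :: "complex \<Rightarrow> complex"
  assumes \<tau>: "Im \<tau> > 0" and G: "sol \<tau> c0 \<mu> (- mark \<tau> ` PP) G"
    and Gsh: "\<And>u k. u \<notin> mark \<tau> ` PP \<Longrightarrow> k \<in> gauss_lattice \<Longrightarrow> G (u + mark \<tau> k) = G u - \<mu> * of_real (Im k)"
    and G0: "(G \<longlongrightarrow> 0) (at 0)"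
begin

lemma G_deriv: "u \<notin> mark \<tau> ` PP \<Longrightarrow> (G has_field_derivative hh \<tau> c0 \<mu> u - om u \<tau> * G u) (at u)"
  using G by (auto simp: sol_def[OF \<tau>])

text \<open>
  At \<open>t\<close> the form \<open>hh - k om\<close> is regular for a suitable constant \<open>k\<close>, and \<open>G - k\<close> is bounded: integrate
  \<open>T (hh - k om)\<close>, of size \<open>\<bar>u - t\<bar>\<close> to the power \<open>- \<alpha>\<close>, along rays.
\<close>

lemma bounded_at_tt: "\<exists>C. \<forall>\<^sub>F u in at (tt \<tau>). norm (G u) \<le> C"
proof -
  \<comment> \<open>At \<open>t\<close> the residues of \<open>hh\<close> and \<open>om\<close> are
    \<open>\<mu> a0\<close> and \<open>- \<alpha>\<close>; with this value the pole of
    \<open>hh - k om\<close> disappears.\<close>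
  define k where "k = - \<mu> * of_real a0 / al"
  define H where "H u = hh \<tau> c0 \<mu> u - k * om u \<tau>" for u
  have c1: "(\<lambda>_. c) \<in> O[at (0::complex)](\<lambda>_. 1)" for c :: complex by (rule bigo_of_isCont) auto
  have v: "(\<lambda>v. qq n (tt \<tau> + v) \<tau>) \<in> O[at 0](\<lambda>_. 1)" for n
  proof -
    have "((\<lambda>v. tt \<tau> + v) has_field_derivative 1) (at 0)" by (auto intro!: derivative_eq_intros)
    from qq_deriv_u[OF this \<tau>, of n] show ?thesis using th0_tt[OF \<tau>] by (intro bigo_of_isCont DERIV_isCont) auto
  qed
  have "(\<lambda>v. c0 - k * be + \<mu> * al / (2 * kap) * (qq 2 (tt \<tau> + v) \<tau> - qq 2 v \<tau>) - k * al * qq 1 (tt \<tau> + v) \<tau>) \<in> O[at 0](\<lambda>_. 1)"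
    by (intro sum_in_bigo landau_o.big.mult_in_1 c1 v qq2_bigo[OF \<tau>])
  moreover have "c0 - k * be + \<mu> * al / (2 * kap) * (qq 2 (tt \<tau> + v) \<tau> - qq 2 v \<tau>) - k * al * qq 1 (tt \<tau> + v) \<tau> = H (tt \<tau> + v)" for v
    using al_pos by (simp add: H_def hh_def[OF \<tau>] k_def om_def Gt_def field_simps)
  ultimately have "(\<lambda>v. H (tt \<tau> + v)) \<in> O[at 0](\<lambda>_. 1)" by simp
  then obtain C where "C > 0" "\<forall>\<^sub>F v in at 0. norm (H (tt \<tau> + v)) \<le> C" by (elim landau_o.bigE) auto
  then obtain r1 where C: "C > 0" and r1: "r1 > 0" "\<And>v. v \<noteq> 0 \<Longrightarrow> norm v < r1 \<Longrightarrow> norm (H (tt \<tau> + v)) \<le> C"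
    unfolding eventually_at by (auto simp: dist_norm)
  obtain r2 a b where r2: "0 < r2" "0 < a" "0 < b"
    "\<And>Q B v. Tbr Q (\<lambda>u. (\<tau>, u)) B \<Longrightarrow> tt \<tau> + v \<in> Q \<Longrightarrow> norm v < r2 \<Longrightarrow>
       a * norm v powr (- \<alpha>) \<le> norm (B (tt \<tau> + v)) \<and> norm (B (tt \<tau> + v)) \<le> b * norm v powr (- \<alpha>)"
    using branch_bounds_tt[OF \<tau>] by blast
  obtain r3 where r3: "r3 > 0" "\<And>u. u \<in> mark \<tau> ` PP \<Longrightarrow> u \<noteq> tt \<tau> \<Longrightarrow> r3 \<le> dist u (tt \<tau>)"
    using not_islimpt_punctures[OF \<tau>, of "tt \<tau>"] unfolding islimpt_approachable by (meson not_le)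
  define r where "r = min r1 (min r2 r3)"
  define \<rho> where "\<rho> = r / 2"
  have r: "r > 0" "\<rho> > 0" "\<rho> < r" using r1 r2 r3 by (auto simp: r_def \<rho>_def)
  have np: "tt \<tau> + v \<notin> mark \<tau> ` PP" if "v \<noteq> 0" "norm v < r" for v
    using r3(2)[of "tt \<tau> + v"] that by (auto simp: r_def dist_norm)
  have "compact (sphere (0::complex) \<rho>)" by simp
  moreover have "continuous_on (sphere 0 \<rho>) (\<lambda>v. G (tt \<tau> + v) - k)"
  proof -
    have "continuous_on (- mark \<tau> ` PP) G"
      by (intro continuous_at_imp_continuous_on ballI DERIV_isCont[OF G_deriv]) auto
    moreover have "continuous_on (sphere 0 \<rho>) (\<lambda>v. tt \<tau> + v)" by (rule continuous_on_add[OF continuous_on_const continuous_on_id])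
    moreover have "(\<lambda>v. tt \<tau> + v) ` sphere 0 \<rho> \<subseteq> - mark \<tau> ` PP"
    proof (rule image_subsetI)
      fix v :: complex assume "v \<in> sphere 0 \<rho>"
      then have "v \<noteq> 0" "norm v < r" using r by auto
      then show "tt \<tau> + v \<in> - mark \<tau> ` PP" using np by blast
    qed
    ultimately have "continuous_on (sphere 0 \<rho>) (\<lambda>v. G (tt \<tau> + v))" by (rule continuous_on_compose2)
    then show ?thesis by (rule continuous_on_diff[OF _ continuous_on_const])
  qed
  ultimately have "bounded ((\<lambda>v. G (tt \<tau> + v) - k) ` sphere 0 \<rho>)" by (intro compact_imp_bounded compact_continuous_image)
  then obtain M where M: "M > 0" "\<And>v. norm v = \<rho> \<Longrightarrow> norm (G (tt \<tau> + v) - k) \<le> M" unfolding bounded_pos by auto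
  define K where "K = M * (b * \<rho> powr (- \<alpha>)) + C * b / (1 - \<alpha>) * \<rho> powr (1 - \<alpha>)"
  have K0: "K \<ge> 0" using M C r2 al_lt1 by (auto simp: K_def)
  have bound: "norm (G (tt \<tau> + v) - k) \<le> K / a * \<rho> powr \<alpha>" if v: "v \<noteq> 0" "norm v < \<rho>" for v
  proof -
    define e where "e = v /\<^sub>R norm v"
    have e: "norm e = 1" "v = norm v *\<^sub>R e" using v(1) by (auto simp: e_def)
    then have "e \<bullet> e = 1" by (simp add: norm_eq_1)
    note e = e this
    \<comment> \<open>A half disc around the ray in direction \<open>e\<close>: it is convex and
      avoids \<open>t\<close>, so a branch exists on it, and the bounds do not depend on the
      ray.\<close>
    define Q where "Q = ball (tt \<tau>) r \<inter> {w. e \<bullet> w > e \<bullet> tt \<tau>}"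
    have Q: "open Q" "convex Q" by (auto simp: Q_def intro!: convex_Int convex_halfspace_gt open_Int open_halfspace_gt)
    have QP: "Q \<inter> mark \<tau> ` PP = {}"
    proof -
      have "w \<notin> mark \<tau> ` PP" if "w \<in> Q" for w
      proof -
        have "w \<noteq> tt \<tau>" "norm (w - tt \<tau>) < r" using that by (auto simp: Q_def dist_norm norm_minus_commute)
        then show ?thesis using np[of "w - tt \<tau>"] by simp
      qed
      then show ?thesis by blast
    qed
    obtain B where B: "Tbr Q (\<lambda>u. (\<tau>, u)) B" using branch_ex[OF \<tau> Q(2) QP] .
    have sQ: "tt \<tau> + x *\<^sub>R e \<in> Q" if "0 < x" "x < r" for x
      using that e by (simp add: Q_def dist_norm inner_add_right)
    have D: "((\<lambda>u. B u * (G u - k)) has_field_derivative B u * H u) (at u)" if "u \<in> Q" for u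
    proof (rule DERIV_cong[OF DERIV_mult[OF branch_D[OF \<tau> B Q(1) that] DERIV_diff[OF G_deriv DERIV_const]]])
      show "u \<notin> mark \<tau> ` PP" using QP that by blast
    qed (simp add: H_def algebra_simps)
    define f where "f x = B (tt \<tau> + x *\<^sub>R e) * (G (tt \<tau> + x *\<^sub>R e) - k)" for x
    have fD: "(f has_vector_derivative e * (B (tt \<tau> + x *\<^sub>R e) * H (tt \<tau> + x *\<^sub>R e))) (at x)" if "0 < x" "x < r" for x
    proof -
      have "((\<lambda>x. tt \<tau> + x *\<^sub>R e) has_vector_derivative e) (at x)" by (auto intro!: derivative_eq_intros)
      from field_vector_diff_chain_at[OF this D[OF sQ[OF that]]] show ?thesis by (simp add: o_def f_def[abs_def])
    qed
    \<comment> \<open>Comparison with an antiderivative of \<open>C b x\<close> to the power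
      \<open>- \<alpha>\<close>, which stays bounded as \<open>x\<close> tends to 0 because
      \<open>\<alpha> < 1\<close>.\<close>
    have "norm (f \<rho> - f (norm v)) \<le> C * b / (1 - \<alpha>) * \<rho> powr (1 - \<alpha>) - C * b / (1 - \<alpha>) * norm v powr (1 - \<alpha>)"
    proof (rule differentiable_bound_general[OF v(2)])
      have "isCont f x" if "x \<in> {norm v..\<rho>}" for x
      proof -
        have "0 < norm v" "norm v \<le> x" "x \<le> \<rho>" using that v(1) by auto
        then show ?thesis using has_vector_derivative_continuous[OF fD, of x] r by linarith
      qed
      then show "continuous_on {norm v..\<rho>} f" by (intro continuous_at_imp_continuous_on) auto
      show "continuous_on {norm v..\<rho>} (\<lambda>x. C * b / (1 - \<alpha>) * x powr (1 - \<alpha>))"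
        using v by (intro continuous_intros) auto
      fix x assume x: "norm v < x" "x < \<rho>"
      then have x0: "0 < x" "x < r" using v(1) r by (auto intro: le_less_trans[of 0 "norm v"])
      show "(f has_vector_derivative e * (B (tt \<tau> + x *\<^sub>R e) * H (tt \<tau> + x *\<^sub>R e))) (at x)" by (rule fD[OF x0])
      have "((\<lambda>x. C * b / (1 - \<alpha>) * x powr (1 - \<alpha>)) has_real_derivative C * b / (1 - \<alpha>) * ((1 - \<alpha>) * x powr (1 - \<alpha> - 1))) (at x)"
        using x0 by (intro DERIV_cmult has_real_derivative_powr)
      then show "((\<lambda>x. C * b / (1 - \<alpha>) * x powr (1 - \<alpha>)) has_vector_derivative C * b * x powr (- \<alpha>)) (at x)"
        using al_lt1 by (simp add: has_real_derivative_iff_has_vector_derivative mult.assoc)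
      have "norm (B (tt \<tau> + x *\<^sub>R e)) \<le> b * x powr (- \<alpha>)"
        using r2(4)[OF B sQ[OF x0]] x0 e(1) by (simp add: r_def)
      moreover have "norm (H (tt \<tau> + x *\<^sub>R e)) \<le> C" using r1(2)[of "x *\<^sub>R e"] x0 e(1) by (cases "e = 0") (auto simp: r_def)
      ultimately have "norm (B (tt \<tau> + x *\<^sub>R e)) * norm (H (tt \<tau> + x *\<^sub>R e)) \<le> (b * x powr (- \<alpha>)) * C"
        using r2(3) by (intro mult_mono) auto
      then show "norm (e * (B (tt \<tau> + x *\<^sub>R e) * H (tt \<tau> + x *\<^sub>R e))) \<le> C * b * x powr (- \<alpha>)"
        by (simp add: norm_mult e(1) mult_ac)
    qed
    moreover have "C * b / (1 - \<alpha>) * norm v powr (1 - \<alpha>) \<ge> 0" using C r2 al_lt1 by auto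
    ultimately have 1: "norm (f \<rho> - f (norm v)) \<le> C * b / (1 - \<alpha>) * \<rho> powr (1 - \<alpha>)" by linarith
    have "norm (f \<rho>) \<le> (b * \<rho> powr (- \<alpha>)) * M"
      unfolding f_def norm_mult
      by (intro mult_mono M(2)) (use r2(4)[OF B sQ[OF r(2,3)]] r2(3) r e(1) in \<open>auto simp: r_def\<close>)
    then have 2: "norm (f (norm v)) \<le> K"
      using 1 norm_triangle_sub[of "f (norm v)" "f \<rho>"] by (simp add: K_def norm_minus_commute mult.commute)
    have vQ: "tt \<tau> + v \<in> Q" using sQ[of "norm v"] v r e(2) by simp
    have "a * norm v powr (- \<alpha>) * norm (G (tt \<tau> + v) - k) \<le> norm (B (tt \<tau> + v)) * norm (G (tt \<tau> + v) - k)"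
      using r2(4)[OF B vQ] v r by (intro mult_right_mono) (auto simp: r_def)
    also have "\<dots> = norm (f (norm v))" using e(2) by (simp add: f_def norm_mult)
    finally have "a * norm v powr (- \<alpha>) * norm (G (tt \<tau> + v) - k) \<le> K" using 2 by simp
    then have "norm (G (tt \<tau> + v) - k) \<le> K / a * norm v powr \<alpha>"
      using r2(2) v(1) by (simp add: powr_minus field_simps)
    also have "\<dots> \<le> K / a * \<rho> powr \<alpha>"
      using v(2) al_pos K0 r2(2) by (intro mult_left_mono powr_mono2) auto
    finally show ?thesis .
  qed
  have "\<forall>\<^sub>F u in at (tt \<tau>). norm (G u) \<le> K / a * \<rho> powr \<alpha> + norm k"
    unfolding eventually_at
  proof (intro exI[of _ \<rho>] conjI ballI impI)
    fix u assume "u \<noteq> tt \<tau> \<and> dist u (tt \<tau>) < \<rho>"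
    then have "norm (G u - k) \<le> K / a * \<rho> powr \<alpha>" using bound[of "u - tt \<tau>"] by (simp add: dist_norm)
    then show "norm (G u) \<le> K / a * \<rho> powr \<alpha> + norm k" using norm_triangle_sub[of "G u" k] by simp
  qed (use r in auto)
  then show ?thesis by blast
qed

lemma eventually_not_puncture: "\<forall>\<^sub>F u in at z. u \<notin> mark \<tau> ` PP"
  using not_islimpt_punctures[OF \<tau>, of z] by (auto simp: islimpt_iff_eventually)

lemma bounded_shift:
  assumes "\<exists>C. \<forall>\<^sub>F u in at z. norm (G u) \<le> C" "l \<in> gauss_lattice"
  shows "\<exists>C. \<forall>\<^sub>F u in at (z + mark \<tau> l). norm (G u) \<le> C"
proof -
  obtain C where "\<forall>\<^sub>F u in at z. norm (G u) \<le> C" using assms by blast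
  then have "\<forall>\<^sub>F u in at z. norm (G (u + mark \<tau> l)) \<le> C + norm (\<mu> * of_real (Im l))"
    using eventually_not_puncture[of z]
  proof eventually_elim
    case (elim u)
    then show ?case using Gsh[OF elim(2) assms(2)] norm_triangle_ineq4[of "G u" "\<mu> * of_real (Im l)"] by simp
  qed
  then have "\<forall>\<^sub>F u in at (z + mark \<tau> l). norm (G u) \<le> C + norm (\<mu> * of_real (Im l))"
    unfolding eventually_at_to_0[of _ z] eventually_at_to_0[of _ "z + mark \<tau> l"] by (simp add: algebra_simps)
  then show ?thesis by blast
qed

theorem no_quasi_periodic_solution: "c0 = 0 \<and> \<mu> = 0"
proof -
  have bdd: "\<exists>C. \<forall>\<^sub>F u in at z. norm (G u) \<le> C" if z: "z \<in> mark \<tau> ` PP" for z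
  proof -
    obtain p where p: "z = mark \<tau> p" "p \<in> gauss_lattice \<or> p - tmark \<alpha> a0 ai \<in> gauss_lattice"
      using z by (auto simp: punctures_iff)
    from p(2) show ?thesis
    proof
      assume l: "p \<in> gauss_lattice"
      have "\<forall>\<^sub>F u in at 0. norm (G u) < 1" using tendsto_norm[OF G0] by (auto simp: order_tendsto_iff)
      then have "\<exists>C. \<forall>\<^sub>F u in at 0. norm (G u) \<le> C" by (intro exI[of _ 1]) (auto elim: eventually_mono)
      from bounded_shift[OF this l] show ?thesis by (simp add: p(1))
    next
      assume l: "p - tmark \<alpha> a0 ai \<in> gauss_lattice"
      from bounded_shift[OF bounded_at_tt l] show ?thesis by (simp add: p(1) tt_mark)
    qed
  qed
  have "G holomorphic_on - mark \<tau> ` PP"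
    using G_deriv unfolding holomorphic_on_open[OF open_compl_punctures[OF \<tau>]] by auto
  from holomorphic_removable_discrete[OF not_islimpt_punctures[OF \<tau>] this bdd]
  obtain g where g: "g holomorphic_on UNIV" "\<And>z. z \<notin> mark \<tau> ` PP \<Longrightarrow> g z = G z" by blast
  have gc: "isCont g z" for z using holomorphic_on_imp_continuous_on[OF g(1)] by (simp add: continuous_on_eq_continuous_at)
  have shift: "g (u + mark \<tau> k) = g u - \<mu> * of_real (Im k)" if k: "k \<in> gauss_lattice" for u k
  proof -
    have "(\<lambda>u. g (u + mark \<tau> k) - (g u - \<mu> * of_real (Im k))) \<midarrow>u\<rightarrow> g (u + mark \<tau> k) - (g u - \<mu> * of_real (Im k))"
      by (intro tendsto_intros isCont_tendsto_compose[OF gc] gc[unfolded isCont_def])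
    moreover have "\<forall>\<^sub>F u in at u. g (u + mark \<tau> k) - (g u - \<mu> * of_real (Im k)) = 0"
      using eventually_not_puncture[of u]
      by eventually_elim (use g(2) Gsh k Gt_lattice(3)[OF \<tau> _ k] in simp)
    ultimately have "(\<lambda>u. 0) \<midarrow>u\<rightarrow> g (u + mark \<tau> k) - (g u - \<mu> * of_real (Im k))"
      by (rule Lim_transform_eventually)
    then show ?thesis using LIM_const_eq by fastforce
  qed
  have l: "1 \<in> gauss_lattice" "\<i> \<in> gauss_lattice" by (auto simp: gauss_lattice_ReIm)
  have m: "mark \<tau> 1 = 1" "mark \<tau> \<i> = \<tau>" by (simp_all add: mark_def)
  have gD: "(g has_field_derivative deriv g u) (at u)" for u using holomorphic_derivI[OF g(1)] by simp
  have per: "deriv g (u + mark \<tau> k) = deriv g u" if k: "k \<in> gauss_lattice" for u k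
  proof -
    have "((\<lambda>u. g (u + mark \<tau> k)) has_field_derivative deriv g (u + mark \<tau> k)) (at u)"
      using gD[of "u + mark \<tau> k"] by (simp add: DERIV_shift)
    moreover have "((\<lambda>u. g (u + mark \<tau> k)) has_field_derivative deriv g u) (at u)"
      unfolding shift[OF k] using DERIV_diff[OF gD[of u] DERIV_const] by simp
    ultimately show ?thesis by (rule DERIV_unique)
  qed
  have "deriv g holomorphic_on UNIV" by (rule holomorphic_deriv[OF g(1)]) auto
  then obtain \<kappa> where \<kappa>: "\<And>u. deriv g u = \<kappa>"
    using entire_elliptic_const[OF \<tau>, of "deriv g"] per[OF l(1)] per[OF l(2)] unfolding m by metis
  have "((\<lambda>u. g u - \<kappa> * u) has_field_derivative 0) (at u)" for u
    using gD[of u] by (auto intro!: derivative_eq_intros simp: \<kappa>)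
  then obtain d where d: "\<And>u. g u - \<kappa> * u = d"
    using has_field_derivative_zero_constant[of UNIV "\<lambda>u. g u - \<kappa> * u"] by auto
  have gu: "g u = d + \<kappa> * u" for u using d[of u] by (simp add: algebra_simps)
  \<comment> \<open>The shift by 1 annihilates the slope, then the shift by \<tau> annihilates
    \<mu>; the value at 0 removes the remaining constant, and the equation gives
    \<open>c0 = 0\<close>.\<close>
  have \<kappa>0: "\<kappa> = 0" using shift[OF l(1), of 0] by (simp add: gu m)
  have \<mu>0: "\<mu> = 0" using shift[OF l(2), of 0] by (simp add: gu m \<kappa>0)
  have "\<forall>\<^sub>F u in at 0. g u = G u" using eventually_not_puncture by eventually_elim (use g(2) in auto)
  then have "(G \<longlongrightarrow> g 0) (at 0)" using gc[of 0] unfolding isCont_def by (rule Lim_transform_eventually[rotated])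
  then have "g 0 = 0" using G0 LIM_unique by blast
  then have d0: "d = 0" by (simp add: gu)
  obtain u where u: "u \<notin> mark \<tau> ` PP"
    using eventually_happens[OF eventually_not_puncture[of 0]] by auto
  have "(G has_field_derivative 0) (at u)"
    by (rule has_field_derivative_transform_within_open[OF DERIV_const open_compl_punctures[OF \<tau>]])
       (use u g(2) in \<open>auto simp: gu d0 \<kappa>0\<close>)
  moreover have "G u = 0" using g(2)[OF u] by (simp add: gu d0 \<kappa>0)
  ultimately have "hh \<tau> c0 \<mu> u = 0" using DERIV_unique[OF _ G_deriv[OF u]] by fastforce
  then show ?thesis using \<mu>0 by (simp add: hh_def[OF \<tau>])
qed

end

end

section \<open>The basis of periods\<close>

text \<open>The inverse matrix is integral because the determinant is 1, so the lattice is preserved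
  in both directions.\<close>

lemma unimodular_basis:
  fixes p q r s :: int
  assumes det: "p * s - q * r = 1"
    and \<zeta>: "\<And>z. \<zeta> z = Re z *\<^sub>R Complex (of_int p) (of_int q) + Im z *\<^sub>R Complex (of_int r) (of_int s)"
  shows "bij \<zeta>" "\<zeta> z \<in> gauss_lattice \<longleftrightarrow> z \<in> gauss_lattice"
proof -
  define \<eta> where "\<eta> w = Complex (of_int s * Re w - of_int r * Im w) (of_int p * Im w - of_int q * Re w)" for w
  have d: "real_of_int p * real_of_int s - real_of_int q * real_of_int r = 1"
    using arg_cong[OF det, of real_of_int] by simp
  have 1: "\<eta> (\<zeta> z) = z" for z
  proof -
    have "Re (\<eta> (\<zeta> z)) = (real_of_int p * of_int s - of_int q * of_int r) * Re z"
      "Im (\<eta> (\<zeta> z)) = (real_of_int p * of_int s - of_int q * of_int r) * Im z"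
      by (simp_all add: \<eta>_def \<zeta> algebra_simps)
    then show ?thesis by (simp add: d complex_eq_iff)
  qed
  have 2: "\<zeta> (\<eta> w) = w" for w
  proof -
    have "Re (\<zeta> (\<eta> w)) = (real_of_int p * of_int s - of_int q * of_int r) * Re w"
      "Im (\<zeta> (\<eta> w)) = (real_of_int p * of_int s - of_int q * of_int r) * Im w"
      by (simp_all add: \<eta>_def \<zeta> algebra_simps)
    then show ?thesis by (simp add: d complex_eq_iff)
  qed
  show "bij \<zeta>" by (rule o_bij[of \<eta>]) (auto simp: 1 2)
  have "\<zeta> z \<in> gauss_lattice" if "z \<in> gauss_lattice" for z using that by (auto simp: gauss_lattice_ReIm \<zeta>)
  moreover have "\<eta> w \<in> gauss_lattice" if "w \<in> gauss_lattice" for w using that by (auto simp: gauss_lattice_ReIm \<eta>_def)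
  ultimately show "\<zeta> z \<in> gauss_lattice \<longleftrightarrow> z \<in> gauss_lattice" using 1[of z] by metis
qed

section \<open>Wronskians of second order linear equations\<close>

context
  fixes S :: "complex set" and p :: complex and \<phi> :: "complex \<Rightarrow> complex"
  assumes S: "open S" "convex S" "S \<noteq> {}"
begin

definition solves :: "(complex \<Rightarrow> complex) \<Rightarrow> bool" where
  "solves F \<longleftrightarrow> F holomorphic_on S \<and> (\<forall>\<tau>\<in>S. deriv (deriv F) \<tau> - p * deriv F \<tau> + \<phi> \<tau> * F \<tau> = 0)"

lemma solves_D:
  assumes "solves F" "\<tau> \<in> S"
  shows "(F has_field_derivative deriv F \<tau>) (at \<tau>)"
    "(deriv F has_field_derivative p * deriv F \<tau> - \<phi> \<tau> * F \<tau>) (at \<tau>)"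
proof -
  have F: "F holomorphic_on S" "deriv (deriv F) \<tau> - p * deriv F \<tau> + \<phi> \<tau> * F \<tau> = 0"
    using assms by (auto simp: solves_def)
  show "(F has_field_derivative deriv F \<tau>) (at \<tau>)" by (rule holomorphic_derivI[OF F(1) S(1) assms(2)])
  have "deriv (deriv F) \<tau> = p * deriv F \<tau> - \<phi> \<tau> * F \<tau>" using F(2) by algebra
  then show "(deriv F has_field_derivative p * deriv F \<tau> - \<phi> \<tau> * F \<tau>) (at \<tau>)"
    using holomorphic_derivI[OF holomorphic_deriv[OF F(1) S(1)] S(1) assms(2)] by simp
qed

definition wr :: "(complex \<Rightarrow> complex) \<Rightarrow> (complex \<Rightarrow> complex) \<Rightarrow> complex \<Rightarrow> complex" where
  "wr F G \<tau> = F \<tau> * deriv G \<tau> - deriv F \<tau> * G \<tau>"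

lemma wr_deriv:
  assumes "solves F" "solves G" "\<tau> \<in> S"
  shows "(wr F G has_field_derivative p * wr F G \<tau>) (at \<tau>)"
  unfolding wr_def[abs_def]
  by (rule DERIV_cong[OF DERIV_diff[OF
        DERIV_mult[OF solves_D(1)[OF assms(1,3)] solves_D(2)[OF assms(2,3)]]
        DERIV_mult[OF solves_D(2)[OF assms(1,3)] solves_D(1)[OF assms(2,3)]]]])
     (simp add: algebra_simps)

text \<open>All Wronskians satisfy the same first order equation, so their quotients are constant.
  By Cramer's rule the coefficients of \<open>F\<close> are the quotients of \<open>wr F F1\<close>
  and \<open>wr F0 F\<close> by \<open>wr F0 F1\<close>.\<close>

lemma solution_basis:
  assumes F0: "solves F0" and F1: "solves F1" and W: "\<And>\<tau>. \<tau> \<in> S \<Longrightarrow> wr F0 F1 \<tau> \<noteq> 0"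
  shows "solves F \<longleftrightarrow> (\<exists>c d. \<forall>\<tau>\<in>S. F \<tau> = c * F0 \<tau> + d * F1 \<tau>)"
    and "(\<forall>\<tau>\<in>S. c * F0 \<tau> + d * F1 \<tau> = 0) \<Longrightarrow> c = 0 \<and> d = 0"
proof -
  have const: "\<exists>c. \<forall>\<tau>\<in>S. wr F G \<tau> = c * wr F0 F1 \<tau>" if "solves F" "solves G" for F G
  proof -
    have "((\<lambda>\<tau>. wr F G \<tau> / wr F0 F1 \<tau>) has_field_derivative 0) (at \<tau> within S)" if "\<tau> \<in> S" for \<tau>
      by (rule has_field_derivative_at_within, rule DERIV_cong[OF DERIV_divide[OF wr_deriv wr_deriv]])
         (use that W F0 F1 \<open>solves F\<close> \<open>solves G\<close> in auto)
    from has_field_derivative_zero_constant[OF S(2) this]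
    obtain c where "\<And>\<tau>. \<tau> \<in> S \<Longrightarrow> wr F G \<tau> / wr F0 F1 \<tau> = c" by blast
    then show ?thesis using W by (metis nonzero_eq_divide_eq)
  qed
  have comb: "deriv F \<tau> = c * deriv F0 \<tau> + d * deriv F1 \<tau>"
    if "\<And>\<tau>. \<tau> \<in> S \<Longrightarrow> F \<tau> = c * F0 \<tau> + d * F1 \<tau>" "\<tau> \<in> S" for F c d \<tau>
    by (rule DERIV_imp_deriv, rule has_field_derivative_transform_within_open[OF
          DERIV_add[OF DERIV_cmult DERIV_cmult] S(1) that(2)]) (use solves_D F0 F1 that in auto)
  show "solves F \<longleftrightarrow> (\<exists>c d. \<forall>\<tau>\<in>S. F \<tau> = c * F0 \<tau> + d * F1 \<tau>)"
  proof
    assume F: "solves F"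
    obtain c where c: "\<And>\<tau>. \<tau> \<in> S \<Longrightarrow> wr F F1 \<tau> = c * wr F0 F1 \<tau>" using const[OF F F1] by blast
    obtain d where d: "\<And>\<tau>. \<tau> \<in> S \<Longrightarrow> wr F0 F \<tau> = d * wr F0 F1 \<tau>" using const[OF F0 F] by blast
    have "F \<tau> = c * F0 \<tau> + d * F1 \<tau>" if "\<tau> \<in> S" for \<tau>
    proof -
      have "wr F0 F1 \<tau> * F \<tau> = wr F F1 \<tau> * F0 \<tau> + wr F0 F \<tau> * F1 \<tau>" by (simp add: wr_def algebra_simps)
      also have "\<dots> = wr F0 F1 \<tau> * (c * F0 \<tau> + d * F1 \<tau>)" by (simp add: c d that algebra_simps)
      finally show ?thesis using W[OF that] by simp
    qed
    then show "\<exists>c d. \<forall>\<tau>\<in>S. F \<tau> = c * F0 \<tau> + d * F1 \<tau>" by blast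
  next
    assume "\<exists>c d. \<forall>\<tau>\<in>S. F \<tau> = c * F0 \<tau> + d * F1 \<tau>"
    then obtain c d where cd: "\<And>\<tau>. \<tau> \<in> S \<Longrightarrow> F \<tau> = c * F0 \<tau> + d * F1 \<tau>" by blast
    have "(\<lambda>\<tau>. c * F0 \<tau> + d * F1 \<tau>) holomorphic_on S"
      using F0 F1 by (auto simp: solves_def intro!: holomorphic_intros)
    then have "F holomorphic_on S" by (rule holomorphic_transform) (simp add: cd)
    moreover have "deriv (deriv F) \<tau> - p * deriv F \<tau> + \<phi> \<tau> * F \<tau> = 0" if "\<tau> \<in> S" for \<tau>
    proof -
      have "deriv (deriv F) \<tau> = c * (p * deriv F0 \<tau> - \<phi> \<tau> * F0 \<tau>) + d * (p * deriv F1 \<tau> - \<phi> \<tau> * F1 \<tau>)"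
        by (rule DERIV_imp_deriv, rule has_field_derivative_transform_within_open[OF
          DERIV_add[OF DERIV_cmult DERIV_cmult] S(1) that]) (use solves_D F0 F1 that comb cd in auto)
      then show ?thesis using comb[OF cd that] cd[OF that] by (simp add: algebra_simps)
    qed
    ultimately show "solves F" by (simp add: solves_def)
  qed
  show "c = 0 \<and> d = 0" if z: "\<forall>\<tau>\<in>S. c * F0 \<tau> + d * F1 \<tau> = 0"
  proof -
    obtain \<tau> where \<tau>: "\<tau> \<in> S" using S(3) by blast
    have 1: "c * F0 \<tau> + d * F1 \<tau> = 0" using z \<tau> by blast
    have 2: "c * deriv F0 \<tau> + d * deriv F1 \<tau> = 0" using comb[of "\<lambda>_. 0" c d \<tau>] z \<tau> by simp
    have "c * wr F0 F1 \<tau> = (c * F0 \<tau> + d * F1 \<tau>) * deriv F1 \<tau> - (c * deriv F0 \<tau> + d * deriv F1 \<tau>) * F1 \<tau>"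
      "d * wr F0 F1 \<tau> = (c * deriv F0 \<tau> + d * deriv F1 \<tau>) * F0 \<tau> - (c * F0 \<tau> + d * F1 \<tau>) * deriv F0 \<tau>"
      by (simp_all add: wr_def algebra_simps)
    then show ?thesis using W[OF \<tau>] unfolding 1 2 by simp
  qed
qed

end

section \<open>The two sides of the parallelogram and their periods\<close>

context params
begin

definition bottom' :: "real \<Rightarrow> real \<Rightarrow> complex" where
  "bottom' e x = Complex 1 (- (if Im (tred \<alpha> a0 ai) = 0 then e * (1 - 2 * x) else 0))"

definition left' :: "real \<Rightarrow> real \<Rightarrow> complex" where
  "left' e x = Complex (- (if Re (tred \<alpha> a0 ai) = 0 then e * (1 - 2 * x) else 0)) 1"

lemma Complex_eq': "Complex x y = x *\<^sub>R 1 + y *\<^sub>R \<i>"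
  by (simp add: complex_eq_iff)

lemma tred_lattice: "tmark \<alpha> a0 ai - tred \<alpha> a0 ai \<in> gauss_lattice"
  by (simp add: gauss_lattice_ReIm tmark_def tred_def frac_def)

lemma tred_range: "0 \<le> Re (tred \<alpha> a0 ai)" "Re (tred \<alpha> a0 ai) < 1" "0 \<le> Im (tred \<alpha> a0 ai)" "Im (tred \<alpha> a0 ai) < 1"
  by (simp_all add: tred_def frac_lt_1)

lemma tred_nonzero: "\<not> (Re (tred \<alpha> a0 ai) = 0 \<and> Im (tred \<alpha> a0 ai) = 0)"
proof
  assume "Re (tred \<alpha> a0 ai) = 0 \<and> Im (tred \<alpha> a0 ai) = 0"
  then have "tred \<alpha> a0 ai = 0" by (simp add: complex_eq_iff)
  then show False using tred_lattice tmark_notin by simp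
qed

lemma PP_tred: "z \<in> PP \<longleftrightarrow> z \<in> gauss_lattice \<or> z - tred \<alpha> a0 ai \<in> gauss_lattice"
  using gauss_lattice_closed(2)[OF _ tred_lattice, of "z - tmark \<alpha> a0 ai"]
    gauss_lattice_closed(3)[OF _ tred_lattice, of "z - tred \<alpha> a0 ai"]
  by (auto simp: punctures_iff)

lemma not_Ints_between: "0 < x \<Longrightarrow> x < 1 \<Longrightarrow> x \<notin> \<int>" for x :: real
  by (auto elim!: Ints_cases)

text \<open>For \<open>e < 1\<close> the push is smaller than the distance to either corner. In
  sheared coordinates the pushed side therefore stays inside one open triangle of the cell.\<close>

lemma bump: "0 < e \<Longrightarrow> e < 1 \<Longrightarrow> 0 < x \<Longrightarrow> x < 1 \<Longrightarrow> 0 < e * x * (1 - x) \<and> e * x * (1 - x) < x \<and> e * x * (1 - x) < 1 - x"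
  for e x :: real
proof -
  assume *: "0 < e" "e < 1" "0 < x" "x < 1"
  have "e * (1 - x) < 1 * 1" "e * x < 1 * 1" using * by (intro mult_strict_mono; simp)+
  then have "x * (e * (1 - x)) < x * 1" "(1 - x) * (e * x) < (1 - x) * 1" using * by (intro mult_strict_left_mono; simp)+
  then show ?thesis using * by (simp add: mult_ac)
qed

context
  fixes e :: real and \<sigma> :: "real \<Rightarrow> complex" and T :: "complex \<times> complex \<Rightarrow> complex"
  assumes e: "0 < e" "e < 1"
    and T: "Tbr (cut_domain e \<alpha> a0 ai \<sigma>) (\<lambda>p. p) T"
begin

abbreviation (input) bot where "bot \<equiv> bottom_side e \<alpha> a0 ai"
abbreviation (input) lef where "lef \<equiv> left_side e \<alpha> a0 ai"
abbreviation (input) s0 where "s0 \<equiv> (\<lambda>(\<tau>, x). T (\<tau>, mark \<tau> (bot x)))"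
abbreviation (input) s1 where "s1 \<equiv> (\<lambda>(\<tau>, x). T (\<tau>, mark \<tau> (lef x)))"

lemma side_derivs:
  "(bot has_vector_derivative bottom' e x) (at x)" "(lef has_vector_derivative left' e x) (at x)"
  "continuous_on UNIV (bottom' e)" "continuous_on UNIV (left' e)"
  unfolding bottom_side_def[abs_def] left_side_def[abs_def] bottom'_def[abs_def] left'_def[abs_def]
    push_bottom_def push_left_def Complex_eq'
  by (cases "Im (tred \<alpha> a0 ai) = 0"; cases "Re (tred \<alpha> a0 ai) = 0";
      simp; auto intro!: derivative_eq_intros continuous_intros simp: algebra_simps)+

lemma side_ends: "bot 0 = 0" "bot 1 = 1" "lef 0 = 0" "lef 1 = \<i>"
  by (simp_all add: bottom_side_def left_side_def push_bottom_def push_left_def complex_eq_iff)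

lemma side_lattice: "bot 1 \<in> gauss_lattice" "lef 1 \<in> gauss_lattice"
  by (simp_all add: side_ends gauss_lattice_ReIm)

lemma side_punctures:
  assumes x: "0 < x" "x < 1"
  shows "bot x \<notin> PP" "lef x \<notin> PP"
proof -
  note b = bump[OF e x] and n = not_Ints_between[OF x] and r = tred_range
  have m: "- y \<notin> \<int>" if "0 < y" "y < 1" for y :: real using not_Ints_between[OF that] by (metis Ints_minus minus_minus)
  have b': "- (e * x * (1 - x)) \<notin> \<int>" by (rule m[OF conjunct1[OF b] less_trans[OF conjunct1[OF conjunct2[OF b]] x(2)]])
  have I: "- Im (tred \<alpha> a0 ai) \<notin> \<int>" if "Im (tred \<alpha> a0 ai) \<noteq> 0" by (rule m) (use that r in auto)
  have R: "- Re (tred \<alpha> a0 ai) \<notin> \<int>" if "Re (tred \<alpha> a0 ai) \<noteq> 0" by (rule m) (use that r in auto)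
  show "bot x \<notin> PP"
    using n b' I by (auto simp: PP_tred gauss_lattice_ReIm bottom_side_def push_bottom_def)
  show "lef x \<notin> PP"
    using n b' R by (auto simp: PP_tred gauss_lattice_ReIm left_side_def push_left_def)
qed

lemma side_branches:
  "Tbr (UHP \<times> {0<..<1::real}) (along bot) s0"
  "Tbr (UHP \<times> {0<..<1::real}) (along lef) s1"
proof -
  have c: "continuous_on UNIV bot" "continuous_on UNIV lef"
    using side_derivs by (auto intro!: continuous_at_imp_continuous_on dest: has_vector_derivative_continuous)
  have in_dom: "(\<tau>, mark \<tau> (bot x)) \<in> cut_domain e \<alpha> a0 ai \<sigma>" "(\<tau>, mark \<tau> (lef x)) \<in> cut_domain e \<alpha> a0 ai \<sigma>"
    if "Im \<tau> > 0" "0 < x" "x < 1" for \<tau> x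
  proof -
    have "\<tau> \<in> UHP" "bot x \<in> bot ` {0<..<1}" "lef x \<in> lef ` {0<..<1}" using that by auto
    then show "(\<tau>, mark \<tau> (bot x)) \<in> cut_domain e \<alpha> a0 ai \<sigma>" "(\<tau>, mark \<tau> (lef x)) \<in> cut_domain e \<alpha> a0 ai \<sigma>"
      unfolding cut_domain_def by blast+
  qed
  show "Tbr (UHP \<times> {0<..<1::real}) (along bot) s0"
    by (rule branch_cong[OF branch_comp[OF T, of "UHP \<times> {0<..<1::real}" "\<lambda>p. (fst p, mark (fst p) (bot (snd p)))"]])
       (use in_dom in \<open>auto intro!: continuous_intros continuous_on_compose2[OF c(1)]\<close>)
  show "Tbr (UHP \<times> {0<..<1::real}) (along lef) s1"
    by (rule branch_cong[OF branch_comp[OF T, of "UHP \<times> {0<..<1::real}" "\<lambda>p. (fst p, mark (fst p) (lef (snd p)))"]])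
       (use in_dom in \<open>auto intro!: continuous_intros continuous_on_compose2[OF c(2)]\<close>)
qed

lemma contour_period:
  assumes g: "\<And>x. (g has_vector_derivative g' x) (at x)"
  shows "contour_integral (\<lambda>x. mark \<tau> (g x)) (\<lambda>u. T (\<tau>, u)) = period (\<lambda>(\<tau>, x). T (\<tau>, mark \<tau> (g x))) g' \<tau>"
  unfolding contour_integral_integral period_def
proof (rule integral_spike[of "{0, 1}"])
  fix x :: real assume x: "x \<in> {0..1} - {0, 1}"
  have "vector_derivative (\<lambda>x. mark \<tau> (g x)) (at x) = mark \<tau> (g' x)"
    by (intro vector_derivative_at has_vector_derivative_mark g)
  then show "ext0 (\<lambda>(\<tau>, x). T (\<tau>, mark \<tau> (g x))) (\<tau>, x) * mark \<tau> (g' x)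
     = T (\<tau>, mark \<tau> (g x)) * vector_derivative (\<lambda>x. mark \<tau> (g x)) (at x)"
    using x by (simp add: ext0_def)
qed auto

lemma F_eq_period:
  "F_zero e \<alpha> a0 ai T = period s0 (bottom' e)" "F_infty e \<alpha> a0 ai T = period s1 (left' e)"
  using contour_period[OF side_derivs(1)] contour_period[OF side_derivs(2)]
  by (auto simp: F_zero_def F_infty_def fun_eq_iff)

lemmas bot_conds = side_derivs(1,3) side_ends(1) side_lattice(1) side_punctures(1) side_branches(1)
lemmas lef_conds = side_derivs(2,4) side_ends(3) side_lattice(2) side_punctures(2) side_branches(2)

lemma bot_tr: "tr s0 bot (bottom' e) n h \<tau> = Ii s0 bot (bottom' e) (eps n) (1 - eps n) h \<tau>"
  and lef_tr: "tr s1 lef (left' e) n h \<tau> = Ii s1 lef (left' e) (eps n) (1 - eps n) h \<tau>"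
  by (rule tr_def[OF bot_conds]; assumption) (rule tr_def[OF lef_conds]; assumption)

text \<open>Nondegeneracy of the Wronskian matrix at a single \<tau>. A vector in its kernel gives a
  form \<open>hh\<close> with vanishing integrals along both sides, from which the glued solution is
  built; the cases differ only in the lattice basis.\<close>

lemma periods_independent:
  assumes \<tau>: "Im \<tau> > 0"
    and z0: "c0 * F_zero e \<alpha> a0 ai T \<tau> + \<mu> * deriv (F_zero e \<alpha> a0 ai T) \<tau> = 0"
    and z1: "c0 * F_infty e \<alpha> a0 ai T \<tau> + \<mu> * deriv (F_infty e \<alpha> a0 ai T) \<tau> = 0"
  shows "c0 = 0 \<and> \<mu> = 0"
proof -
  have h: "(\<lambda>u. c0 + \<mu> * Gt u \<tau>) = hh \<tau> c0 \<mu>" by (simp add: hh_def[OF \<tau>] fun_eq_iff)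
  have lim0: "(\<lambda>n. Ii s0 bot (bottom' e) (eps n) (1 - eps n) (hh \<tau> c0 \<mu>) \<tau>) \<longlonglongrightarrow> 0"
    using period_deriv_limit[OF bot_conds \<tau>, of c0 \<mu>] z0 unfolding bot_tr h F_eq_period by simp
  have lim1: "(\<lambda>n. Ii s1 lef (left' e) (eps n) (1 - eps n) (hh \<tau> c0 \<mu>) \<tau>) \<longlonglongrightarrow> 0"
    using period_deriv_limit[OF lef_conds \<tau>, of c0 \<mu>] z1 unfolding lef_tr h F_eq_period by simp
  define x1 where "x1 = Re (tred \<alpha> a0 ai)"
  define y1 where "y1 = Im (tred \<alpha> a0 ai)"
  have r: "0 \<le> x1" "x1 < 1" "0 \<le> y1" "y1 < 1" "x1 \<noteq> 0 \<or> y1 \<noteq> 0"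
    using tred_range tred_nonzero by (auto simp: x1_def y1_def)
  have t1: "tred \<alpha> a0 ai = Complex x1 y1" by (simp add: x1_def y1_def)
  have bx: "Re (bot x) = x" "Im (bot x) = - (if y1 = 0 then e * x * (1 - x) else 0)"
    and lx: "Im (lef x) = x" "Re (lef x) = - (if x1 = 0 then e * x * (1 - x) else 0)" for x
    by (simp_all add: bottom_side_def push_bottom_def left_side_def push_left_def y1_def x1_def)
  note bmp = bump[OF e]
  consider "x1 \<noteq> 0" "y1 \<noteq> 0" | "x1 \<noteq> 0" "y1 = 0" | "x1 = 0" "y1 \<noteq> 0" using r(5) by blast
  then show ?thesis
  proof cases
    case 1
    define \<zeta> where "\<zeta> z = Re z *\<^sub>R (1::complex) + Im z *\<^sub>R \<i>" for z
    have id: "\<zeta> z = z" for z by (simp add: \<zeta>_def complex_eq_iff)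
    have B: "bij \<zeta>" "\<zeta> z \<in> gauss_lattice \<longleftrightarrow> z \<in> gauss_lattice" for z
      by (simp_all add: id[abs_def] bij_id[unfolded id_def])
    have xy: "0 < x1" "x1 < 1" "0 < y1" "y1 < 1" using 1 r by auto
    have tl: "tmark \<alpha> a0 ai - \<zeta> (Complex x1 y1) \<in> gauss_lattice" using tred_lattice by (simp add: id t1)
    have row: "Fc \<tau> c0 \<mu> 0 (mark \<tau> (\<zeta> z)) = Fc \<tau> c0 \<mu> 1 (mark \<tau> (\<zeta> z))"
      if "0 < Re z" "Re z < 1" "y1 - 1 < Im z" "Im z < y1" for z
      by (rule direct_row[OF \<tau> xy \<zeta>_def B tl side_derivs(1) side_ends(1,2) side_branches(1) id[symmetric] lim0])
         (use that xy in \<open>auto simp: bx\<close>)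
    have col: "Fc \<tau> c0 \<mu> 0 (mark \<tau> (\<zeta> z)) = Fc \<tau> c0 \<mu> \<i> (mark \<tau> (\<zeta> z))"
      if "x1 - 1 < Re z" "Re z < x1" "0 < Im z" "Im z < 1" for z
      by (rule direct_column[OF \<tau> xy \<zeta>_def B tl side_derivs(2) side_ends(3,4) side_branches(2) id[symmetric] lim1])
         (use that xy in \<open>auto simp: lx\<close>)
    show ?thesis
      by (rule glued_solution[OF \<tau> xy \<zeta>_def B tl row col], assumption+) (rule no_quasi_periodic_solution[OF \<tau>])
  next
    case 2
    \<comment> \<open>Here \<open>t = x1\<close> lies on the bottom side. In the basis
      \<open>1 - \<i>\<close>, \<open>\<i>\<close> it is the diagonal point \<open>(x1, x1)\<close>;
      the left side is still a basis vector, and the pushed bottom side runs from 0 to the sum of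
      the basis vectors.\<close>
    define \<zeta> where "\<zeta> z = Re z *\<^sub>R (1 - \<i>) + Im z *\<^sub>R \<i>" for z
    have B: "bij \<zeta>" "\<zeta> z \<in> gauss_lattice \<longleftrightarrow> z \<in> gauss_lattice" for z
      by (rule unimodular_basis[where p = 1 and q = "-1" and r = 0 and s = 1]; simp add: \<zeta>_def complex_eq_iff)+
    have xy: "0 < x1" "x1 < 1" "0 < x1" "x1 < 1" using 2 r by auto
    have tl: "tmark \<alpha> a0 ai - \<zeta> (Complex x1 x1) \<in> gauss_lattice"
      using tred_lattice 2 by (simp add: \<zeta>_def t1 complex_eq_iff gauss_lattice_ReIm)
    have q: "z = \<zeta> (Complex (Re z) (Im z + Re z))" for z by (simp add: \<zeta>_def complex_eq_iff)
    have col: "Fc \<tau> c0 \<mu> 0 (mark \<tau> (\<zeta> z)) = Fc \<tau> c0 \<mu> \<i> (mark \<tau> (\<zeta> z))"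
      if "x1 - 1 < Re z" "Re z < x1" "0 < Im z" "Im z < 1" for z
      by (rule direct_column[OF \<tau> xy \<zeta>_def B tl side_derivs(2) side_ends(3,4) side_branches(2) q lim1])
         (use that xy in \<open>auto simp: lx\<close>)
    have row: "Fc \<tau> c0 \<mu> 0 (mark \<tau> (\<zeta> z)) = Fc \<tau> c0 \<mu> (1 - \<i>) (mark \<tau> (\<zeta> z))"
      if "0 < Re z" "Re z < 1" "x1 - 1 < Im z" "Im z < x1" for z
      by (rule triangle_row[OF \<tau> xy \<zeta>_def B tl side_derivs(1) side_ends(1,2) side_branches(1) q lim0 refl _ _ col])
         (use that xy 2 bmp in \<open>auto simp: bx\<close>)
    show ?thesis
      by (rule glued_solution[OF \<tau> xy \<zeta>_def B tl row col], assumption+) (rule no_quasi_periodic_solution[OF \<tau>])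
  next
    case 3
    \<comment> \<open>Here \<open>t = y1 \<i>\<close> lies on the left side. In the basis
      \<open>1\<close>, \<open>\<i> - 1\<close> it is the diagonal point \<open>(y1, y1)\<close>,
      and the pushed left side is the one joining opposite corners.\<close>
    define \<zeta> where "\<zeta> z = Re z *\<^sub>R (1::complex) + Im z *\<^sub>R (\<i> - 1)" for z
    have B: "bij \<zeta>" "\<zeta> z \<in> gauss_lattice \<longleftrightarrow> z \<in> gauss_lattice" for z
      by (rule unimodular_basis[where p = 1 and q = 0 and r = "-1" and s = 1]; simp add: \<zeta>_def complex_eq_iff)+
    have xy: "0 < y1" "y1 < 1" "0 < y1" "y1 < 1" using 3 r by auto
    have tl: "tmark \<alpha> a0 ai - \<zeta> (Complex y1 y1) \<in> gauss_lattice"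
      using tred_lattice 3 by (simp add: \<zeta>_def t1 complex_eq_iff gauss_lattice_ReIm)
    have q: "z = \<zeta> (Complex (Re z + Im z) (Im z))" for z by (simp add: \<zeta>_def complex_eq_iff)
    have row: "Fc \<tau> c0 \<mu> 0 (mark \<tau> (\<zeta> z)) = Fc \<tau> c0 \<mu> 1 (mark \<tau> (\<zeta> z))"
      if "0 < Re z" "Re z < 1" "y1 - 1 < Im z" "Im z < y1" for z
      by (rule direct_row[OF \<tau> xy \<zeta>_def B tl side_derivs(1) side_ends(1,2) side_branches(1) q lim0])
         (use that xy in \<open>auto simp: bx\<close>)
    have col: "Fc \<tau> c0 \<mu> 0 (mark \<tau> (\<zeta> z)) = Fc \<tau> c0 \<mu> (\<i> - 1) (mark \<tau> (\<zeta> z))"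
      if "y1 - 1 < Re z" "Re z < y1" "0 < Im z" "Im z < 1" for z
      by (rule triangle_column[OF \<tau> xy \<zeta>_def B tl side_derivs(2) side_ends(3,4) side_branches(2) q lim1 refl _ _ row])
         (use that xy 3 bmp in \<open>auto simp: lx\<close>)
    show ?thesis
      by (rule glued_solution[OF \<tau> xy \<zeta>_def B tl row col], assumption+) (rule no_quasi_periodic_solution[OF \<tau>])
  qed
qed

lemma UHP_ne: "UHP \<noteq> {}"
proof -
  have "\<i> \<in> UHP" by simp
  then show ?thesis by blast
qed

lemma p0_eq: "p0 = 2 * \<i> * of_real pi * of_real (a0\<^sup>2 / \<alpha>)"
  by (simp add: p0_def kap_def)

lemma ode_solution_iff: "ode_solution \<alpha> a0 ai F \<longleftrightarrow> solves UHP p0 (phi_pot \<alpha> a0 ai) F"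
  by (simp add: ode_solution_def solves_def[OF open_UHP convex_UHP UHP_ne] p0_eq)

theorem period_basis:
  shows "(\<forall>\<tau>\<in>UHP. c * F_zero e \<alpha> a0 ai T \<tau> + d * F_infty e \<alpha> a0 ai T \<tau> = 0) \<Longrightarrow> c = 0 \<and> d = 0"
    and "ode_solution \<alpha> a0 ai F \<longleftrightarrow> (\<exists>c d. \<forall>\<tau>\<in>UHP. F \<tau> = c * F_zero e \<alpha> a0 ai T \<tau> + d * F_infty e \<alpha> a0 ai T \<tau>)"
proof -
  define F0 where "F0 = F_zero e \<alpha> a0 ai T"
  define F1 where "F1 = F_infty e \<alpha> a0 ai T"
  note SU = open_UHP convex_UHP UHP_ne
  have s0: "solves UHP p0 (phi_pot \<alpha> a0 ai) F0" unfolding solves_def[OF SU] F0_def F_eq_period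
    using period_hol[OF bot_conds] period_ode[OF bot_conds] by (auto simp: phi_pot_eq)
  have s1: "solves UHP p0 (phi_pot \<alpha> a0 ai) F1" unfolding solves_def[OF SU] F1_def F_eq_period
    using period_hol[OF lef_conds] period_ode[OF lef_conds] by (auto simp: phi_pot_eq)
  have W: "wr F0 F1 \<tau> \<noteq> 0" if "\<tau> \<in> UHP" for \<tau>
  proof
    assume "wr F0 F1 \<tau> = 0"
    then have w: "F0 \<tau> * deriv F1 \<tau> = deriv F0 \<tau> * F1 \<tau>" by (simp add: wr_def[OF SU])
    have ind: "c0 = 0 \<and> \<mu> = 0"
      if "c0 * F0 \<tau> + \<mu> * deriv F0 \<tau> = 0" "c0 * F1 \<tau> + \<mu> * deriv F1 \<tau> = 0" for c0 \<mu>
      using periods_independent[of \<tau> c0 \<mu>] that \<open>\<tau> \<in> UHP\<close> unfolding F0_def F1_def by simp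
    \<comment> \<open>If the Wronskian vanished, the vectors \<open>(- F0', F0)\<close> and
      \<open>(- F1', F1)\<close> would lie in the kernel, which forces \<open>F0 = F1 = 0\<close>;
      then \<open>(1, 0)\<close> would lie in the kernel as well.\<close>
    have "F0 \<tau> = 0" using ind[of "- deriv F0 \<tau>" "F0 \<tau>"] w by simp
    moreover have "F1 \<tau> = 0" using ind[of "- deriv F1 \<tau>" "F1 \<tau>"] w by (simp add: mult.commute)
    ultimately show False using ind[of 1 0] by simp
  qed
  show "ode_solution \<alpha> a0 ai F \<longleftrightarrow> (\<exists>c d. \<forall>\<tau>\<in>UHP. F \<tau> = c * F_zero e \<alpha> a0 ai T \<tau> + d * F_infty e \<alpha> a0 ai T \<tau>)"
    unfolding ode_solution_iff F0_def[symmetric] F1_def[symmetric] by (rule solution_basis(1)[OF SU s0 s1 W])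
  show "c = 0 \<and> d = 0" if "\<forall>\<tau>\<in>UHP. c * F_zero e \<alpha> a0 ai T \<tau> + d * F_infty e \<alpha> a0 ai T \<tau> = 0"
    by (rule solution_basis(2)[OF SU s0 s1 W]) (use that in \<open>auto simp: F0_def F1_def\<close>)
qed

end

section \<open>Holomorphy of the matrix entries and of the potential\<close>

lemma qq_tt_hol: "(\<lambda>\<tau>. qq n (tt \<tau>) \<tau>) holomorphic_on UHP"
  unfolding holomorphic_on_open[OF open_UHP]
  by (intro ballI exI, rule qq_chain[OF tt_deriv DERIV_ident]) (auto simp: th0_tt)

lemma Yc_hol: "Yc holomorphic_on UHP"
  unfolding holomorphic_on_open[OF open_UHP] by (intro ballI exI, rule Yc_deriv) auto

lemma M_hol: "M11 holomorphic_on UHP" "M22 holomorphic_on UHP" "M21 holomorphic_on UHP"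
  unfolding M11_def[abs_def] M22_def[abs_def] M21_def[abs_def] AA_def[abs_def] Let_def r1_def r2_def r3_def
  using al_pos by (auto simp: Yc_hol qq_tt_hol intro!: holomorphic_intros)

lemma GM_matrix_hol: "(\<lambda>\<tau>. GM_matrix \<alpha> a0 ai \<tau> $ i $ j) holomorphic_on UHP"
proof -
  have *: "f holomorphic_on UHP" if "g holomorphic_on UHP" "\<And>\<tau>. Im \<tau> > 0 \<Longrightarrow> f \<tau> = g \<tau>" for f g
    by (rule holomorphic_transform[OF that(1)]) (simp add: that(2))
  have "(\<lambda>\<tau>. M12) holomorphic_on UHP" by auto
  note h = *[OF M_hol(1) GM_matrix_eq(1)] *[OF this GM_matrix_eq(2)] *[OF M_hol(3) GM_matrix_eq(3)] *[OF M_hol(2) GM_matrix_eq(4)]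
  show ?thesis using h exhaust_2[of i] exhaust_2[of j] by auto
qed

lemma phi_pot_hol: "phi_pot \<alpha> a0 ai holomorphic_on UHP"
proof -
  have "deriv M11 holomorphic_on UHP" by (rule holomorphic_deriv[OF M_hol(1) open_UHP])
  then have "(\<lambda>\<tau>. M11 \<tau> * M22 \<tau> - M12 * M21 \<tau> - deriv M11 \<tau>) holomorphic_on UHP"
    by (intro holomorphic_intros M_hol open_UHP)
  then show ?thesis
    by (rule holomorphic_transform) (simp add: phi_pot_eq phi_def DERIV_imp_deriv[OF M11_deriv])
qed

end

theorem proposition1p10:
  fixes \<alpha> a0 ai :: real
  assumes "0 < \<alpha>" and "\<alpha> < 1"
    and "\<not> (\<exists>m n :: int. a0 = \<alpha> * of_int m \<and> ai = \<alpha> * of_int n)"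
  shows
    "(\<forall>i j. (\<lambda>\<tau>. GM_matrix \<alpha> a0 ai \<tau> $ i $ j) holomorphic_on UHP) \<and>
     (\<forall>\<tau>\<in>UHP.
        gauss_manin \<alpha> a0 ai (sec0 \<alpha> a0 ai) \<tau> =
          H1_add (H1_scale \<alpha> a0 ai \<tau> (GM_matrix \<alpha> a0 ai \<tau> $ 1 $ 1) (sec0 \<alpha> a0 ai \<tau>))
                 (H1_scale \<alpha> a0 ai \<tau> (GM_matrix \<alpha> a0 ai \<tau> $ 1 $ 2) (sec1 \<alpha> a0 ai \<tau>)) \<and>
        gauss_manin \<alpha> a0 ai (sec1 \<alpha> a0 ai) \<tau> =
          H1_add (H1_scale \<alpha> a0 ai \<tau> (GM_matrix \<alpha> a0 ai \<tau> $ 2 $ 1) (sec0 \<alpha> a0 ai \<tau>))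
                 (H1_scale \<alpha> a0 ai \<tau> (GM_matrix \<alpha> a0 ai \<tau> $ 2 $ 2) (sec1 \<alpha> a0 ai \<tau>))) \<and>
     phi_pot \<alpha> a0 ai holomorphic_on UHP \<and>
     (\<forall>e \<sigma> T. 0 < e \<and> e < 1 \<and> is_cut e \<alpha> a0 ai \<sigma> \<and>
        is_T_branch \<alpha> a0 ai (cut_domain e \<alpha> a0 ai \<sigma>) (\<lambda>p. p) T \<longrightarrow>
        (\<forall>c d. (\<forall>\<tau>\<in>UHP. c * F_zero e \<alpha> a0 ai T \<tau> + d * F_infty e \<alpha> a0 ai T \<tau> = 0)
               \<longrightarrow> c = 0 \<and> d = 0) \<and>
        (\<forall>F. ode_solution \<alpha> a0 ai F \<longleftrightarrow>
             (\<exists>c d. \<forall>\<tau>\<in>UHP. F \<tau> = c * F_zero e \<alpha> a0 ai T \<tau> + d * F_infty e \<alpha> a0 ai T \<tau>)))"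
proof -
  interpret params \<alpha> a0 ai by unfold_locales (fact assms)+
  show ?thesis
    by (intro conjI allI ballI impI GM_matrix_hol phi_pot_hol gauss_manin_rows[OF UHP_iff[THEN iffD1]]; (elim conjE)?)
       (use period_basis in blast)+
qed

end
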